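(* Let $p$ be a prime and $\alpha,\beta$ integers different from $1$, and assume that either $p>3$, or $p=3$ and neither $\alpha$ nor $\beta$ is congruent to $7$ modulo $9$. Suppose $v_p(\alpha-1)=v_p(\beta-1)=m>0$ and that $\ell=v_p(\alpha-\beta)$ satisfies $m<\ell<2m$ and $2\ell>3m$. Then $|G_p|=p^{5m+\ell}$, the nilpotency class of $G_p$ is $5$, $o(a)=o(b)=p^{m+\ell}$ and $o(c)=p^{2m}$.
   Context: $G(\alpha,\beta)=\langle A,B\mid A^{[A,B]}=A^{\alpha},\ B^{[B,A]}=B^{\beta}\rangle$ with $[x,y]=x^{-1}y^{-1}xy$, $y^x=x^{-1}yx$, and $C=[A,B]$. The group $G(\alpha,\beta)$ is finite and nilpotent, hence the direct product of its Sylow subgroups; $G_p$ denotes its Sylow $p$-subgroup and $a,b,c$ denote the images of $A,B,C$ under the canonical projection $G(\alpha,\beta)\to G_p$. $v_p$ is the $p$-adic valuation and $o(x)$ the order of $x$. *)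

theory Defs
  imports "HOL-Algebra.Algebra" "HOL-Computational_Algebra.Primes" "HOL-Number_Theory.Cong"
begin

text \<open>A letter is a generator together with a flag; flag True means the inverse generator.\<close>
type_synonym 'g word = "('g \<times> bool) list"

definition winv :: "'g word \<Rightarrow> 'g word" where
  "winv w = rev (map (\<lambda>(g, e). (g, \<not> e)) w)"

definition wpow :: "'g word \<Rightarrow> int \<Rightarrow> 'g word" where
  "wpow w k = (if 0 \<le> k then concat (replicate (nat k) w)
               else concat (replicate (nat (- k)) (winv w)))"

text \<open>The congruence on words generated by free cancellation and by the relators R
  (equivalently: equality in the group F/N, N the normal closure of R).\<close>
inductive peq :: "'g word set \<Rightarrow> 'g word \<Rightarrow> 'g word \<Rightarrow> bool" for R where
  peq_refl: "peq R u u"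
| peq_sym: "peq R u v \<Longrightarrow> peq R v u"
| peq_trans: "peq R u v \<Longrightarrow> peq R v w \<Longrightarrow> peq R u w"
| peq_cancel: "peq R (u @ [(g, e), (g, \<not> e)] @ v) (u @ v)"
| peq_rel: "r \<in> R \<Longrightarrow> peq R (u @ r @ v) (u @ v)"

definition wclass :: "'g word set \<Rightarrow> 'g word \<Rightarrow> 'g word set" where
  "wclass R u = {w. peq R u w}"

definition pmult :: "'g word set \<Rightarrow> 'g word set \<Rightarrow> 'g word set \<Rightarrow> 'g word set" where
  "pmult R U V = wclass R ((SOME u. u \<in> U) @ (SOME v. v \<in> V))"

definition presented_group :: "'g word set \<Rightarrow> 'g word set monoid" where
  "presented_group R =
     \<lparr> carrier = range (wclass R),
       monoid.mult = pmult R,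
       one = wclass R [] \<rparr>"

definition wA :: "bool word" where "wA = [(True, False)]"
definition wB :: "bool word" where "wB = [(False, False)]"
definition wC :: "bool word" where "wC = winv wA @ winv wB @ wA @ wB"

text \<open>Relators: A^[A,B] A^(-alpha) = C^-1 A C A^(-alpha), and
  B^[B,A] B^(-beta) = C B C^-1 B^(-beta) (since [B,A] = C^-1, y^x = x^-1 y x).\<close>
definition Grels :: "int \<Rightarrow> int \<Rightarrow> bool word set" where
  "Grels \<alpha> \<beta> = { winv wC @ wA @ wC @ wpow wA (- \<alpha>),
                   wC @ wB @ winv wC @ wpow wB (- \<beta>) }"

definition Gab :: "int \<Rightarrow> int \<Rightarrow> bool word set monoid" where
  "Gab \<alpha> \<beta> = presented_group (Grels \<alpha> \<beta>)"

definition genA :: "int \<Rightarrow> int \<Rightarrow> bool word set" where "genA \<alpha> \<beta> = wclass (Grels \<alpha> \<beta>) wA"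
definition genB :: "int \<Rightarrow> int \<Rightarrow> bool word set" where "genB \<alpha> \<beta> = wclass (Grels \<alpha> \<beta>) wB"
definition genC :: "int \<Rightarrow> int \<Rightarrow> bool word set" where "genC \<alpha> \<beta> = wclass (Grels \<alpha> \<beta>) wC"

text \<open>In a finite nilpotent group the unique Sylow p-subgroup is the set of p-elements.\<close>
definition sylow_p :: "('a, 'b) monoid_scheme \<Rightarrow> nat \<Rightarrow> 'a set" where
  "sylow_p G p = {x \<in> carrier G. \<exists>k::nat. x [^]\<^bsub>G\<^esub> (p ^ k) = \<one>\<^bsub>G\<^esub>}"

definition sylow_group :: "('a, 'b) monoid_scheme \<Rightarrow> nat \<Rightarrow> ('a, 'b) monoid_scheme" where
  "sylow_group G p = G\<lparr>carrier := sylow_p G p\<rparr>"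

text \<open>The p-part of x: the unique element y of the cyclic group generated by x that is a
  p-element with x y^-1 of order prime to p. In a finite nilpotent group G = G_p x G_p'
  this is exactly the image of x under the canonical projection G \<rightarrow> G_p.\<close>
definition ppart :: "('a, 'b) monoid_scheme \<Rightarrow> nat \<Rightarrow> 'a \<Rightarrow> 'a" where
  "ppart G p x = (THE y. y \<in> generate G {x} \<and> (\<exists>k::nat. y [^]\<^bsub>G\<^esub> (p ^ k) = \<one>\<^bsub>G\<^esub>)
                     \<and> coprime (group.ord G (x \<otimes>\<^bsub>G\<^esub> inv\<^bsub>G\<^esub> y)) p)"

fun lcs :: "('a, 'b) monoid_scheme \<Rightarrow> nat \<Rightarrow> 'a set" where
  "lcs G 0 = carrier G"
| "lcs G (Suc n) = generate G {x \<otimes>\<^bsub>G\<^esub> y \<otimes>\<^bsub>G\<^esub> inv\<^bsub>G\<^esub> x \<otimes>\<^bsub>G\<^esub> inv\<^bsub>G\<^esub> y | x y. x \<in> lcs G n \<and> y \<in> carrier G}"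

text \<open>lcs G n is gamma_(n+1)(G); the class is the least c with gamma_(c+1)(G) = 1.\<close>
definition nil_class :: "('a, 'b) monoid_scheme \<Rightarrow> nat" where
  "nil_class G = (LEAST c. lcs G c = {\<one>\<^bsub>G\<^esub>})"

end

theory Submission
  imports Defs "HOL-Number_Theory.Number_Theory"
begin

text \<open>Write \<open>G\<close> for the group, with \<open>A C = C A^\<alpha>\<close> and \<open>B C^-1 = C^-1 B^\<beta>\<close> for \<open>C = [A,B]\<close>.
  Comparing two evaluations of conjugates of powers of \<open>A\<close> and \<open>B\<close> puts a power of \<open>C\<close> into
  \<open>\<langle>A\<rangle>\<close>; hence \<open>A\<close>, \<open>B\<close>, \<open>C\<close> have finite order, every prime dividing the order of \<open>A\<close> divides
  \<open>\<alpha> - 1\<close>, and \<open>G = \<langle>A\<rangle>\<langle>C\<rangle>\<langle>B\<rangle>\<close>. The \<open>p\<close>-parts \<open>a\<close>, \<open>b\<close>, \<open>c\<close> satisfy the same relations and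
  commute with the \<open>p'\<close>-parts, so \<open>\<langle>a,b\<rangle>\<close> is the Sylow subgroup.

  Upper bound: there is a relation \<open>b^y = a^x c^e\<close> with \<open>v_p(x) = v_p(y) = 2m\<close> and \<open>v_p(e) = \<ell>\<close>
  (the value of \<open>v_p(x)\<close> is where \<open>\<alpha> \<equiv> 7 (mod 9)\<close> has to be excluded). As \<open>b\<close> commutes with
  \<open>b^y\<close> and, symmetrically, \<open>a\<close> with a power of \<open>a\<close> written in \<open>b\<close> and \<open>c\<close>, one gets
  \<open>a^(p^(m+\<ell>)) = c^(p^(2m)) = 1\<close>, and the order divides \<open>p^((m+\<ell>) + 2m + 2m)\<close>.

  Lower bound: a group of order \<open>p^(5m+\<ell>)\<close> with these relations is built from \<open>\<langle>a\<rangle>\<close> by adjoining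
  \<open>c\<close>, then \<open>d = b^(p^m)\<close>, then \<open>b\<close>, each as a cyclic extension; its class is read off from the
  upper and lower central series.\<close>

section \<open>Geometric sums and valuations\<close>

text \<open>The engine is \<open>key_relation\<close>: C^k A^t B with t = \<alpha>^k can be
  rewritten through A C^k = C^k A^t or through A^t B = B (A C)^t, and comparing the results ties
  powers of A, B and C together. Taking k = 2 keeps \<alpha>^k and \<beta>^k nonnegative for any
  signs and gives finite orders. Then \<alpha>, \<beta> count only modulo these orders and can be
  shifted to be positive, after which k = 1 gives the relation between a, b and c.

  The inequalities on l control error terms in the upper bound: l < 2m makes p^(3m) negligible
  against p^(m+l), and 3m < 2l makes p^(2l-m) negligible against p^(2m). What survives is linear
  modulo p. The evaluation and its mirror image under A <-> B add up instead of cancelling, because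
  \<alpha> and \<beta> agree modulo p^(m+1); the sum is a unit since p is odd.

  In the model everything is dictated by the action of b: a -> a c, c -> d^w c, d -> d. Its p^m-th
  iterate has to be conjugation by d, which fixes how d acts on a and c, and its compatibility with
  a c = c a^\<alpha> fixes the value of t = d^(p^m).\<close>

definition geo :: "nat \<Rightarrow> int \<Rightarrow> int" where
  "geo n x = (\<Sum>i<n. x ^ i)"

lemma geo_0 [simp]: "geo 0 x = 0" and geo_1 [simp]: "geo (Suc 0) x = 1"
  by (simp_all add: geo_def)

lemma geo_Suc: "geo (Suc n) x = geo n x + x ^ n"
  by (simp add: geo_def)

lemma geo_Suc': "geo (Suc n) x = 1 + x * geo n x"
proof (induction n)
  case (Suc n)
  have "geo (Suc (Suc n)) x = 1 + x * geo n x + x ^ Suc n" using Suc by (simp add: geo_Suc)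
  then show ?case by (simp add: geo_Suc[of n] algebra_simps)
qed simp

lemma geo_times: "(x - 1) * geo n x = x ^ n - 1"
  by (induction n) (simp_all add: geo_Suc algebra_simps)

lemma geo_add: "geo (m + n) x = geo m x + x ^ m * geo n x"
  by (induction n) (simp_all add: geo_Suc algebra_simps power_add)

lemma geo_mult: "geo (m * n) x = geo m x * geo n (x ^ m)"
proof (induction n)
  case (Suc n)
  have "geo (m * Suc n) x = geo (m * n) x + x ^ (m * n) * geo m x"
    using geo_add[of "m * n" m x] by (simp add: add.commute)
  then show ?case using Suc by (simp add: geo_Suc power_mult algebra_simps)
qed simp

lemma dvd_power_minus_1:
  fixes x d :: int
  assumes "d dvd x - 1" shows "d dvd x ^ n - 1"
  using assms geo_times[of x n] by (metis dvd_mult2)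

lemma geo_cong_base:
  assumes "d dvd x - 1" shows "d dvd geo n x - int n"
proof (induction n)
  case (Suc n)
  have "geo (Suc n) x - int (Suc n) = (geo n x - int n) + (x ^ n - 1)"
    by (simp add: geo_Suc)
  then show ?case using Suc dvd_power_minus_1[OF assms, of n] by (metis dvd_add)
qed simp

lemma power_linear:
  fixes h :: int
  shows "\<exists>r. (1 + h) ^ n = 1 + int n * h + h\<^sup>2 * r"
proof (induction n)
  case (Suc n)
  then obtain r where "(1 + h) ^ n = 1 + int n * h + h\<^sup>2 * r" by blast
  then have "(1 + h) ^ Suc n = 1 + int (Suc n) * h + h\<^sup>2 * (int n + r + h * r)"
    by (simp add: algebra_simps power2_eq_square)
  then show ?case by blast
qed simp

text \<open>The factor 2 clears the denominator of the binomial coefficient, so that the expansion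
  stays in the integers; the remainder is an unspecified multiple of the next power of h. The
  factors 2 and 6 in the two sum lemmas below have the same origin.\<close>

lemma power_quadratic:
  fixes h :: int
  shows "\<exists>r. 2 * (1 + h) ^ n = 2 + 2 * int n * h + int n * (int n - 1) * h\<^sup>2 + 2 * h ^ 3 * r"
proof (induction n)
  case (Suc n)
  then obtain r where r: "2 * (1 + h) ^ n = 2 + 2 * int n * h + int n * (int n - 1) * h\<^sup>2 + 2 * h ^ 3 * r" by blast
  \<comment> \<open>The new cross term n (n - 1) h^3 has to be absorbed into
    \<open>2 * h ^ 3 * r\<close>, so it must be even.\<close>
  have "even (int n * (int n - 1))" by simp
  then obtain s where s: "int n * (int n - 1) = 2 * s" by blast
  have "2 * (1 + h) ^ Suc n = (1 + h) * (2 * (1 + h) ^ n)" by simp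
  also have "\<dots> = 2 + 2 * int (Suc n) * h + int (Suc n) * (int (Suc n) - 1) * h\<^sup>2
      + h ^ 3 * (int n * (int n - 1)) + 2 * h ^ 3 * (r + h * r)"
    unfolding r by (simp add: algebra_simps power2_eq_square power3_eq_cube)
  finally have "2 * (1 + h) ^ Suc n = 2 + 2 * int (Suc n) * h + int (Suc n) * (int (Suc n) - 1) * h\<^sup>2
      + 2 * h ^ 3 * (s + r + h * r)"
    unfolding s by (simp add: algebra_simps)
  then show ?case by blast
qed simp

lemma geo_quadratic:
  fixes h :: int
  shows "\<exists>q. 2 * geo n (1 + h) = 2 * int n + int n * (int n - 1) * h + 2 * h\<^sup>2 * q"
proof (induction n)
  case (Suc n)
  then obtain q where q: "2 * geo n (1 + h) = 2 * int n + int n * (int n - 1) * h + 2 * h\<^sup>2 * q" by blast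
  obtain r where r: "(1 + h) ^ n = 1 + int n * h + h\<^sup>2 * r" using power_linear by blast
  have "2 * geo (Suc n) (1 + h) = 2 * int (Suc n) + int (Suc n) * (int (Suc n) - 1) * h + 2 * h\<^sup>2 * (q + r)"
    using q r by (simp add: geo_Suc algebra_simps)
  then show ?case by blast
qed simp

lemma geo_cubic:
  fixes h :: int
  shows "\<exists>q. 6 * geo n (1 + h) = 6 * int n + 3 * int n * (int n - 1) * h
    + int n * (int n - 1) * (int n - 2) * h\<^sup>2 + 6 * h ^ 3 * q"
proof (induction n)
  case (Suc n)
  then obtain q where q: "6 * geo n (1 + h) = 6 * int n + 3 * int n * (int n - 1) * h
    + int n * (int n - 1) * (int n - 2) * h\<^sup>2 + 6 * h ^ 3 * q" by blast
  obtain r where r: "2 * (1 + h) ^ n = 2 + 2 * int n * h + int n * (int n - 1) * h\<^sup>2 + 2 * h ^ 3 * r"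
    using power_quadratic by blast
  have "6 * geo (Suc n) (1 + h) = 6 * geo n (1 + h) + 3 * (2 * (1 + h) ^ n)" by (simp add: geo_Suc)
  also have "\<dots> = 6 * int (Suc n) + 3 * int (Suc n) * (int (Suc n) - 1) * h
    + int (Suc n) * (int (Suc n) - 1) * (int (Suc n) - 2) * h\<^sup>2 + 6 * h ^ 3 * (q + r)"
    unfolding q r by (simp add: algebra_simps)
  finally show ?case by blast
qed simp

section \<open>Valuations of geometric sums at an odd prime\<close>

locale odd_prime =
  fixes p :: nat
  assumes prime_p: "Factorial_Ring.prime p" and odd_p: "odd p"
begin

lemma p_gt_2: "p > 2"
  using prime_p odd_p prime_gt_1_nat[of p] by (cases "p = 2") auto

lemma prime_int_p: "Factorial_Ring.prime (int p)"
  using prime_p by simp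

lemma dvd_cancel_2:
  assumes "int p ^ k dvd 2 * z" shows "int p ^ k dvd z"
proof -
  have "coprime (int p) 2" using odd_p by simp
  then have "coprime (int p ^ k) 2" by (simp only: coprime_power_left_iff simp_thms disj_comms)
  then show ?thesis using assms coprime_dvd_mult_right_iff by blast
qed

text \<open>In the expansion of a sum of p terms the linear term is p (p - 1) / 2 times x - 1. For
  odd p it keeps the factor p, so that only p itself remains modulo p^(e+1).\<close>

lemma geo_p:
  assumes "int p ^ e dvd x - 1" "e \<ge> 1"
  shows "int p ^ (e + 1) dvd geo p x - int p"
proof (rule dvd_cancel_2)
  obtain h where h: "x - 1 = int p ^ e * h" using assms by auto
  obtain q where q: "2 * geo p (1 + (x - 1)) = 2 * int p + int p * (int p - 1) * (x - 1) + 2 * (x - 1)\<^sup>2 * q"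
    using geo_quadratic by blast
  have "int p ^ (e + 1) dvd int p * (x - 1)" using assms by (simp add: mult_dvd_mono)
  moreover have "int p ^ (e + 1) dvd (x - 1)\<^sup>2"
  proof -
    have "int p ^ (e + 1) dvd int p ^ (e + e)" using assms by (intro le_imp_power_dvd) simp
    also have "\<dots> dvd (x - 1)\<^sup>2" unfolding power_add power2_eq_square using assms by (intro mult_dvd_mono)
    finally show ?thesis .
  qed
  moreover have "2 * (geo p x - int p) = int p * (x - 1) * (int p - 1) + (x - 1)\<^sup>2 * (2 * q)"
    using q by (simp add: algebra_simps)
  ultimately show "int p ^ (e + 1) dvd 2 * (geo p x - int p)"
    by (metis dvd_add dvd_mult2)
qed

lemma power_p_minus_1:
  assumes "int p ^ e dvd x - 1" "e \<ge> 1"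
  shows "int p ^ (e + 1) dvd x ^ p - 1"
proof -
  have "int p dvd geo p x"
    using geo_p[OF assms] assms(2)
    by (metis (no_types, opaque_lifting) add.commute dvd_diff_commute dvd_power_le dvd_refl dvd_trans le_add1 power_one_right zdvd_zdiffD)
  then have "int p ^ e * int p dvd (x - 1) * geo p x" using assms(1) by (rule mult_dvd_mono[rotated])
  then show ?thesis by (simp add: geo_times mult.commute)
qed

text \<open>The induction on f splits off one factor p of n and replaces x by x^p. This trades one
  power of p in n for one more power of p in x - 1, so f + e stays constant.\<close>

lemma geo_cong:
  assumes "int p ^ e dvd x - 1" "e \<ge> 1" "int p ^ f dvd int n"
  shows "int p ^ (f + e) dvd geo n x - int n"
  using assms
proof (induction f arbitrary: n x e)
  case 0
  then show ?case by (simp add: geo_cong_base)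
next
  case (Suc f)
  have "p > 0" using p_gt_2 by simp
  have pn: "p ^ Suc f dvd n" using Suc.prems(3) by (simp add: int_dvd_int_iff[symmetric] del: int_dvd_int_iff)
  then obtain k where "n = p ^ Suc f * k" by auto
  then have n1: "n = p * (p ^ f * k)" "int p ^ f dvd int (p ^ f * k)" by simp_all
  define n1 where "n1 = p ^ f * k"
  note n1 = n1[folded n1_def]
  have xp: "int p ^ (e + 1) dvd x ^ p - 1" using power_p_minus_1 Suc.prems by blast
  have I: "int p ^ (f + (e + 1)) dvd geo n1 (x ^ p) - int n1"
    using Suc.IH[OF xp _ n1(2)] by simp
  have J: "int p ^ (e + 1) dvd geo p x - int p" using geo_p Suc.prems by blast
  have "geo n x - int n = geo p x * (geo n1 (x ^ p) - int n1) + (geo p x - int p) * int n1"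
    unfolding n1(1) geo_mult by (simp add: algebra_simps)
  moreover have "int p ^ (f + (e + 1)) dvd (geo p x - int p) * int n1"
    using mult_dvd_mono[OF J n1(2)] by (simp add: power_add algebra_simps)
  ultimately have "int p ^ (f + (e + 1)) dvd geo n x - int n"
    using I by (metis dvd_add dvd_mult)
  then show ?case by simp
qed

lemma geo_dvd:
  assumes "int p dvd x - 1" "int p ^ f dvd int n"
  shows "int p ^ f dvd geo n x"
proof -
  have "int p ^ (f + 1) dvd geo n x - int n" using geo_cong[of 1 x f n] assms by simp
  then have "int p ^ f dvd geo n x - int n" by (metis dvd_mult_left power_add)
  then show ?thesis using assms(2) by (metis zdvd_zdiffD dvd_diff_commute)
qed

lemma power_minus_1_dvd:
  assumes "int p ^ e dvd x - 1" "e \<ge> 1" "int p ^ f dvd int n"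
  shows "int p ^ (f + e) dvd x ^ n - 1"
proof -
  have "int p dvd x - 1" using assms(1,2) by (metis dvd_power dvd_trans not_less zero_less_iff_neq_zero One_nat_def Suc_le_eq)
  then have "int p ^ e * int p ^ f dvd (x - 1) * geo n x"
    using assms geo_dvd by (intro mult_dvd_mono) auto
  then show ?thesis by (simp add: geo_times power_add mult.commute)
qed

lemma coprime_6:
  assumes "p > 3" shows "\<not> int p dvd 3" "\<not> int p dvd 6"
proof -
  show "\<not> int p dvd 3" using assms zdvd_imp_le[of "int p" 3] by auto
  then show "\<not> int p dvd 6"
    using prime_dvd_mult_iff[OF prime_int_p, of 2 3] p_gt_2 zdvd_imp_le[of "int p" 2] by auto
qed

lemma dvd_cancel_6:
  assumes "p > 3" "int p ^ k dvd 6 * z" shows "int p ^ k dvd z"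
proof -
  have "coprime (int p) 6" using coprime_6[OF assms(1)] prime_int_p by (simp add: prime_imp_coprime)
  then have "coprime (int p ^ k) 6" by (simp only: coprime_power_left_iff simp_thms disj_comms)
  then show ?thesis using assms coprime_dvd_mult_right_iff by blast
qed

text \<open>This number is the exponent of A in \<open>key_relation\<close> for k = 1. Up to the
  unit \<alpha> it is h^2 times a factor that is -1/2 modulo p for p > 3. For p = 3 the denominator
  6 costs a factor 3, and the next digit of \<alpha> decides.\<close>

lemma relation_exponent_multiplicity:
  fixes \<alpha> :: int
  assumes \<alpha>: "\<alpha> > 1" and m: "m \<ge> 1" and d: "int p ^ m dvd \<alpha> - 1" and nd: "\<not> int p ^ (m + 1) dvd \<alpha> - 1"
    and p3: "p > 3 \<or> (p = 3 \<and> \<not> [\<alpha> = 7] (mod 9))"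
  shows "int p ^ (2 * m) dvd \<alpha> * geo (nat \<alpha>) \<alpha> - \<alpha> * \<alpha> ^ nat \<alpha>"
    and "\<not> int p ^ (2 * m + 1) dvd \<alpha> * geo (nat \<alpha>) \<alpha> - \<alpha> * \<alpha> ^ nat \<alpha>"
proof -
  define n where "n = nat (\<alpha> - 1)"
  define h where "h = \<alpha> - 1"
  define g where "g = geo n \<alpha>"
  \<comment> \<open>The number in question is \<alpha> f. Writing f through the sum g of h =
    \<alpha> - 1 powers shows the cancellation: g and h agree to first order, so f starts with
    h^2.\<close>
  define f where "f = (1 - h\<^sup>2) * g - h"
  have hn: "h = int n" "\<alpha> = 1 + h" and na: "nat \<alpha> = Suc n" using \<alpha> by (auto simp: h_def n_def)
  have "geo (Suc n) \<alpha> - \<alpha> ^ Suc n = geo (Suc n) \<alpha> * (1 - h) - 1"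
    using geo_times[of \<alpha> "Suc n"] by (simp add: h_def algebra_simps)
  also have "\<dots> = f" unfolding geo_Suc' g_def[symmetric] f_def by (simp add: hn(2) power2_eq_square algebra_simps)
  finally have "\<alpha> * geo (nat \<alpha>) \<alpha> - \<alpha> * \<alpha> ^ nat \<alpha> = \<alpha> * f"
    unfolding na by (metis right_diff_distrib)
  moreover have p\<alpha>: "\<not> int p dvd \<alpha>"
  proof
    assume "int p dvd \<alpha>"
    moreover have "int p dvd \<alpha> - 1" using d m by (metis dvd_power dvd_trans One_nat_def Suc_le_eq)
    ultimately have "int p dvd 1" by (metis dvd_diff diff_diff_eq2 add_diff_cancel_left')
    then show False using p_gt_2 by simp
  qed
  then have cop: "coprime (int p ^ k) \<alpha>" for k
    using prime_int_p by (simp add: prime_imp_coprime)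
  moreover obtain h1 where h1: "h = int p ^ m * h1" using d h_def by auto
  have nh1: "\<not> int p dvd h1" using nd h1 by (auto simp: h_def[symmetric])
  have pg: "int p dvd g"
  proof -
    have "int p ^ m dvd g" unfolding g_def
      using geo_dvd[of \<alpha> m n] d m hn by (metis dvd_power dvd_trans One_nat_def Suc_le_eq h_def)
    then show ?thesis using m by (metis dvd_power dvd_trans One_nat_def Suc_le_eq)
  qed
  have ph: "int p dvd h" using h1 m by (metis dvd_mult2 dvd_power One_nat_def Suc_le_eq)
  obtain q where q: "6 * g = 6 * h + 3 * h * (h - 1) * h + h * (h - 1) * (h - 2) * h\<^sup>2 + 6 * h ^ 3 * q"
    using geo_cubic[of n h] hn by (auto simp: g_def)
  then have f6: "6 * f = h\<^sup>2 * (3 * (h - 1) + h * (h - 1) * (h - 2) + 6 * h * q - 6 * g)"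
    by (simp add: f_def power2_eq_square power3_eq_cube algebra_simps)
  have "int p ^ (2 * m) dvd f \<and> \<not> int p ^ (2 * m + 1) dvd f"
  proof (cases "p > 3")
    case True
    let ?b = "3 * (h - 1) + h * (h - 1) * (h - 2) + 6 * h * q - 6 * g"
    have "int p dvd ?b + 3"
    proof -
      have "?b + 3 = h * (3 + (h - 1) * (h - 2) + 6 * q) - 6 * g" by (simp add: algebra_simps)
      then show ?thesis using ph pg by (metis dvd_diff dvd_mult dvd_mult2)
    qed
    then have nb: "\<not> int p dvd ?b" using coprime_6[OF True] by (metis dvd_add_right_iff)
    have e: "6 * f = int p ^ (2 * m) * (h1\<^sup>2 * ?b)"
      using f6 h1 by (simp add: power_mult_distrib power_mult[symmetric] mult.commute mult.left_commute)
    then have 1: "int p ^ (2 * m) dvd f" using dvd_cancel_6[OF True] by (metis dvd_triv_left)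
    have "\<not> int p ^ (2 * m + 1) dvd f"
    proof
      assume "int p ^ (2 * m + 1) dvd f"
      then have "int p ^ (2 * m) * int p dvd int p ^ (2 * m) * (h1\<^sup>2 * ?b)"
        using e by (metis dvd_mult power_add power_one_right)
      then have "int p dvd h1\<^sup>2 * ?b" using p_gt_2 by simp
      then show False using nh1 nb prime_int_p by (metis prime_dvd_mult_iff prime_dvd_power)
    qed
    with 1 show ?thesis by blast
  next
    case False
    then have p: "p = 3" and a7: "\<not> [\<alpha> = 7] (mod 9)" using p3 by auto
    obtain h' where h': "h = 3 * h'" using ph p by auto
    let ?b = "(h - 1) + h' * (h - 1) * (h - 2) + 6 * h' * q - 2 * g"
    have f2: "2 * f = h\<^sup>2 * ?b"
    proof -
      have "3 * (2 * f) = 3 * (h\<^sup>2 * ?b)" using f6 by (simp add: h' algebra_simps)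
      then show ?thesis by simp
    qed
    \<comment> \<open>Modulo 3 the bracket is 2 h' - 1 with \<alpha> = 1 + 3 h'; it vanishes exactly
      when \<alpha> is 7 modulo 9.\<close>
    have "int p dvd ?b - (2 * h' - 1)"
    proof -
      have "?b - (2 * h' - 1) = 3 * (h' + h' * h' * (h - 3) + 2 * h' * q) - 2 * g"
        by (simp add: h' algebra_simps)
      then show ?thesis using p pg by (metis dvd_diff dvd_mult dvd_triv_left of_nat_numeral)
    qed
    moreover have "\<not> int p dvd 2 * h' - 1"
    proof
      assume "int p dvd 2 * h' - 1"
      then obtain r where "2 * h' - 1 = 3 * r" using p by auto
      then have "h' = 3 * (h' - r) - 1" by simp
      then have "\<alpha> - 7 = 9 * (h' - r - 1)" using h' hn(2) by simp
      then show False using a7 by (metis cong_iff_dvd_diff dvd_triv_left)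
    qed
    ultimately have nb: "\<not> int p dvd ?b" by (metis zdvd_zdiffD dvd_diff_commute)
    have e: "2 * f = int p ^ (2 * m) * (h1\<^sup>2 * ?b)"
      using f2 h1 by (simp add: power_mult_distrib power_mult[symmetric] mult.commute mult.left_commute)
    then have 1: "int p ^ (2 * m) dvd f" using dvd_cancel_2 by (metis dvd_triv_left)
    have "\<not> int p ^ (2 * m + 1) dvd f"
    proof
      assume "int p ^ (2 * m + 1) dvd f"
      then have "int p ^ (2 * m) * int p dvd int p ^ (2 * m) * (h1\<^sup>2 * ?b)"
        using e by (metis dvd_mult power_add power_one_right)
      then have "int p dvd h1\<^sup>2 * ?b" using p_gt_2 by simp
      then show False using nh1 nb prime_int_p by (metis prime_dvd_mult_iff prime_dvd_power)
    qed
    with 1 show ?thesis by blast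
  qed
  ultimately show "int p ^ (2 * m) dvd \<alpha> * geo (nat \<alpha>) \<alpha> - \<alpha> * \<alpha> ^ nat \<alpha>"
    and "\<not> int p ^ (2 * m + 1) dvd \<alpha> * geo (nat \<alpha>) \<alpha> - \<alpha> * \<alpha> ^ nat \<alpha>"
    using cop coprime_dvd_mult_right_iff by (metis dvd_mult, metis)
qed

text \<open>Modulo p the quotient S' is (p^m - 1) / 2, hence -1/2, so S' + 1 is 1/2. In the model S'
  measures how the p^m-th power of the action of b moves a, and S' + 1 has to be inverted to find
  t.\<close>

lemma arithmetic_geometric_sum:
  fixes \<beta> :: int
  assumes m: "m \<ge> 2" and d: "int p ^ m dvd \<beta> - 1"
  obtains S' where "(\<Sum>i<p ^ m. int i * \<beta> ^ i) = int p ^ m * S'" "\<not> int p dvd S' + 1"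
proof -
  define n where "n = int (p ^ m)"
  obtain k1 where "\<beta> - 1 = int p ^ m * k1" using d by (elim dvdE)
  then have k1: "\<beta> = 1 + n * k1" by (simp add: n_def algebra_simps)
  have "\<exists>R. 6 * (\<Sum>i<N. int i * \<beta> ^ i) = 3 * int N * (int N - 1)
     + n * k1 * (int N * (int N - 1) * (2 * int N - 1)) + 6 * (n * k1)\<^sup>2 * R" for N
  proof (induction N)
    case (Suc N)
    then obtain R where R: "6 * (\<Sum>i<N. int i * \<beta> ^ i) = 3 * int N * (int N - 1)
     + n * k1 * (int N * (int N - 1) * (2 * int N - 1)) + 6 * (n * k1)\<^sup>2 * R" by blast
    obtain r where r: "\<beta> ^ N = 1 + int N * (n * k1) + (n * k1)\<^sup>2 * r"
      using power_linear[of "n * k1" N] k1 by auto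
    have "6 * (\<Sum>i<Suc N. int i * \<beta> ^ i) = 3 * int (Suc N) * (int (Suc N) - 1)
     + n * k1 * (int (Suc N) * (int (Suc N) - 1) * (2 * int (Suc N) - 1)) + 6 * (n * k1)\<^sup>2 * (R + int N * r)"
      using R r by (simp add: algebra_simps power2_eq_square)
    then show ?case by blast
  qed simp
  then obtain R where R: "6 * (\<Sum>i<p ^ m. int i * \<beta> ^ i) = 3 * n * (n - 1)
     + n * k1 * (n * (n - 1) * (2 * n - 1)) + 6 * (n * k1)\<^sup>2 * R" unfolding n_def by blast
  define S where "S = (\<Sum>i<p ^ m. int i * \<beta> ^ i)"
  have S6: "6 * S = n * (3 * (n - 1) + n * (k1 * (n - 1) * (2 * n - 1)) + 6 * n * k1\<^sup>2 * R)"
    using R by (simp add: S_def algebra_simps power2_eq_square)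
  have pn: "int p dvd n" using m by (simp add: n_def)
  have n0: "n \<noteq> 0" using p_gt_2 by (simp add: n_def)
  have "\<exists>S'. S = n * S' \<and> \<not> int p dvd S' + 1"
  proof (cases "p > 3")
    case True
    have "int p ^ m dvd S" using dvd_cancel_6[OF True, of m S] S6 n_def by auto
    then obtain S' where S': "S = n * S'" by (auto simp: n_def)
    have "n * (6 * S') = n * (3 * (n - 1) + n * (k1 * (n - 1) * (2 * n - 1)) + 6 * n * k1\<^sup>2 * R)"
      using S6 S' by (simp add: mult.left_commute)
    then have "6 * S' = 3 * (n - 1) + n * (k1 * (n - 1) * (2 * n - 1)) + 6 * n * k1\<^sup>2 * R"
      using n0 by (metis mult_left_cancel)
    then have e: "6 * (S' + 1) = n * (3 + k1 * (n - 1) * (2 * n - 1) + 6 * k1\<^sup>2 * R) + 3"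
      by (simp add: algebra_simps)
    have "\<not> int p dvd S' + 1"
    proof
      assume "int p dvd S' + 1"
      then have "int p dvd n * (3 + k1 * (n - 1) * (2 * n - 1) + 6 * k1\<^sup>2 * R) + 3"
        using e by (metis dvd_mult)
      then have "int p dvd 3" using pn dvd_add_right_iff dvd_mult2 by blast
      then show False using coprime_6[OF True] by simp
    qed
    then show ?thesis using S' by blast
  next
    case False
    then have p: "p = 3" using p_gt_2 by simp
    \<comment> \<open>For p = 3 the denominator 6 costs one factor 3 of n = 3^m; m \<ge> 2 leaves n'
      = n / 3 still divisible by 3.\<close>
    obtain m' where m': "m = Suc (Suc m')" using m by (metis add_2_eq_Suc le_Suc_ex)
    define n' where "n' = (3::int) ^ Suc m'"
    have n': "n = 3 * n'" by (simp add: n_def p m' n'_def)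
    have "3 * (2 * S) = 3 * (n * ((n - 1) + n' * (k1 * (n - 1) * (2 * n - 1)) + 2 * n * k1\<^sup>2 * R))"
      using S6 by (simp add: n' algebra_simps)
    then have S2: "2 * S = n * ((n - 1) + n' * (k1 * (n - 1) * (2 * n - 1)) + 2 * n * k1\<^sup>2 * R)" by simp
    then have "int p ^ m dvd S" using dvd_cancel_2[of m S] n_def by auto
    then obtain S' where S': "S = n * S'" by (auto simp: n_def)
    have "n * (2 * S') = n * ((n - 1) + n' * (k1 * (n - 1) * (2 * n - 1)) + 2 * n * k1\<^sup>2 * R)"
      using S2 S' by (simp add: mult.left_commute)
    then have "2 * S' = (n - 1) + n' * (k1 * (n - 1) * (2 * n - 1)) + 2 * n * k1\<^sup>2 * R"
      using n0 by (metis mult_left_cancel)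
    then have e: "2 * (S' + 1) = n' * (3 + k1 * (n - 1) * (2 * n - 1) + 6 * k1\<^sup>2 * R) + 1"
      by (simp add: n' algebra_simps)
    have "\<not> int p dvd S' + 1"
    proof
      assume "int p dvd S' + 1"
      then have "int p dvd n' * (3 + k1 * (n - 1) * (2 * n - 1) + 6 * k1\<^sup>2 * R) + 1"
        using e by (metis dvd_mult)
      moreover have "int p dvd n'" by (simp add: n'_def p)
      ultimately have "int p dvd 1" using dvd_add_right_iff dvd_mult2 by blast
      then show False using p by simp
    qed
    then show ?thesis using S' by blast
  qed
  then show thesis using that by (auto simp: S_def n_def)
qed

end

section \<open>Arithmetic at the primes dividing an order\<close>

lemma dvd_power_self_minus_1:
  fixes x :: int and n :: nat
  assumes "n > 0" "\<And>q. Factorial_Ring.prime q \<Longrightarrow> q dvd n \<Longrightarrow> int q dvd x - 1"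
  shows "int n dvd x ^ n - 1"
  using assms
proof (induction n rule: prime_divisors_induct)
  case (factor q n)
  then have n: "n > 0" and q: "int q dvd x - 1" by auto
  have I: "int n dvd x ^ n - 1" using factor n by (metis dvd_mult)
  \<comment> \<open>x^n is 1 modulo q, so this sum of q terms is divisible by q; it is the cofactor
    of x^n - 1 in x^(q n) - 1 and supplies the new factor.\<close>
  have "int q dvd geo q (x ^ n) - int q"
    using dvd_power_minus_1[OF q] by (rule geo_cong_base)
  then have "int q dvd geo q (x ^ n)" by (metis zdvd_zdiffD dvd_diff_commute dvd_refl)
  then have "int n * int q dvd (x ^ n - 1) * geo q (x ^ n)" using I by (intro mult_dvd_mono)
  then show ?case by (simp add: geo_times power_mult[symmetric] mult.commute)
next
  case (unit n) then show ?case by simp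
qed simp

text \<open>The witness is k = totient h, where h is the order of \<alpha> modulo q. As \<alpha> is
  prime to h, t = \<alpha>^k is 1 modulo h, so \<alpha>^t is \<alpha> modulo q. Multiplying the
  exponent by \<alpha> - 1 then leaves \<alpha> (\<alpha> - 1) (1 - t) modulo q, and q dividing 1 -
  t would force h to divide k, although 0 < k < h.\<close>

lemma exists_power_relation_exponent_not_dvd:
  fixes \<alpha> :: int and q n :: nat
  assumes q: "Factorial_Ring.prime q" and \<alpha>: "\<alpha> > 0" and nd: "\<not> int q dvd \<alpha> - 1" and qn: "q dvd n"
    and cop: "coprime \<alpha> (int n)" and d: "int q dvd \<alpha> ^ n - 1"
  shows "\<exists>k. \<not> int q dvd \<alpha> * geo (nat (\<alpha> ^ k)) \<alpha> - \<alpha> ^ k * \<alpha> ^ nat (\<alpha> ^ k)"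
proof -
  define a where "a = nat \<alpha>"
  have a: "\<alpha> = int a" using \<alpha> by (simp add: a_def)
  have copn: "coprime a n" using cop a by simp
  have copq: "coprime q a" using copn qn by (metis coprime_commute coprime_divisors dvd_refl)
  define h where "h = ord q a"
  have "[a ^ n = 1] (mod q)"
    using d a by (metis cong_iff_dvd_diff cong_int_iff of_nat_1 of_nat_power)
  then have hn: "h dvd n" by (simp add: h_def ord_divides')
  have h0: "h > 0" using copq by (simp add: h_def ord_eq_0 zero_less_iff_neq_zero)
  have h1: "h \<noteq> 1"
  proof
    assume "h = 1"
    then have "[a ^ 1 = 1] (mod q)" using ord_works[of a q] by (simp add: h_def)
    then show False using nd a by (metis cong_iff_dvd_diff cong_int_iff of_nat_1 power_one_right)
  qed
  define k where "k = totient h"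
  have k0: "k > 0" and kh: "k < h" using h0 h1 totient_less[of h] by (auto simp: k_def)
  have "coprime a h" using copn hn by (metis coprime_divisors dvd_refl)
  then have "[a ^ k = 1] (mod h)" unfolding k_def by (rule euler_theorem)
  then have e1: "[a ^ (a ^ k) = a ^ 1] (mod q)"
    using order_divides_expdiff[OF copq] h_def by blast
  define t where "t = a ^ k"
  have nt: "nat (\<alpha> ^ k) = t" by (simp add: a t_def nat_power_eq)
  have e2: "int q dvd \<alpha> ^ t - \<alpha>"
    using e1 by (metis a cong_iff_dvd_diff cong_int_iff of_nat_power power_one_right t_def)
  have "\<not> int q dvd \<alpha> * geo t \<alpha> - int t * \<alpha> ^ t"
  proof
    assume "int q dvd \<alpha> * geo t \<alpha> - int t * \<alpha> ^ t"
    then have "int q dvd (\<alpha> - 1) * (\<alpha> * geo t \<alpha> - int t * \<alpha> ^ t)" by simp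
    also have "(\<alpha> - 1) * (\<alpha> * geo t \<alpha> - int t * \<alpha> ^ t)
      = \<alpha> * ((\<alpha> - 1) * geo t \<alpha>) - (\<alpha> - 1) * int t * \<alpha> ^ t" by (simp add: algebra_simps)
    also have "\<dots> = (\<alpha> ^ t - \<alpha>) * (\<alpha> - (\<alpha> - 1) * int t) + \<alpha> * (\<alpha> - 1) * (1 - int t)"
      unfolding geo_times by (simp add: algebra_simps)
    finally have "int q dvd \<alpha> * (\<alpha> - 1) * (1 - int t)"
      using dvd_add_right_iff[OF dvd_mult2[OF e2]] by blast
    moreover have "\<not> int q dvd \<alpha>"
    proof
      assume "int q dvd \<alpha>"
      then have "is_unit q" using coprime_common_divisor[OF copq dvd_refl] a by simp
      then show False using q by auto
    qed
    ultimately have "int q dvd 1 - int t" using nd q by (simp add: prime_dvd_mult_iff)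
    then have "[1 = int t] (mod int q)" by (simp add: cong_iff_dvd_diff)
    then have "[a ^ k = 1] (mod q)" unfolding t_def[symmetric]
      by (metis cong_int_iff cong_sym of_nat_1)
    then have "h dvd k" by (simp add: h_def ord_divides')
    then show False using k0 kh by (metis dvd_imp_le not_less)
  qed
  then have "\<not> int q dvd \<alpha> * geo (nat (\<alpha> ^ k)) \<alpha> - \<alpha> ^ k * \<alpha> ^ nat (\<alpha> ^ k)"
    unfolding nt by (simp add: a t_def)
  then show ?thesis ..
qed

section \<open>The Macdonald relations\<close>

context group
begin

lemma inv_cancel_left [simp]:
  assumes "x \<in> carrier G" "y \<in> carrier G"
  shows "inv x \<otimes> (x \<otimes> y) = y" "x \<otimes> (inv x \<otimes> y) = y"
  using assms by (simp_all add: m_assoc[symmetric])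

text \<open>Products are kept associated to the right; this form applies a relation between two
  factors in front of a tail w.\<close>

lemma commute_ext:
  assumes "x \<otimes> y = u \<otimes> v" "x \<in> carrier G" "y \<in> carrier G" "u \<in> carrier G" "v \<in> carrier G" "w \<in> carrier G"
  shows "x \<otimes> (y \<otimes> w) = u \<otimes> (v \<otimes> w)"
  using assms by (simp add: m_assoc[symmetric])

lemma int_pow_add_ext:
  assumes "x \<in> carrier G" "y \<in> carrier G"
  shows "x [^] (i::int) \<otimes> (x [^] (j::int) \<otimes> y) = x [^] (i + j) \<otimes> y"
  using assms by (simp add: int_pow_mult m_assoc)

lemma conj_int_pow:
  assumes "x \<otimes> y = y \<otimes> z" "x \<in> carrier G" "y \<in> carrier G" "z \<in> carrier G"
  shows "x [^] (i::int) \<otimes> y = y \<otimes> z [^] i"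
proof -
  have nat: "x [^] (int n) \<otimes> y = y \<otimes> z [^] (int n)" for n
  proof (induction n)
    case (Suc n)
    have "x [^] (int (Suc n)) \<otimes> y = x [^] int n \<otimes> (x \<otimes> y)"
      using assms by (simp add: int_pow_mult m_assoc add.commute[of 1])
    also have "\<dots> = (x [^] int n \<otimes> y) \<otimes> z" using assms by (simp add: m_assoc)
    also have "\<dots> = y \<otimes> z [^] (int (Suc n))"
      using assms Suc by (simp add: int_pow_mult m_assoc add.commute[of 1])
    finally show ?case .
  qed (use assms in simp)
  show ?thesis
  proof (cases "i \<ge> 0")
    case True
    then show ?thesis using nat[of "nat i"] by simp
  next
    case False
    define n where "n = nat (- i)"
    have i: "i = - int n" using False by (simp add: n_def)
    have "x [^] (- int n) \<otimes> (x [^] int n \<otimes> y) \<otimes> z [^] (- int n)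
        = x [^] (- int n) \<otimes> (y \<otimes> z [^] int n) \<otimes> z [^] (- int n)" by (simp only: nat)
    then show ?thesis unfolding i using assms
      by (simp add: m_assoc int_pow_add_ext int_pow_mult[symmetric])
  qed
qed

lemma twist:
  assumes "x \<otimes> y = y \<otimes> x [^] (k::int)" "x \<in> carrier G" "y \<in> carrier G"
  shows "x [^] (i::int) \<otimes> y [^] int j = y [^] int j \<otimes> x [^] (i * k ^ j)"
proof (induction j)
  case (Suc j)
  have "x [^] i \<otimes> y [^] int (Suc j) = (x [^] i \<otimes> y [^] int j) \<otimes> y"
    using assms by (simp add: int_pow_mult m_assoc add.commute[of 1])
  also have "\<dots> = y [^] int j \<otimes> (x [^] (i * k ^ j) \<otimes> y)"
    using Suc assms by (simp add: m_assoc)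
  also have "\<dots> = y [^] int j \<otimes> (y \<otimes> (x [^] k) [^] (i * k ^ j))"
    using conj_int_pow[OF assms(1)] assms by simp
  also have "\<dots> = y [^] int (Suc j) \<otimes> x [^] (i * k ^ Suc j)"
    using assms by (simp add: int_pow_mult m_assoc add.commute[of 1] int_pow_pow mult_ac)
  finally show ?case .
qed (use assms in simp)

text \<open>Each new factor y passes the accumulated power of x and multiplies its exponent by k,
  which is the recursion of the geometric sum.\<close>

lemma twist_pow:
  assumes "x \<otimes> y = y \<otimes> x [^] (k::int)" "x \<in> carrier G" "y \<in> carrier G"
  shows "(y \<otimes> x) [^] int n = y [^] int n \<otimes> x [^] geo n k"
proof (induction n)
  case (Suc n)
  have "(y \<otimes> x) [^] int (Suc n) = y [^] int n \<otimes> x [^] geo n k \<otimes> (y \<otimes> x)"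
    using Suc assms by (simp add: int_pow_mult add.commute[of 1])
  also have "\<dots> = y [^] int n \<otimes> (x [^] geo n k \<otimes> y [^] int 1) \<otimes> x"
    using assms by (simp add: m_assoc)
  also have "\<dots> = y [^] int n \<otimes> (y [^] int 1 \<otimes> x [^] (geo n k * k)) \<otimes> x [^] (1::int)"
    using twist[OF assms, of "geo n k" 1] assms by simp
  also have "\<dots> = y [^] (int n + int 1) \<otimes> x [^] (geo n k * k + 1)"
    using assms by (simp add: int_pow_mult m_assoc del: of_nat_1)
  also have "\<dots> = y [^] int (Suc n) \<otimes> x [^] geo (Suc n) k"
    by (simp add: geo_Suc' mult.commute add.commute)
  finally show ?case .
qed (use assms in simp)

lemma twist_pow_gen:
  assumes "x \<otimes> y = y \<otimes> x [^] (k::int)" "x \<in> carrier G" "y \<in> carrier G"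
  shows "(y [^] int d \<otimes> x [^] (i::int)) [^] int n = y [^] int (d * n) \<otimes> x [^] (i * geo n (k ^ d))"
proof -
  have "x [^] i \<otimes> y [^] int d = y [^] int d \<otimes> (x [^] i) [^] (k ^ d)"
    using twist[OF assms, of i d] assms by (simp add: int_pow_pow)
  from twist_pow[OF this] assms show ?thesis by (simp add: int_pow_pow)
qed

lemma twist_pow':
  assumes "x \<otimes> y = y \<otimes> x [^] (k::int)" "x \<in> carrier G" "y \<in> carrier G"
  shows "(x \<otimes> y) [^] int n = y [^] int n \<otimes> x [^] (k * geo n k)"
  using twist_pow_gen[OF assms, of 1 k n] assms by simp

lemma pow_eq_split:
  assumes "x [^] (i::int) \<otimes> y [^] (j::int) = x [^] (i'::int) \<otimes> y [^] (j'::int)" "x \<in> carrier G" "y \<in> carrier G"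
  shows "x [^] (i' - i) = y [^] (j - j')"
proof -
  have "x [^] (- i) \<otimes> (x [^] i \<otimes> y [^] j) \<otimes> y [^] (- j') = x [^] (- i) \<otimes> (x [^] i' \<otimes> y [^] j') \<otimes> y [^] (- j')"
    by (simp only: assms(1))
  then have "y [^] (j + - j') = x [^] (- i + i')"
    using assms(2,3) by (simp add: m_assoc int_pow_add_ext int_pow_mult[symmetric])
  then show ?thesis by (simp add: add.commute)
qed

end

text \<open>\<open>AB\<close> encodes C = [A,B]. The relations are required of elements of an
  arbitrary group, so that the same results serve the presented group, its p-parts, its quotients
  and the model.\<close>

locale macd = group G for G (structure) +
  fixes A B C and \<alpha> \<beta> :: int
  assumes A [simp, intro]: "A \<in> carrier G" and B [simp, intro]: "B \<in> carrier G" and C [simp, intro]: "C \<in> carrier G"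
    and AB: "A \<otimes> B = B \<otimes> A \<otimes> C"
    and AC: "A \<otimes> C = C \<otimes> A [^] \<alpha>"
    and BC: "B \<otimes> inv C = inv C \<otimes> B [^] \<beta>"
begin

lemma BA: "B \<otimes> A = A \<otimes> B \<otimes> inv C"
  by (simp add: AB m_assoc)

text \<open>Every statement about A has a mirror image about B; C turns into its inverse because
  [B,A] is the inverse of [A,B].\<close>

lemma swap: "macd G B A (inv C) \<beta> \<alpha>"
  by unfold_locales (use BA AC BC in simp_all)

lemma A_pow_C: "A [^] (i::int) \<otimes> C [^] int j = C [^] int j \<otimes> A [^] (i * \<alpha> ^ j)"
  by (rule twist[OF AC]) simp_all

lemma C_pow_B: "C [^] int j \<otimes> B [^] (i::int) = B [^] (i * \<beta> ^ j) \<otimes> C [^] int j"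
proof -
  have "B [^] i \<otimes> (inv C) [^] int j = (inv C) [^] int j \<otimes> B [^] (i * \<beta> ^ j)"
    by (rule twist[OF BC]) simp_all
  then have "B [^] i \<otimes> C [^] (- int j) = C [^] (- int j) \<otimes> B [^] (i * \<beta> ^ j)"
    by (simp add: int_pow_inv int_pow_neg)
  then have "C [^] int j \<otimes> (B [^] i \<otimes> C [^] (- int j)) \<otimes> C [^] int j
    = C [^] int j \<otimes> (C [^] (- int j) \<otimes> B [^] (i * \<beta> ^ j)) \<otimes> C [^] int j" by simp
  then show ?thesis by (simp add: m_assoc int_pow_add_ext int_pow_mult[symmetric])
qed

lemma A_pow_B: "A [^] (i::int) \<otimes> B = B \<otimes> (A \<otimes> C) [^] i"
  by (rule conj_int_pow) (simp_all add: AB m_assoc)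

lemma AC_pow: "(A \<otimes> C) [^] int n = C [^] int n \<otimes> A [^] (\<alpha> * geo n \<alpha>)"
  by (rule twist_pow'[OF AC]) simp_all

lemma B_pow_A: "B [^] int n \<otimes> A = A \<otimes> (C [^] (- int n) \<otimes> B [^] (\<beta> * geo n \<beta>))"
proof -
  interpret s: macd G B A "inv C" \<beta> \<alpha> by (rule swap)
  show ?thesis using s.A_pow_B[of "int n"] s.AC_pow[of n] by (simp add: int_pow_inv int_pow_neg)
qed

text \<open>C^k A^t B is evaluated in two ways. Moving A^t to the left through C^k leaves A B^u C^k.
  Moving it to the right through B gives (A C)^t, after which B^u has to pass a single A. Cancelling
  the leading A leaves a relation in which A occurs only at the end of one side and B only at the
  start of the other.\<close>

lemma key_relation:
  assumes t: "int t = \<alpha> ^ k" and u: "int u = \<beta> ^ k"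
  shows "C [^] (int k + int t) \<otimes> A [^] (\<alpha> * geo t \<alpha> - int t * \<alpha> ^ t)
       = B [^] (int u * \<beta> ^ u - \<beta> * geo u \<beta>) \<otimes> C [^] (int k + int u)"
proof -
  define x where "x = \<alpha> * geo t \<alpha> - int t * \<alpha> ^ t"
  have s1: "A \<otimes> C [^] int k = C [^] int k \<otimes> A [^] int t"
    using A_pow_C[of 1 k] t by simp
  have s2: "C [^] int k \<otimes> B = B [^] int u \<otimes> C [^] int k"
    using C_pow_B[of k 1] u by simp
  \<comment> \<open>(A C)^t is written with A^t in front, because C^k A^t is again A C^k.\<close>
  have s3: "A [^] int t \<otimes> B = B \<otimes> (A [^] int t \<otimes> (C [^] int t \<otimes> A [^] x))"
  proof -
    have "A [^] int t \<otimes> (C [^] int t \<otimes> A [^] x) = C [^] int t \<otimes> (A [^] (int t * \<alpha> ^ t) \<otimes> A [^] x)"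
      using commute_ext[OF A_pow_C] by simp
    also have "\<dots> = (A \<otimes> C) [^] int t" by (simp add: AC_pow int_pow_mult[symmetric] x_def)
    finally show ?thesis using A_pow_B by simp
  qed
  have "C [^] int k \<otimes> (A [^] int t \<otimes> B) = A \<otimes> (B [^] int u \<otimes> C [^] int k)"
    using commute_ext[OF s1[symmetric], of B] s2 by simp
  moreover have "C [^] int k \<otimes> (A [^] int t \<otimes> B)
    = A \<otimes> (C [^] (- int u) \<otimes> (B [^] (\<beta> * geo u \<beta>) \<otimes> (C [^] (int k + int t) \<otimes> A [^] x)))"
  proof -
    have "C [^] int k \<otimes> (A [^] int t \<otimes> B)
      = B [^] int u \<otimes> (C [^] int k \<otimes> (A [^] int t \<otimes> (C [^] int t \<otimes> A [^] x)))"
      using commute_ext[OF s2] by (simp add: s3)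
    also have "\<dots> = B [^] int u \<otimes> (A \<otimes> (C [^] int k \<otimes> (C [^] int t \<otimes> A [^] x)))"
      using commute_ext[OF s1[symmetric]] by simp
    also have "\<dots> = A \<otimes> ((C [^] (- int u) \<otimes> B [^] (\<beta> * geo u \<beta>)) \<otimes> (C [^] int k \<otimes> (C [^] int t \<otimes> A [^] x)))"
      using commute_ext[OF B_pow_A] by simp
    finally show ?thesis by (simp add: m_assoc int_pow_add_ext)
  qed
  ultimately have "B [^] int u \<otimes> C [^] int k
    = C [^] (- int u) \<otimes> (B [^] (\<beta> * geo u \<beta>) \<otimes> (C [^] (int k + int t) \<otimes> A [^] x))"
    by simp
  then have "C [^] int u \<otimes> (B [^] int u \<otimes> C [^] int k)
    = C [^] int u \<otimes> (C [^] (- int u) \<otimes> (B [^] (\<beta> * geo u \<beta>) \<otimes> (C [^] (int k + int t) \<otimes> A [^] x)))" by simp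
  moreover have "C [^] int u \<otimes> (B [^] int u \<otimes> C [^] int k) = B [^] (int u * \<beta> ^ u) \<otimes> C [^] (int k + int u)"
    using commute_ext[OF C_pow_B] by (simp add: int_pow_mult[symmetric] add.commute)
  ultimately have "B [^] (- (\<beta> * geo u \<beta>)) \<otimes> (B [^] (int u * \<beta> ^ u) \<otimes> C [^] (int k + int u))
    = B [^] (- (\<beta> * geo u \<beta>)) \<otimes> (B [^] (\<beta> * geo u \<beta>) \<otimes> (C [^] (int k + int t) \<otimes> A [^] x))"
    by (simp add: int_pow_add_ext)
  then show ?thesis by (simp add: int_pow_add_ext x_def add.commute[of "- _"])
qed

text \<open>Both sides of the hypothesis are brought to the form C^i A^j. The exponents of C differ
  by D (\<beta> - 1), so this power of C is a power of A. For negative \<beta> the power of W is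
  first moved to the other side, so that only natural powers are expanded.\<close>

lemma C_pow_in_A_aux:
  assumes W: "C \<otimes> W = W [^] \<beta> \<otimes> C" and W_def: "W = C [^] int D \<otimes> A [^] (j::int)"
  shows "\<exists>i::int. C [^] (int D * (\<beta> - 1)) = A [^] i"
proof (cases "\<beta> \<ge> 0")
  case True
  then have b: "\<beta> = int (nat \<beta>)" by simp
  let ?n = "nat \<beta>" let ?g = "j * geo ?n (\<alpha> ^ D)"
  have "W [^] \<beta> = C [^] int (D * ?n) \<otimes> A [^] ?g"
    unfolding W_def by (subst b) (rule twist_pow_gen[OF AC], simp_all)
  then have "W [^] \<beta> \<otimes> C = C [^] int (D * ?n) \<otimes> (A [^] ?g \<otimes> C [^] int 1)" by (simp add: m_assoc)
  also have "\<dots> = C [^] (int (D * ?n) + 1) \<otimes> A [^] (?g * \<alpha>)"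
    unfolding A_pow_C by (simp add: int_pow_mult m_assoc)
  finally have "C [^] (1 + int D) \<otimes> A [^] j = C [^] (int (D * ?n) + 1) \<otimes> A [^] (?g * \<alpha>)"
    using W W_def by (simp add: int_pow_mult m_assoc)
  from pow_eq_split[OF this] have "C [^] (int (D * ?n) - int D) = A [^] (j - ?g * \<alpha>)" by simp
  then show ?thesis using b by (auto simp: algebra_simps)
next
  case False
  define n where "n = nat (- \<beta>)"
  have b: "\<beta> = - int n" using False by (simp add: n_def)
  have Wc: "W \<in> carrier G" by (simp add: W_def)
  let ?g = "j * geo n (\<alpha> ^ D)"
  have "W [^] int n \<otimes> (C \<otimes> W) = C"
    unfolding W b using Wc by (simp add: int_pow_add_ext)
  moreover have "W [^] int n = C [^] int (D * n) \<otimes> A [^] ?g"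
    unfolding W_def by (rule twist_pow_gen[OF AC]) simp_all
  ultimately have "C [^] int (D * n) \<otimes> (A [^] ?g \<otimes> (C [^] int (Suc D) \<otimes> A [^] j)) = C"
    by (simp add: W_def m_assoc int_pow_mult)
  then have "C [^] (int (D * n) + int (Suc D)) \<otimes> A [^] (?g * \<alpha> ^ Suc D + j) = C [^] (1::int) \<otimes> A [^] (0::int)"
    unfolding commute_ext[OF A_pow_C A[THEN int_pow_closed] C[THEN int_pow_closed] C[THEN int_pow_closed]
      A[THEN int_pow_closed] A[THEN int_pow_closed]]
    by (simp add: int_pow_add_ext int_pow_mult[symmetric])
  from pow_eq_split[OF this] have "C [^] (1 - (int (D * n) + int (Suc D))) = A [^] (?g * \<alpha> ^ Suc D + j)" by simp
  moreover have "1 - (int (D * n) + int (Suc D)) = int D * (\<beta> - 1)" by (simp add: b algebra_simps)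
  ultimately show ?thesis by metis
qed

text \<open>\<open>key_relation\<close> read as a conjugation: W = A^x C^(t-u) is the conjugate of
  B^y by C^(k+t). To get a nonnegative exponent of C, W is inverted when t < u; therefore y is
  described only up to sign and D as an absolute value.\<close>

lemma key_relation_conj:
  assumes t: "int t = \<alpha> ^ k" and u: "int u = \<beta> ^ k"
  obtains D :: nat and j y :: int where "int D = \<bar>\<alpha> ^ k - \<beta> ^ k\<bar>"
    "\<bar>y\<bar> = \<bar>int u * \<beta> ^ u - \<beta> * geo u \<beta>\<bar>"
    "C [^] int (k + t) \<otimes> (C [^] int D \<otimes> A [^] j) = B [^] y \<otimes> C [^] int (k + t)"
proof -
  define x where "x = \<alpha> * geo t \<alpha> - int t * \<alpha> ^ t"
  define y where "y = int u * \<beta> ^ u - \<beta> * geo u \<beta>"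
  define W where "W = A [^] x \<otimes> C [^] (int t - int u)"
  define s where "s = int (k + t)"
  have Wc [simp]: "W \<in> carrier G" by (simp add: W_def)
  have key: "C [^] s \<otimes> A [^] x = B [^] y \<otimes> C [^] (int k + int u)"
    unfolding s_def using key_relation[OF t u] by (simp add: x_def y_def)
  have Ws: "C [^] s \<otimes> W = B [^] y \<otimes> C [^] s"
  proof -
    have "C [^] s \<otimes> W = (C [^] s \<otimes> A [^] x) \<otimes> C [^] (int t - int u)" by (simp add: W_def m_assoc)
    then show ?thesis unfolding key by (simp add: m_assoc int_pow_mult[symmetric] s_def algebra_simps)
  qed
  show thesis
  proof (cases "t \<ge> u")
    case True
    have W1: "W = C [^] int (t - u) \<otimes> A [^] (x * \<alpha> ^ (t - u))"
      using A_pow_C[of x "t - u"] True by (simp add: W_def)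
    show thesis
      by (rule that[of "t - u" y "x * \<alpha> ^ (t - u)"])
        (use Ws W1 True in \<open>simp_all add: y_def s_def t[symmetric] u[symmetric]\<close>)
  next
    case False
    have W1: "inv W = C [^] int (u - t) \<otimes> A [^] (- x)"
    proof -
      have "int (u - t) = - (int t - int u)" using False by simp
      then have "C [^] int (u - t) = inv (C [^] (int t - int u))" by (metis C int_pow_neg)
      then show ?thesis by (simp add: W_def inv_mult_group int_pow_neg)
    qed
    have "C [^] s \<otimes> W [^] (- 1 :: int) = (B [^] y) [^] (- 1 :: int) \<otimes> C [^] s"
      using conj_int_pow[OF Ws[symmetric], of "- 1"] by simp
    then have W2: "C [^] s \<otimes> inv W = B [^] (- y) \<otimes> C [^] s" by (simp add: int_pow_neg)
    show thesis
      by (rule that[of "u - t" "- y" "- x"])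
        (use W2 W1 False in \<open>simp_all add: y_def s_def t[symmetric] u[symmetric]\<close>)
  qed
qed

text \<open>Conjugation by C acts on powers of B through \<beta>, and C commutes with C^s. So it
  acts in the same way on W, a conjugate of a power of B by C^s, and \<open>C_pow_in_A_aux\<close>
  applies.\<close>

lemma C_pow_in_A:
  assumes t: "\<alpha> ^ k \<ge> 0" and u: "\<beta> ^ k \<ge> 0"
  shows "\<exists>i::int. C [^] ((\<alpha> ^ k - \<beta> ^ k) * (\<beta> - 1)) = A [^] i"
proof -
  define t u where tu: "t = nat (\<alpha> ^ k)" "u = nat (\<beta> ^ k)"
  have t': "int t = \<alpha> ^ k" and u': "int u = \<beta> ^ k" using t u by (simp_all add: tu)
  define s where "s = int (k + t)"
  obtain D :: nat and j y :: int where D: "int D = \<bar>\<alpha> ^ k - \<beta> ^ k\<bar>"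
    and Ws: "C [^] int (k + t) \<otimes> (C [^] int D \<otimes> A [^] j) = B [^] y \<otimes> C [^] int (k + t)"
    by (rule key_relation_conj[OF t' u'])
  define W where "W = C [^] int D \<otimes> A [^] j"
  note Ws = Ws[folded W_def s_def]
  have Wc [simp]: "W \<in> carrier G" by (simp add: W_def)
  have W\<beta>: "C [^] s \<otimes> W [^] \<beta> = B [^] (y * \<beta>) \<otimes> C [^] s"
    using conj_int_pow[OF Ws[symmetric], of \<beta>] by (simp add: int_pow_pow)
  have CBy: "C \<otimes> B [^] y = B [^] (y * \<beta>) \<otimes> C" using C_pow_B[of 1 y] by simp
  have CC: "C [^] s \<otimes> C = C \<otimes> C [^] s"
    using int_pow_mult[OF C, of s 1] int_pow_mult[OF C, of 1 s] by (simp add: add.commute)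
  have WC: "C \<otimes> W = W [^] \<beta> \<otimes> C"
  proof -
    have "C [^] s \<otimes> (C \<otimes> W) = C \<otimes> (C [^] s \<otimes> W)"
      using commute_ext[OF CC] by simp
    also have "\<dots> = B [^] (y * \<beta>) \<otimes> (C \<otimes> C [^] s)"
      unfolding Ws using commute_ext[OF CBy] by simp
    also have "\<dots> = (B [^] (y * \<beta>) \<otimes> C [^] s) \<otimes> C" by (simp add: CC m_assoc)
    also have "\<dots> = C [^] s \<otimes> (W [^] \<beta> \<otimes> C)" by (simp add: W\<beta>[symmetric] m_assoc)
    finally show ?thesis by simp
  qed
  obtain i :: int where i: "C [^] (int D * (\<beta> - 1)) = A [^] i" using C_pow_in_A_aux[OF WC W_def] by blast
  show ?thesis
  proof (cases "\<alpha> ^ k \<ge> \<beta> ^ k")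
    case True
    then show ?thesis using D i by auto
  next
    case False
    have "C [^] (- (int D * (\<beta> - 1))) = A [^] (- i)" using i by (simp add: int_pow_neg)
    moreover have "- (int D * (\<beta> - 1)) = (\<alpha> ^ k - \<beta> ^ k) * (\<beta> - 1)" 
    proof -
      have "int D = - (\<alpha> ^ k - \<beta> ^ k)" using False D by simp
      then show ?thesis by (simp only: mult_minus_left minus_minus)
    qed
    ultimately show ?thesis by metis
  qed
qed

text \<open>A power of C lying in <A> commutes with A but also conjugates it to A^(\<alpha>^D).
  Hence A^(\<alpha>^D - 1) = 1, and |\<alpha>| \<ge> 2 makes this exponent nonzero.\<close>

lemma A_finite_order:
  assumes "C [^] (K::int) = A [^] (i::int)" "K \<noteq> 0" "\<bar>\<alpha>\<bar> \<ge> 2"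
  shows "ord A > 0"
proof -
  define D where "D = nat \<bar>K\<bar>"
  have D: "D > 0" using assms by (simp add: D_def)
  have "\<exists>j::int. C [^] int D = A [^] j"
  proof (cases "K \<ge> 0")
    case True then show ?thesis using assms D_def by auto
  next
    case False
    then have "C [^] int D = A [^] (- i)" using assms(1) by (simp add: D_def int_pow_neg)
    then show ?thesis by blast
  qed
  then obtain j :: int where j: "C [^] int D = A [^] j" by blast
  have "A [^] (1::int) \<otimes> C [^] int D = C [^] int D \<otimes> A [^] (1 * \<alpha> ^ D)" by (rule A_pow_C)
  then have "A [^] (1 + j) = A [^] (j + \<alpha> ^ D)" unfolding j by (simp add: int_pow_mult)
  then have "A [^] (1 + j) \<otimes> A [^] (- 1 - j) = A [^] (j + \<alpha> ^ D) \<otimes> A [^] (- 1 - j)" by simp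
  then have "A [^] (\<alpha> ^ D - 1) = \<one>" by (simp add: int_pow_mult[symmetric] algebra_simps)
  then have "int (ord A) dvd \<alpha> ^ D - 1" by (simp add: int_pow_eq_id)
  moreover have "\<alpha> ^ D - 1 \<noteq> 0"
  proof
    assume "\<alpha> ^ D - 1 = 0"
    then have "\<bar>\<alpha>\<bar> ^ D = 1" by (simp add: power_abs[symmetric])
    moreover have "\<bar>\<alpha>\<bar> ^ D > 1" using assms(3) D by (simp add: one_less_power)
    ultimately show False by simp
  qed
  ultimately show ?thesis by (metis dvd_0_left_iff gr0I of_nat_0)
qed

end

lemma (in macd) hom_image:
  assumes "h \<in> hom G H" "group H"
  shows "macd H (h A) (h B) (h C) \<alpha> \<beta>"
proof -
  interpret H: group H by fact
  interpret h: group_hom G H h using assms by unfold_locales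
  show ?thesis
  proof (unfold_locales)
    show "h A \<otimes>\<^bsub>H\<^esub> h B = h B \<otimes>\<^bsub>H\<^esub> h A \<otimes>\<^bsub>H\<^esub> h C"
      using arg_cong[OF AB, of h] by simp
    show "h A \<otimes>\<^bsub>H\<^esub> h C = h C \<otimes>\<^bsub>H\<^esub> h A [^]\<^bsub>H\<^esub> \<alpha>"
      using arg_cong[OF AC, of h] by (simp add: h.hom_int_pow)
    show "h B \<otimes>\<^bsub>H\<^esub> inv\<^bsub>H\<^esub> h C = inv\<^bsub>H\<^esub> h C \<otimes>\<^bsub>H\<^esub> h B [^]\<^bsub>H\<^esub> \<beta>"
      using arg_cong[OF BC, of h] by (simp add: h.hom_int_pow)
  qed simp_all
qed

section \<open>Primes dividing the orders\<close>

lemma (in group) int_pow_as_nat_pow: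
  assumes "x \<in> carrier G" "ord x > 0"
  shows "\<exists>n::nat. x [^] (i::int) = x [^] int n"
proof -
  have "x [^] i = x [^] int (nat (i mod int (ord x)))"
    using assms by (simp add: int_pow_eq) (metis dvd_minus_mod mod_0_imp_dvd dvd_diff_commute)
  then show ?thesis by blast
qed

lemma (in group) pow_coprime_pow:
  assumes "x \<in> carrier G" "x [^] int d = \<one>" "coprime K (int d)"
  shows "\<exists>v::int. x = (x [^] K) [^] v"
proof -
  obtain v w where "v * K + w * int d = 1" using assms(3) by (metis bezout_int coprime_iff_gcd_eq_1)
  then have "x [^] (1::int) = x [^] (K * v + int d * w)" by (simp add: mult.commute)
  also have "\<dots> = (x [^] K) [^] v \<otimes> (x [^] int d) [^] w" 
    using assms(1) by (simp add: int_pow_mult int_pow_pow)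
  finally show ?thesis using assms by (metis int_pow_1 int_pow_closed int_pow_one r_one)
qed

context macd
begin

text \<open>A C is the conjugate of A by B.\<close>

lemma AC_pow_ord: "(A \<otimes> C) [^] int e = \<one> \<longleftrightarrow> A [^] int e = \<one>"
proof -
  have "A [^] int e \<otimes> B = B \<otimes> (A \<otimes> C) [^] int e" by (rule A_pow_B)
  then show ?thesis
    by (metis A B C int_pow_closed l_cancel_one' m_closed r_cancel_one')
qed

text \<open>Raising A C to the order of A gives 1, while the normal form of this power is C^(ord A)
  times a power of A.\<close>

lemma C_pow_ord_A: "\<exists>i::int. C [^] int (ord A) = A [^] i"
proof -
  have "(A \<otimes> C) [^] int (ord A) = \<one>" by (simp add: AC_pow_ord int_pow_eq_id)
  then have "C [^] int (ord A) \<otimes> A [^] (\<alpha> * geo (ord A) \<alpha>) = C [^] (0::int) \<otimes> A [^] (0::int)"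
    using AC_pow[of "ord A"] by simp
  from pow_eq_split[OF this] have "C [^] (- int (ord A)) = A [^] (\<alpha> * geo (ord A) \<alpha>)" by simp
  then have "C [^] int (ord A) = A [^] (- (\<alpha> * geo (ord A) \<alpha>))"
    by (metis A C int_pow_neg minus_minus)
  then show ?thesis by blast
qed

lemma commuting_C_pow:
  assumes "C [^] int D = A [^] (i::int)"
  shows "int (ord A) dvd \<alpha> ^ D - 1"
proof -
  have "A [^] (1::int) \<otimes> C [^] int D = C [^] int D \<otimes> A [^] (1 * \<alpha> ^ D)" by (rule A_pow_C)
  then have "A [^] (1 + i) = A [^] (i + \<alpha> ^ D)" unfolding assms by (simp add: int_pow_mult)
  then show ?thesis by (simp add: int_pow_eq)
qed

lemma ord_A_dvd: "int (ord A) dvd \<alpha> ^ ord A - 1"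
  using C_pow_ord_A commuting_C_pow by blast

text \<open>If d is the common divisor, conjugation by C sends A^(ord A / d) to 1, so this power is
  already 1.\<close>

lemma coprime_ord_A:
  assumes "ord A > 0" shows "coprime \<alpha> (int (ord A))"
proof -
  let ?d = "gcd \<alpha> (int (ord A))"
  obtain k where k: "int (ord A) = ?d * k" by (metis dvdE gcd_dvd2)
  obtain j where j: "\<alpha> = ?d * j" by (metis dvdE gcd_dvd1)
  have "A [^] k \<otimes> C [^] int 1 = C [^] int 1 \<otimes> A [^] (k * \<alpha> ^ 1)" by (rule A_pow_C)
  moreover have "A [^] (k * \<alpha> ^ 1) = \<one>"
  proof -
    have "k * \<alpha> ^ 1 = int (ord A) * j" using j k by (metis mult.assoc mult.commute power_one_right)
    then show ?thesis by (simp add: int_pow_eq_id)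
  qed
  ultimately have "A [^] k = \<one>" by (metis A C int_pow_closed r_cancel_one r_one)
  then have "?d * k dvd k" using k by (simp add: int_pow_eq_id)
  moreover have "k \<noteq> 0" using k assms by auto
  ultimately have "?d dvd 1" by (metis dvd_mult_cancel_right mult_1)
  then show ?thesis by (simp add: coprime_iff_gcd_eq_1)
qed

lemma ord_C_pos:
  assumes "ord A > 0" shows "ord C > 0"
proof -
  obtain i :: int where "C [^] int (ord A) = A [^] i" using C_pow_ord_A by blast
  then have "C [^] (int (ord A) * int (ord A)) = A [^] (i * int (ord A))" by (metis A C int_pow_pow)
  also have "\<dots> = \<one>" by (simp add: int_pow_eq_id)
  finally have "int (ord C) dvd int (ord A) * int (ord A)" by (simp add: int_pow_eq_id)
  then show ?thesis using assms by (metis dvd_0_left_iff gr0I less_numeral_extra(3) mult_eq_0_iff of_nat_0 of_nat_eq_0_iff)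
qed

text \<open>If B conjugates A^e into <A>, conjugation by A B = B A C can be computed with and
  without C, and C contributes a factor \<alpha>. So \<alpha> - 1 kills A^(e j), and conjugating
  back by B it kills A^e.\<close>

lemma normalized_pow_dvd:
  fixes e j :: int
  assumes "A [^] e \<otimes> B = B \<otimes> A [^] (e * j)"
  shows "A [^] (e * (\<alpha> - 1)) = \<one>"
proof -
  have eA: "A [^] e \<otimes> A = A \<otimes> A [^] e" for e :: int
    using int_pow_mult[OF A, of e 1] int_pow_mult[OF A, of 1 e] by (simp add: add.commute)
  have eC: "A [^] e \<otimes> C = C \<otimes> A [^] (e * \<alpha>)" for e :: int using A_pow_C[of e 1] by simp
  have "A [^] e \<otimes> (B \<otimes> (A \<otimes> C)) = B \<otimes> (A \<otimes> (C \<otimes> A [^] (e * j * \<alpha>)))"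
    using commute_ext[OF assms] commute_ext[OF eA] eC by simp
  moreover have "A [^] e \<otimes> (B \<otimes> (A \<otimes> C)) = B \<otimes> (A \<otimes> (C \<otimes> A [^] (e * j)))"
  proof -
    have "B \<otimes> (A \<otimes> C) = A \<otimes> B" by (simp add: AB m_assoc)
    then have "A [^] e \<otimes> (B \<otimes> (A \<otimes> C)) = A \<otimes> (A [^] e \<otimes> B)"
      using commute_ext[OF eA, where w = B] by simp
    also have "\<dots> = (A \<otimes> B) \<otimes> A [^] (e * j)" by (simp add: assms m_assoc)
    finally show ?thesis by (simp add: AB m_assoc)
  qed
  ultimately have "A [^] (e * j * \<alpha>) = A [^] (e * j)" by simp
  then have 1: "A [^] (e * j * (\<alpha> - 1)) = \<one>"
    by (simp add: int_pow_eq int_pow_eq_id algebra_simps) (metis dvd_diff_commute)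
  have "(A [^] e) [^] (\<alpha> - 1) \<otimes> B = B \<otimes> (A [^] (e * j)) [^] (\<alpha> - 1)"
    by (rule conj_int_pow[OF assms]) simp_all
  then have "A [^] (e * (\<alpha> - 1)) \<otimes> B = B" using 1 by (simp add: int_pow_pow)
  then show ?thesis by (metis A B int_pow_closed r_cancel_one)
qed

text \<open>The conjugate x = (A C)^e of A^e has order dividing d, and x^K lies in <A> because C^(e
  K) does. As K is prime to d, x itself lies in <A>; there, order dividing d means an exponent
  divisible by e.\<close>

lemma normalize_part:
  assumes n: "ord A = d * e" "ord A > 0" and cop: "coprime (int K) (int d)" and CK: "C [^] int K = A [^] (i::int)"
  shows "\<exists>j. A [^] int e \<otimes> B = B \<otimes> A [^] (int e * j)"
proof -
  define x where "x = (A \<otimes> C) [^] int e"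
  have xc: "x \<in> carrier G" by (simp add: x_def)
  have xd: "x [^] int d = \<one>"
  proof -
    have "x [^] int d = (A \<otimes> C) [^] int (e * d)" by (simp add: x_def int_pow_pow)
    also have "\<dots> = \<one>" unfolding AC_pow_ord using n by (simp add: int_pow_eq_id mult.commute)
    finally show ?thesis .
  qed
  have "x [^] int K = C [^] int (e * K) \<otimes> A [^] (\<alpha> * geo e \<alpha> * geo K (\<alpha> ^ e))"
    unfolding x_def AC_pow by (rule twist_pow_gen[OF AC]) simp_all
  moreover have "C [^] int (e * K) = A [^] (i * int e)"
    using CK by (metis A C int_pow_pow mult.commute of_nat_mult)
  ultimately obtain g :: int where g: "x [^] int K = A [^] g" by (simp add: int_pow_mult[symmetric])
  obtain v where "x = (x [^] int K) [^] (v::int)" using pow_coprime_pow[OF xc xd cop] by blast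
  then have x: "x = A [^] (g * v)" by (simp add: g int_pow_pow)
  then have "A [^] (g * v * int d) = \<one>" using xd by (simp add: int_pow_pow)
  then have "int d * int e dvd int d * (g * v)" using n by (simp add: int_pow_eq_id mult.commute)
  then have "int e dvd g * v" using n by auto
  then obtain j where "g * v = int e * j" by blast
  then have "A [^] int e \<otimes> B = B \<otimes> A [^] (int e * j)" using A_pow_B[of "int e"] x by (simp add: x_def)
  then show ?thesis by blast
qed

lemma dvd_of_coprime_C_pow:
  assumes n: "ord A = d * e" "ord A > 0" and cop: "coprime (int K) (int d)" and CK: "C [^] int K = A [^] (i::int)"
  shows "int d dvd \<alpha> - 1"
proof -
  obtain j where "A [^] int e \<otimes> B = B \<otimes> A [^] (int e * j)" using normalize_part[OF assms] by blast
  then have "A [^] (int e * (\<alpha> - 1)) = \<one>" by (rule normalized_pow_dvd)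
  then have "int e * int d dvd int e * (\<alpha> - 1)" using n by (simp add: int_pow_eq_id mult.commute)
  then show ?thesis using n by auto
qed

text \<open>A common element of <A> and <B> commutes with B, which is the case j = 1 of
  \<open>normalized_pow_dvd\<close>.\<close>

lemma inter_exponent:
  assumes "A [^] (i::int) = B [^] (j::int)"
  shows "A [^] (i * (\<alpha> - 1)) = \<one>"
proof (rule normalized_pow_dvd[where j = 1])
  show "A [^] i \<otimes> B = B \<otimes> A [^] (i * 1)"
    unfolding assms mult_1_right using int_pow_mult[OF B, of j 1] int_pow_mult[OF B, of 1 j]
    by (simp add: add.commute)
qed

lemma C_pow_in_B:
  assumes "\<alpha> > 0" "\<beta> > 0"
  shows "\<exists>i::int. C [^] ((\<alpha> - \<beta>) * (\<alpha> - 1)) = B [^] i"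
proof -
  interpret s: macd G B A "inv C" \<beta> \<alpha> by (rule swap)
  obtain i :: int where "inv C [^] ((\<beta> - \<alpha>) * (\<alpha> - 1)) = B [^] i" using s.C_pow_in_A[of 1] assms by auto
  moreover have "inv C [^] ((\<beta> - \<alpha>) * (\<alpha> - 1)) = C [^] (- ((\<beta> - \<alpha>) * (\<alpha> - 1)))"
    by (simp add: int_pow_inv int_pow_neg)
  moreover have "- ((\<beta> - \<alpha>) * (\<alpha> - 1)) = (\<alpha> - \<beta>) * (\<alpha> - 1)" by (simp add: algebra_simps)
  ultimately show ?thesis by metis
qed

lemma C_natpow_in_B:
  assumes "\<alpha> > 0" "\<beta> > 0"
  shows "\<exists>i::int. C [^] int (nat \<bar>(\<alpha> - \<beta>) * (\<alpha> - 1)\<bar>) = B [^] i"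
proof -
  obtain i :: int where i: "C [^] ((\<alpha> - \<beta>) * (\<alpha> - 1)) = B [^] i" using C_pow_in_B assms by blast
  then have "C [^] (- ((\<alpha> - \<beta>) * (\<alpha> - 1))) = B [^] (- i)" by (simp add: int_pow_neg)
  with i show ?thesis by (cases "(\<alpha> - \<beta>) * (\<alpha> - 1) \<ge> 0") auto
qed

lemma C_natpow_in_A:
  assumes "\<alpha> > 0" "\<beta> > 0"
  shows "\<exists>i::int. C [^] int (nat \<bar>(\<alpha> - \<beta>) * (\<beta> - 1)\<bar>) = A [^] i"
proof -
  obtain i :: int where i: "C [^] ((\<alpha> - \<beta>) * (\<beta> - 1)) = A [^] i" using C_pow_in_A[of 1] assms by auto
  then have "C [^] (- ((\<alpha> - \<beta>) * (\<beta> - 1))) = A [^] (- i)" by (simp add: int_pow_neg)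
  with i show ?thesis by (cases "(\<alpha> - \<beta>) * (\<beta> - 1) \<ge> 0") auto
qed

text \<open>As C has finite order, conjugating by the inverse of C^s is conjugating by a natural
  power of C, and that maps <A> into itself.\<close>

lemma conj_C_pow_A:
  assumes "ord C > 0" "C [^] int s \<otimes> A [^] (i::int) = V \<otimes> C [^] int s" "V \<in> carrier G"
  shows "\<exists>j::int. V = A [^] j"
proof -
  define e where "e = s * (ord C - 1)"
  have "int s + int e = int (ord C) * int s"
    using assms(1) by (simp add: e_def algebra_simps of_nat_diff Suc_leI)
  then have C1: "C [^] (int s + int e) = \<one>" by (simp add: int_pow_eq_id)
  have "V = V \<otimes> C [^] int s \<otimes> C [^] int e" using C1 assms by (simp add: m_assoc int_pow_mult[symmetric])
  also have "\<dots> = C [^] int s \<otimes> (A [^] i \<otimes> C [^] int e)" using assms by (simp add: m_assoc[symmetric])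
  also have "\<dots> = C [^] (int s + int e) \<otimes> A [^] (i * \<alpha> ^ e)" by (simp add: A_pow_C int_pow_add_ext)
  finally show ?thesis using C1 by auto
qed

text \<open>Since \<alpha> - \<beta> divides \<alpha>^k - \<beta>^k, the hypothesis gives C^(D s) =
  1. Raising the relation of \<open>key_relation_conj\<close> to the power s makes C disappear from
  W, and B^(y s) becomes the conjugate of a power of A under a power of C.\<close>

lemma key_exponent_B:
  assumes pos: "\<alpha> > 0" "\<beta> > 0" and oC: "ord C > 0" and Cs: "C [^] ((\<alpha> - \<beta>) * int s) = \<one>"
    and u: "int u = \<beta> ^ k"
  shows "\<exists>j::int. B [^] ((int u * \<beta> ^ u - \<beta> * geo u \<beta>) * int s) = A [^] j"
proof -
  define t where "t = nat (\<alpha> ^ k)"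
  have t: "int t = \<alpha> ^ k" using pos by (simp add: t_def)
  obtain D :: nat and j y :: int where D: "int D = \<bar>\<alpha> ^ k - \<beta> ^ k\<bar>"
    and y: "\<bar>y\<bar> = \<bar>int u * \<beta> ^ u - \<beta> * geo u \<beta>\<bar>"
    and Ws: "C [^] int (k + t) \<otimes> (C [^] int D \<otimes> A [^] j) = B [^] y \<otimes> C [^] int (k + t)"
    by (rule key_relation_conj[OF t u])
  have "\<alpha> - \<beta> dvd \<alpha> ^ k - \<beta> ^ k" by (metis dvd_def power_diff_sumr2)
  then have "\<alpha> - \<beta> dvd int D" by (simp add: D)
  then have "(\<alpha> - \<beta>) * int s dvd int D * int s" by simp
  moreover have "int (ord C) dvd (\<alpha> - \<beta>) * int s" using Cs by (simp add: int_pow_eq_id)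
  ultimately have "int (ord C) dvd int D * int s" using dvd_trans by blast
  then have CD: "C [^] int (D * s) = \<one>" by (simp add: int_pow_eq_id)
  have "C [^] int (k + t) \<otimes> (C [^] int D \<otimes> A [^] j) [^] int s = (B [^] y) [^] int s \<otimes> C [^] int (k + t)"
    using conj_int_pow[OF Ws[symmetric], of "int s"] by simp
  moreover have "(C [^] int D \<otimes> A [^] j) [^] int s = C [^] int (D * s) \<otimes> A [^] (j * geo s (\<alpha> ^ D))"
    by (rule twist_pow_gen[OF AC]) simp_all
  ultimately have "C [^] int (k + t) \<otimes> A [^] (j * geo s (\<alpha> ^ D)) = B [^] (y * int s) \<otimes> C [^] int (k + t)"
    using CD by (simp add: int_pow_pow)
  from conj_C_pow_A[OF oC this] obtain j' :: int where j': "B [^] (y * int s) = A [^] j'" by auto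
  then have j'': "B [^] (- y * int s) = A [^] (- j')" by (simp add: int_pow_neg)
  show ?thesis
  proof (cases "y = int u * \<beta> ^ u - \<beta> * geo u \<beta>")
    case True then show ?thesis using j' by blast
  next
    case False
    then have "- y = int u * \<beta> ^ u - \<beta> * geo u \<beta>" using y by linarith
    then show ?thesis using j'' by metis
  qed
qed

lemma key_exponent_A:
  assumes pos: "\<alpha> > 0" "\<beta> > 0" and oC: "ord C > 0" and Cs: "C [^] ((\<alpha> - \<beta>) * int s) = \<one>"
    and t: "int t = \<alpha> ^ k"
  shows "\<exists>j::int. A [^] ((int t * \<alpha> ^ t - \<alpha> * geo t \<alpha>) * int s) = B [^] j"
proof -
  interpret s: macd G B A "inv C" \<beta> \<alpha> by (rule swap)
  have "inv C [^] ((\<beta> - \<alpha>) * int s) = \<one>"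
    using Cs by (simp add: int_pow_inv int_pow_eq_id) (metis dvd_minus_iff minus_diff_eq mult_minus_left)
  then show ?thesis using s.key_exponent_B pos oC t by simp
qed

text \<open>T collects the elements x with <b> x contained in x <b>. It is closed under products; an
  inverse is obtained as a natural power, which is where the finite orders of A and B enter.\<close>

lemma normal_cyclic:
  assumes gen: "generate G {A, B} = carrier G" and "ord A > 0" "ord B > 0" "b \<in> carrier G"
    and bA: "b \<otimes> A = A \<otimes> b [^] (j::int)" and bB: "b \<otimes> B = B \<otimes> b [^] (k::int)"
  shows "generate G {b} \<lhd> G"
proof -
  define T where "T = {x \<in> carrier G. \<forall>i::int. \<exists>j::int. b [^] i \<otimes> x = x \<otimes> b [^] j}"
  have Tm: "x \<otimes> y \<in> T" if "x \<in> T" "y \<in> T" for x y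
  proof -
    have xy: "x \<in> carrier G" "y \<in> carrier G" using that by (auto simp: T_def)
    have "\<exists>j::int. b [^] i \<otimes> (x \<otimes> y) = x \<otimes> y \<otimes> b [^] j" for i :: int
    proof -
      obtain j :: int where j: "b [^] i \<otimes> x = x \<otimes> b [^] j" using \<open>x \<in> T\<close> by (auto simp: T_def)
      obtain k :: int where k: "b [^] j \<otimes> y = y \<otimes> b [^] k" using \<open>y \<in> T\<close> by (auto simp: T_def)
      have "b [^] i \<otimes> (x \<otimes> y) = x \<otimes> y \<otimes> b [^] k"
        using commute_ext[OF j, of y] k xy assms by (simp add: m_assoc)
      then show ?thesis by blast
    qed
    then show ?thesis using xy by (simp add: T_def)
  qed
  have T1: "\<one> \<in> T" using assms by (auto simp: T_def)
  have Tp: "x [^] n \<in> T" if "x \<in> T" for x and n :: nat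
    by (induction n) (use that T1 Tm in simp_all)
  have TA: "A \<in> T" and TB: "B \<in> T"
    unfolding T_def using conj_int_pow[OF bA] conj_int_pow[OF bB] assms by (auto simp: int_pow_pow)
  have Tinv: "inv x \<in> T" if "x \<in> T" "ord x > 0" for x
  proof -
    have x: "x \<in> carrier G" using that by (simp add: T_def)
    have "x [^] (ord x - 1) \<otimes> x = x [^] ord x" using that x by (metis Suc_diff_1 nat_pow_Suc)
    then have "inv x = x [^] (ord x - 1)" using x by (simp add: inv_equality)
    then show ?thesis using Tp that by simp
  qed
  have all: "carrier G \<subseteq> T"
  proof
    fix x assume "x \<in> carrier G"
    then have "x \<in> generate G {A, B}" using gen by simp
    then show "x \<in> T" by (induction rule: generate.induct) (use T1 TA TB Tinv Tm assms in auto)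
  qed
  show ?thesis unfolding normal_inv_iff
  proof (intro conjI ballI)
    show "subgroup (generate G {b}) G" using assms by (simp add: generate_is_subgroup)
    fix x h assume x: "x \<in> carrier G" and "h \<in> generate G {b}"
    then obtain i :: int where h: "h = b [^] i" using generate_pow[OF \<open>b \<in> carrier G\<close>] by auto
    have "inv x \<in> T" using all x by auto
    then obtain j :: int where j: "b [^] i \<otimes> inv x = inv x \<otimes> b [^] j" by (auto simp: T_def)
    have "x \<otimes> h \<otimes> inv x = b [^] j" using j x assms by (simp add: h m_assoc)
    then show "x \<otimes> h \<otimes> inv x \<in> generate G {b}" using generate_pow[OF \<open>b \<in> carrier G\<close>] by auto
  qed
qed

text \<open>The proof is by contradiction and splits according to whether q divides \<beta> - 1 or
  \<alpha> - \<beta>. Either a power of C with exponent prime to q lies in <A> or <B>, or the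
  exponents of \<open>key_relation\<close> for all k have to be used together.\<close>

theorem prime_dvd_ord_A:
  assumes pos: "\<alpha> > 0" "\<beta> > 0" and oA: "ord A > 0" and oB: "ord B > 0"
    and gen: "generate G {A, B} = carrier G" and q: "Factorial_Ring.prime q" "q dvd ord A"
  shows "int q dvd \<alpha> - 1"
proof (rule ccontr)
  assume nd: "\<not> int q dvd \<alpha> - 1"
  have qi: "Factorial_Ring.prime (int q)" using q by simp
  have copq: "coprime z (int q)" if "\<not> int q dvd z" for z
    using prime_imp_coprime[OF qi that] by (simp add: coprime_commute)
  obtain e where e: "ord A = q * e" using q by blast
  consider "int q dvd \<beta> - 1" | "\<not> int q dvd \<beta> - 1" "int q dvd \<alpha> - \<beta>" | "\<not> int q dvd \<beta> - 1" "\<not> int q dvd \<alpha> - \<beta>"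
    by blast
  then show False
  proof cases
    case 3
    obtain i :: int where "C [^] int (nat \<bar>(\<alpha> - \<beta>) * (\<beta> - 1)\<bar>) = A [^] i" using C_natpow_in_A pos by blast
    moreover have "\<not> int q dvd int (nat \<bar>(\<alpha> - \<beta>) * (\<beta> - 1)\<bar>)" using 3 qi by (simp add: prime_dvd_mult_iff)
    ultimately show False using dvd_of_coprime_C_pow[OF e oA] copq nd by blast
  next
    case 2
    obtain i :: int where i: "C [^] ((\<alpha> - \<beta>) * (\<beta> - 1)) = A [^] i" using C_pow_in_A[of 1] pos by auto
    obtain j :: int where j: "C [^] ((\<alpha> - \<beta>) * (\<alpha> - 1)) = B [^] j" using C_pow_in_B pos by blast
    \<comment> \<open>C^((\<alpha>-\<beta>)(\<alpha>-1)(\<beta>-1)) lies in <A> and in <B>, so one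
      more factor \<alpha> - 1 kills it; this is the multiplier s. Every exponent x of
      \<open>key_relation\<close> then satisfies A^(x s (\<alpha>-1)) = 1, so q would divide x for
      all k.\<close>
    have "A [^] (i * (\<alpha> - 1)) = C [^] ((\<alpha> - \<beta>) * (\<beta> - 1) * (\<alpha> - 1))" using i by (metis C int_pow_pow A)
    also have "\<dots> = C [^] ((\<alpha> - \<beta>) * (\<alpha> - 1) * (\<beta> - 1))" by (simp add: mult_ac)
    also have "\<dots> = B [^] (j * (\<beta> - 1))" using j by (metis C int_pow_pow B)
    finally have "A [^] (i * (\<alpha> - 1) * (\<alpha> - 1)) = \<one>" by (rule inter_exponent)
    moreover have "A [^] (i * (\<alpha> - 1) * (\<alpha> - 1)) = C [^] ((\<alpha> - \<beta>) * (\<beta> - 1) * ((\<alpha> - 1) * (\<alpha> - 1)))"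
      using i by (metis C int_pow_pow A mult.assoc)
    ultimately have "C [^] ((\<alpha> - \<beta>) * ((\<beta> - 1) * ((\<alpha> - 1) * (\<alpha> - 1)))) = \<one>" by (simp add: mult.assoc)
    moreover define s where "s = nat ((\<beta> - 1) * ((\<alpha> - 1) * (\<alpha> - 1)))"
    have s: "int s = (\<beta> - 1) * ((\<alpha> - 1) * (\<alpha> - 1))" unfolding s_def using pos by (intro nat_0_le mult_nonneg_nonneg) auto
    ultimately have Cs: "C [^] ((\<alpha> - \<beta>) * int s) = \<one>" by simp
    have "int q dvd \<alpha> * geo (nat (\<alpha> ^ k)) \<alpha> - \<alpha> ^ k * \<alpha> ^ nat (\<alpha> ^ k)" for k
    proof -
      have t: "int (nat (\<alpha> ^ k)) = \<alpha> ^ k" using pos by simp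
      define x where "x = \<alpha> ^ k * \<alpha> ^ nat (\<alpha> ^ k) - \<alpha> * geo (nat (\<alpha> ^ k)) \<alpha>"
      obtain j :: int where "A [^] (x * int s) = B [^] j"
        using key_exponent_A[OF pos ord_C_pos[OF oA] Cs t] t by (auto simp: x_def)
      then have "A [^] (x * int s * (\<alpha> - 1)) = \<one>" by (rule inter_exponent)
      then have "int (ord A) dvd x * int s * (\<alpha> - 1)" by (simp add: int_pow_eq_id)
      then have "int q dvd x * int s * (\<alpha> - 1)" using e by (metis dvd_mult_left of_nat_mult)
      then have "int q dvd x" using nd 2 qi by (auto simp: prime_dvd_mult_iff s)
      then show ?thesis unfolding x_def by (metis dvd_diff_commute)
    qed
    moreover have "int q dvd \<alpha> ^ ord A - 1" using ord_A_dvd e by (metis dvd_mult_left of_nat_mult)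
    ultimately show False
      using exists_power_relation_exponent_not_dvd[OF q(1) pos(1) nd q(2) coprime_ord_A[OF oA]] by blast
  next
    case 1
    have nd2: "\<not> int q dvd \<alpha> - \<beta>"
    proof
      assume "int q dvd \<alpha> - \<beta>"
      then have "int q dvd (\<alpha> - \<beta>) + (\<beta> - 1)" using 1 by (rule dvd_add)
      then show False using nd by simp
    qed
    define K where "K = nat \<bar>(\<alpha> - \<beta>) * (\<alpha> - 1)\<bar>"
    obtain i :: int where i: "C [^] int K = B [^] i" unfolding K_def using C_natpow_in_B pos by blast
    have qK: "\<not> int q dvd int K" using nd nd2 qi by (simp add: K_def prime_dvd_mult_iff)
    obtain f r' where r': "ord B = q ^ f * r'" "\<not> q dvd r'"
      using oB q(1) by (metis multiplicity_decompose' not_gr_zero not_prime_unit)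
    interpret s: macd G B A "inv C" \<beta> \<alpha> by (rule swap)
    \<comment> \<open>b generates the q-part of <B>. A normalises <b> because C^K lies in <B> with K
      prime to q, so <b> can be factored out.\<close>
    define b where "b = B [^] int r'"
    have bc: "b \<in> carrier G" by (simp add: b_def)
    have "inv C [^] int K = B [^] (- i)" using i by (simp add: int_pow_inv int_pow_neg)
    moreover have "coprime (int K) (int (q ^ f))" using copq[OF qK] by simp
    ultimately obtain j :: int where "B [^] int r' \<otimes> A = A \<otimes> B [^] (int r' * j)"
      using s.normalize_part[OF r'(1) oB] by blast
    then have bA: "b \<otimes> A = A \<otimes> b [^] j" by (simp add: b_def int_pow_pow)
    have bB: "b \<otimes> B = B \<otimes> b [^] (1::int)"
      using int_pow_mult[OF B, of "int r'" 1] int_pow_mult[OF B, of 1 "int r'"] by (simp add: b_def add.commute)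
    have N: "generate G {b} \<lhd> G" by (rule normal_cyclic[OF gen oA oB bc bA bB])
    then interpret N: normal "generate G {b}" G .
    let ?N = "generate G {b}" let ?Q = "G Mod ?N" let ?h = "\<lambda>x. ?N #> x"
    have h: "?h \<in> hom G ?Q" by (rule N.r_coset_hom_Mod)
    interpret Q: group ?Q by (rule N.factorgroup_is_group)
    interpret h: group_hom G ?Q ?h using h by unfold_locales
    interpret mQ: macd ?Q "?h A" "?h B" "?h C" \<alpha> \<beta> by (rule hom_image[OF h Q.group_axioms])
    have "b \<in> ?N" by (simp add: generate.incl)
    then have hb: "?h b = \<one>\<^bsub>?Q\<^esub>" using N.rcos_const by (simp add: FactGroup_def)
    have "A [^] int (ord A) = \<one>" by (simp add: int_pow_eq_id)
    then have "?h A [^]\<^bsub>?Q\<^esub> int (ord A) = \<one>\<^bsub>?Q\<^esub>"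
      using h.hom_int_pow[OF A, of "int (ord A)"] h.hom_one by metis
    then have "int (Q.ord (?h A)) dvd int (ord A)" using Q.int_pow_eq_id[OF mQ.A] by blast
    then have "Q.ord (?h A) dvd ord A" by simp
    then have oQ: "Q.ord (?h A) > 0" using oA by (metis dvd_0_left_iff gr0I less_numeral_extra(3))
    have "?h C [^]\<^bsub>?Q\<^esub> int (K * r') = ?h (C [^] int (K * r'))" by (rule h.hom_int_pow[symmetric]) simp
    also have "C [^] int (K * r') = b [^] i"
    proof -
      have "C [^] int (K * r') = (C [^] int K) [^] int r'" by (simp add: int_pow_pow)
      then show ?thesis by (simp add: i b_def int_pow_pow mult.commute)
    qed
    also have "?h (b [^] i) = \<one>\<^bsub>?Q\<^esub>" by (metis hb h.hom_int_pow[OF bc] Q.int_pow_one)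
    finally have CQ: "?h C [^]\<^bsub>?Q\<^esub> int (K * r') = ?h A [^]\<^bsub>?Q\<^esub> (0::int)" by simp
    have copK: "coprime (int (K * r')) (int q)"
      using copq[of "int (K * r')"] qK r'(2) qi by (simp add: prime_dvd_mult_iff)
    \<comment> \<open>In the quotient C^(K r') is trivial with K r' prime to q, so q does not divide
      the order of the image of A. Upstairs that order moves A into <b>, hence into <B>, and a
      factor \<alpha> - 1 kills the result.\<close>
    have nq: "\<not> q dvd Q.ord (?h A)"
    proof
      assume "q dvd Q.ord (?h A)"
      then obtain e' where "Q.ord (?h A) = q * e'" by blast
      from mQ.dvd_of_coprime_C_pow[OF this oQ copK CQ] nd show False by simp
    qed
    have "?h (A [^] int (Q.ord (?h A))) = \<one>\<^bsub>?Q\<^esub>"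
      using h.hom_int_pow[OF A] Q.int_pow_eq_id[OF mQ.A] by (metis dvd_refl)
    then have "?N #> A [^] int (Q.ord (?h A)) = ?N" by (simp add: FactGroup_def)
    then have "A [^] int (Q.ord (?h A)) \<in> ?N"
      using N.subgroup_axioms coset_join1 by (metis A int_pow_closed)
    then obtain k :: int where "A [^] int (Q.ord (?h A)) = b [^] k" using generate_pow[OF bc] by auto
    then have "A [^] int (Q.ord (?h A)) = B [^] (int r' * k)" by (simp add: b_def int_pow_pow)
    then have "A [^] (int (Q.ord (?h A)) * (\<alpha> - 1)) = \<one>" by (rule inter_exponent)
    then have "int (ord A) dvd int (Q.ord (?h A)) * (\<alpha> - 1)" by (simp add: int_pow_eq_id)
    then have "int q dvd int (Q.ord (?h A)) * (\<alpha> - 1)" using e by (metis dvd_mult_left of_nat_mult)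
    then show False using nq nd qi by (simp add: prime_dvd_mult_iff)
  qed
qed

end

section \<open>Product decomposition\<close>

text \<open>H <g> is the disjoint union of the cosets H g^i for i < j0, where j0 is the least
  positive exponent with g^j0 in H, and j0 divides r. As K is only a set of products, the cosets are
  counted by an explicit bijection.\<close>

lemma (in group) card_dvd_of_cyclic_cosets:
  assumes H: "subgroup H G" "finite H" and g: "g \<in> carrier G" and r: "r > 0" "g [^] int r \<in> H"
    and K: "K = {h \<otimes> g [^] (j::int) | h j. h \<in> H}"
  shows "finite K" "card K dvd card H * r"
proof -
  interpret H: subgroup H G by fact
  define j0 where "j0 = (LEAST n. n > 0 \<and> g [^] int n \<in> H)"
  have j0: "j0 > 0" "g [^] int j0 \<in> H"
    using LeastI[of "\<lambda>n. n > 0 \<and> g [^] int n \<in> H" r] r by (simp_all add: j0_def)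
  have least: "n = 0" if "n < j0" "g [^] int n \<in> H" for n
    using not_less_Least[of n "\<lambda>n. n > 0 \<and> g [^] int n \<in> H"] that unfolding j0_def by simp
  have mod_mem: "g [^] (j mod int j0) = g [^] (- (j div int j0) * int j0) \<otimes> g [^] j" for j :: int
  proof -
    have "j mod int j0 = - (j div int j0) * int j0 + j" by (simp add: minus_div_mult_eq_mod[symmetric])
    then show ?thesis using g by (metis int_pow_mult)
  qed
  have mult_mem: "g [^] (k * int j0) \<in> H" for k :: int
    using subgroup_int_pow_closed[OF H(1) j0(2), of k] g by (simp add: int_pow_pow mult.commute)
  have dvd: "int j0 dvd j" if "g [^] j \<in> H" for j :: int
  proof -
    have "g [^] (j mod int j0) \<in> H" unfolding mod_mem by (rule H.m_closed[OF mult_mem that])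
    moreover have m: "int (nat (j mod int j0)) = j mod int j0" using j0 by simp
    ultimately have "g [^] int (nat (j mod int j0)) \<in> H" by (simp only: m)
    moreover have "nat (j mod int j0) < j0" using j0 by (simp add: nat_less_iff)
    ultimately have "nat (j mod int j0) = 0" by (intro least)
    moreover have "j mod int j0 \<ge> 0" using j0 by simp
    ultimately have "j mod int j0 = 0" by linarith
    then show ?thesis by auto
  qed
  have bij: "bij_betw (\<lambda>(h, i). h \<otimes> g [^] int i) (H \<times> {..<j0}) K"
    unfolding bij_betw_def
  proof
    show "inj_on (\<lambda>(h, i). h \<otimes> g [^] int i) (H \<times> {..<j0})"
    proof (rule inj_onI)
      fix x y assume xy: "x \<in> H \<times> {..<j0}" "y \<in> H \<times> {..<j0}"
        "(case x of (h, i) \<Rightarrow> h \<otimes> g [^] int i) = (case y of (h, i) \<Rightarrow> h \<otimes> g [^] int i)"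
      obtain h i h' i' where x: "x = (h, i)" and y: "y = (h', i')" by (cases x, cases y)
      have h: "h \<in> H" "h' \<in> H" and i: "i < j0" "i' < j0" and e': "h \<otimes> g [^] int i = h' \<otimes> g [^] int i'"
        using xy by (simp_all only: x y mem_Times_iff fst_conv snd_conv lessThan_iff prod.case)
      have hc: "h \<in> carrier G" "h' \<in> carrier G" using h by auto
      have "g [^] (int i - int i') = inv h \<otimes> h'"
      proof -
        have "inv h \<otimes> (h \<otimes> g [^] int i) \<otimes> g [^] (- int i') = inv h \<otimes> (h' \<otimes> g [^] int i') \<otimes> g [^] (- int i')"
          by (simp only: e')
        then show ?thesis using g hc by (simp add: m_assoc int_pow_mult[symmetric])
      qed
      then have "g [^] (int i - int i') \<in> H" using h by simp
      then have "int j0 dvd int i - int i'" by (rule dvd)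
      then have "i = i'" using i
        by (metis mod_eq_dvd_iff mod_less of_nat_eq_iff of_nat_mod)
      then show "x = y" using e' hc g by (simp add: x y)
    qed
    show "(\<lambda>(h, i). h \<otimes> g [^] int i) ` (H \<times> {..<j0}) = K"
    proof
      show "(\<lambda>(h, i). h \<otimes> g [^] int i) ` (H \<times> {..<j0}) \<subseteq> K"
      proof (rule image_subsetI)
        fix x assume "x \<in> H \<times> {..<j0}"
        then have "fst x \<in> H" by auto
        then show "(case x of (h, i) \<Rightarrow> h \<otimes> g [^] int i) \<in> K" unfolding K split_beta by blast
      qed
      show "K \<subseteq> (\<lambda>(h, i). h \<otimes> g [^] int i) ` (H \<times> {..<j0})"
      proof
        fix x assume "x \<in> K"
        then obtain h j where h: "h \<in> H" and x: "x = h \<otimes> g [^] (j::int)" unfolding K by blast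
        let ?k = "(j div int j0) * int j0"
        have "j = ?k + j mod int j0" by simp
        then have "g [^] j = g [^] ?k \<otimes> g [^] (j mod int j0)" using g by (metis int_pow_mult)
        moreover have "int (nat (j mod int j0)) = j mod int j0" using j0 by simp
        ultimately have "x = (h \<otimes> g [^] ?k) \<otimes> g [^] int (nat (j mod int j0))"
          using x h g H.mem_carrier by (simp only: m_assoc int_pow_closed)
        moreover have "h \<otimes> g [^] ?k \<in> H" using h mult_mem by simp
        moreover have "nat (j mod int j0) < j0" using j0 by (simp add: nat_less_iff)
        ultimately show "x \<in> (\<lambda>(h, i). h \<otimes> g [^] int i) ` (H \<times> {..<j0})"
          by (intro image_eqI[of _ _ "(h \<otimes> g [^] ?k, nat (j mod int j0))"])
            (simp_all only: prod.case mem_Times_iff fst_conv snd_conv lessThan_iff simp_thms)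
      qed
    qed
  qed
  show "finite K" using bij H(2) bij_betw_finite by blast
  have "card K = card H * j0" using bij_betw_same_card[OF bij] by (simp add: card_cartesian_product)
  moreover have "int j0 dvd int r" using dvd r by blast
  ultimately show "card K dvd card H * r" by simp
qed

section \<open>The factorisation <A><C><B> and the resulting order bound\<close>

context macd
begin

definition AC_prod :: "'a set" where
  "AC_prod = {A [^] (j::int) \<otimes> C [^] (i::int) | i j. True}"

context
  assumes oA: "ord A > 0" and oB: "ord B > 0"
begin

lemma C_pow_nat: "\<exists>n. C [^] (i::int) = C [^] int n"
  using int_pow_as_nat_pow[OF C ord_C_pos[OF oA]] .

lemma A_past_C: "\<exists>j'. A [^] (j::int) \<otimes> C [^] (i::int) = C [^] i \<otimes> A [^] (j'::int)"
  using C_pow_nat[of i] A_pow_C by metis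

lemma C_past_A: "\<exists>j'. C [^] (i::int) \<otimes> A [^] (j::int) = A [^] (j'::int) \<otimes> C [^] i"
proof -
  obtain j' :: int where j': "A [^] (- j) \<otimes> C [^] (- i) = C [^] (- i) \<otimes> A [^] j'" using A_past_C by blast
  have "inv (A [^] (- j) \<otimes> C [^] (- i)) = inv (C [^] (- i) \<otimes> A [^] j')" using j' by simp
  then have "C [^] i \<otimes> A [^] j = A [^] (- j') \<otimes> C [^] i" by (simp add: inv_mult_group int_pow_neg)
  then show ?thesis by blast
qed

lemma C_past_B: "\<exists>j'. C [^] (i::int) \<otimes> B [^] (j::int) = B [^] (j'::int) \<otimes> C [^] i"
  using C_pow_nat[of i] C_pow_B by metis

lemma B_past_C: "\<exists>j'. B [^] (j::int) \<otimes> C [^] (i::int) = C [^] i \<otimes> B [^] (j'::int)"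
proof -
  obtain j' :: int where j': "C [^] (- i) \<otimes> B [^] (- j) = B [^] j' \<otimes> C [^] (- i)" using C_past_B by blast
  have "inv (C [^] (- i) \<otimes> B [^] (- j)) = inv (B [^] j' \<otimes> C [^] (- i))" using j' by simp
  then have "B [^] j \<otimes> C [^] i = C [^] i \<otimes> B [^] (- j')" by (simp add: inv_mult_group int_pow_neg)
  then show ?thesis by blast
qed

lemma AC_prod_subgroup: "subgroup AC_prod G"
proof
  show "AC_prod \<subseteq> carrier G" by (auto simp: AC_prod_def)
  show "\<one> \<in> AC_prod" unfolding AC_prod_def by (auto intro!: exI[of _ "0::int"])
  fix x assume "x \<in> AC_prod"
  then obtain i j :: int where x: "x = A [^] j \<otimes> C [^] i" by (auto simp: AC_prod_def)
  have "inv x = C [^] (- i) \<otimes> A [^] (- j)" by (simp add: x inv_mult_group int_pow_neg)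
  then show "inv x \<in> AC_prod" using C_past_A[of "- i" "- j"] unfolding AC_prod_def by auto
  fix y assume "y \<in> AC_prod"
  then obtain i' j' :: int where y: "y = A [^] j' \<otimes> C [^] i'" by (auto simp: AC_prod_def)
  obtain k :: int where k: "C [^] i \<otimes> A [^] j' = A [^] k \<otimes> C [^] i" using C_past_A by blast
  have "x \<otimes> y = A [^] (j + k) \<otimes> C [^] (i + i')"
    using commute_ext[OF k, of "C [^] i'"] by (simp add: x y m_assoc int_pow_mult)
  then show "x \<otimes> y \<in> AC_prod" unfolding AC_prod_def by blast
qed

text \<open>The set of products is closed under right multiplication by powers of B, C and A. For A
  one factor at a time suffices: \<open>B_pow_A\<close> replaces B^n A by A and a power of C
  followed by a power of B, and the subgroup <A><C> on the left absorbs the first two.\<close>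

lemma generate_AB: "generate G {A, B} = {h \<otimes> B [^] (j::int) | h j. h \<in> AC_prod}" (is "_ = ?S")
proof
  interpret M: subgroup AC_prod G by (rule AC_prod_subgroup)
  have AM: "A [^] (i::int) \<in> AC_prod" and CM: "C [^] (i::int) \<in> AC_prod" for i
  proof -
    have "A [^] i = A [^] i \<otimes> C [^] (0::int)" "C [^] i = A [^] (0::int) \<otimes> C [^] i" by simp_all
    then show "A [^] i \<in> AC_prod" "C [^] i \<in> AC_prod" unfolding AC_prod_def by blast+
  qed
  have Sc: "?S \<subseteq> carrier G" by auto
  have SB: "x \<otimes> B [^] (j::int) \<in> ?S" if x: "x \<in> ?S" for x j
  proof -
    obtain h k where h: "h \<in> AC_prod" "x = h \<otimes> B [^] (k::int)" using x by blast
    then have "x \<otimes> B [^] j = h \<otimes> B [^] (k + j)" by (simp add: m_assoc int_pow_mult)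
    then show ?thesis using h by blast
  qed
  have SC: "x \<otimes> C [^] (i::int) \<in> ?S" if x: "x \<in> ?S" for x i
  proof -
    obtain h k where h: "h \<in> AC_prod" "x = h \<otimes> B [^] (k::int)" using x by blast
    obtain k' :: int where k': "B [^] k \<otimes> C [^] i = C [^] i \<otimes> B [^] k'" using B_past_C by blast
    have "x \<otimes> C [^] i = (h \<otimes> C [^] i) \<otimes> B [^] k'" using h k' by (simp add: m_assoc)
    then show ?thesis using h CM M.m_closed by blast
  qed
  have SA1: "x \<otimes> A \<in> ?S" if x: "x \<in> ?S" for x
  proof -
    obtain h k where h: "h \<in> AC_prod" "x = h \<otimes> B [^] (k::int)" using x by blast
    obtain n where n: "B [^] k = B [^] int n" using int_pow_as_nat_pow[OF B oB] by blast
    have "x \<otimes> A = h \<otimes> (A [^] (1::int) \<otimes> (C [^] (- int n) \<otimes> B [^] (\<beta> * geo n \<beta>)))"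
      using h B_pow_A[of n] by (simp only: n m_assoc M.mem_carrier A B int_pow_closed int_pow_1)
    also have "\<dots> = (h \<otimes> A [^] (1::int) \<otimes> C [^] (- int n)) \<otimes> B [^] (\<beta> * geo n \<beta>)"
      using h by (simp add: m_assoc)
    finally show ?thesis using h AM CM M.m_closed by blast
  qed
  have SA: "x \<otimes> A [^] (i::int) \<in> ?S" if x: "x \<in> ?S" for x i
  proof -
    have N: "x \<otimes> A [^] int n \<in> ?S" for n
    proof (induction n)
      case 0 then show ?case using x subsetD[OF Sc x] by simp
    next
      case (Suc n)
      have "x \<otimes> A [^] int (Suc n) = (x \<otimes> A [^] int n) \<otimes> A"
        using subsetD[OF Sc x] by (simp add: int_pow_mult m_assoc add.commute[of 1])
      then show ?case using SA1[OF Suc] by simp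
    qed
    obtain n where n: "A [^] i = A [^] int n" using int_pow_as_nat_pow[OF A oA, of i] by blast
    show ?thesis unfolding n by (rule N)
  qed
  have SM: "x \<otimes> h \<in> ?S" if x: "x \<in> ?S" and hA: "h \<in> AC_prod" for x h
  proof -
    obtain i j :: int where h: "h = A [^] j \<otimes> C [^] i" using hA by (auto simp: AC_prod_def)
    have e: "x \<otimes> h = (x \<otimes> A [^] j) \<otimes> C [^] i" using subsetD[OF Sc x] by (simp add: h m_assoc)
    show ?thesis unfolding e by (rule SC[OF SA[OF x]])
  qed
  have BS: "B [^] (j::int) \<in> ?S" for j
  proof -
    have "B [^] j = \<one> \<otimes> B [^] j" by simp
    then show ?thesis using M.one_closed by blast
  qed
  have "subgroup ?S G"
  proof
    show "?S \<subseteq> carrier G" by (rule Sc)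
    show "\<one> \<in> ?S" using BS[of 0] by (simp only: int_pow_0)
    fix x assume x: "x \<in> ?S"
    then obtain h k where h: "h \<in> AC_prod" "x = h \<otimes> B [^] (k::int)" by blast
    have e: "inv x = B [^] (- k) \<otimes> inv h" using h by (simp add: inv_mult_group int_pow_neg)
    show "inv x \<in> ?S" unfolding e by (rule SM[OF BS M.m_inv_closed[OF h(1)]])
    fix y assume "y \<in> ?S"
    then obtain h' k' where h': "h' \<in> AC_prod" "y = h' \<otimes> B [^] (k'::int)" by blast
    have e: "x \<otimes> y = (x \<otimes> h') \<otimes> B [^] k'" using h' subsetD[OF Sc x] by (simp add: m_assoc)
    show "x \<otimes> y \<in> ?S" unfolding e by (rule SB[OF SM[OF x h'(1)]])
  qed
  moreover have "A \<in> ?S" using SA[OF BS[of 0], of 1] by (simp only: int_pow_0 int_pow_1 l_one A)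
  moreover have "B \<in> ?S" using BS[of 1] by (simp only: int_pow_1 B)
  ultimately show "generate G {A, B} \<subseteq> ?S" by (intro generate_subgroup_incl) auto
  interpret K: subgroup "generate G {A, B}" G by (rule generate_is_subgroup) auto
  have AK: "A \<in> generate G {A, B}" and BK: "B \<in> generate G {A, B}" by (auto intro: generate.incl)
  have "C = inv A \<otimes> (inv B \<otimes> (A \<otimes> B))" by (simp add: AB m_assoc)
  then have CK: "C \<in> generate G {A, B}" using AK BK by simp
  show "?S \<subseteq> generate G {A, B}"
    using subgroup_int_pow_closed[OF K.subgroup_axioms] AK BK CK by (auto simp: AC_prod_def)
qed

lemma card_generate_AB:
  assumes "r > 0" "C [^] int r = A [^] (i::int)" "t > 0" "B [^] int t \<in> AC_prod"
  shows "finite (generate G {A, B})" "card (generate G {A, B}) dvd ord A * r * t"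
proof -
  have gA: "generate G {A} = {A [^] (k::int) | k. k \<in> UNIV}" by (rule generate_pow) simp
  have fA: "card (generate G {A}) = ord A" by (simp add: generate_pow_card)
  then have "finite (generate G {A})" using oA by (metis card.infinite less_numeral_extra(3))
  moreover have "C [^] int r \<in> generate G {A}" using assms(2) gA by auto
  moreover have "AC_prod = {h \<otimes> C [^] (j::int) | h j. h \<in> generate G {A}}" unfolding AC_prod_def gA by blast
  moreover have "subgroup (generate G {A}) G" by (simp add: generate_is_subgroup)
  ultimately have 1: "finite AC_prod" "card AC_prod dvd card (generate G {A}) * r"
    using card_dvd_of_cyclic_cosets[of "generate G {A}" C r AC_prod] assms(1) by auto
  have 2: "finite (generate G {A, B})" "card (generate G {A, B}) dvd card AC_prod * t"
    using card_dvd_of_cyclic_cosets[OF AC_prod_subgroup 1(1) B assms(3,4) generate_AB] by auto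
  show "finite (generate G {A, B})" by (rule 2)
  show "card (generate G {A, B}) dvd ord A * r * t"
    using 1 2 fA by (metis dvd_trans mult_dvd_mono dvd_refl)
qed

end

end

section \<open>Splitting off the p-part\<close>

lemma (in group) commute_pow:
  assumes "x \<otimes> y = y \<otimes> x" "x \<in> carrier G" "y \<in> carrier G"
  shows "x [^] (i::int) \<otimes> y = y \<otimes> x [^] i"
  using conj_int_pow[OF assms(1)] assms by simp

lemma (in group) commute_mult:
  assumes "x \<otimes> y = y \<otimes> x" "x \<otimes> z = z \<otimes> x" "x \<in> carrier G" "y \<in> carrier G" "z \<in> carrier G"
  shows "x \<otimes> (y \<otimes> z) = (y \<otimes> z) \<otimes> x"
  using assms commute_ext[OF assms(1), of z] by (simp add: m_assoc)

text \<open>p^E s is a common multiple of the orders of A and C, and w is 1 modulo p^E and 0 modulo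
  s, so w-th powers are p-parts and (1 - w)-th powers the complementary parts. The squares in
  \<open>wp\<close> and \<open>ws\<close> are there because a c is only seen to have order dividing
  p^(2E), and a' c' order dividing s^2.\<close>

locale macd_split = macd +
  fixes p E s :: nat and w :: int
  assumes odd_prime: "odd_prime p" and p\<alpha>: "int p dvd \<alpha> - 1"
    and oA: "ord A > 0" "ord A dvd p ^ E * s" and oC: "ord C dvd p ^ E * s" and s: "\<not> p dvd s"
    and wp: "int p ^ (2 * E) dvd w - 1" and ws: "int s ^ 2 dvd w"
    and primes: "\<And>q. Factorial_Ring.prime q \<Longrightarrow> q dvd ord A \<Longrightarrow> int q dvd \<alpha> - 1"
begin

abbreviation "a \<equiv> A [^] w"
abbreviation "a' \<equiv> A [^] (1 - w)"
abbreviation "c \<equiv> C [^] w"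
abbreviation "c' \<equiv> C [^] (1 - w)"

lemma s_pos: "s > 0" using s by (cases s) auto

lemma pE: "int p ^ E dvd w - 1" and sw: "int s dvd w"
  using wp ws by (metis dvd_mult_left mult_2 power_add, metis dvd_mult_left power2_eq_square)

lemma pow_one:
  assumes "g \<in> carrier G" "ord g dvd p ^ E * s" "int (p ^ E * s) dvd z"
  shows "g [^] z = \<one>"
  using assms by (metis dvd_trans int_dvd_int_iff int_pow_eq_id)

lemma a_order: "a [^] int (p ^ E) = \<one>" and c_order: "c [^] int (p ^ E) = \<one>"
proof -
  have "int (p ^ E * s) dvd w * int (p ^ E)" using sw by (simp add: mult.commute mult_dvd_mono)
  then show "a [^] int (p ^ E) = \<one>" "c [^] int (p ^ E) = \<one>"
    using pow_one oA(2) oC by (simp_all only: int_pow_pow A C)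
qed

lemma a'_order: "a' [^] int s = \<one>" and c'_order: "c' [^] int s = \<one>"
proof -
  have "int (p ^ E * s) dvd (1 - w) * int s" using pE
    by (simp add: mult_dvd_mono) (metis dvd_diff_commute dvd_refl mult_dvd_mono)
  then show "a' [^] int s = \<one>" "c' [^] int s = \<one>"
    using pow_one oA(2) oC by (simp_all only: int_pow_pow A C)
qed

lemma a_a': "a \<otimes> a' = A" and c_c': "c \<otimes> c' = C"
  by (simp_all add: int_pow_mult[symmetric])

text \<open>\<open>A_pow_C\<close> takes natural exponents of C. Reducing z modulo p^E s gives one
  and keeps divisibility by the divisors of p^E s.\<close>

lemma C_pow_as_nat:
  obtains N where "C [^] (z::int) = C [^] int N" "\<And>d. d dvd int (p ^ E * s) \<Longrightarrow> d dvd z \<Longrightarrow> d dvd int N"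
proof -
  let ?n = "int (p ^ E * s)"
  have n: "?n > 0" using s_pos odd_prime.prime_p[OF odd_prime] by (simp add: prime_gt_0_nat)
  have N: "int (nat (z mod ?n)) = z mod ?n" using n by simp
  have "int (ord C) dvd z mod ?n - z"
  proof -
    have "?n dvd z mod ?n - z" by (metis dvd_diff_commute dvd_minus_mod)
    then show ?thesis using oC dvd_trans int_dvd_int_iff by blast
  qed
  then have "C [^] z = C [^] int (nat (z mod ?n))" unfolding N by (simp add: int_pow_eq)
  moreover have "d dvd int (nat (z mod ?n))" if "d dvd ?n" "d dvd z" for d
    unfolding N using that by (simp add: dvd_mod)
  ultimately show thesis using that by blast
qed

text \<open>c' is C^N with p^E dividing N. As p divides \<alpha> - 1, \<alpha>^N is 1 modulo p^E, so
  C^N centralises the p-part of A.\<close>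

lemma a_c': "a \<otimes> c' = c' \<otimes> a"
proof -
  interpret P: odd_prime p by (rule odd_prime)
  have pE': "int p ^ E dvd 1 - w" using pE dvd_diff_commute by blast
  have d: "int p ^ E dvd int (p ^ E * s)" by simp
  obtain N where N: "c' = C [^] int N"
      "\<And>d. d dvd int (p ^ E * s) \<Longrightarrow> d dvd 1 - w \<Longrightarrow> d dvd int N"
    using C_pow_as_nat[of "1 - w"] by blast
  have "int p ^ E dvd int N" using N(2)[OF d pE'] .
  then have "int p ^ (E + 1) dvd \<alpha> ^ N - 1" using P.power_minus_1_dvd[of 1 \<alpha> E N] p\<alpha> by simp
  then have "int p ^ E dvd \<alpha> ^ N - 1" by (metis dvd_mult_left power_add)
  then have "int s * int p ^ E dvd w * (\<alpha> ^ N - 1)" using sw by (simp add: mult_dvd_mono)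
  then have "int (p ^ E * s) dvd w * \<alpha> ^ N - w" by (simp add: algebra_simps)
  then have "int (ord A) dvd w * \<alpha> ^ N - w" using oA(2) dvd_trans int_dvd_int_iff by blast
  then have "a = A [^] (w * \<alpha> ^ N)" by (simp add: int_pow_eq)
  then show ?thesis using A_pow_C[of w N] N(1) by simp
qed

text \<open>Here c = C^N with s dividing N, and the part n' of ord A prime to p divides s. That
  \<alpha>^N is 1 modulo n' comes from \<open>dvd_power_self_minus_1\<close>; for this the
  hypothesis \<open>primes\<close> is in the locale.\<close>

lemma a'_c: "a' \<otimes> c = c \<otimes> a'"
proof -
  obtain N where N: "c = C [^] int N" "\<And>d. d dvd int (p ^ E * s) \<Longrightarrow> d dvd w \<Longrightarrow> d dvd int N"
    using C_pow_as_nat[of w] by blast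
  have sN: "int s dvd int N" using N(2)[of "int s"] sw by simp
  have P: "Factorial_Ring.prime p" using odd_prime by (simp add: odd_prime_def)
  obtain e n' where n': "ord A = p ^ e * n'" "\<not> p dvd n'"
    using oA(1) P by (metis multiplicity_decompose' not_gr_zero not_prime_unit)
  have n0: "n' > 0" using n' oA by (cases n') auto
  have n1: "int n' dvd \<alpha> ^ n' - 1"
    by (rule dvd_power_self_minus_1[OF n0 primes]) (use n' in auto)
  have "n' dvd N"
  proof -
    have "coprime p n'" using P n'(2) by (rule prime_imp_coprime)
    then have "coprime n' (p ^ E)" by (simp add: coprime_commute)
    moreover have "n' dvd p ^ E * s" using oA(2) n'(1) by (metis dvd_mult_right)
    ultimately have "n' dvd s" by (simp add: coprime_dvd_mult_right_iff)
    then show ?thesis using sN by auto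
  qed
  then obtain k where "N = n' * k" by blast
  then have nN: "int n' dvd \<alpha> ^ N - 1" using dvd_power_minus_1[OF n1] by (simp add: power_mult)
  have "e \<le> E"
  proof -
    have "coprime (p ^ e) s" using P s by (simp add: prime_imp_coprime)
    moreover have "p ^ e dvd p ^ E * s" using oA(2) n'(1) by (metis dvd_mult_left)
    ultimately have "p ^ e dvd p ^ E" by (simp add: coprime_dvd_mult_left_iff)
    then show ?thesis using P by (metis dvd_power_iff_le prime_ge_2_nat)
  qed
  then have "int p ^ e dvd 1 - w" using pE by (metis dvd_diff_commute dvd_trans le_imp_power_dvd)
  then have "int p ^ e * int n' dvd (1 - w) * (\<alpha> ^ N - 1)" using nN by (rule mult_dvd_mono)
  then have "int (ord A) dvd (1 - w) * \<alpha> ^ N - (1 - w)" by (simp add: n' algebra_simps)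
  then have "a' = A [^] ((1 - w) * \<alpha> ^ N)" by (simp add: int_pow_eq)
  then show ?thesis using A_pow_C[of "1 - w" N] N(1) by simp
qed

lemma a_C: "A [^] (i::int) \<otimes> C = C \<otimes> (A [^] i) [^] \<alpha>"
  using A_pow_C[of i 1] by (simp add: int_pow_pow)

lemma a_c: "a \<otimes> c = c \<otimes> a [^] \<alpha>"
proof -
  have "a \<otimes> (c \<otimes> c') = c \<otimes> c' \<otimes> a [^] \<alpha>" using a_C[of w] by (simp only: c_c')
  also have "\<dots> = c \<otimes> a [^] \<alpha> \<otimes> c'"
    using commute_pow[OF a_c', of \<alpha>] by (simp add: m_assoc)
  finally have "(a \<otimes> c) \<otimes> c' = (c \<otimes> a [^] \<alpha>) \<otimes> c'" by (simp add: m_assoc)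
  then show ?thesis by (metis A C int_pow_closed m_closed r_cancel)
qed

lemma a'_c': "a' \<otimes> c' = c' \<otimes> a' [^] \<alpha>"
proof -
  have "a' \<otimes> (c \<otimes> c') = c \<otimes> c' \<otimes> a' [^] \<alpha>" using a_C[of "1 - w"] by (simp only: c_c')
  moreover have "a' \<otimes> (c \<otimes> c') = c \<otimes> (a' \<otimes> c')" using commute_ext[OF a'_c, of c'] by simp
  ultimately have "c \<otimes> (a' \<otimes> c') = c \<otimes> (c' \<otimes> a' [^] \<alpha>)" by (simp add: m_assoc)
  then show ?thesis by simp
qed

lemma a_a'_commute: "a \<otimes> a' = a' \<otimes> a" and c_c'_commute: "c \<otimes> c' = c' \<otimes> c"
  by (simp_all add: int_pow_mult[symmetric])

lemma ac_pow: "(a \<otimes> c) [^] w = a \<otimes> c" "(a \<otimes> c) [^] (1 - w) = \<one>"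
proof -
  let ?n = "p ^ E"
  have "(a \<otimes> c) [^] int ?n = c [^] int ?n \<otimes> a [^] (\<alpha> * geo ?n \<alpha>)"
    by (rule twist_pow'[OF a_c]) simp_all
  then have "(a \<otimes> c) [^] int ?n = a [^] (\<alpha> * geo ?n \<alpha>)" by (simp only: c_order l_one A int_pow_closed)
  then have "((a \<otimes> c) [^] int ?n) [^] int ?n = (a [^] int ?n) [^] (\<alpha> * geo ?n \<alpha>)"
    by (simp only: int_pow_pow A int_pow_closed mult.commute mult.left_commute)
  then have "(a \<otimes> c) [^] (int ?n * int ?n) = \<one>"
    by (simp only: a_order int_pow_one int_pow_pow m_closed A C int_pow_closed)
  then have "int (ord (a \<otimes> c)) dvd int ?n * int ?n" by (simp add: int_pow_eq_id)
  also have "\<dots> dvd w - 1" using wp by (simp add: power_add[symmetric] mult_2)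
  finally have d: "int (ord (a \<otimes> c)) dvd w - 1" .
  then show "(a \<otimes> c) [^] (1 - w) = \<one>" by (simp add: int_pow_eq_id) (metis dvd_diff_commute)
  have "(a \<otimes> c) [^] (1::int) = (a \<otimes> c) [^] w" using d by (simp only: int_pow_eq m_closed A C int_pow_closed)
  then show "(a \<otimes> c) [^] w = a \<otimes> c" by simp
qed

lemma a'c'_pow: "(a' \<otimes> c') [^] w = \<one>"
proof -
  have "(a' \<otimes> c') [^] int s = c' [^] int s \<otimes> a' [^] (\<alpha> * geo s \<alpha>)"
    by (rule twist_pow'[OF a'_c']) simp_all
  then have "(a' \<otimes> c') [^] int s = a' [^] (\<alpha> * geo s \<alpha>)" by (simp only: c'_order l_one A int_pow_closed)
  then have "((a' \<otimes> c') [^] int s) [^] int s = (a' [^] int s) [^] (\<alpha> * geo s \<alpha>)"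
    by (simp only: int_pow_pow A int_pow_closed mult.commute mult.left_commute)
  then have "(a' \<otimes> c') [^] (int s * int s) = \<one>"
    by (simp only: a'_order int_pow_one int_pow_pow m_closed A C int_pow_closed)
  then have "int (ord (a' \<otimes> c')) dvd int s * int s" by (simp add: int_pow_eq_id)
  also have "\<dots> dvd w" using ws by (simp add: power2_eq_square)
  finally show ?thesis by (simp add: int_pow_eq_id)
qed

lemma a'_pow: "a' [^] w = \<one>"
proof -
  have "int (ord a') dvd int s" using a'_order by (simp add: int_pow_eq_id)
  then show ?thesis using sw dvd_trans by (metis A int_pow_closed int_pow_eq_id)
qed

text \<open>A C is the commuting product of a c and a' c'; the w-th power keeps the first factor and
  kills the second. As B conjugates A to A C, it conjugates a = A^w to a c.\<close>

lemma a_B: "a \<otimes> B = B \<otimes> (a \<otimes> c)"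
proof -
  have 1: "(a \<otimes> c) \<otimes> (a' \<otimes> c') = A \<otimes> C"
  proof -
    have "(a \<otimes> c) \<otimes> (a' \<otimes> c') = a \<otimes> (a' \<otimes> (c \<otimes> c'))"
      using commute_ext[OF a'_c, of c'] by (simp add: m_assoc)
    then show ?thesis using a_a' by (simp add: c_c' m_assoc[symmetric])
  qed
  have "a' \<otimes> (a \<otimes> c) = (a \<otimes> c) \<otimes> a'" using commute_mult[OF a_a'_commute[symmetric] a'_c] by simp
  moreover have "c' \<otimes> (a \<otimes> c) = (a \<otimes> c) \<otimes> c'" using commute_mult[OF a_c'[symmetric] c_c'_commute[symmetric]] by simp
  ultimately have 2: "(a \<otimes> c) \<otimes> (a' \<otimes> c') = (a' \<otimes> c') \<otimes> (a \<otimes> c)"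
    using commute_mult[of "a \<otimes> c" a' c'] by simp
  have "(A \<otimes> C) [^] w = (a \<otimes> c) [^] w \<otimes> (a' \<otimes> c') [^] w"
    unfolding 1[symmetric] by (rule int_pow_mult_distrib[OF 2]) simp_all
  then have "(A \<otimes> C) [^] w = a \<otimes> c" by (simp only: ac_pow a'c'_pow r_one m_closed A C int_pow_closed)
  then show ?thesis using A_pow_B[of w] by simp
qed

text \<open>If b conjugates A to A c, it conjugates the p-part a of A to the p-part of A c, namely a c,
  and fixes the complementary part of A.\<close>
lemma conj_parts:
  assumes b: "b \<in> carrier G" and bA: "b \<otimes> A = A \<otimes> (b \<otimes> inv c)"
  shows "a \<otimes> b = b \<otimes> (a \<otimes> c)" "a' \<otimes> b = b \<otimes> a'"
proof -
  have "A \<otimes> b = b \<otimes> (A \<otimes> c)"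
    using arg_cong[OF bA, of "\<lambda>x. x \<otimes> c"] b by (simp add: m_assoc)
  then have conj: "A [^] z \<otimes> b = b \<otimes> (A \<otimes> c) [^] z" for z :: int
    using b by (intro conj_int_pow) simp_all
  have 1: "A \<otimes> c = (a \<otimes> c) \<otimes> a'"
  proof -
    have "(a \<otimes> c) \<otimes> a' = (a \<otimes> a') \<otimes> c" using a'_c by (simp add: m_assoc)
    then show ?thesis by (simp only: a_a')
  qed
  have 2: "(a \<otimes> c) \<otimes> a' = a' \<otimes> (a \<otimes> c)"
    using commute_mult[OF a_a'_commute[symmetric] a'_c] by simp
  have 3: "(A \<otimes> c) [^] z = (a \<otimes> c) [^] z \<otimes> a' [^] z" for z :: int
    unfolding 1 by (rule int_pow_mult_distrib[OF 2]) simp_all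
  have "(A \<otimes> c) [^] w = a \<otimes> c"
    unfolding 3 by (simp only: ac_pow a'_pow r_one m_closed A C int_pow_closed)
  then show "a \<otimes> b = b \<otimes> (a \<otimes> c)" using conj[of w] by simp
  have "a' [^] (1 - w) = a' [^] (1::int) \<otimes> a' [^] (- w)"
    using int_pow_mult[of a' 1 "- w"] by simp
  also have "a' [^] (- w) = inv (a' [^] w)" by (rule int_pow_neg) simp
  finally have "a' [^] (1 - w) = a'" by (simp only: a'_pow inv_one r_one int_pow_1 A int_pow_closed)
  then have "(A \<otimes> c) [^] (1 - w) = a'" unfolding 3 by (simp only: ac_pow l_one A int_pow_closed)
  then show "a' \<otimes> b = b \<otimes> a'" using conj[of "1 - w"] by simp
qed

end

context macd
begin

text \<open>E0 lets E be as large as later estimates require. The commutator relation of the p-parts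
  comes from \<open>conj_parts\<close> with b = B^w; that of the complementary parts is what remains
  of A B = B A C after cancelling a b = b a c.\<close>

lemma p_part_decomposition:
  assumes odd: "odd_prime p" and pos: "\<alpha> > 0" "\<beta> > 0" and oA: "ord A > 0" and oB: "ord B > 0"
    and gen: "generate G {A, B} = carrier G" and p\<alpha>: "int p dvd \<alpha> - 1" and p\<beta>: "int p dvd \<beta> - 1"
  obtains E s w where "E \<ge> E0" "\<not> p dvd s" "int p ^ E dvd w - 1" "int s dvd w"
    "macd G (A [^] w) (B [^] w) (C [^] w) \<alpha> \<beta>"
    "(A [^] w) [^] int (p ^ E) = \<one>" "(B [^] w) [^] int (p ^ E) = \<one>" "(C [^] w) [^] int (p ^ E) = \<one>"
    "macd G (A [^] (1 - w)) (B [^] (1 - w)) (C [^] (1 - w)) \<alpha> \<beta>"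
    "(A [^] (1 - w)) [^] int s = \<one>" "(B [^] (1 - w)) [^] int s = \<one>" "(C [^] (1 - w)) [^] int s = \<one>"
    "A [^] w \<otimes> B [^] (1 - w) = B [^] (1 - w) \<otimes> A [^] w"
    "B [^] w \<otimes> A [^] (1 - w) = A [^] (1 - w) \<otimes> B [^] w"
proof -
  interpret P: odd_prime p by (rule odd)
  interpret sw: macd G B A "inv C" \<beta> \<alpha> by (rule swap)
  define n where "n = ord A * ord B * ord C"
  have n: "n > 0" using oA oB ord_C_pos by (simp add: n_def)
  obtain E1 s where s: "n = p ^ E1 * s" "\<not> p dvd s"
    using n P.prime_p by (metis multiplicity_decompose' not_gr_zero not_prime_unit)
  define E where "E = E1 + E0"
  have nE: "n dvd p ^ E * s" by (simp add: s(1) E_def power_add)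
  have "coprime (int p ^ (2 * E)) (int s ^ 2)" using s(2) P.prime_p by (simp add: prime_imp_coprime)
  then obtain u v where uv: "u * int p ^ (2 * E) + v * int s ^ 2 = 1" by (metis bezout_int coprime_iff_gcd_eq_1)
  define w where "w = v * int s ^ 2"
  have wp: "int p ^ (2 * E) dvd w - 1"
  proof -
    have "w - 1 = - u * int p ^ (2 * E)" using uv by (simp add: w_def)
    then show ?thesis by simp
  qed
  have ws: "int s ^ 2 dvd w" by (simp add: w_def)
  have o: "ord A dvd n" "ord B dvd n" "ord C dvd n" by (simp_all add: n_def)
  interpret m: macd_split G A B C \<alpha> \<beta> p E s w
    by unfold_locales (use odd p\<alpha> oA o nE s(2) wp ws prime_dvd_ord_A[OF pos oA oB gen] dvd_trans in auto)
  have gen': "generate G {B, A} = carrier G" using gen by (simp add: insert_commute)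
  interpret m': macd_split G B A "inv C" \<beta> \<alpha> p E s w
    by unfold_locales
      (use odd p\<beta> oB o nE s(2) wp ws sw.prime_dvd_ord_A[OF pos(2,1) oB oA gen'] dvd_trans in auto)
  let ?a = "A [^] w" let ?b = "B [^] w" let ?c = "C [^] w"
  let ?a' = "A [^] (1 - w)" let ?b' = "B [^] (1 - w)" let ?c' = "C [^] (1 - w)"
  have invc: "inv C [^] z = inv (C [^] z)" for z :: int by (simp add: int_pow_inv)
  have "?b \<otimes> A = A \<otimes> (?b \<otimes> inv ?c)" using m'.a_B by (simp add: invc)
  then have ab: "?a \<otimes> ?b = ?b \<otimes> (?a \<otimes> ?c)" and a'b: "?a' \<otimes> ?b = ?b \<otimes> ?a'"
    using m.conj_parts[of ?b] by simp_all
  have "?a \<otimes> B = B \<otimes> (?a \<otimes> inv (inv C [^] w))" using m.a_B by (simp add: invc)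
  then have b'a: "?b' \<otimes> ?a = ?a \<otimes> ?b'" using m'.conj_parts(2)[of ?a] by simp
  have bc: "?b \<otimes> inv ?c = inv ?c \<otimes> ?b [^] \<beta>" using m'.a_c by (simp add: invc)
  have b'c': "?b' \<otimes> inv ?c' = inv ?c' \<otimes> ?b' [^] \<beta>" using m'.a'_c' by (simp add: invc)
  have b'c: "?b' \<otimes> ?c = ?c \<otimes> ?b'"
  proof -
    have "?c [^] (- 1 :: int) \<otimes> ?b' = ?b' \<otimes> ?c [^] (- 1 :: int)" using m'.a'_c by (simp add: invc int_pow_neg)
    then have "(?c [^] (- 1 :: int)) [^] (- 1 :: int) \<otimes> ?b' = ?b' \<otimes> (?c [^] (- 1 :: int)) [^] (- 1 :: int)"
      by (rule commute_pow) simp_all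
    then show ?thesis by (simp add: int_pow_neg)
  qed
  have a'b': "?a' \<otimes> ?b' = ?b' \<otimes> (?a' \<otimes> ?c')"
  proof -
    have e1: "A \<otimes> B = (?a \<otimes> ?b) \<otimes> (?a' \<otimes> ?b')"
    proof -
      have "A \<otimes> B = ?a \<otimes> (?a' \<otimes> (?b \<otimes> ?b'))"
        using m.a_a' m'.a_a' by (metis A B int_pow_closed m_assoc m_closed)
      then show ?thesis using commute_ext[OF a'b, of ?b'] by (simp add: m_assoc)
    qed
    have e2: "B \<otimes> A \<otimes> C = (?b \<otimes> (?a \<otimes> ?c)) \<otimes> (?b' \<otimes> (?a' \<otimes> ?c'))"
    proof -
      have "B \<otimes> A \<otimes> C = (?b \<otimes> ?b') \<otimes> (?a \<otimes> ?a') \<otimes> (?c \<otimes> ?c')" using m.a_a' m'.a_a' m.c_c' by simp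
      also have "\<dots> = ?b \<otimes> (?b' \<otimes> (?a \<otimes> (?a' \<otimes> (?c \<otimes> ?c'))))" by (simp add: m_assoc)
      also have "\<dots> = ?b \<otimes> (?a \<otimes> (?b' \<otimes> (?c \<otimes> (?a' \<otimes> ?c'))))"
        using commute_ext[OF b'a, of "?a' \<otimes> (?c \<otimes> ?c')"] commute_ext[OF m.a'_c, of ?c'] by simp
      also have "\<dots> = ?b \<otimes> (?a \<otimes> (?c \<otimes> (?b' \<otimes> (?a' \<otimes> ?c'))))"
        using commute_ext[OF b'c, of "?a' \<otimes> ?c'"] by simp
      finally show ?thesis by (simp add: m_assoc)
    qed
    have "(?a \<otimes> ?b) \<otimes> (?a' \<otimes> ?b') = (?a \<otimes> ?b) \<otimes> (?b' \<otimes> (?a' \<otimes> ?c'))"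
      using AB unfolding e1 e2 by (simp only: ab)
    then show ?thesis by (metis A B C int_pow_closed l_cancel m_closed)
  qed
  have "macd G ?a ?b ?c \<alpha> \<beta>"
    by unfold_locales (use ab m.a_c bc in \<open>simp_all add: m_assoc\<close>)
  moreover have "macd G ?a' ?b' ?c' \<alpha> \<beta>"
    by unfold_locales (use a'b' m.a'_c' b'c' in \<open>simp_all add: m_assoc\<close>)
  moreover have "E \<ge> E0" by (simp add: E_def)
  ultimately show thesis
    using that[of E s w] s(2) m.pE m.sw m.a_order m'.a_order m.c_order m.a'_order m'.a'_order m.c'_order b'a a'b
    by (simp only: not_False_eq_True)
qed

end

section \<open>The upper bound\<close>

lemma (in odd_prime) inverse_mod_power:
  assumes "\<not> int p dvd u" shows "\<exists>v. int p ^ e dvd u * v - 1"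
proof -
  have "coprime (int p) u" using prime_int_p assms by (rule prime_imp_coprime)
  then have "coprime u (int p ^ e)" by (simp add: coprime_commute)
  then obtain v w where "v * u + w * int p ^ e = 1" by (metis bezout_int coprime_iff_gcd_eq_1)
  then have "u * v - 1 = - w * int p ^ e" by (simp add: algebra_simps)
  then show ?thesis by (metis dvd_triv_right)
qed

lemma (in odd_prime) not_dvd_cofactor:
  assumes "z = int p ^ e * z1" "\<not> int p ^ (e + 1) dvd z" shows "\<not> int p dvd z1"
  using assms by auto

lemma (in group) int_pow_cong:
  assumes "x \<in> carrier G" "x [^] (n::int) = \<one>" "n dvd i - j"
  shows "x [^] i = x [^] j"
proof -
  have "int (ord x) dvd n" using assms by (simp add: int_pow_eq_id)
  then have "int (ord x) dvd j - i" using assms(3) by (metis dvd_diff_commute dvd_trans)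
  then show ?thesis using assms(1) by (simp add: int_pow_eq)
qed

lemma (in group) int_pow_one_of_unit:
  assumes "odd_prime p" "x \<in> carrier G" "x [^] (int p ^ e) = \<one>" "x [^] (i * u) = \<one>" "\<not> int p dvd u"
  shows "x [^] (i::int) = \<one>"
proof -
  interpret P: odd_prime p by fact
  obtain v where "int p ^ e dvd u * v - 1" using P.inverse_mod_power assms by blast
  then have "int p ^ e dvd i * (u * v - 1)" by simp
  then have "int p ^ e dvd i * u * v - i" by (simp add: algebra_simps)
  then have "x [^] (i * u * v) = x [^] i" using int_pow_cong assms by blast
  moreover have "x [^] (i * u * v) = \<one>" using assms by (metis int_pow_one int_pow_pow)
  ultimately show ?thesis by simp
qed

text \<open>Replaces an integer exponent by a natural one with the same residue modulo p^E, which
  preserves the valuation e because e < E; geometric sums and \<open>A_pow_C\<close> take natural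
  arguments.\<close>

lemma (in odd_prime) reduced_exponent:
  assumes "int p ^ e dvd z" "\<not> int p ^ (e + 1) dvd z" "e < E"
  obtains n z1 where "int n = int p ^ e * z1" "\<not> int p dvd z1" "int p ^ E dvd int n - z"
proof -
  define n where "n = nat (z mod int p ^ E)"
  have n: "int n = z mod int p ^ E" using p_gt_2 by (simp add: n_def)
  then have d: "int p ^ E dvd int n - z" by (metis dvd_diff_commute dvd_minus_mod)
  have d1: "int p ^ e dvd int n - z" "int p ^ (e + 1) dvd int n - z"
    by (rule dvd_trans[OF le_imp_power_dvd d], use assms(3) in simp)+
  then have "int p ^ e dvd int n" using assms(1) by (metis zdvd_zdiffD dvd_diff_commute)
  then obtain z1 where z1: "int n = int p ^ e * z1" by (elim dvdE)
  have "\<not> int p ^ (e + 1) dvd int n" using d1(2) assms(2) by (metis zdvd_zdiffD dvd_diff_commute)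
  then have "\<not> int p dvd z1" using z1 by auto
  then show thesis using that z1 d by blast
qed

text \<open>h1 and k1 are the unit cofactors of \<alpha> - 1 and \<beta> - 1; they agree modulo p
  because l > m. E is any exponent such that p^E kills the three elements, and unit cofactors of
  exponents are inverted modulo p^E.\<close>

locale macd_p = macd +
  fixes p E m l :: nat and h1 k1 :: int
  assumes odd_prime: "odd_prime p"
    and Ap: "A [^] (int p ^ E) = \<one>" and Bp: "B [^] (int p ^ E) = \<one>" and Cp: "C [^] (int p ^ E) = \<one>"
    and \<alpha>_eq: "\<alpha> = 1 + int p ^ m * h1" and \<beta>_eq: "\<beta> = 1 + int p ^ m * k1"
    and h1k1: "\<not> int p dvd h1" "\<not> int p dvd k1" "int p dvd h1 - k1"
    and E: "0 < E" and m: "0 < m" "m < l" "l < 2 * m" "3 * m < 2 * l"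
begin

lemma swap_p: "macd_p G B A (inv C) \<beta> \<alpha> p E m l k1 h1"
proof -
  interpret s: macd G B A "inv C" \<beta> \<alpha> by (rule swap)
  show ?thesis
    by unfold_locales (use odd_prime.prime_p[OF odd_prime] odd_prime.odd_p[OF odd_prime] Ap Bp Cp \<alpha>_eq \<beta>_eq h1k1 E m dvd_diff_commute in \<open>auto simp: int_pow_inv\<close>)
qed

context
  fixes x y d :: nat and x1 y1 d1 :: int
  assumes x: "int x = int p ^ (2 * m) * x1" and y: "int y = int p ^ (2 * m) * y1" and d: "int d = int p ^ l * d1"
    and units: "\<not> int p dvd x1" "\<not> int p dvd y1" "\<not> int p dvd d1"
    and rel: "B [^] int y = A [^] int x \<otimes> C [^] int d"
begin

lemma rel': "B [^] int y = C [^] int d \<otimes> A [^] (int x * \<alpha> ^ d)"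
  using rel A_pow_C by simp

text \<open>B commutes with B^y, that is, with A^x C^d. Pulling B through A^x turns A^x into (A
  C)^x, pulling it through C^d produces B^(\<beta>^d - 1), and C^d cancels.\<close>

lemma B_commute: "C [^] int x \<otimes> A [^] (\<alpha> * geo x \<alpha>) \<otimes> B [^] (\<beta> ^ d - 1) = A [^] int x"
proof -
  have CB: "C [^] int d \<otimes> B = B \<otimes> (B [^] (\<beta> ^ d - 1) \<otimes> C [^] int d)"
  proof -
    have "C [^] int d \<otimes> B = B [^] (1 + (\<beta> ^ d - 1)) \<otimes> C [^] int d" using C_pow_B[of d 1] by simp
    also have "\<dots> = B [^] (1::int) \<otimes> B [^] (\<beta> ^ d - 1) \<otimes> C [^] int d" by (simp only: int_pow_mult B)
    finally show ?thesis by (simp add: m_assoc)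
  qed
  have AB': "A [^] int x \<otimes> B = B \<otimes> (C [^] int x \<otimes> A [^] (\<alpha> * geo x \<alpha>))"
    using A_pow_B[of "int x"] AC_pow[of x] by simp
  have "B \<otimes> B [^] int y = B [^] int y \<otimes> B"
    using int_pow_mult[OF B, of 1 "int y"] int_pow_mult[OF B, of "int y" 1] by (simp add: add.commute)
  then have "B \<otimes> (A [^] int x \<otimes> C [^] int d) = A [^] int x \<otimes> (C [^] int d \<otimes> B)"
    unfolding rel by (simp add: m_assoc)
  also have "\<dots> = (A [^] int x \<otimes> B) \<otimes> (B [^] (\<beta> ^ d - 1) \<otimes> C [^] int d)" unfolding CB by (simp add: m_assoc)
  also have "\<dots> = B \<otimes> (C [^] int x \<otimes> A [^] (\<alpha> * geo x \<alpha>) \<otimes> B [^] (\<beta> ^ d - 1) \<otimes> C [^] int d)"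
    unfolding AB' by (simp add: m_assoc)
  finally have "A [^] int x \<otimes> C [^] int d = C [^] int x \<otimes> A [^] (\<alpha> * geo x \<alpha>) \<otimes> B [^] (\<beta> ^ d - 1) \<otimes> C [^] int d"
    by (simp only: l_cancel A B C int_pow_closed m_closed)
  then have "A [^] int x = C [^] int x \<otimes> A [^] (\<alpha> * geo x \<alpha>) \<otimes> B [^] (\<beta> ^ d - 1)"
    by (simp only: r_cancel A B C int_pow_closed m_closed)
  then show ?thesis by (rule sym)
qed

lemma rel_pow: "B [^] (int y * int z) = C [^] int (d * z) \<otimes> A [^] (int x * \<alpha> ^ d * geo z (\<alpha> ^ d))"
proof -
  have "(C [^] int d \<otimes> A [^] (int x * \<alpha> ^ d)) [^] int z
      = C [^] int (d * z) \<otimes> A [^] (int x * \<alpha> ^ d * geo z (\<alpha> ^ d))"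
    by (rule twist_pow_gen[OF AC]) simp_all
  then show ?thesis unfolding rel'[symmetric] by (simp add: int_pow_pow)
qed

text \<open>B^(\<beta>^d - 1) is written as (B^y)^z and expanded by \<open>rel_pow\<close>, which
  turns \<open>B_commute\<close> into C^(x + d z) = A^\<xi>. Here x + d z is p^(2m) times a unit,
  and \<xi> is p^(m+l) times a number congruent to -x1 z1, where y1 z1 is k1 d1 modulo p.\<close>

lemma C_pow_eq_A_pow:
  "\<exists>\<theta>. C [^] (int p ^ (2 * m)) = A [^] (int p ^ (m + l) * \<theta>) \<and> int p dvd \<theta> * y1 + k1 * d1"
proof -
  interpret P: odd_prime p by (rule odd_prime)
  have dp: "int p ^ i dvd int p ^ j" if "i \<le> j" for i j using that by (rule le_imp_power_dvd)
  have pm: "int p ^ m dvd \<alpha> - 1" "int p ^ m dvd \<beta> - 1" by (simp_all add: \<alpha>_eq \<beta>_eq)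
  have p1: "int p dvd \<alpha> - 1" using pm(1) m by (metis dvd_power dvd_trans)
  \<comment> \<open>L is the excess of m + l over 2m; g and q are the slacks of l < 2m and 3m < 2l.
    Both inequalities are strict, and the factor p gained in this way removes the corresponding
    terms modulo p.\<close>
  define L g q where "L = l - m" and "g = 2 * m - l - 1" and "q = 2 * l - 3 * m - 1"
  have e: "m + l = 2 * m + L" "3 * m = 2 * m + L + 1 + g" "l + L = 2 * m + 1 + q" "l = m + L"
    using m by (simp_all add: L_def g_def q_def)
  define r1 where "r1 = (geo d \<beta> - int d) div int p ^ (l + m)"
  have r1: "geo d \<beta> = int d + int p ^ (l + m) * r1"
    using P.geo_cong[OF pm(2), of l d] m d by (simp add: r1_def)
  define \<kappa> where "\<kappa> = k1 * (d1 + int p ^ m * r1)"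
  have \<kappa>: "\<beta> ^ d - 1 = int p ^ (m + l) * \<kappa>"
  proof -
    have bm: "\<beta> - 1 = int p ^ m * k1" by (simp add: \<beta>_eq)
    have "\<beta> ^ d - 1 = (\<beta> - 1) * geo d \<beta>" by (simp only: geo_times)
    then show ?thesis unfolding bm r1 d \<kappa>_def by (simp add: power_add algebra_simps)
  qed
  obtain v where v: "int p ^ E dvd y1 * v - 1" using P.inverse_mod_power units by blast
  \<comment> \<open>z1 solves y1 z1 = \<kappa> modulo p^E, so that z = p^L z1 satisfies y z =
    \<beta>^d - 1 modulo p^E.\<close>
  define z1 where "z1 = nat ((\<kappa> * v) mod int p ^ E)"
  have p0: "int p ^ E > 0" using P.p_gt_2 by simp
  have z1: "int p ^ E dvd y1 * int z1 - \<kappa>"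
  proof -
    have "int z1 = (\<kappa> * v) mod int p ^ E" using p0 by (simp add: z1_def)
    then have "int z1 = \<kappa> * v + int p ^ E * (- (\<kappa> * v div int p ^ E))"
      by (simp add: minus_mult_div_eq_mod[symmetric])
    then obtain r where r: "int z1 = \<kappa> * v + int p ^ E * r" by blast
    have "y1 * int z1 - \<kappa> = (y1 * v - 1) * \<kappa> + int p ^ E * (y1 * r)" by (simp add: r algebra_simps)
    then show ?thesis using v by (metis dvd_add dvd_mult2 dvd_triv_left)
  qed
  define z where "z = p ^ L * z1"
  have zi: "int z = int p ^ L * int z1" by (simp add: z_def)
  have yz: "B [^] (int y * int z) = B [^] (\<beta> ^ d - 1)"
  proof (rule int_pow_cong[OF B Bp])
    have "int y * int z - (\<beta> ^ d - 1) = int p ^ (m + l) * (y1 * int z1 - \<kappa>)"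
      unfolding \<kappa> y zi e(1) by (simp add: power_add algebra_simps)
    then show "int p ^ E dvd int y * int z - (\<beta> ^ d - 1)" using z1 by simp
  qed
  define \<xi> where "\<xi> = int x - \<alpha> ^ (d * z + 1) * geo x \<alpha> - int x * \<alpha> ^ d * geo z (\<alpha> ^ d)"
  have C\<xi>: "C [^] (int x + int (d * z)) = A [^] \<xi>"
  proof -
    have "C [^] int x \<otimes> (A [^] (\<alpha> * geo x \<alpha>) \<otimes> C [^] int (d * z)) \<otimes> A [^] (int x * \<alpha> ^ d * geo z (\<alpha> ^ d)) = A [^] int x"
      using B_commute unfolding yz[symmetric] rel_pow by (simp add: m_assoc)
    then have "C [^] (int x + int (d * z)) \<otimes> A [^] (\<alpha> * geo x \<alpha> * \<alpha> ^ (d * z) + int x * \<alpha> ^ d * geo z (\<alpha> ^ d))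
        = C [^] (0::int) \<otimes> A [^] int x"
      unfolding A_pow_C by (simp add: m_assoc int_pow_mult)
    from pow_eq_split[OF this[symmetric]] have "C [^] (int x + int (d * z))
        = A [^] (int x - (\<alpha> * geo x \<alpha> * \<alpha> ^ (d * z) + int x * \<alpha> ^ d * geo z (\<alpha> ^ d)))" by simp
    then show ?thesis by (simp add: \<xi>_def algebra_simps)
  qed
  have "\<exists>Q. \<xi> = - (int p ^ (m + l)) * (x1 * int z1 + int p * Q)"
  proof -
    obtain r2 where r2: "geo x \<alpha> = int x + int p ^ (3 * m) * r2"
    proof -
      have "int p ^ (2 * m + m) dvd geo x \<alpha> - int x" using P.geo_cong[OF pm(1), of "2 * m" x] m x by simp
      moreover have "2 * m + m = 3 * m" by simp
      ultimately obtain r where "geo x \<alpha> - int x = int p ^ (3 * m) * r" by (metis dvdE)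
      then show thesis using that[of r] by simp
    qed
    obtain r3 where r3: "\<alpha> ^ (d * z + 1) = 1 + int p ^ m * r3"
    proof -
      obtain r where "\<alpha> ^ (d * z + 1) - 1 = int p ^ m * r" using dvd_power_minus_1[OF pm(1)] by (metis dvdE)
      then show thesis using that[of r] by simp
    qed
    obtain r5 where r5: "\<alpha> ^ d = 1 + int p * r5"
    proof -
      obtain r where "\<alpha> ^ d - 1 = int p * r" using dvd_power_minus_1[OF p1] by (metis dvdE)
      then show thesis using that[of r] by simp
    qed
    obtain r4 where r4: "geo z (\<alpha> ^ d) = int z + int p ^ (L + 1) * r4"
    proof -
      have "int p ^ (L + 1) dvd geo z (\<alpha> ^ d) - int z"
        using P.geo_cong[of 1 "\<alpha> ^ d" L z] dvd_power_minus_1[OF p1] zi by simp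
      then obtain r where "geo z (\<alpha> ^ d) - int z = int p ^ (L + 1) * r" by (metis dvdE)
      then show thesis using that[of r] by simp
    qed
    define T PL Gp M where "T = int p ^ (2 * m)" and "PL = int p ^ L" and "Gp = int p ^ g" and "M = int p ^ m"
    have p3: "int p ^ (3 * m) = T * PL * int p * Gp" unfolding e(2) T_def PL_def Gp_def by (simp add: power_add)
    have MT: "M * T = T * PL * int p * Gp"
    proof -
      have "M * T = int p ^ (m + 2 * m)" unfolding M_def T_def by (simp only: power_add)
      moreover have "m + 2 * m = 3 * m" by simp
      ultimately show ?thesis by (simp only: p3)
    qed
    have pL: "int p ^ (L + 1) = PL * int p" by (simp add: PL_def)
    have pml: "int p ^ (m + l) = T * PL" unfolding e(1) T_def PL_def by (simp add: power_add)
    have "\<xi> = T * x1 - (1 + M * r3) * (T * x1 + T * PL * int p * Gp * r2)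
        - T * x1 * (1 + int p * r5) * (PL * int z1 + PL * int p * r4)"
      unfolding \<xi>_def r2 r3 r4 unfolding r5 zi x p3 pL T_def[symmetric] M_def[symmetric] PL_def[symmetric] by simp
    also have "\<dots> = - (M * T) * (r3 * x1) - (1 + M * r3) * (T * PL * int p * Gp * r2)
        - T * x1 * (1 + int p * r5) * (PL * int z1 + PL * int p * r4)" by (simp add: algebra_simps)
    also have "\<dots> = - (T * PL) * (x1 * int z1 + int p * (Gp * (r3 * x1) + (1 + M * r3) * Gp * r2
        + x1 * (r4 + r5 * (int z1 + int p * r4))))"
      unfolding MT by (simp add: algebra_simps)
    finally show ?thesis unfolding pml by blast
  qed
  then obtain Q where Q: "\<xi> = - (int p ^ (m + l)) * (x1 * int z1 + int p * Q)" by blast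
  \<comment> \<open>d z is divisible by p^(l+L), and l + L = 2l - m exceeds 2m; adding it to x =
    p^(2m) x1 changes the cofactor only by a multiple of p.\<close>
  define x2 where "x2 = x1 + int p * (int p ^ q * (d1 * int z1))"
  have x2: "int x + int (d * z) = int p ^ (2 * m) * x2"
  proof -
    have "int (d * z) = int p ^ (l + L) * (d1 * int z1)" by (simp add: d zi power_add)
    then show ?thesis unfolding e(3) by (simp add: x x2_def power_add algebra_simps)
  qed
  have "\<not> int p dvd x2" using units(1) unfolding x2_def by (simp add: dvd_add_left_iff)
  then obtain u where u: "int p ^ E dvd x2 * u - 1" using P.inverse_mod_power by blast
  define \<theta> where "\<theta> = - (x1 * int z1 + int p * Q) * u"
  have "C [^] (int p ^ (2 * m)) = C [^] (int p ^ (2 * m) * x2 * u)"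
  proof (rule int_pow_cong[OF C Cp])
    have "int p ^ (2 * m) - int p ^ (2 * m) * x2 * u = - (int p ^ (2 * m)) * (x2 * u - 1)"
      by (simp add: algebra_simps)
    then show "int p ^ E dvd int p ^ (2 * m) - int p ^ (2 * m) * x2 * u" using u by (metis dvd_mult)
  qed
  also have "\<dots> = (A [^] \<xi>) [^] u" unfolding C\<xi>[symmetric] x2 by (simp only: int_pow_pow C)
  also have "\<dots> = A [^] (int p ^ (m + l) * \<theta>)"
    unfolding Q by (simp add: int_pow_pow \<theta>_def algebra_simps)
  finally have C\<theta>: "C [^] (int p ^ (2 * m)) = A [^] (int p ^ (m + l) * \<theta>)" .
  have "int p dvd \<theta> * y1 + k1 * d1"
  proof -
    have pE: "int p dvd int p ^ E" using E by simp
    obtain s1 where "x2 * u - 1 = int p * s1" using dvd_trans[OF pE u] by (elim dvdE)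
    then have s1: "x2 * u = 1 + int p * s1" by simp
    obtain s2 where "y1 * int z1 - \<kappa> = int p * s2" using dvd_trans[OF pE z1] by (elim dvdE)
    then have s2: "y1 * int z1 = \<kappa> + int p * s2" by simp
    have "int p dvd int p ^ m" using m(1) by simp
    then obtain M where M: "int p ^ m = int p * M" by (elim dvdE)
    define N where "N = int p ^ q * (d1 * int z1)"
    have x1u: "x1 * u = 1 + int p * (s1 - N * u)" using s1 by (simp add: x2_def N_def algebra_simps)
    have "\<theta> * y1 + k1 * d1 = - (x1 * u) * (y1 * int z1) - int p * (Q * u * y1) + k1 * d1"
      by (simp add: \<theta>_def algebra_simps)
    also have "\<dots> = int p * (- (s1 - N * u) * (\<kappa> + int p * s2) - s2 - k1 * M * r1 - Q * u * y1)"
      unfolding x1u s2 \<kappa>_def M by (simp add: algebra_simps)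
    finally show ?thesis by simp
  qed
  with C\<theta> show ?thesis by blast
qed

text \<open>The mirror image of \<open>C_pow_eq_A_pow\<close> expresses the inverse of C^(p^(2m)) by
  B. Turning that power of B into one of A gives A^(p^(m+l) M) = 1 with M congruent to -(h1 + k1)
  d1, that is, to -2 h1 d1 modulo p, a unit.\<close>

lemma A_pow_C_pow_trivial:
  "A [^] (int p ^ (m + l)) = \<one>" "C [^] (int p ^ (2 * m)) = \<one>"
proof -
  interpret P: odd_prime p by (rule odd_prime)
  have rel_sw: "A [^] int x = B [^] int y \<otimes> inv C [^] int d"
    unfolding rel by (simp add: m_assoc int_pow_inv)
  obtain \<theta> where \<theta>: "C [^] (int p ^ (2 * m)) = A [^] (int p ^ (m + l) * \<theta>)" "int p dvd \<theta> * y1 + k1 * d1"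
    using C_pow_eq_A_pow by blast
  obtain \<theta>' where \<theta>': "inv C [^] (int p ^ (2 * m)) = B [^] (int p ^ (m + l) * \<theta>')" "int p dvd \<theta>' * x1 + h1 * d1"
    using macd_p.C_pow_eq_A_pow[OF swap_p y x d units(2,1,3) rel_sw] by blast
  define L q where "L = l - m" and "q = 2 * l - 3 * m - 1"
  have e: "m + l = 2 * m + L" "l + L = 2 * m + 1 + q" using m by (simp_all add: L_def q_def)
  have pm: "int p dvd \<alpha> - 1" using m by (simp add: \<alpha>_eq)
  obtain r1 where r1: "\<alpha> ^ d = 1 + int p * r1"
  proof -
    obtain r where "\<alpha> ^ d - 1 = int p * r" using dvd_power_minus_1[OF pm, of d] by (elim dvdE)
    then show thesis using that[of r] by simp
  qed
  obtain r2 where r2: "geo (p ^ L) (\<alpha> ^ d) = int p ^ L + int p ^ (L + 1) * r2"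
  proof -
    have "int p ^ (L + 1) dvd geo (p ^ L) (\<alpha> ^ d) - int (p ^ L)"
      using P.geo_cong[of 1 "\<alpha> ^ d" L "p ^ L"] dvd_power_minus_1[OF pm] by simp
    then obtain r where "geo (p ^ L) (\<alpha> ^ d) - int (p ^ L) = int p ^ (L + 1) * r" by (elim dvdE)
    then show thesis using that[of r] by simp
  qed
  define r3 where "r3 = r1 + r2 + int p * r1 * r2"
  \<comment> \<open>Modulo p only x1 survives in \<eta>: the contribution of C^(d p^L) carries an
    extra p because l + L > 2m.\<close>
  define \<eta> where "\<eta> = x1 + int p * (x1 * r3 + int p ^ q * d1 * \<theta>)"
  have "B [^] (int y * int (p ^ L)) = A [^] (int p ^ (m + l) * \<eta>)"
  proof -
    have "int (d * p ^ L) = int p ^ (l + L) * d1" by (simp add: d power_add)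
    then have "int (d * p ^ L) = int p ^ (2 * m) * (int p * (int p ^ q * d1))"
      unfolding e(2) by (simp add: power_add)
    then have "C [^] int (d * p ^ L) = (C [^] (int p ^ (2 * m))) [^] (int p * (int p ^ q * d1))"
      by (simp only: int_pow_pow C)
    then have 1: "C [^] int (d * p ^ L) = A [^] (int p ^ (m + l) * \<theta> * (int p * (int p ^ q * d1)))"
      by (simp only: \<theta>(1) int_pow_pow A)
    have 2: "int x * \<alpha> ^ d * geo (p ^ L) (\<alpha> ^ d) = int p ^ (m + l) * (x1 * (1 + int p * r3))"
      unfolding x r2 unfolding r1 e(1) r3_def by (simp add: power_add algebra_simps)
    show ?thesis unfolding rel_pow 1 2 by (simp add: int_pow_mult[symmetric] \<eta>_def algebra_simps)
  qed
  moreover have "int y * int (p ^ L) = int p ^ (m + l) * y1" unfolding e(1) by (simp add: y power_add)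
  ultimately have B\<eta>: "B [^] (int p ^ (m + l) * y1) = A [^] (int p ^ (m + l) * \<eta>)" by simp
  have "(B [^] (int p ^ (m + l) * y1)) [^] \<theta>' = (inv C [^] (int p ^ (2 * m))) [^] y1"
    unfolding \<theta>'(1) by (simp add: int_pow_pow algebra_simps)
  also have "\<dots> = inv (C [^] (int p ^ (2 * m))) [^] y1" by (simp add: int_pow_inv)
  also have "\<dots> = A [^] (- (int p ^ (m + l) * \<theta> * y1))"
    unfolding \<theta>(1) by (simp add: int_pow_inv int_pow_neg int_pow_pow)
  finally have "A [^] (int p ^ (m + l) * \<eta> * \<theta>') = A [^] (- (int p ^ (m + l) * \<theta> * y1))"
    unfolding B\<eta> by (simp add: int_pow_pow)
  then have "A [^] (int p ^ (m + l) * \<eta> * \<theta>') \<otimes> A [^] (int p ^ (m + l) * \<theta> * y1) = \<one>"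
    by (simp add: int_pow_mult[symmetric])
  then have "A [^] (int p ^ (m + l) * (\<eta> * \<theta>' + \<theta> * y1)) = \<one>"
    by (simp add: int_pow_mult[symmetric] algebra_simps)
  moreover have "\<not> int p dvd \<eta> * \<theta>' + \<theta> * y1"
  proof
    assume "int p dvd \<eta> * \<theta>' + \<theta> * y1"
    moreover have "int p dvd (\<theta>' * x1 + h1 * d1) + (\<theta> * y1 + k1 * d1)
        + int p * ((x1 * r3 + int p ^ q * d1 * \<theta>) * \<theta>') + (h1 - k1) * d1"
      by (intro dvd_add[OF dvd_add[OF dvd_add[OF \<theta>'(2) \<theta>(2)]]] dvd_mult2[OF h1k1(3)]) simp
    ultimately have "int p dvd (\<theta>' * x1 + h1 * d1) + (\<theta> * y1 + k1 * d1)
        + int p * ((x1 * r3 + int p ^ q * d1 * \<theta>) * \<theta>') + (h1 - k1) * d1 - (\<eta> * \<theta>' + \<theta> * y1)"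
      using dvd_diff by blast
    also have "\<dots> = 2 * h1 * d1" by (simp add: \<eta>_def algebra_simps)
    finally have "int p dvd 2 * h1 * d1" .
    moreover have "\<not> int p dvd 2" using P.p_gt_2 zdvd_imp_le[of "int p" 2] by auto
    ultimately show False using h1k1(1) units(3) P.prime_int_p by (simp add: prime_dvd_mult_iff)
  qed
  ultimately show *: "A [^] (int p ^ (m + l)) = \<one>"
    using int_pow_one_of_unit[OF odd_prime A Ap] by blast
  show "C [^] (int p ^ (2 * m)) = \<one>" unfolding \<theta>(1) using * by (metis A int_pow_one int_pow_pow)
qed

lemma B_pow_in_AC_prod:
  assumes "ord A > 0" "ord B > 0"
  shows "B [^] (int p ^ (2 * m)) \<in> AC_prod"
proof -
  interpret P: odd_prime p by (rule odd_prime)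
  obtain v where v: "int p ^ E dvd y1 * v - 1" using P.inverse_mod_power units by blast
  have "int p ^ E dvd int p ^ (2 * m) * (y1 * v - 1)" using v by simp
  then have "int p ^ E dvd int y * v - int p ^ (2 * m)" by (simp add: y algebra_simps)
  then have "B [^] (int y * v) = B [^] (int p ^ (2 * m))" by (rule int_pow_cong[OF B Bp])
  then have "B [^] (int p ^ (2 * m)) = (A [^] int x \<otimes> C [^] int d) [^] v"
    unfolding rel[symmetric] by (simp add: int_pow_pow)
  moreover have "A [^] int x \<otimes> C [^] int d \<in> AC_prod" unfolding AC_prod_def by blast
  ultimately show ?thesis using subgroup_int_pow_closed[OF AC_prod_subgroup[OF assms]] by simp
qed

end

text \<open>\<open>key_relation\<close> for k = 1 becomes B^y = A^x C^d once C^(1+\<alpha>) is moved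
  past A, which multiplies the exponent of A by the inverse v of the unit \<alpha>^(1+\<alpha>). The
  relation then bounds the contributions of the three factors of <A><C><B>.\<close>

theorem p_group_bound:
  assumes pos: "\<alpha> > 1" "\<beta> > 1" and big: "3 * m < E"
    and dl: "int p ^ l dvd \<alpha> - \<beta>" "\<not> int p ^ (l + 1) dvd \<alpha> - \<beta>"
    and p3: "p > 3 \<or> (p = 3 \<and> \<not> [\<alpha> = 7] (mod 9) \<and> \<not> [\<beta> = 7] (mod 9))"
  shows "finite (generate G {A, B})" "card (generate G {A, B}) dvd p ^ (5 * m + l)"
proof -
  interpret P: odd_prime p by (rule odd_prime)
  define x0 where "x0 = \<alpha> * geo (nat \<alpha>) \<alpha> - \<alpha> * \<alpha> ^ nat \<alpha>"
  define y0 where "y0 = \<beta> * \<beta> ^ nat \<beta> - \<beta> * geo (nat \<beta>) \<beta>"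
  have v\<alpha>: "int p ^ m dvd \<alpha> - 1" "\<not> int p ^ (m + 1) dvd \<alpha> - 1"
    and v\<beta>: "int p ^ m dvd \<beta> - 1" "\<not> int p ^ (m + 1) dvd \<beta> - 1"
    using h1k1 P.p_gt_2 by (auto simp: \<alpha>_eq \<beta>_eq)
  have x0: "int p ^ (2 * m) dvd x0" "\<not> int p ^ (2 * m + 1) dvd x0"
    using P.relation_exponent_multiplicity[OF pos(1) _ v\<alpha>] m p3 by (auto simp: x0_def)
  have y0: "int p ^ (2 * m) dvd y0" "\<not> int p ^ (2 * m + 1) dvd y0"
    using P.relation_exponent_multiplicity[OF pos(2) _ v\<beta>] m p3 unfolding y0_def
    by (auto simp: dvd_diff_commute[of _ "\<beta> * \<beta> ^ nat \<beta>"])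
  have key: "C [^] int (1 + nat \<alpha>) \<otimes> A [^] x0 = B [^] y0 \<otimes> C [^] int (1 + nat \<beta>)"
    using key_relation[of "nat \<alpha>" 1 "nat \<beta>"] pos by (simp add: x0_def y0_def)
  have np: "\<not> int p dvd \<alpha> ^ (1 + nat \<alpha>)"
  proof
    assume "int p dvd \<alpha> ^ (1 + nat \<alpha>)"
    then have "int p dvd \<alpha>" using P.prime_int_p prime_dvd_power by blast
    moreover have "int p dvd \<alpha> - 1" using m by (simp add: \<alpha>_eq)
    ultimately have "int p dvd \<alpha> - (\<alpha> - 1)" by (rule dvd_diff)
    then show False using P.p_gt_2 by simp
  qed
  obtain v where v: "int p ^ E dvd \<alpha> ^ (1 + nat \<alpha>) * v - 1" using P.inverse_mod_power[OF np] by blast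
  have "0 < E" using big by simp
  then have "int p dvd int p ^ E" by simp
  from dvd_trans[OF this v] have pv: "int p dvd \<alpha> ^ (1 + nat \<alpha>) * v - 1" .
  have nv: "\<not> int p dvd v"
  proof
    assume "int p dvd v"
    then have "int p dvd \<alpha> ^ (1 + nat \<alpha>) * v" by simp
    from dvd_diff[OF this pv] have "int p dvd 1" by simp
    then show False using P.p_gt_2 by simp
  qed
  have x0': "int p ^ (2 * m) dvd x0 * v" "\<not> int p ^ (2 * m + 1) dvd x0 * v"
  proof -
    show "int p ^ (2 * m) dvd x0 * v" using x0 by simp
    have "coprime (int p) v" using P.prime_int_p nv by (rule prime_imp_coprime)
    then have "coprime (int p ^ (2 * m + 1)) v" by simp
    then show "\<not> int p ^ (2 * m + 1) dvd x0 * v" using x0 by (simp add: coprime_dvd_mult_left_iff)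
  qed
  have e: "2 * m < E" "l < E" using big m by simp_all
  obtain x x1 where x: "int x = int p ^ (2 * m) * x1" "\<not> int p dvd x1" "int p ^ E dvd int x - x0 * v"
    using P.reduced_exponent[OF x0' e(1)] by blast
  obtain y y1 where y: "int y = int p ^ (2 * m) * y1" "\<not> int p dvd y1" "int p ^ E dvd int y - y0"
    using P.reduced_exponent[OF y0 e(1)] by blast
  obtain d d1 where d: "int d = int p ^ l * d1" "\<not> int p dvd d1" "int p ^ E dvd int d - (\<alpha> - \<beta>)"
    using P.reduced_exponent[OF dl e(2)] by blast
  have rel: "B [^] int y = A [^] int x \<otimes> C [^] int d"
  proof -
    have x0v: "A [^] (x0 * v) \<otimes> C [^] int (1 + nat \<alpha>) = C [^] int (1 + nat \<alpha>) \<otimes> A [^] x0"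
    proof -
      have "int p ^ E dvd x0 * (\<alpha> ^ (1 + nat \<alpha>) * v - 1)" using v by simp
      then have "int p ^ E dvd x0 * v * \<alpha> ^ (1 + nat \<alpha>) - x0" by (simp add: algebra_simps)
      then have "A [^] (x0 * v * \<alpha> ^ (1 + nat \<alpha>)) = A [^] x0" by (rule int_pow_cong[OF A Ap])
      then show ?thesis unfolding A_pow_C by simp
    qed
    have "B [^] y0 \<otimes> C [^] int (1 + nat \<beta>) \<otimes> C [^] (- int (1 + nat \<beta>))
        = A [^] (x0 * v) \<otimes> C [^] int (1 + nat \<alpha>) \<otimes> C [^] (- int (1 + nat \<beta>))"
      by (simp only: x0v key)
    then have "B [^] y0 = A [^] (x0 * v) \<otimes> C [^] (int (1 + nat \<alpha>) + - int (1 + nat \<beta>))"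
      by (simp only: m_assoc int_pow_mult[symmetric] A B C int_pow_closed) simp
    moreover have "int (1 + nat \<alpha>) + - int (1 + nat \<beta>) = \<alpha> - \<beta>" using pos by simp
    ultimately have "B [^] y0 = A [^] (x0 * v) \<otimes> C [^] (\<alpha> - \<beta>)" by (simp only:)
    then show ?thesis
      using int_pow_cong[OF A Ap x(3)] int_pow_cong[OF B Bp y(3)] int_pow_cong[OF C Cp d(3)] by (simp only:)
  qed
  note ctx = x(1) y(1) d(1) x(2) y(2) d(2) rel
  have A1: "A [^] int (p ^ (m + l)) = \<one>" using A_pow_C_pow_trivial(1)[OF ctx] by simp
  have C1: "C [^] int (p ^ (2 * m)) = A [^] (0::int)" using A_pow_C_pow_trivial(2)[OF ctx] by simp
  have pp: "p ^ k > 0" for k using P.p_gt_2 by simp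
  have dA: "int (ord A) dvd int (p ^ (m + l))" using A1 by (simp only: int_pow_eq_id A)
  then have oA: "ord A dvd p ^ (m + l)" by (simp only: int_dvd_int_iff)
  then have A0: "ord A > 0" using pp by (metis dvd_0_left_iff gr0I less_numeral_extra(3))
  have "int (ord B) dvd int (p ^ E)" using Bp by (simp add: int_pow_eq_id)
  then have B0: "ord B > 0" using pp by (metis dvd_0_left_iff gr0I less_numeral_extra(3) int_dvd_int_iff)
  have B1: "B [^] int (p ^ (2 * m)) \<in> AC_prod" using B_pow_in_AC_prod[OF ctx A0 B0] by simp
  show "finite (generate G {A, B})" using card_generate_AB(1)[OF A0 B0 pp C1 pp B1] .
  have "card (generate G {A, B}) dvd ord A * p ^ (2 * m) * p ^ (2 * m)"
    using card_generate_AB(2)[OF A0 B0 pp C1 pp B1] .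
  also have "\<dots> dvd p ^ (m + l) * p ^ (2 * m) * p ^ (2 * m)" using oA by (intro mult_dvd_mono) auto
  also have "\<dots> = p ^ (5 * m + l)" by (simp add: power_add[symmetric] algebra_simps)
  finally show "card (generate G {A, B}) dvd p ^ (5 * m + l)" .
qed

end

section \<open>Cyclic extensions\<close>

definition cext :: "('a, 'b) monoid_scheme \<Rightarrow> ('a \<Rightarrow> 'a) \<Rightarrow> nat \<Rightarrow> 'a \<Rightarrow> (nat \<times> 'a) monoid" where
  "cext N \<sigma> n t =
    \<lparr> carrier = {..<n} \<times> carrier N,
      monoid.mult = (\<lambda>u v. ((fst u + fst v) mod n,
        t [^]\<^bsub>N\<^esub> ((fst u + fst v) div n) \<otimes>\<^bsub>N\<^esub> ((\<sigma> ^^ fst v) (snd u) \<otimes>\<^bsub>N\<^esub> snd v))),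
      one = (0, \<one>\<^bsub>N\<^esub>) \<rparr>"

text \<open>The pair (i, x) stands for s^i x, where s is a new element with s^n = t
  that acts on N by conjugation as \<sigma>.\<close>
locale cyclic_extension = N: group N for N (structure) +
  fixes \<sigma> :: "'a \<Rightarrow> 'a" and n :: nat and t :: 'a
  assumes \<sigma>: "\<sigma> \<in> hom N N" and n: "n > 1" and t [simp]: "t \<in> carrier N" and \<sigma>t: "\<sigma> t = t"
    and \<sigma>n: "\<And>x. x \<in> carrier N \<Longrightarrow> t \<otimes> (\<sigma> ^^ n) x = x \<otimes> t"
begin

abbreviation "E \<equiv> cext N \<sigma> n t"
definition "s = (1::nat, \<one>)"
definition emb :: "'a \<Rightarrow> nat \<times> 'a" where "emb x = (0, x)"

lemma \<sigma>_pow_hom: "\<sigma> ^^ j \<in> hom N N"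
proof (induction j)
  case 0 show ?case by (simp add: hom_def)
next
  case (Suc j)
  have "\<sigma> \<circ> (\<sigma> ^^ j) \<in> hom N N" by (rule Group.hom_compose[OF Suc \<sigma>])
  then show ?case by (simp only: funpow.simps)
qed

lemma \<sigma>_pow_closed [simp]: "x \<in> carrier N \<Longrightarrow> (\<sigma> ^^ j) x \<in> carrier N"
  using hom_in_carrier[OF \<sigma>_pow_hom] .

lemma \<sigma>_pow_mult: "x \<in> carrier N \<Longrightarrow> y \<in> carrier N \<Longrightarrow> (\<sigma> ^^ j) (x \<otimes> y) = (\<sigma> ^^ j) x \<otimes> (\<sigma> ^^ j) y"
  using hom_mult[OF \<sigma>_pow_hom] .

lemma \<sigma>_pow_one [simp]: "(\<sigma> ^^ j) \<one> = \<one>"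
  using hom_one[OF \<sigma>_pow_hom N.group_axioms N.group_axioms] .

lemma \<sigma>_one [simp]: "\<sigma> \<one> = \<one>"
  using \<sigma>_pow_one[of 1] by simp

lemma \<sigma>_pow_t [simp]: "(\<sigma> ^^ j) t = t"
  by (induction j) (simp_all add: \<sigma>t)

lemma \<sigma>_pow_t_pow [simp]: "(\<sigma> ^^ j) (t [^] (k::nat)) = t [^] k"
  by (induction k) (simp_all add: \<sigma>_pow_mult)

text \<open>Iterates \<open>\<sigma>n\<close>: the exponent n q of \<sigma> is traded for moving t^q
  across x. Associativity uses this to move a carry.\<close>

lemma \<sigma>_pow_multiple: "x \<in> carrier N \<Longrightarrow> t [^] q \<otimes> (\<sigma> ^^ (n * q)) x = x \<otimes> t [^] q"
proof (induction q arbitrary: x)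
  case (Suc q)
  have "(\<sigma> ^^ (n * Suc q)) x = (\<sigma> ^^ (n * q)) ((\<sigma> ^^ n) x)"
  proof -
    have "n * Suc q = n * q + n" by simp
    then show ?thesis by (simp only: funpow_add comp_apply)
  qed
  then have "t [^] Suc q \<otimes> (\<sigma> ^^ (n * Suc q)) x = t \<otimes> (t [^] q \<otimes> (\<sigma> ^^ (n * q)) ((\<sigma> ^^ n) x))"
    using Suc.prems by (simp add: N.nat_pow_Suc2 N.m_assoc del: N.nat_pow_Suc nat_pow_Suc)
  also have "\<dots> = (t \<otimes> (\<sigma> ^^ n) x) \<otimes> t [^] q" using Suc by (simp add: N.m_assoc)
  also have "\<dots> = x \<otimes> t [^] Suc q"
    using Suc.prems by (simp add: \<sigma>n N.nat_pow_Suc2 N.m_assoc del: N.nat_pow_Suc nat_pow_Suc)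
  finally show ?case .
qed simp

lemma E_simps: "carrier E = {..<n} \<times> carrier N" "\<one>\<^bsub>E\<^esub> = (0, \<one>)"
  "(i, x) \<otimes>\<^bsub>E\<^esub> (j, y) = ((i + j) mod n, t [^] ((i + j) div n) \<otimes> ((\<sigma> ^^ j) x \<otimes> y))"
  by (simp_all add: cext_def)

text \<open>Both bracketings collect the same total number of carries. They differ in whether the
  carry t^q' of j + k stands before or after the twisted x, and \<open>tw\<close> reconciles the
  two.\<close>

lemma E_assoc:
  assumes "x \<in> carrier N" "y \<in> carrier N" "z \<in> carrier N"
  shows "((i, x) \<otimes>\<^bsub>E\<^esub> (j, y)) \<otimes>\<^bsub>E\<^esub> (k, z) = (i, x) \<otimes>\<^bsub>E\<^esub> ((j, y) \<otimes>\<^bsub>E\<^esub> (k, z))"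
proof -
  define q r where "q = (i + j) div n" and "r = (i + j) mod n"
  define q' r' where "q' = (j + k) div n" and "r' = (j + k) mod n"
  have jk: "j + k = r' + n * q'" by (simp add: q'_def r'_def)
  have mods: "(r + k) mod n = (i + r') mod n" by (simp add: r_def r'_def mod_add_left_eq mod_add_right_eq add.assoc)
  have divs: "(r + k) div n + q = (i + r') div n + q'"
  proof -
    have "(r + k) div n + q = (r + k + n * q) div n" using n by simp
    also have "r + k + n * q = i + j + k" by (simp add: r_def q_def)
    also have "\<dots> = i + r' + n * q'" using jk by simp
    also have "\<dots> div n = (i + r') div n + q'" using n by simp
    finally show ?thesis .
  qed
  have tw: "t [^] q' \<otimes> (\<sigma> ^^ (k + j)) x = (\<sigma> ^^ r') x \<otimes> t [^] q'"
  proof -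
    have "k + j = r' + n * q'" using jk by simp
    then have "(\<sigma> ^^ (k + j)) x = (\<sigma> ^^ r') ((\<sigma> ^^ (n * q')) x)" by (simp only: funpow_add comp_apply)
    then have "t [^] q' \<otimes> (\<sigma> ^^ (k + j)) x = (\<sigma> ^^ r') (t [^] q' \<otimes> (\<sigma> ^^ (n * q')) x)"
      using assms by (simp add: \<sigma>_pow_mult)
    also have "\<dots> = (\<sigma> ^^ r') x \<otimes> t [^] q'" using assms by (simp add: \<sigma>_pow_multiple \<sigma>_pow_mult)
    finally show ?thesis .
  qed
  have "t [^] ((r + k) div n) \<otimes> ((\<sigma> ^^ k) (t [^] q \<otimes> ((\<sigma> ^^ j) x \<otimes> y)) \<otimes> z)
      = t [^] ((r + k) div n) \<otimes> t [^] q \<otimes> ((\<sigma> ^^ (k + j)) x \<otimes> ((\<sigma> ^^ k) y \<otimes> z))"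
    using assms by (simp add: \<sigma>_pow_mult N.m_assoc funpow_add)
  also have "\<dots> = t [^] ((i + r') div n) \<otimes> t [^] q' \<otimes> ((\<sigma> ^^ (k + j)) x \<otimes> ((\<sigma> ^^ k) y \<otimes> z))"
    by (simp add: N.nat_pow_mult divs)
  also have "\<dots> = t [^] ((i + r') div n) \<otimes> ((t [^] q' \<otimes> (\<sigma> ^^ (k + j)) x) \<otimes> ((\<sigma> ^^ k) y \<otimes> z))"
    using assms by (simp add: N.m_assoc)
  also have "\<dots> = t [^] ((i + r') div n) \<otimes> ((\<sigma> ^^ r') x \<otimes> (t [^] q' \<otimes> ((\<sigma> ^^ k) y \<otimes> z)))"
    unfolding tw using assms by (simp add: N.m_assoc)
  finally show ?thesis
    by (simp add: E_simps q_def[symmetric] r_def[symmetric] q'_def[symmetric] r'_def[symmetric] mods)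
qed

lemma group_E: "group E"
proof (rule groupI)
  show "\<one>\<^bsub>E\<^esub> \<in> carrier E" using n by (simp add: E_simps)
  fix u assume u: "u \<in> carrier E"
  obtain i x where ix: "u = (i, x)" "i < n" "x \<in> carrier N" using u by (auto simp: E_simps)
  show "\<one>\<^bsub>E\<^esub> \<otimes>\<^bsub>E\<^esub> u = u" using ix by (simp add: E_simps)
  show "\<exists>v\<in>carrier E. v \<otimes>\<^bsub>E\<^esub> u = \<one>\<^bsub>E\<^esub>"
  proof (cases "i = 0")
    case True
    then have "(0, inv x) \<otimes>\<^bsub>E\<^esub> u = \<one>\<^bsub>E\<^esub>" "(0, inv x) \<in> carrier E" using ix n by (simp_all add: E_simps)
    then show ?thesis by blast
  next
    case False
    \<comment> \<open>A left inverse of s^i x with i > 0 starts with s^(n-i); the product carries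
      exactly once, and the factor \<open>inv t\<close> cancels this t.\<close>
    define y where "y = (\<sigma> ^^ (n - i)) (inv x \<otimes> inv t)"
    have y: "y \<in> carrier N" using ix by (simp add: y_def)
    have "(\<sigma> ^^ i) y = (\<sigma> ^^ n) (inv x \<otimes> inv t)"
    proof -
      have "(\<sigma> ^^ i) y = (\<sigma> ^^ (i + (n - i))) (inv x \<otimes> inv t)" by (simp only: y_def funpow_add comp_apply)
      then show ?thesis using ix(2) by simp
    qed
    then have "t \<otimes> (\<sigma> ^^ i) y = inv x \<otimes> inv t \<otimes> t" using \<sigma>n ix by simp
    then have "t \<otimes> ((\<sigma> ^^ i) y \<otimes> x) = \<one>" using ix y by (simp add: N.m_assoc[symmetric]) (simp add: N.m_assoc)
    then have "(n - i, y) \<otimes>\<^bsub>E\<^esub> u = \<one>\<^bsub>E\<^esub>" using ix n y by (simp add: E_simps)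
    moreover have "(n - i, y) \<in> carrier E" using False ix y by (simp add: E_simps)
    ultimately show ?thesis by blast
  qed
  fix v assume v: "v \<in> carrier E"
  obtain j y where jy: "v = (j, y)" "y \<in> carrier N" using v by (auto simp: E_simps)
  show "u \<otimes>\<^bsub>E\<^esub> v \<in> carrier E" using ix jy n by (simp add: E_simps)
  fix w assume w: "w \<in> carrier E"
  then obtain k z where "w = (k, z)" "z \<in> carrier N" by (auto simp: E_simps)
  then show "u \<otimes>\<^bsub>E\<^esub> v \<otimes>\<^bsub>E\<^esub> w = u \<otimes>\<^bsub>E\<^esub> (v \<otimes>\<^bsub>E\<^esub> w)" using E_assoc ix jy by simp
qed

sublocale E: group E by (rule group_E)

lemma emb_hom: "emb \<in> hom N E"
  using n by (auto simp: hom_def emb_def E_simps)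

sublocale emb: group_hom N E emb
  by unfold_locales (rule emb_hom)

lemma s_closed [simp]: "s \<in> carrier E" using n by (simp add: s_def E_simps)

lemma emb_s: "x \<in> carrier N \<Longrightarrow> emb x \<otimes>\<^bsub>E\<^esub> s = s \<otimes>\<^bsub>E\<^esub> emb (\<sigma> x)"
  using n hom_in_carrier[OF \<sigma>] by (simp add: s_def emb_def E_simps)

lemma s_pow: "k < n \<Longrightarrow> s [^]\<^bsub>E\<^esub> k = (k, \<one>)"
proof (induction k)
  case 0 then show ?case by (simp add: E_simps)
next
  case (Suc k)
  then have "s [^]\<^bsub>E\<^esub> Suc k = (k, \<one>) \<otimes>\<^bsub>E\<^esub> s" by simp
  also have "\<dots> = (Suc k, \<one>)" using Suc.prems by (simp add: s_def E_simps)
  finally show ?case .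
qed

lemma s_pow_n: "s [^]\<^bsub>E\<^esub> n = emb t"
proof -
  obtain k where k: "Suc k = n" using n by (metis less_imp_Suc_add)
  have "s [^]\<^bsub>E\<^esub> Suc k = s [^]\<^bsub>E\<^esub> k \<otimes>\<^bsub>E\<^esub> s" by simp
  also have "s [^]\<^bsub>E\<^esub> k = (k, \<one>)" using k by (intro s_pow) simp
  also have "(k, \<one>) \<otimes>\<^bsub>E\<^esub> s = emb t" using n by (simp add: s_def emb_def E_simps k)
  finally show ?thesis by (simp only: k)
qed

lemma E_elem: "x \<in> carrier N \<Longrightarrow> i < n \<Longrightarrow> (i, x) = s [^]\<^bsub>E\<^esub> i \<otimes>\<^bsub>E\<^esub> emb x"
  using s_pow[of i] by (simp add: emb_def E_simps)

lemma E_cases: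
  assumes "u \<in> carrier E"
  obtains i :: nat and x where "x \<in> carrier N" "u = s [^]\<^bsub>E\<^esub> i \<otimes>\<^bsub>E\<^esub> emb x"
proof -
  obtain i x where "u = (i, x)" "i < n" "x \<in> carrier N" using assms by (auto simp: E_simps)
  then show thesis using that[of x i] E_elem[of x i] by simp
qed

lemma card_E: "card (carrier E) = n * card (carrier N)"
  by (simp add: E_simps card_cartesian_product)

text \<open>Universal property of the extension: a homomorphism on N extends as soon as some s' acts
  on its image as s does on N and has the right n-th power. The actions of d and b on the layers of
  the model are obtained from it.\<close>

lemma hom_extension:
  assumes K: "group K" and f: "f \<in> hom N K" and s': "s' \<in> carrier K"
    and fs: "\<And>x. x \<in> carrier N \<Longrightarrow> f x \<otimes>\<^bsub>K\<^esub> s' = s' \<otimes>\<^bsub>K\<^esub> f (\<sigma> x)" and st: "s' [^]\<^bsub>K\<^esub> n = f t"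
  obtains F where "F \<in> hom E K" "\<And>x. x \<in> carrier N \<Longrightarrow> F (emb x) = f x" "F s = s'"
proof -
  interpret K: group K by (rule K)
  interpret f: group_hom N K f using f by unfold_locales
  define F where "F = (\<lambda>u :: nat \<times> 'a. s' [^]\<^bsub>K\<^esub> fst u \<otimes>\<^bsub>K\<^esub> f (snd u))"
  have fsj: "f x \<otimes>\<^bsub>K\<^esub> s' [^]\<^bsub>K\<^esub> j = s' [^]\<^bsub>K\<^esub> j \<otimes>\<^bsub>K\<^esub> f ((\<sigma> ^^ j) x)" if "x \<in> carrier N" for x j
  proof (induction j)
    case 0 then show ?case using that by simp
  next
    case (Suc j)
    have "f x \<otimes>\<^bsub>K\<^esub> s' [^]\<^bsub>K\<^esub> Suc j = (f x \<otimes>\<^bsub>K\<^esub> s' [^]\<^bsub>K\<^esub> j) \<otimes>\<^bsub>K\<^esub> s'" using that s' by (simp add: K.m_assoc)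
    also have "\<dots> = s' [^]\<^bsub>K\<^esub> j \<otimes>\<^bsub>K\<^esub> (f ((\<sigma> ^^ j) x) \<otimes>\<^bsub>K\<^esub> s')" using that s' Suc by (simp add: K.m_assoc)
    also have "\<dots> = s' [^]\<^bsub>K\<^esub> j \<otimes>\<^bsub>K\<^esub> (s' \<otimes>\<^bsub>K\<^esub> f (\<sigma> ((\<sigma> ^^ j) x)))" using that fs by simp
    also have "\<dots> = s' [^]\<^bsub>K\<^esub> Suc j \<otimes>\<^bsub>K\<^esub> f ((\<sigma> ^^ Suc j) x)"
      using that s' hom_in_carrier[OF \<sigma>] by (simp add: K.m_assoc)
    finally show ?case .
  qed
  have "F \<in> hom E K"
  proof (rule homI)
    fix u assume u: "u \<in> carrier E"
    then obtain i x where ix: "u = (i, x)" "x \<in> carrier N" by (auto simp: E_simps)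
    then show "F u \<in> carrier K" using s' by (simp add: F_def)
    fix v assume v: "v \<in> carrier E"
    then obtain j y where jy: "v = (j, y)" "y \<in> carrier N" by (auto simp: E_simps)
    have ft: "f (t [^] q) = s' [^]\<^bsub>K\<^esub> (n * q)" for q :: nat
      using s' st by (simp add: f.hom_nat_pow K.nat_pow_pow[symmetric])
    have "F (u \<otimes>\<^bsub>E\<^esub> v) = s' [^]\<^bsub>K\<^esub> ((i + j) mod n) \<otimes>\<^bsub>K\<^esub> (s' [^]\<^bsub>K\<^esub> (n * ((i + j) div n)) \<otimes>\<^bsub>K\<^esub> (f ((\<sigma> ^^ j) x) \<otimes>\<^bsub>K\<^esub> f y))"
      using ix jy by (simp add: F_def E_simps ft)
    also have "\<dots> = (s' [^]\<^bsub>K\<^esub> ((i + j) mod n) \<otimes>\<^bsub>K\<^esub> s' [^]\<^bsub>K\<^esub> (n * ((i + j) div n))) \<otimes>\<^bsub>K\<^esub> (f ((\<sigma> ^^ j) x) \<otimes>\<^bsub>K\<^esub> f y)"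
      using ix jy s' by (simp add: K.m_assoc)
    also have "s' [^]\<^bsub>K\<^esub> ((i + j) mod n) \<otimes>\<^bsub>K\<^esub> s' [^]\<^bsub>K\<^esub> (n * ((i + j) div n)) = s' [^]\<^bsub>K\<^esub> i \<otimes>\<^bsub>K\<^esub> s' [^]\<^bsub>K\<^esub> j"
      using s' by (simp add: K.nat_pow_mult)
    also have "s' [^]\<^bsub>K\<^esub> i \<otimes>\<^bsub>K\<^esub> s' [^]\<^bsub>K\<^esub> j \<otimes>\<^bsub>K\<^esub> (f ((\<sigma> ^^ j) x) \<otimes>\<^bsub>K\<^esub> f y)
        = s' [^]\<^bsub>K\<^esub> i \<otimes>\<^bsub>K\<^esub> ((s' [^]\<^bsub>K\<^esub> j \<otimes>\<^bsub>K\<^esub> f ((\<sigma> ^^ j) x)) \<otimes>\<^bsub>K\<^esub> f y)"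
      using ix jy s' by (simp add: K.m_assoc)
    also have "\<dots> = F u \<otimes>\<^bsub>K\<^esub> F v"
      unfolding fsj[OF ix(2), symmetric] using ix jy s' by (simp add: F_def K.m_assoc)
    finally show "F (u \<otimes>\<^bsub>E\<^esub> v) = F u \<otimes>\<^bsub>K\<^esub> F v" .
  qed
  moreover have "F (emb x) = f x" if "x \<in> carrier N" for x using that by (simp add: F_def emb_def)
  moreover have "F s = s'" using s' by (simp add: F_def s_def)
  ultimately show thesis using that by blast
qed

end

text \<open>The mirror image of \<open>twist\<close> and \<open>twist_pow_gen\<close>, with powers
  of x collected on the left; this is the form in which c meets d.\<close>

lemma (in group) twist_left_pow:
  assumes yx: "y \<otimes> x = x [^] (k::int) \<otimes> y" and x: "x \<in> carrier G" and y: "y \<in> carrier G"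
  shows "y [^] int j \<otimes> x [^] (i::int) = x [^] (i * k ^ j) \<otimes> y [^] int j"
    and "(x [^] (i::int) \<otimes> y) [^] int n = x [^] (i * geo n k) \<otimes> y [^] int n"
proof -
  have 1: "y \<otimes> x [^] i = x [^] (i * k) \<otimes> y" for i :: int
    using conj_int_pow[OF yx[symmetric], of i] x y by (simp add: int_pow_pow mult.commute)
  have step: "y [^] int (Suc j) = y \<otimes> y [^] int j" for j
    using int_pow_mult[OF y, of 1 "int j"] y by simp
  have step': "z [^] int (Suc j) = z [^] int j \<otimes> z" if "z \<in> carrier G" for j z
    using int_pow_mult[OF that, of "int j" 1] that by (simp add: add.commute)
  have P: "y [^] int j \<otimes> x [^] (i::int) = x [^] (i * k ^ j) \<otimes> y [^] int j" for i j
  proof (induction j arbitrary: i)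
    case (Suc j)
    have "y [^] int (Suc j) \<otimes> x [^] i = y \<otimes> (x [^] (i * k ^ j) \<otimes> y [^] int j)"
      using Suc x y by (simp only: step m_assoc int_pow_closed)
    also have "\<dots> = x [^] (i * k ^ j * k) \<otimes> (y \<otimes> y [^] int j)"
      using commute_ext[OF 1, where w = "y [^] int j"] x y by simp
    finally show ?case by (simp only: step) (simp add: mult_ac)
  qed (use x y in simp)
  show "y [^] int j \<otimes> x [^] (i::int) = x [^] (i * k ^ j) \<otimes> y [^] int j" by (rule P)
  show "(x [^] (i::int) \<otimes> y) [^] int n = x [^] (i * geo n k) \<otimes> y [^] int n"
  proof (induction n)
    case (Suc n)
    have "(x [^] i \<otimes> y) [^] int (Suc n) = x [^] (i * geo n k) \<otimes> (y [^] int n \<otimes> (x [^] i \<otimes> y))"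
      using Suc x y by (simp only: step' m_assoc int_pow_closed m_closed)
    also have "\<dots> = x [^] (i * geo n k) \<otimes> (x [^] (i * k ^ n) \<otimes> (y [^] int n \<otimes> y))"
      using commute_ext[OF P, where w = y] x y by simp
    also have "\<dots> = x [^] (i * geo n k + i * k ^ n) \<otimes> y [^] int (Suc n)"
      using x y by (simp only: int_pow_add_ext step' m_closed int_pow_closed)
    finally show ?case by (simp only: geo_Suc distrib_left)
  qed (use x y in simp)
qed

section \<open>Relations in the model\<close>

text \<open>In the model, \<open>b\<close> acts on \<open>c\<close> by \<open>c \<mapsto> d^w c\<close> where \<open>d = b^(p^m)\<close>. The relation
  \<open>b^y = a^x c^e\<close> of the upper bound dictates \<open>t^(w^2 (S + 1)) = c^ed a^ex\<close> for \<open>t = d^(p^m)\<close>, with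
  \<open>ex\<close>, \<open>ed\<close> reduced modulo the orders of \<open>a\<close>, \<open>c\<close>; \<open>v\<close> inverts the exponent of \<open>t\<close>.\<close>
locale model_params = odd_prime p for p :: nat +
  fixes m l w ex ed :: nat and \<alpha> \<beta> S v :: int
  assumes ml: "0 < m" "m < l" "l < 2 * m" "3 * m < 2 * l"
    and \<alpha>: "\<alpha> > 1" "int p ^ m dvd \<alpha> - 1" and \<beta>: "\<beta> = 1 + int p ^ m * int w"
    and ex: "int p ^ (2 * m) dvd int ex" "\<not> int p ^ (2 * m + 1) dvd int ex"
      "int p ^ (m + l) dvd int ex - (\<alpha> * geo (nat \<alpha>) \<alpha> - \<alpha> * \<alpha> ^ nat \<alpha>)"
    and ed: "int p ^ l dvd int ed" "int p ^ (2 * m) dvd int ed - (\<alpha> - \<beta>)"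
    and S: "(\<Sum>i<p ^ m. int i * \<beta> ^ i) = int p ^ m * S"
    and v: "int p ^ (m + l) dvd int w ^ 2 * (S + 1) * v - 1"
begin

lemma p_pow_dvd: "i \<le> j \<Longrightarrow> int p ^ i dvd int p ^ j"
  by (rule le_imp_power_dvd)

lemma p_dvd_trans: "i \<le> j \<Longrightarrow> int p ^ j dvd z \<Longrightarrow> int p ^ i dvd z"
  using p_pow_dvd dvd_trans by blast

lemma \<alpha>1: "int p dvd \<alpha> - 1"
  using \<alpha>(2) p_dvd_trans[of 1 m] ml by simp

lemma \<beta>m: "int p ^ m dvd \<beta> - 1" by (simp add: \<beta>)

lemma \<beta>1: "int p dvd \<beta> - 1"
  using \<beta>m p_dvd_trans[of 1 m] ml by simp

lemma \<alpha>_pow: "int p ^ f dvd int n \<Longrightarrow> int p ^ (f + m) dvd \<alpha> ^ n - 1"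
  using power_minus_1_dvd[OF \<alpha>(2), of f n] ml by simp

lemma \<alpha>_pow_cong:
  assumes "int p ^ (2 * m) dvd int i - int j" shows "int p ^ (m + l) dvd \<alpha> ^ i - \<alpha> ^ j"
proof -
  have *: "int p ^ (m + l) dvd \<alpha> ^ i - \<alpha> ^ j" if "i \<ge> j" "int p ^ (2 * m) dvd int i - int j" for i j
  proof -
    have "int p ^ (2 * m) dvd int (i - j)" using that by (simp add: of_nat_diff)
    from \<alpha>_pow[OF this] have "int p ^ (m + l) dvd \<alpha> ^ (i - j) - 1" by (rule p_dvd_trans[rotated]) (use ml in simp)
    then have "int p ^ (m + l) dvd \<alpha> ^ j * (\<alpha> ^ (i - j) - 1)" by simp
    moreover have "\<alpha> ^ j * (\<alpha> ^ (i - j) - 1) = \<alpha> ^ i - \<alpha> ^ j"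
      using that(1) by (simp add: right_diff_distrib power_add[symmetric])
    ultimately show ?thesis by simp
  qed
  show ?thesis
  proof (cases "i \<ge> j")
    case True then show ?thesis using * assms by blast
  next
    case False
    then have "int p ^ (m + l) dvd \<alpha> ^ j - \<alpha> ^ i" using *[of i j] assms dvd_diff_commute by auto
    then show ?thesis using dvd_diff_commute by blast
  qed
qed

lemma geo_ex_cong:
  assumes "int p ^ m dvd k - 1" shows "int p ^ (m + l) dvd k * geo ex k - int ex"
proof -
  have 1: "int p ^ (2 * m + m) dvd geo ex k - int ex" using geo_cong[OF assms _ ex(1)] ml by simp
  have 2: "int p ^ (m + 2 * m) dvd (k - 1) * int ex" unfolding power_add using assms ex(1) by (rule mult_dvd_mono)
  have "k * geo ex k - int ex = k * (geo ex k - int ex) + (k - 1) * int ex" by (simp add: algebra_simps)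
  moreover have "int p ^ (m + l) dvd k * (geo ex k - int ex)" "int p ^ (m + l) dvd (k - 1) * int ex"
    using p_dvd_trans[OF _ 1, of "m + l"] p_dvd_trans[OF _ 2, of "m + l"] ml by auto
  ultimately show ?thesis by simp
qed

end

text \<open>The relations of <a,c> in the model, for a pair in any group. Keeping pair and group
  variable allows the images of (a, c) under d and b to be treated as pairs of the same
  kind.\<close>

locale ac_pair = model_params + group K for K (structure) +
  fixes a c
  assumes a [simp, intro]: "a \<in> carrier K" and c [simp, intro]: "c \<in> carrier K"
    and ac: "a \<otimes> c = c \<otimes> a [^] \<alpha>"
    and a_ord: "a [^] (int p ^ (m + l)) = \<one>" and c_ord: "c [^] (int p ^ (2 * m)) = \<one>"
begin

definition "\<tau> = c [^] int ed \<otimes> a [^] int ex"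
text \<open>The value prescribed for b^(p^(2m)), written in a and c alone because d and b are
  adjoined only later.\<close>

definition "t = \<tau> [^] v"
definition "g = c [^] (int p ^ m)"

lemma closed [simp]: "\<tau> \<in> carrier K" "t \<in> carrier K" "g \<in> carrier K"
  by (simp_all add: \<tau>_def t_def g_def)

lemma a_cong: "int p ^ (m + l) dvd i - j \<Longrightarrow> a [^] i = a [^] j"
  by (rule int_pow_cong[OF a a_ord])

lemma c_cong: "int p ^ (2 * m) dvd i - j \<Longrightarrow> c [^] i = c [^] j"
  by (rule int_pow_cong[OF c c_ord])

lemma a_one: "int p ^ (m + l) dvd i \<Longrightarrow> a [^] i = \<one>"
  using a_cong[of i 0] by simp

lemma c_one: "int p ^ (2 * m) dvd i \<Longrightarrow> c [^] i = \<one>"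
  using c_cong[of i 0] by simp

lemma a_pow_c_pow: "a [^] (i::int) \<otimes> c [^] int j = c [^] int j \<otimes> a [^] (i * \<alpha> ^ j)"
  by (rule twist[OF ac]) simp_all

lemma c_pow_a: "int p ^ l dvd int k \<Longrightarrow> a \<otimes> c [^] int k = c [^] int k \<otimes> a"
proof -
  assume "int p ^ l dvd int k"
  then have "int p ^ (m + l) dvd \<alpha> ^ k - 1" using \<alpha>_pow by (simp add: add.commute)
  then have "a [^] (\<alpha> ^ k) = a" using a_cong[of "\<alpha> ^ k" 1] by simp
  then show ?thesis using a_pow_c_pow[of 1 k] by simp
qed

lemma a_pow_c: "int p ^ (2 * m) dvd i \<Longrightarrow> a [^] i \<otimes> c = c \<otimes> a [^] i"
proof -
  assume "int p ^ (2 * m) dvd i"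
  then have "int p ^ (2 * m + m) dvd i * (\<alpha> - 1)" unfolding power_add using \<alpha>(2) by (rule mult_dvd_mono)
  then have "int p ^ (2 * m + m) dvd i * \<alpha> - i" by (simp only: right_diff_distrib mult_1_right)
  then have "int p ^ (m + l) dvd i * \<alpha> - i" by (rule p_dvd_trans[rotated]) (use ml in simp)
  then have "a [^] (i * \<alpha>) = a [^] i" by (rule a_cong)
  then show ?thesis using a_pow_c_pow[of i 1] by simp
qed

lemma pow_self_commute: "y \<in> carrier K \<Longrightarrow> y [^] (i::int) \<otimes> y = y \<otimes> y [^] i"
  using commute_pow[of y y i] by simp

text \<open>With the next lemma, \<tau> is central in <a,c>: p^l | ed makes c^ed commute with a, and
  p^(2m) | ex makes a^ex commute with c.\<close>

lemma \<tau>_a: "\<tau> \<otimes> a = a \<otimes> \<tau>"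
  unfolding \<tau>_def using commute_mult[OF c_pow_a[OF ed(1)] pow_self_commute[OF a, symmetric]] by simp

lemma \<tau>_c: "\<tau> \<otimes> c = c \<otimes> \<tau>"
  unfolding \<tau>_def using commute_mult[OF pow_self_commute[OF c, symmetric] a_pow_c[OF ex(1), symmetric]] by simp

lemma t_a: "t [^] (i::int) \<otimes> a = a \<otimes> t [^] i"
  using commute_pow[OF \<tau>_a] by (simp add: t_def int_pow_pow)

lemma t_c: "t [^] (i::int) \<otimes> c = c \<otimes> t [^] i"
  using commute_pow[OF \<tau>_c] by (simp add: t_def int_pow_pow)

lemma t_c_pow: "t [^] (i::int) \<otimes> c [^] (j::int) = c [^] j \<otimes> t [^] i"
  using commute_pow[OF t_c[of i, symmetric], of j] by simp

lemma \<tau>_pow: "\<tau> [^] (i::int) = c [^] (int ed * i) \<otimes> a [^] (int ex * i)"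
proof -
  have "c [^] int ed \<otimes> a [^] int ex = a [^] int ex \<otimes> c [^] int ed"
    using commute_pow[OF c_pow_a[OF ed(1)], of "int ex"] by simp
  from int_pow_mult_distrib[OF this, of i] show ?thesis by (simp add: \<tau>_def int_pow_pow)
qed

lemma \<tau>_one: "int p ^ (l - m) dvd i \<Longrightarrow> \<tau> [^] i = \<one>"
proof -
  assume i: "int p ^ (l - m) dvd i"
  have "int p ^ (l + (l - m)) dvd int ed * i" unfolding power_add using ed(1) i by (rule mult_dvd_mono)
  then have 1: "int p ^ (2 * m) dvd int ed * i" by (rule p_dvd_trans[rotated]) (use ml in simp)
  have "int p ^ (2 * m + (l - m)) dvd int ex * i" unfolding power_add using ex(1) i by (rule mult_dvd_mono)
  then have 2: "int p ^ (m + l) dvd int ex * i" by (rule p_dvd_trans[rotated]) (use ml in simp)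
  show ?thesis by (simp add: \<tau>_pow a_one[OF 2] c_one[OF 1])
qed

lemma t_one: "int p ^ (l - m) dvd i \<Longrightarrow> t [^] i = \<one>"
  using \<tau>_one[of "v * i"] by (simp add: t_def int_pow_pow)

lemma t_cong: "int p ^ (l - m) dvd i - j \<Longrightarrow> t [^] i = t [^] j"
  using int_pow_cong[of t "int p ^ (l - m)"] t_one[of "int p ^ (l - m)"] by simp

lemma t_v: "t [^] (int w ^ 2 * (S + 1)) = \<tau>"
proof -
  have "int p ^ (l - m) dvd v * (int w ^ 2 * (S + 1)) - 1"
    using v by (simp add: mult.commute) (rule p_dvd_trans[rotated], assumption, simp)
  then have "\<tau> [^] (v * (int w ^ 2 * (S + 1))) = \<tau> [^] (1::int)"
    using int_pow_cong[of \<tau> "int p ^ (l - m)"] \<tau>_one[of "int p ^ (l - m)"] by simp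
  then show ?thesis by (simp add: t_def int_pow_pow)
qed

lemma ac_pow: "(a \<otimes> c) [^] int n = c [^] int n \<otimes> a [^] (\<alpha> * geo n \<alpha>)"
  by (rule twist_pow'[OF ac]) simp_all

text \<open>This is a c = c a^\<alpha> transported by b, with the power of d already moved out, as
  \<open>pair2\<close> shows. Matching exponents of c modulo p^(2m) means p^m w + 2 + ed = 1 +
  \<alpha>, which is the choice of ed; the choice of ex then matches the exponents of a.\<close>

lemma main_relation: "a \<otimes> (c [^] int (p ^ m * w) \<otimes> (\<tau> \<otimes> (c \<otimes> c))) = c \<otimes> (a \<otimes> c) [^] \<alpha>"
proof -
  let ?n = "nat \<alpha>" let ?e = "p ^ m * w + 2 + ed"
  have na: "int ?n = \<alpha>" using \<alpha>(1) by simp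
  have "\<tau> \<otimes> (c \<otimes> c) = (c \<otimes> c) \<otimes> \<tau>" using commute_mult[OF \<tau>_c \<tau>_c] by simp
  also have "\<dots> = c [^] (2 + int ed) \<otimes> a [^] int ex"
    using int_pow_mult[OF c, of 1 1] by (simp add: \<tau>_def int_pow_mult m_assoc)
  finally have "c [^] int (p ^ m * w) \<otimes> (\<tau> \<otimes> (c \<otimes> c)) = c [^] int ?e \<otimes> a [^] int ex"
    by (simp only: int_pow_add_ext a c int_pow_closed) (simp add: algebra_simps)
  then have "a \<otimes> (c [^] int (p ^ m * w) \<otimes> (\<tau> \<otimes> (c \<otimes> c))) = (a [^] (1::int) \<otimes> c [^] int ?e) \<otimes> a [^] int ex"
    by (simp add: m_assoc)
  also have "\<dots> = c [^] int ?e \<otimes> a [^] (\<alpha> ^ ?e + int ex)"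
    unfolding a_pow_c_pow by (simp add: m_assoc int_pow_mult)
  also have "\<dots> = c [^] (1 + \<alpha>) \<otimes> a [^] (\<alpha> * geo ?n \<alpha>)"
  proof -
    have e: "int ?e - int (1 + ?n) = int ed - (\<alpha> - \<beta>)" using na by (simp add: \<beta>)
    have d: "int p ^ (2 * m) dvd int ?e - int (1 + ?n)" unfolding e by (rule ed(2))
    have "c [^] int ?e = c [^] int (1 + ?n)" using d by (rule c_cong)
    moreover have "a [^] (\<alpha> ^ ?e + int ex) = a [^] (\<alpha> * geo ?n \<alpha>)"
    proof (rule a_cong)
      have "\<alpha> ^ ?e + int ex - \<alpha> * geo ?n \<alpha> = (\<alpha> ^ ?e - \<alpha> ^ (1 + ?n)) + (int ex - (\<alpha> * geo ?n \<alpha> - \<alpha> * \<alpha> ^ ?n))"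
        by simp
      moreover have "int p ^ (m + l) dvd \<alpha> ^ ?e - \<alpha> ^ (1 + ?n)" using d by (rule \<alpha>_pow_cong)
      ultimately show "int p ^ (m + l) dvd \<alpha> ^ ?e + int ex - \<alpha> * geo ?n \<alpha>" using ex(3) by (metis dvd_add)
    qed
    ultimately show ?thesis using na by simp
  qed
  also have "\<dots> = c \<otimes> (c [^] int ?n \<otimes> a [^] (\<alpha> * geo ?n \<alpha>))" using na by (simp add: int_pow_mult m_assoc)
  also have "\<dots> = c \<otimes> (a \<otimes> c) [^] int ?n" by (simp only: ac_pow)
  finally show ?thesis by (simp only: na)
qed

lemma g_c: "g \<otimes> c = c \<otimes> g"
  unfolding g_def by (rule pow_self_commute) simp

lemma g_pow: "g [^] (i::int) = c [^] (int p ^ m * i)"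
  by (simp add: g_def int_pow_pow)

lemma g_one: "int p ^ m dvd i \<Longrightarrow> g [^] i = \<one>"
  unfolding g_pow by (rule c_one) (simp add: mult_2 power_add mult_dvd_mono)

lemma t_g: "t [^] (i::int) \<otimes> g = g \<otimes> t [^] i"
  unfolding g_def by (rule t_c_pow)

abbreviation "\<kappa> \<equiv> \<alpha> ^ (p ^ m)"

lemma \<kappa>: "int p ^ (2 * m) dvd \<kappa> - 1"
  using \<alpha>_pow[of m "p ^ m"] by (simp add: mult_2)

lemma a_g: "a \<otimes> g = g \<otimes> a [^] \<kappa>"
  using a_pow_c_pow[of 1 "p ^ m"] by (simp add: g_def)

lemma a_g_pow: "(a \<otimes> g) [^] int n = g [^] int n \<otimes> a [^] (\<kappa> * geo n \<kappa>)"
  by (rule twist_pow'[OF a_g]) simp_all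

text \<open>a1 and c1 are to be the images of a and c under conjugation by d. They arise by
  iterating a -> a c, c -> d^w c exactly p^m times: the image of a then contains d^(w p^m S), which
  is t^(w S).\<close>

abbreviation "a1 \<equiv> a \<otimes> g \<otimes> t [^] (int w * S)"
abbreviation "c1 \<equiv> t [^] int w \<otimes> c"

lemma a1_pow: "a1 [^] (i::int) = (a \<otimes> g) [^] i \<otimes> t [^] (int w * S * i)"
proof -
  have "t [^] (int w * S) \<otimes> (a \<otimes> g) = (a \<otimes> g) \<otimes> t [^] (int w * S)"
    by (rule commute_mult[OF t_a t_g]) simp_all
  then have "(a \<otimes> g) \<otimes> t [^] (int w * S) = t [^] (int w * S) \<otimes> (a \<otimes> g)" by simp
  from int_pow_mult_distrib[OF this, of i] show ?thesis by (simp add: int_pow_pow)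
qed

lemma c1_pow: "c1 [^] (i::int) = t [^] (int w * i) \<otimes> c [^] i"
  using int_pow_mult_distrib[OF t_c[of "int w"], of i] by (simp add: int_pow_pow)

lemma lm_le_m: "l - m \<le> m" using ml by simp

lemma pair1: "ac_pair p m l w ex ed \<alpha> \<beta> S v K a1 c1"
proof (unfold_locales)
  let ?z = "t [^] (int w * S)"
  show "a1 [^] (int p ^ (m + l)) = \<one>"
  proof -
    have "a1 [^] int (p ^ (m + l)) = \<one>"
    proof -
      have "int p ^ (m + l) dvd geo (p ^ (m + l)) \<kappa>"
        using geo_dvd[of \<kappa> "m + l" "p ^ (m + l)"] \<kappa> p_dvd_trans[of 1 "2 * m"] ml by simp
      then have "a [^] (\<kappa> * geo (p ^ (m + l)) \<kappa>) = \<one>" by (intro a_one dvd_mult)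
      moreover have "g [^] int (p ^ (m + l)) = \<one>" by (rule g_one) (simp add: power_add)
      moreover have "t [^] (int w * S * int (p ^ (m + l))) = \<one>"
        by (rule t_one) (use p_pow_dvd[of "l - m" "m + l"] in simp)
      ultimately show ?thesis unfolding a1_pow a_g_pow by simp
    qed
    then show ?thesis by simp
  qed
  show "c1 [^] (int p ^ (2 * m)) = \<one>"
    unfolding c1_pow using c_ord t_one[of "int w * int p ^ (2 * m)"] p_pow_dvd[of "l - m" "2 * m"] ml by simp
  show "a1 \<otimes> c1 = c1 \<otimes> a1 [^] \<alpha>"
  proof -
    let ?n = "nat \<alpha>"
    have na: "int ?n = \<alpha>" using \<alpha>(1) by simp
    have "a1 [^] \<alpha> = (a \<otimes> g) [^] int ?n \<otimes> t [^] (int w * S * \<alpha>)" by (simp only: a1_pow na)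
    also have "t [^] (int w * S * \<alpha>) = ?z"
    proof (rule t_cong)
      have "int w * S * \<alpha> - int w * S = (int w * S) * (\<alpha> - 1)" by (simp add: algebra_simps)
      then show "int p ^ (l - m) dvd int w * S * \<alpha> - int w * S"
        using p_dvd_trans[OF lm_le_m \<alpha>(2)] by simp
    qed
    also have "(a \<otimes> g) [^] int ?n = g \<otimes> a [^] (\<kappa> * \<alpha>)"
    proof -
      have "g [^] int ?n = g"
      proof -
        have "g [^] (1 + (\<alpha> - 1)) = g [^] (1::int) \<otimes> g [^] (\<alpha> - 1)" by (rule int_pow_mult) simp
        then show ?thesis using g_one[OF \<alpha>(2)] na by simp
      qed
      \<comment> \<open>\<kappa> is 1 modulo p^(2m), so the terms by which the geometric sum differs
        from \<alpha> are divisible by p^(3m), and 3m \<ge> m + l.\<close>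
      moreover have "a [^] (\<kappa> * geo ?n \<kappa>) = a [^] (\<kappa> * \<alpha>)"
      proof (rule a_cong)
        obtain q where q: "2 * geo ?n (1 + (\<kappa> - 1)) = 2 * int ?n + int ?n * (int ?n - 1) * (\<kappa> - 1) + 2 * (\<kappa> - 1)\<^sup>2 * q"
          using geo_quadratic by blast
        have e: "2 * (geo ?n \<kappa> - \<alpha>) = \<alpha> * ((\<alpha> - 1) * (\<kappa> - 1)) + (\<kappa> - 1)\<^sup>2 * (2 * q)"
          using q unfolding na by (simp add: algebra_simps)
        have "int p ^ (m + 2 * m) dvd (\<alpha> - 1) * (\<kappa> - 1)" unfolding power_add using \<alpha>(2) \<kappa> by (rule mult_dvd_mono)
        then have d1: "int p ^ (m + l) dvd (\<alpha> - 1) * (\<kappa> - 1)" by (rule p_dvd_trans[rotated]) (use ml in simp)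
        have "int p ^ (2 * m + 2 * m) dvd (\<kappa> - 1)\<^sup>2" unfolding power_add power2_eq_square using \<kappa> \<kappa> by (rule mult_dvd_mono)
        then have d2: "int p ^ (m + l) dvd (\<kappa> - 1)\<^sup>2" by (rule p_dvd_trans[rotated]) (use ml in simp)
        have "int p ^ (m + l) dvd 2 * (geo ?n \<kappa> - \<alpha>)" unfolding e by (rule dvd_add[OF dvd_mult[OF d1] dvd_mult2[OF d2]])
        then have "int p ^ (m + l) dvd geo ?n \<kappa> - \<alpha>" by (rule dvd_cancel_2)
        then have "int p ^ (m + l) dvd \<kappa> * (geo ?n \<kappa> - \<alpha>)" by simp
        then show "int p ^ (m + l) dvd \<kappa> * geo ?n \<kappa> - \<kappa> * \<alpha>" by (simp add: right_diff_distrib)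
      qed
      ultimately show ?thesis unfolding a_g_pow by simp
    qed
    also have "g \<otimes> a [^] (\<kappa> * \<alpha>) = a [^] \<alpha> \<otimes> g"
      using a_pow_c_pow[of \<alpha> "p ^ m"] by (simp add: g_def mult.commute)
    finally have 1: "a1 [^] \<alpha> = a [^] \<alpha> \<otimes> g \<otimes> ?z" .
    have "a1 \<otimes> c1 = a \<otimes> (g \<otimes> (?z \<otimes> (t [^] int w \<otimes> c)))" by (simp add: m_assoc)
    also have "\<dots> = a \<otimes> (g \<otimes> (c \<otimes> (?z \<otimes> t [^] int w)))"
    proof -
      have "?z \<otimes> (t [^] int w \<otimes> c) = (?z \<otimes> t [^] int w) \<otimes> c" by (simp add: m_assoc)
      also have "\<dots> = c \<otimes> (?z \<otimes> t [^] int w)" using t_c[of "int w * S + int w"] by (simp add: int_pow_mult)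
      finally show ?thesis by simp
    qed
    also have "\<dots> = (a \<otimes> c) \<otimes> (g \<otimes> (?z \<otimes> t [^] int w))"
      using commute_ext[OF g_c, of "?z \<otimes> t [^] int w"] by (simp add: m_assoc)
    also have "\<dots> = (c \<otimes> a [^] \<alpha> \<otimes> g) \<otimes> (?z \<otimes> t [^] int w)" unfolding ac by (simp add: m_assoc)
    also have "?z \<otimes> t [^] int w = t [^] int w \<otimes> ?z"
      using int_pow_mult[of t "int w * S" "int w"] int_pow_mult[of t "int w" "int w * S"] by (simp add: add.commute)
    also have "(c \<otimes> a [^] \<alpha> \<otimes> g) \<otimes> (t [^] int w \<otimes> ?z) = t [^] int w \<otimes> (c \<otimes> a [^] \<alpha> \<otimes> g) \<otimes> ?z"
    proof -
      have "t [^] int w \<otimes> a [^] \<alpha> = a [^] \<alpha> \<otimes> t [^] int w" using commute_pow[OF t_a[of "int w", symmetric], of \<alpha>] by simp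
      from commute_mult[OF commute_mult[OF t_c this] t_g] show ?thesis by (simp add: m_assoc)
    qed
    finally show ?thesis unfolding 1 by (simp add: m_assoc)
  qed
qed simp_all

text \<open>The action of d has to fix t, since t becomes a power of d; this reduces to fixing
  \<tau>.\<close>

lemma \<tau>1: "c1 [^] int ed \<otimes> a1 [^] int ex = \<tau>"
proof -
  have "int p ^ (l - m) dvd int w * int ed" using p_dvd_trans[OF _ ed(1), of "l - m"] by simp
  then have 1: "c1 [^] int ed = c [^] int ed" unfolding c1_pow using t_one by simp
  have "int p ^ m dvd int ex" using p_dvd_trans[OF _ ex(1), of m] by simp
  then have "g [^] int ex = \<one>" by (rule g_one)
  moreover have "a [^] (\<kappa> * geo ex \<kappa>) = a [^] int ex"
    by (rule a_cong, rule geo_ex_cong) (use \<kappa> p_dvd_trans[of m "2 * m"] in simp)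
  moreover have "t [^] (int w * S * int ex) = \<one>"
    by (rule t_one) (use p_dvd_trans[OF _ ex(1), of "l - m"] ml in simp)
  ultimately have "a1 [^] int ex = a [^] int ex" unfolding a1_pow a_g_pow by simp
  with 1 show ?thesis by (simp add: \<tau>_def)
qed

lemma t1: "ac_pair.t ex ed v K a1 c1 = t"
proof -
  interpret q: ac_pair p m l w ex ed \<alpha> \<beta> S v K a1 c1 by (rule pair1)
  show ?thesis unfolding q.t_def q.\<tau>_def \<tau>1 by (rule t_def[symmetric])
qed

lemma hom_pair:
  assumes "h \<in> hom K L" "group L"
  shows "ac_pair p m l w ex ed \<alpha> \<beta> S v L (h a) (h c)" "ac_pair.t ex ed v L (h a) (h c) = h t"
proof -
  interpret L: group L by fact
  interpret h: group_hom K L h using assms by unfold_locales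
  show A: "ac_pair p m l w ex ed \<alpha> \<beta> S v L (h a) (h c)"
  proof (unfold_locales)
    show "h a \<otimes>\<^bsub>L\<^esub> h c = h c \<otimes>\<^bsub>L\<^esub> h a [^]\<^bsub>L\<^esub> \<alpha>" using arg_cong[OF ac, of h] by (simp add: h.hom_int_pow)
    show "h a [^]\<^bsub>L\<^esub> (int p ^ (m + l)) = \<one>\<^bsub>L\<^esub>" using arg_cong[OF a_ord, of h] by (simp add: h.hom_int_pow)
    show "h c [^]\<^bsub>L\<^esub> (int p ^ (2 * m)) = \<one>\<^bsub>L\<^esub>" using arg_cong[OF c_ord, of h] by (simp add: h.hom_int_pow)
  qed simp_all
  interpret q: ac_pair p m l w ex ed \<alpha> \<beta> S v L "h a" "h c" by (rule A)
  show "q.t = h t" by (simp add: q.t_def q.\<tau>_def t_def \<tau>_def h.hom_int_pow del: pow_nat)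
qed

end

text \<open>Adds D with the action just described. The lemmas of this locale check that a -> a c, c
  -> D^w c, D -> D respects all relations, so that b can be adjoined next.\<close>

locale acd_triple = ac_pair +
  fixes D
  assumes D [simp, intro]: "D \<in> carrier K" and aD: "a \<otimes> D = D \<otimes> a1" and cD: "c \<otimes> D = D \<otimes> c1"
    and D_ord: "D [^] (int p ^ m) = t"
begin

lemma a1_closed [simp]: "a1 \<in> carrier K" and c1_closed [simp]: "c1 \<in> carrier K" by simp_all

lemma t_D: "t [^] (i::int) \<otimes> D = D \<otimes> t [^] i"
proof -
  have "a [^] int ex \<otimes> D = D \<otimes> a1 [^] int ex" "c [^] int ed \<otimes> D = D \<otimes> c1 [^] int ed"
    using conj_int_pow[OF aD] conj_int_pow[OF cD] by simp_all
  then have "\<tau> \<otimes> D = D \<otimes> (c1 [^] int ed \<otimes> a1 [^] int ex)"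
    using commute_ext[of "c [^] int ed" D D "c1 [^] int ed" "a1 [^] int ex"] by (simp add: \<tau>_def m_assoc)
  then have "\<tau> \<otimes> D = D \<otimes> \<tau>" by (simp only: \<tau>1)
  from commute_pow[OF this] show ?thesis by (simp add: t_def int_pow_pow)
qed

lemma D_pow_m: "D [^] (int p ^ m * i) = t [^] i"
  using D_ord by (metis D int_pow_pow)

lemma D_one: "int p ^ l dvd i \<Longrightarrow> D [^] i = \<one>"
proof -
  assume "int p ^ l dvd i"
  moreover have "int p ^ l = int p ^ m * int p ^ (l - m)" using ml by (simp add: power_add[symmetric])
  ultimately obtain k where "i = int p ^ m * (int p ^ (l - m) * k)" by (metis dvdE mult.assoc)
  then show ?thesis using t_one[of "int p ^ (l - m) * k"] by (simp only: D_pow_m) simp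
qed

lemma cD': "c \<otimes> D = D [^] \<beta> \<otimes> c"
proof -
  have "D [^] \<beta> = D [^] (1::int) \<otimes> D [^] (int p ^ m * int w)" unfolding \<beta> by (rule int_pow_mult) simp
  also have "\<dots> = D \<otimes> t [^] int w" by (simp only: D_pow_m int_pow_1 D)
  finally show ?thesis using cD by (simp add: m_assoc)
qed

lemma c_pow_D_pow: "c [^] int j \<otimes> D [^] (i::int) = D [^] (i * \<beta> ^ j) \<otimes> c [^] int j"
  and D_c_pow: "(D [^] (i::int) \<otimes> c) [^] int n = D [^] (i * geo n \<beta>) \<otimes> c [^] int n"
  by (rule twist_left_pow[OF cD']; simp)+

lemma g_D: "g \<otimes> D = D \<otimes> g"
proof -
  have "c [^] int (p ^ m) \<otimes> D = D \<otimes> c1 [^] int (p ^ m)" by (rule conj_int_pow[OF cD]) simp_all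
  moreover have "t [^] (int w * int (p ^ m)) = \<one>" by (rule t_one) (use p_pow_dvd[OF lm_le_m] in simp)
  ultimately show ?thesis unfolding c1_pow by (simp add: g_def)
qed

lemma a_D_pow: "a \<otimes> D [^] int j = D [^] int j \<otimes> (a \<otimes> (g [^] int j \<otimes> t [^] (int w * S * int j)))"
proof (induction j)
  case (Suc j)
  let ?g = "g [^] int j" let ?t = "t [^] (int w * S * int j)"
  have step: "y [^] int (Suc j) = y \<otimes> y [^] int j" if "y \<in> carrier K" for y
    using int_pow_mult[OF that, of 1 "int j"] that by simp
  have stepD: "D [^] int (Suc j) = D [^] int j \<otimes> D"
    using int_pow_mult[OF D, of "int j" 1] by (simp add: add.commute)
  have comm: "?g \<otimes> (?t \<otimes> D) = D \<otimes> (?g \<otimes> ?t)"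
    using t_D[of "int w * S * int j"] commute_ext[OF commute_pow[OF g_D, of "int j"], of ?t] by simp
  have "a \<otimes> D [^] int (Suc j) = (a \<otimes> D [^] int j) \<otimes> D" by (simp only: stepD m_assoc a D int_pow_closed)
  also have "\<dots> = D [^] int j \<otimes> (a \<otimes> (?g \<otimes> (?t \<otimes> D)))" unfolding Suc by (simp add: m_assoc)
  also have "\<dots> = D [^] int j \<otimes> ((a \<otimes> D) \<otimes> (?g \<otimes> ?t))" unfolding comm by (simp add: m_assoc)
  also have "\<dots> = (D [^] int j \<otimes> D) \<otimes> (a \<otimes> (g \<otimes> (t [^] (int w * S) \<otimes> (?g \<otimes> ?t))))" unfolding aD by (simp add: m_assoc)
  also have "t [^] (int w * S) \<otimes> (?g \<otimes> ?t) = ?g \<otimes> (t [^] (int w * S) \<otimes> ?t)"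
    using commute_ext[OF commute_pow[OF t_g[of "int w * S", symmetric], of "int j", symmetric], of ?t] by simp
  also have "t [^] (int w * S) \<otimes> ?t = t [^] (int w * S * int (Suc j))"
    by (simp add: int_pow_mult[symmetric] algebra_simps)
  finally show ?case by (simp add: step stepD m_assoc del: of_nat_Suc)
qed simp

abbreviation "a2 \<equiv> a \<otimes> c"
abbreviation "c2 \<equiv> D [^] int w \<otimes> c"

text \<open>Moving D^w to the front of a c D^w c leaves a c^(p^m w) t^(w^2 (S+1)) c c behind it: the
  exponent of t is w S w from passing a plus w w from passing c. This power of t was arranged to be
  \<tau>, and \<open>main_relation\<close> finishes.\<close>

lemma pair2: "ac_pair p m l w ex ed \<alpha> \<beta> S v K a2 c2"
proof (unfold_locales)
  have "a2 [^] int (p ^ (m + l)) = \<one>"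
  proof -
    have "int p ^ (m + l) dvd geo (p ^ (m + l)) \<alpha>" using geo_dvd[OF \<alpha>1, of "m + l" "p ^ (m + l)"] by simp
    then have "a [^] (\<alpha> * geo (p ^ (m + l)) \<alpha>) = \<one>" by (intro a_one dvd_mult)
    moreover have "c [^] int (p ^ (m + l)) = \<one>" by (rule c_one) (use p_pow_dvd[of "2 * m" "m + l"] ml in simp)
    ultimately show ?thesis unfolding ac_pow by simp
  qed
  then show "a2 [^] (int p ^ (m + l)) = \<one>" by simp
  have "c2 [^] int (p ^ (2 * m)) = \<one>"
  proof -
    have "int p ^ (2 * m) dvd geo (p ^ (2 * m)) \<beta>" using geo_dvd[OF \<beta>1, of "2 * m" "p ^ (2 * m)"] by simp
    then have "int p ^ l dvd geo (p ^ (2 * m)) \<beta>" by (rule p_dvd_trans[rotated]) (use ml in simp)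
    then have "D [^] (int w * geo (p ^ (2 * m)) \<beta>) = \<one>" by (intro D_one dvd_mult)
    moreover have "c [^] int (p ^ (2 * m)) = \<one>" using c_ord by simp
    ultimately show ?thesis unfolding D_c_pow by simp
  qed
  then show "c2 [^] (int p ^ (2 * m)) = \<one>" by simp
  show "a2 \<otimes> c2 = c2 \<otimes> a2 [^] \<alpha>"
  proof -
    have cDw: "c \<otimes> D [^] int w = D [^] int w \<otimes> (t [^] (int w * int w) \<otimes> c)"
    proof -
      have "c \<otimes> D [^] int w = D [^] (int w * \<beta>) \<otimes> c" using c_pow_D_pow[of 1 "int w"] by simp
      also have "int w * \<beta> = int w + int p ^ m * (int w * int w)" by (simp add: \<beta> algebra_simps)
      also have "D [^] \<dots> = D [^] int w \<otimes> t [^] (int w * int w)" by (simp only: int_pow_mult D D_pow_m)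
      finally show ?thesis by (simp add: m_assoc)
    qed
    let ?T = "t [^] (int w * S * int w)" let ?T' = "t [^] (int w * int w)"
    have "a2 \<otimes> c2 = a \<otimes> ((c \<otimes> D [^] int w) \<otimes> c)" by (simp add: m_assoc)
    also have "\<dots> = (a \<otimes> D [^] int w) \<otimes> (?T' \<otimes> (c \<otimes> c))" unfolding cDw by (simp add: m_assoc)
    also have "\<dots> = D [^] int w \<otimes> (a \<otimes> (g [^] int w \<otimes> ((?T \<otimes> ?T') \<otimes> (c \<otimes> c))))"
      unfolding a_D_pow by (simp add: m_assoc)
    also have "?T \<otimes> ?T' = \<tau>"
      unfolding t_v[symmetric] by (simp add: int_pow_mult[symmetric] power2_eq_square algebra_simps)
    also have "g [^] int w = c [^] int (p ^ m * w)" by (simp add: g_pow)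
    also have "a \<otimes> (c [^] int (p ^ m * w) \<otimes> (\<tau> \<otimes> (c \<otimes> c))) = c \<otimes> a2 [^] \<alpha>" by (rule main_relation)
    finally show ?thesis by (simp add: m_assoc)
  qed
qed simp_all

lemma t2: "ac_pair.t ex ed v K a2 c2 = t"
proof -
  interpret q: ac_pair p m l w ex ed \<alpha> \<beta> S v K a2 c2 by (rule pair2)
  have "int p ^ l dvd int w * geo ed \<beta>" using geo_dvd[OF \<beta>1 ed(1)] by simp
  then have "D [^] (int w * geo ed \<beta>) = \<one>" by (rule D_one)
  then have "c2 [^] int ed = c [^] int ed" unfolding D_c_pow by simp
  moreover have "a2 [^] int ex = a [^] int ex"
  proof -
    have "c [^] int ex = \<one>" using ex(1) by (rule c_one)
    moreover have "a [^] (\<alpha> * geo ex \<alpha>) = a [^] int ex" using geo_ex_cong[OF \<alpha>(2)] by (rule a_cong)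
    ultimately show ?thesis unfolding ac_pow by simp
  qed
  ultimately show ?thesis by (simp only: q.t_def q.\<tau>_def \<tau>_def t_def)
qed

lemma c2_pow_m: "c2 [^] (int p ^ m) = t [^] int w \<otimes> g"
proof -
  have "int p ^ (m + m) dvd geo (p ^ m) \<beta> - int (p ^ m)" using geo_cong[OF \<beta>m, of m "p ^ m"] ml by simp
  then obtain r where "geo (p ^ m) \<beta> - int (p ^ m) = int p ^ (m + m) * r" by (elim dvdE)
  then have r: "geo (p ^ m) \<beta> = int p ^ m * (1 + int p ^ m * r)" by (simp add: power_add algebra_simps)
  have "int w * geo (p ^ m) \<beta> = int p ^ m * (int w + int p ^ m * (int w * r))" by (simp add: r algebra_simps)
  then have "D [^] (int w * geo (p ^ m) \<beta>) = t [^] (int w + int p ^ m * (int w * r))" by (simp only: D_pow_m)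
  also have "\<dots> = t [^] int w" by (rule t_cong) (use p_pow_dvd[OF lm_le_m] in simp)
  finally have "c2 [^] int (p ^ m) = t [^] int w \<otimes> c [^] int (p ^ m)" unfolding D_c_pow by simp
  then show ?thesis by (simp add: g_def)
qed

text \<open>By \<open>c2_pow_m\<close> the right-hand side is D times the a1 formed from the new
  pair, so a D = D a1 persists under the action of b. \<open>c2_D\<close> is the same for c.\<close>

lemma a2_D: "a2 \<otimes> D = D \<otimes> (a2 \<otimes> c2 [^] (int p ^ m) \<otimes> t [^] (int w * S))"
proof -
  let ?z = "t [^] (int w * S)"
  have "a2 \<otimes> D = (a \<otimes> D) \<otimes> c1" using cD by (simp add: m_assoc)
  also have "\<dots> = D \<otimes> (a \<otimes> (g \<otimes> (?z \<otimes> (t [^] int w \<otimes> c))))" unfolding aD by (simp add: m_assoc)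
  also have "?z \<otimes> (t [^] int w \<otimes> c) = c \<otimes> (t [^] int w \<otimes> ?z)"
  proof -
    have "?z \<otimes> (t [^] int w \<otimes> c) = t [^] (int w + int w * S) \<otimes> c"
      by (simp add: m_assoc[symmetric] int_pow_mult[symmetric] add.commute)
    also have "\<dots> = c \<otimes> t [^] (int w + int w * S)" by (rule t_c)
    finally show ?thesis by (simp add: int_pow_mult)
  qed
  also have "g \<otimes> (c \<otimes> (t [^] int w \<otimes> ?z)) = c \<otimes> ((t [^] int w \<otimes> g) \<otimes> ?z)"
    using commute_ext[OF g_c, of "t [^] int w \<otimes> ?z"] t_g[of "int w"] by (simp add: m_assoc)
  finally show ?thesis unfolding c2_pow_m by (simp add: m_assoc)
qed

lemma c2_D: "c2 \<otimes> D = D \<otimes> (t [^] int w \<otimes> c2)"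
proof -
  have "c2 \<otimes> D = D [^] int w \<otimes> (D \<otimes> (t [^] int w \<otimes> c))" using cD by (simp add: m_assoc)
  also have "\<dots> = D \<otimes> (D [^] int w \<otimes> (t [^] int w \<otimes> c))"
    using commute_ext[OF pow_self_commute[OF D, of "int w"], of "t [^] int w \<otimes> c"] by simp
  also have "D [^] int w \<otimes> (t [^] int w \<otimes> c) = t [^] int w \<otimes> (D [^] int w \<otimes> c)"
    using commute_ext[OF commute_pow[OF t_D[symmetric], of "int w" "int w"], of c] by simp
  finally show ?thesis .
qed

end

section \<open>The model group\<close>

context model_params
begin

section \<open>First layer of the model: a and c\<close>

definition "modulus = p ^ (m + l)"
definition "\<sigma>0 x = (\<alpha> * x) mod int modulus"
abbreviation "N0 \<equiv> integer_mod_group modulus"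

lemma modulus_gt_1: "modulus > 1"
  unfolding modulus_def using p_gt_2 ml by (intro one_less_power) auto

lemma carrier_N0: "carrier N0 = {0..<int modulus}"
  using modulus_gt_1 by (simp add: carrier_integer_mod_group)

lemma \<sigma>0_pow: "x \<in> carrier N0 \<Longrightarrow> (\<sigma>0 ^^ k) x = (\<alpha> ^ k * x) mod int modulus"
proof (induction k)
  case (Suc k)
  then show ?case by (simp add: \<sigma>0_def mod_mult_right_eq mult.assoc)
qed (simp add: carrier_N0)

text \<open>With trivial n-th power this is the semidirect product of Z/p^(m+l) with a cyclic group
  of order p^(2m) acting as multiplication by powers of \<alpha>. \<open>N0\<close> is additive, so
  its identity is 0.\<close>

sublocale M: cyclic_extension N0 \<sigma>0 "p ^ (2 * m)" 0
proof -
  interpret N0: group N0 by simp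
  show "cyclic_extension N0 \<sigma>0 (p ^ (2 * m)) 0"
  proof (unfold_locales)
    show "\<sigma>0 \<in> hom N0 N0"
    proof (rule homI)
      fix x y assume "x \<in> carrier N0" "y \<in> carrier N0"
      show "\<sigma>0 x \<in> carrier N0" using modulus_gt_1 by (simp add: carrier_N0 \<sigma>0_def)
      show "\<sigma>0 (x \<otimes>\<^bsub>N0\<^esub> y) = \<sigma>0 x \<otimes>\<^bsub>N0\<^esub> \<sigma>0 y"
        by (simp add: \<sigma>0_def mod_mult_right_eq mod_add_eq distrib_left)
    qed
    show "1 < p ^ (2 * m)" using p_gt_2 ml by (intro one_less_power) auto
    show "0 \<in> carrier N0" by simp
    show "\<sigma>0 0 = 0" by (simp add: \<sigma>0_def)
    fix x assume x: "x \<in> carrier N0"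
    have "int modulus dvd \<alpha> ^ (p ^ (2 * m)) - 1"
      using \<alpha>_pow_cong[of "p ^ (2 * m)" 0] by (simp add: modulus_def)
    then have "int modulus dvd \<alpha> ^ (p ^ (2 * m)) * x - x" by (metis dvd_mult2 left_diff_distrib mult_1)
    then have "(\<alpha> ^ (p ^ (2 * m)) * x) mod int modulus = x mod int modulus" by (simp add: mod_eq_dvd_iff)
    then have "(\<sigma>0 ^^ (p ^ (2 * m))) x = x" using x by (simp add: \<sigma>0_pow carrier_N0)
    then show "0 \<otimes>\<^bsub>N0\<^esub> (\<sigma>0 ^^ (p ^ (2 * m))) x = x \<otimes>\<^bsub>N0\<^esub> 0" by simp
  qed
qed

abbreviation "MM \<equiv> cext N0 \<sigma>0 (p ^ (2 * m)) 0"
definition "aM = M.emb 1"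
definition "cM = M.s"

lemma one_N0: "1 \<in> carrier N0" using modulus_gt_1 by (simp add: carrier_N0)

lemma aM_pow: "aM [^]\<^bsub>MM\<^esub> (i::int) = M.emb (i mod int modulus)"
  unfolding aM_def M.emb.hom_int_pow[OF one_N0, symmetric] by (simp add: int_pow_integer_mod_group)

lemma MM_elem:
  assumes "u \<in> carrier MM"
  obtains i :: nat and j :: int where "u = cM [^]\<^bsub>MM\<^esub> int i \<otimes>\<^bsub>MM\<^esub> aM [^]\<^bsub>MM\<^esub> j"
proof -
  obtain i :: nat and x where "x \<in> carrier N0" "u = M.s [^]\<^bsub>MM\<^esub> i \<otimes>\<^bsub>MM\<^esub> M.emb x" using M.E_cases[OF assms] .
  then have "u = cM [^]\<^bsub>MM\<^esub> int i \<otimes>\<^bsub>MM\<^esub> aM [^]\<^bsub>MM\<^esub> x"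
    by (simp add: cM_def aM_pow carrier_N0 int_pow_int del: pow_nat)
  then show thesis using that by blast
qed

sublocale Mp: ac_pair p m l w ex ed \<alpha> \<beta> S v MM aM cM
proof (unfold_locales)
  show "aM \<in> carrier MM" "cM \<in> carrier MM" using one_N0 by (simp_all add: aM_def cM_def)
  show "aM \<otimes>\<^bsub>MM\<^esub> cM = cM \<otimes>\<^bsub>MM\<^esub> aM [^]\<^bsub>MM\<^esub> \<alpha>"
    unfolding aM_pow unfolding aM_def cM_def M.emb_s[OF one_N0] by (simp add: \<sigma>0_def)
  show "aM [^]\<^bsub>MM\<^esub> (int p ^ (m + l)) = \<one>\<^bsub>MM\<^esub>"
    unfolding aM_pow using M.emb.hom_one by (simp add: modulus_def)
  have "cM [^]\<^bsub>MM\<^esub> int (p ^ (2 * m)) = \<one>\<^bsub>MM\<^esub>"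
    unfolding cM_def int_pow_int M.s_pow_n using M.emb.hom_one by simp
  then show "cM [^]\<^bsub>MM\<^esub> (int p ^ (2 * m)) = \<one>\<^bsub>MM\<^esub>" by simp
qed

lemma MM_indep:
  assumes "cM [^]\<^bsub>MM\<^esub> (i::int) \<otimes>\<^bsub>MM\<^esub> aM [^]\<^bsub>MM\<^esub> (j::int) = \<one>\<^bsub>MM\<^esub>"
  shows "int p ^ (2 * m) dvd i \<and> int p ^ (m + l) dvd j"
proof -
  define k where "k = nat (i mod int (p ^ (2 * m)))"
  have p0: "int (p ^ (2 * m)) > 0" using p_gt_2 by simp
  have ki: "int k = i mod int (p ^ (2 * m))" using p0 by (simp add: k_def)
  have k: "k < p ^ (2 * m)" using p0 ki by (metis of_nat_less_iff pos_mod_bound)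
  have "int p ^ (2 * m) dvd i - int k" unfolding ki by (metis dvd_minus_mod of_nat_power)
  then have "cM [^]\<^bsub>MM\<^esub> i = cM [^]\<^bsub>MM\<^esub> int k" by (rule Mp.c_cong)
  also have "\<dots> = (k, 0)" unfolding cM_def int_pow_int using M.s_pow[OF k] by simp
  finally have "(k, 0) \<otimes>\<^bsub>MM\<^esub> M.emb (j mod int modulus) = \<one>\<^bsub>MM\<^esub>" using assms by (simp add: aM_pow)
  then have "k = 0" "j mod int modulus = 0" using k by (simp_all add: M.emb_def M.E_simps)
  then show ?thesis using ki by (auto simp: modulus_def dvd_eq_mod_eq_0)
qed

text \<open>\<open>MM\<close> is universal for the relations of \<open>ac_pair\<close>; together
  with \<open>MM_hom_eq\<close> this reduces homomorphisms on \<open>MM\<close> to the images of a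
  and c.\<close>

lemma MM_hom:
  assumes "ac_pair p m l w ex ed \<alpha> \<beta> S v K a c"
  obtains F where "F \<in> hom MM K" "F aM = a" "F cM = c"
proof -
  interpret q: ac_pair p m l w ex ed \<alpha> \<beta> S v K a c by fact
  define f where "f = (\<lambda>i::int. a [^]\<^bsub>K\<^esub> i)"
  have fmod: "f (i mod int modulus) = f i" for i
  proof -
    have "int modulus dvd i mod int modulus - i" by (metis dvd_diff_commute dvd_minus_mod)
    then show ?thesis unfolding f_def by (intro q.a_cong) (simp add: modulus_def)
  qed
  have f: "f \<in> hom N0 K"
  proof (rule homI)
    fix x y show "f x \<in> carrier K" by (simp add: f_def)
    show "f (x \<otimes>\<^bsub>N0\<^esub> y) = f x \<otimes>\<^bsub>K\<^esub> f y"
      using fmod[of "x + y"] by (simp add: f_def q.int_pow_mult)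
  qed
  have fs: "f x \<otimes>\<^bsub>K\<^esub> c = c \<otimes>\<^bsub>K\<^esub> f (\<sigma>0 x)" for x
    unfolding \<sigma>0_def fmod using q.a_pow_c_pow[of x 1] by (simp add: f_def mult.commute)
  have "c [^]\<^bsub>K\<^esub> int (p ^ (2 * m)) = \<one>\<^bsub>K\<^esub>" using q.c_ord by simp
  then have st: "c [^]\<^bsub>K\<^esub> (p ^ (2 * m)) = f 0" unfolding int_pow_int by (simp add: f_def)
  obtain F where F: "F \<in> hom MM K" "\<And>x. x \<in> carrier N0 \<Longrightarrow> F (M.emb x) = f x" "F M.s = c"
    using M.hom_extension[OF q.is_group f q.c fs st] by blast
  have "F aM = a" using F(2)[OF one_N0] by (simp add: aM_def f_def)
  then show thesis using that F by (simp add: cM_def)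
qed

lemma MM_hom_eq:
  assumes "F \<in> hom MM K" "F' \<in> hom MM K" "group K" "F aM = F' aM" "F cM = F' cM" "u \<in> carrier MM"
  shows "F u = F' u"
proof -
  interpret K: group K by fact
  interpret F: group_hom MM K F using assms by unfold_locales
  interpret F': group_hom MM K F' using assms by unfold_locales
  obtain i :: nat and j :: int where "u = cM [^]\<^bsub>MM\<^esub> int i \<otimes>\<^bsub>MM\<^esub> aM [^]\<^bsub>MM\<^esub> j"
    using MM_elem[OF assms(6)] .
  then show ?thesis using assms(4,5) by (simp add: F.hom_int_pow F'.hom_int_pow del: pow_nat)
qed

section \<open>Second layer: adjoining d\<close>

definition "\<delta> = (SOME F. F \<in> hom MM MM \<and> F aM = Mp.a1 \<and> F cM = Mp.c1)"

lemma \<delta>: "\<delta> \<in> hom MM MM" "\<delta> aM = Mp.a1" "\<delta> cM = Mp.c1"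
proof -
  obtain F where "F \<in> hom MM MM" "F aM = Mp.a1" "F cM = Mp.c1" using MM_hom[OF Mp.pair1] .
  then have "\<exists>F. F \<in> hom MM MM \<and> F aM = Mp.a1 \<and> F cM = Mp.c1" by blast
  from someI_ex[OF this] show "\<delta> \<in> hom MM MM" "\<delta> aM = Mp.a1" "\<delta> cM = Mp.c1"
    unfolding \<delta>_def by blast+
qed

sublocale \<delta>: group_hom MM MM \<delta>
  by unfold_locales (rule \<delta>)

lemma \<delta>_t: "\<delta> Mp.t = Mp.t"
  using Mp.hom_pair(2)[OF \<delta>(1) M.group_E] Mp.t1 by (simp only: \<delta>)

lemma \<delta>_t_pow: "\<delta> (Mp.t [^]\<^bsub>MM\<^esub> (i::int)) = Mp.t [^]\<^bsub>MM\<^esub> i"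
  by (simp only: \<delta>.hom_int_pow[OF Mp.closed(2)] \<delta>_t)

lemma \<delta>_g: "\<delta> Mp.g = Mp.g"
proof -
  have "\<delta> Mp.g = Mp.c1 [^]\<^bsub>MM\<^esub> (int p ^ m)" unfolding Mp.g_def by (simp only: \<delta>.hom_int_pow[OF Mp.c] \<delta>)
  moreover have "Mp.t [^]\<^bsub>MM\<^esub> (int w * int p ^ m) = \<one>\<^bsub>MM\<^esub>"
    by (rule Mp.t_one) (use p_pow_dvd[OF Mp.lm_le_m] in simp)
  ultimately show ?thesis unfolding Mp.c1_pow by (simp add: Mp.g_def)
qed

text \<open>For k = p^m the extra factors vanish because the orders of g and t divide p^m. So
  \<delta>^(p^m) is the identity, in agreement with conjugation by the central element t.\<close>

lemma \<delta>_pow: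
  "(\<delta> ^^ k) aM = aM \<otimes>\<^bsub>MM\<^esub> (Mp.g [^]\<^bsub>MM\<^esub> int k \<otimes>\<^bsub>MM\<^esub> Mp.t [^]\<^bsub>MM\<^esub> (int w * S * int k))"
  "(\<delta> ^^ k) cM = Mp.t [^]\<^bsub>MM\<^esub> (int w * int k) \<otimes>\<^bsub>MM\<^esub> cM"
proof (induction k)
  case (Suc k)
  let ?g = "Mp.g [^]\<^bsub>MM\<^esub> int k" let ?t = "Mp.t [^]\<^bsub>MM\<^esub> (int w * S * int k)"
  have dg: "\<delta> ?g = ?g" by (simp only: \<delta>.hom_int_pow[OF Mp.closed(3)] \<delta>_g)
  have step: "y [^]\<^bsub>MM\<^esub> int (Suc k) = y \<otimes>\<^bsub>MM\<^esub> y [^]\<^bsub>MM\<^esub> int k" if "y \<in> carrier MM" for y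
    using M.E.int_pow_mult[OF that, of 1 "int k"] that by simp
  have "(\<delta> ^^ Suc k) aM = Mp.a1 \<otimes>\<^bsub>MM\<^esub> (?g \<otimes>\<^bsub>MM\<^esub> ?t)"
    using Suc(1) by (simp add: \<delta>(2) dg \<delta>_t_pow del: pow_nat)
  also have "\<dots> = aM \<otimes>\<^bsub>MM\<^esub> (Mp.g \<otimes>\<^bsub>MM\<^esub> (Mp.t [^]\<^bsub>MM\<^esub> (int w * S) \<otimes>\<^bsub>MM\<^esub> (?g \<otimes>\<^bsub>MM\<^esub> ?t)))"
    by (simp add: M.E.m_assoc)
  also have "Mp.t [^]\<^bsub>MM\<^esub> (int w * S) \<otimes>\<^bsub>MM\<^esub> (?g \<otimes>\<^bsub>MM\<^esub> ?t) = ?g \<otimes>\<^bsub>MM\<^esub> (Mp.t [^]\<^bsub>MM\<^esub> (int w * S) \<otimes>\<^bsub>MM\<^esub> ?t)"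
    using M.E.commute_ext[OF M.E.commute_pow[OF Mp.t_g[of "int w * S", symmetric], of "int k", symmetric], of ?t] by simp
  also have "Mp.t [^]\<^bsub>MM\<^esub> (int w * S) \<otimes>\<^bsub>MM\<^esub> ?t = Mp.t [^]\<^bsub>MM\<^esub> (int w * S * int (Suc k))"
  proof -
    have "int w * S + int w * S * int k = int w * S * int (Suc k)" by (simp add: algebra_simps)
    then show ?thesis by (simp only: M.E.int_pow_mult[OF Mp.closed(2), symmetric])
  qed
  finally show "(\<delta> ^^ Suc k) aM = aM \<otimes>\<^bsub>MM\<^esub> (Mp.g [^]\<^bsub>MM\<^esub> int (Suc k) \<otimes>\<^bsub>MM\<^esub> Mp.t [^]\<^bsub>MM\<^esub> (int w * S * int (Suc k)))"
    by (simp add: step M.E.m_assoc del: of_nat_Suc)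
  have "(\<delta> ^^ Suc k) cM = Mp.t [^]\<^bsub>MM\<^esub> (int w * int k) \<otimes>\<^bsub>MM\<^esub> (Mp.t [^]\<^bsub>MM\<^esub> int w \<otimes>\<^bsub>MM\<^esub> cM)"
    using Suc(2) by (simp add: \<delta>(3) \<delta>_t_pow del: pow_nat)
  also have "\<dots> = Mp.t [^]\<^bsub>MM\<^esub> (int w * int (Suc k)) \<otimes>\<^bsub>MM\<^esub> cM"
  proof -
    have "int w * int k + int w = int w * int (Suc k)" by (simp add: algebra_simps)
    then show ?thesis by (simp only: M.E.int_pow_add_ext[OF Mp.closed(2) Mp.c])
  qed
  finally show "(\<delta> ^^ Suc k) cM = Mp.t [^]\<^bsub>MM\<^esub> (int w * int (Suc k)) \<otimes>\<^bsub>MM\<^esub> cM" .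
qed simp_all

lemma hom_funpow: "F \<in> hom L L \<Longrightarrow> (F ^^ k) \<in> hom L L"
proof (induction k)
  case 0 show ?case by (simp add: hom_def)
next
  case (Suc k)
  have "F \<circ> (F ^^ k) \<in> hom L L" using Suc by (intro Group.hom_compose[of _ L L]) auto
  then show ?case by (simp only: funpow.simps)
qed

lemma pm_gt_1: "1 < p ^ m" using p_gt_2 ml by (intro one_less_power) auto

sublocale H: cyclic_extension MM \<delta> "p ^ m" Mp.t
proof (unfold_locales)
  show "\<delta> \<in> hom MM MM" by (rule \<delta>)
  show "1 < p ^ m" by (rule pm_gt_1)
  show "Mp.t \<in> carrier MM" by simp
  show "\<delta> Mp.t = Mp.t" by (rule \<delta>_t)
  fix u assume u: "u \<in> carrier MM"
  have g1: "Mp.g [^]\<^bsub>MM\<^esub> int (p ^ m) = \<one>\<^bsub>MM\<^esub>" by (rule Mp.g_one) simp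
  have t1: "Mp.t [^]\<^bsub>MM\<^esub> (i * int (p ^ m)) = \<one>\<^bsub>MM\<^esub>" for i :: int
    by (rule Mp.t_one) (use p_pow_dvd[OF Mp.lm_le_m] in simp)
  have "(\<delta> ^^ (p ^ m)) aM = aM" "(\<delta> ^^ (p ^ m)) cM = cM"
    unfolding \<delta>_pow g1 t1 by simp_all
  moreover have "(\<lambda>x. x) \<in> hom MM MM" by (simp add: hom_def)
  ultimately have "(\<delta> ^^ (p ^ m)) u = u"
    using MM_hom_eq[OF hom_funpow[OF \<delta>(1)] _ M.group_E _ _ u, of "\<lambda>x. x"] by simp
  moreover have "Mp.t \<otimes>\<^bsub>MM\<^esub> u = u \<otimes>\<^bsub>MM\<^esub> Mp.t"
  proof -
    obtain i :: nat and j :: int where ij: "u = cM [^]\<^bsub>MM\<^esub> int i \<otimes>\<^bsub>MM\<^esub> aM [^]\<^bsub>MM\<^esub> j" using MM_elem[OF u] .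
    have "Mp.t \<otimes>\<^bsub>MM\<^esub> cM = cM \<otimes>\<^bsub>MM\<^esub> Mp.t" "Mp.t \<otimes>\<^bsub>MM\<^esub> aM = aM \<otimes>\<^bsub>MM\<^esub> Mp.t"
      using Mp.t_c[of 1] Mp.t_a[of 1] by simp_all
    then have "Mp.t \<otimes>\<^bsub>MM\<^esub> cM [^]\<^bsub>MM\<^esub> int i = cM [^]\<^bsub>MM\<^esub> int i \<otimes>\<^bsub>MM\<^esub> Mp.t"
      "Mp.t \<otimes>\<^bsub>MM\<^esub> aM [^]\<^bsub>MM\<^esub> j = aM [^]\<^bsub>MM\<^esub> j \<otimes>\<^bsub>MM\<^esub> Mp.t"
      using M.E.commute_pow[of cM Mp.t "int i"] M.E.commute_pow[of aM Mp.t j] by simp_all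
    from M.E.commute_mult[OF this] show ?thesis by (simp only: ij Mp.closed Mp.a Mp.c M.E.int_pow_closed)
  qed
  ultimately show "Mp.t \<otimes>\<^bsub>MM\<^esub> (\<delta> ^^ (p ^ m)) u = u \<otimes>\<^bsub>MM\<^esub> Mp.t" by simp
qed

abbreviation "HH \<equiv> cext MM \<delta> (p ^ m) Mp.t"
definition "aH = H.emb aM"
definition "cH = H.emb cM"
definition "dH = H.s"

lemma Hp_pair: "ac_pair p m l w ex ed \<alpha> \<beta> S v HH aH cH" and Hp_t: "ac_pair.t ex ed v HH aH cH = H.emb Mp.t"
  unfolding aH_def cH_def by (rule Mp.hom_pair[OF H.emb_hom H.group_E])+

sublocale Hq: ac_pair p m l w ex ed \<alpha> \<beta> S v HH aH cH by (rule Hp_pair)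

lemma emb_t_pow: "H.emb (Mp.t [^]\<^bsub>MM\<^esub> (i::int)) = Hq.t [^]\<^bsub>HH\<^esub> i"
  unfolding Hp_t by (rule H.emb.hom_int_pow) simp

sublocale Hp: acd_triple p m l w ex ed \<alpha> \<beta> S v HH aH cH dH
proof (unfold_locales)
  show "dH \<in> carrier HH" by (simp add: dH_def)
  have "H.emb Mp.g = Hq.g" unfolding Hq.g_def unfolding Mp.g_def cH_def by (rule H.emb.hom_int_pow) simp
  then have "H.emb (\<delta> aM) = Hq.a1" unfolding \<delta>
    by (simp add: emb_t_pow del: pow_nat) (simp add: aH_def)
  then show "aH \<otimes>\<^bsub>HH\<^esub> dH = dH \<otimes>\<^bsub>HH\<^esub> Hq.a1" using H.emb_s[of aM] by (simp add: aH_def dH_def)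
  have "H.emb (\<delta> cM) = Hq.c1" unfolding \<delta> by (simp add: emb_t_pow del: pow_nat) (simp add: cH_def)
  then show "cH \<otimes>\<^bsub>HH\<^esub> dH = dH \<otimes>\<^bsub>HH\<^esub> Hq.c1" using H.emb_s[of cM] by (simp add: cH_def dH_def)
  have "dH [^]\<^bsub>HH\<^esub> int (p ^ m) = Hq.t" unfolding int_pow_int Hp_t dH_def by (rule H.s_pow_n)
  then show "dH [^]\<^bsub>HH\<^esub> (int p ^ m) = Hq.t" by simp
qed

section \<open>Third layer: adjoining b\<close>

lemma \<sigma>b_exists: "\<exists>F. F \<in> hom HH HH \<and> F aH = Hp.a2 \<and> F cH = Hp.c2 \<and> F dH = dH"
proof -
  obtain f where f: "f \<in> hom MM HH" "f aM = Hp.a2" "f cM = Hp.c2" using MM_hom[OF Hp.pair2] .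
  interpret f: group_hom MM HH f using f by unfold_locales
  have ft: "f Mp.t = Hq.t" using Mp.hom_pair(2)[OF f(1) H.group_E] Hp.t2 by (simp only: f)
  have ftp: "f (Mp.t [^]\<^bsub>MM\<^esub> (i::int)) = Hq.t [^]\<^bsub>HH\<^esub> i" for i
    by (simp only: f.hom_int_pow[OF Mp.closed(2)] ft)
  have fs: "f x \<otimes>\<^bsub>HH\<^esub> dH = dH \<otimes>\<^bsub>HH\<^esub> f (\<delta> x)" if x: "x \<in> carrier MM" for x
  proof -
    \<comment> \<open>x -> d^(-1) f(x) d and x -> f(\<delta> x) are homomorphisms on
      \<open>MM\<close>, so they need only be compared on a and c, where \<open>a2_D\<close> and
      \<open>c2_D\<close> say that they agree.\<close>
    define f' where "f' = (\<lambda>x. inv\<^bsub>HH\<^esub> dH \<otimes>\<^bsub>HH\<^esub> (f x \<otimes>\<^bsub>HH\<^esub> dH))"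
    have f': "f' \<in> hom MM HH"
      by (rule homI) (simp_all add: f'_def H.E.m_assoc)
    have f\<delta>: "f \<circ> \<delta> \<in> hom MM HH" by (rule Group.hom_compose[OF \<delta>(1) f(1)])
    have "f (\<delta> aM) = Hp.a2 \<otimes>\<^bsub>HH\<^esub> Hp.c2 [^]\<^bsub>HH\<^esub> (int p ^ m) \<otimes>\<^bsub>HH\<^esub> Hq.t [^]\<^bsub>HH\<^esub> (int w * S)"
      unfolding \<delta> Mp.g_def by (simp only: f.hom_mult f.hom_int_pow Mp.a Mp.c Mp.closed M.E.int_pow_closed M.E.m_closed f ft)
    then have 1: "f' aM = (f \<circ> \<delta>) aM" using Hp.a2_D by (simp add: f'_def f(2))
    have "f (\<delta> cM) = Hq.t [^]\<^bsub>HH\<^esub> int w \<otimes>\<^bsub>HH\<^esub> Hp.c2"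
      unfolding \<delta> by (simp only: f.hom_mult f.hom_int_pow Mp.a Mp.c Mp.closed M.E.int_pow_closed M.E.m_closed f ft)
    then have 2: "f' cM = (f \<circ> \<delta>) cM" using Hp.c2_D by (simp add: f'_def f(3))
    have "f' x = (f \<circ> \<delta>) x" by (rule MM_hom_eq[OF f' f\<delta> H.group_E 1 2 x])
    then have "dH \<otimes>\<^bsub>HH\<^esub> f' x = dH \<otimes>\<^bsub>HH\<^esub> f (\<delta> x)" by simp
    then show ?thesis using x by (simp add: f'_def)
  qed
  have st: "dH [^]\<^bsub>HH\<^esub> (p ^ m) = f Mp.t" unfolding ft Hp_t dH_def by (rule H.s_pow_n)
  obtain F where "F \<in> hom HH HH" "\<And>x. x \<in> carrier MM \<Longrightarrow> F (H.emb x) = f x" "F H.s = dH"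
    using H.hom_extension[OF H.group_E f(1) Hp.D fs st] by blast
  then have "F \<in> hom HH HH \<and> F aH = Hp.a2 \<and> F cH = Hp.c2 \<and> F dH = dH"
    using f by (simp add: aH_def cH_def dH_def)
  then show ?thesis by blast
qed

definition "\<sigma>b = (SOME F. F \<in> hom HH HH \<and> F aH = Hp.a2 \<and> F cH = Hp.c2 \<and> F dH = dH)"

lemma \<sigma>b: "\<sigma>b \<in> hom HH HH" "\<sigma>b aH = Hp.a2" "\<sigma>b cH = Hp.c2" "\<sigma>b dH = dH"
  using someI_ex[OF \<sigma>b_exists] unfolding \<sigma>b_def by blast+

sublocale \<sigma>b: group_hom HH HH \<sigma>b
  by unfold_locales (rule \<sigma>b)

lemma HH_elem:
  assumes "u \<in> carrier HH"
  obtains k i :: nat and j :: int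
  where "u = dH [^]\<^bsub>HH\<^esub> int k \<otimes>\<^bsub>HH\<^esub> (cH [^]\<^bsub>HH\<^esub> int i \<otimes>\<^bsub>HH\<^esub> aH [^]\<^bsub>HH\<^esub> j)"
proof -
  obtain k :: nat and x where kx: "x \<in> carrier MM" "u = H.s [^]\<^bsub>HH\<^esub> k \<otimes>\<^bsub>HH\<^esub> H.emb x" using H.E_cases[OF assms] .
  obtain i :: nat and j :: int where "x = cM [^]\<^bsub>MM\<^esub> int i \<otimes>\<^bsub>MM\<^esub> aM [^]\<^bsub>MM\<^esub> j" using MM_elem[OF kx(1)] .
  then have "H.emb x = cH [^]\<^bsub>HH\<^esub> int i \<otimes>\<^bsub>HH\<^esub> aH [^]\<^bsub>HH\<^esub> j"
    by (simp only: H.emb.hom_mult H.emb.hom_int_pow Mp.a Mp.c M.E.int_pow_closed aH_def cH_def)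
  then show thesis using that kx(2) by (simp add: dH_def int_pow_int del: pow_nat)
qed

lemma \<sigma>b_d_pow: "(\<sigma>b ^^ k) (dH [^]\<^bsub>HH\<^esub> (i::int)) = dH [^]\<^bsub>HH\<^esub> i"
proof (induction k)
  case (Suc k)
  have "\<sigma>b (dH [^]\<^bsub>HH\<^esub> i) = dH [^]\<^bsub>HH\<^esub> i" by (simp only: \<sigma>b.hom_int_pow[OF Hp.D] \<sigma>b)
  then show ?case using Suc by simp
qed simp

lemma \<sigma>b_c: "(\<sigma>b ^^ k) cH = dH [^]\<^bsub>HH\<^esub> (int w * int k) \<otimes>\<^bsub>HH\<^esub> cH"
proof (induction k)
  case (Suc k)
  have "\<sigma>b (dH [^]\<^bsub>HH\<^esub> (int w * int k)) = dH [^]\<^bsub>HH\<^esub> (int w * int k)" using \<sigma>b_d_pow[of 1] by simp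
  then have "(\<sigma>b ^^ Suc k) cH = dH [^]\<^bsub>HH\<^esub> (int w * int k) \<otimes>\<^bsub>HH\<^esub> (dH [^]\<^bsub>HH\<^esub> int w \<otimes>\<^bsub>HH\<^esub> cH)"
    using Suc by (simp add: \<sigma>b(3) del: pow_nat)
  also have "\<dots> = dH [^]\<^bsub>HH\<^esub> (int w * int (Suc k)) \<otimes>\<^bsub>HH\<^esub> cH"
  proof -
    have "int w * int k + int w = int w * int (Suc k)" by (simp add: algebra_simps)
    then show ?thesis by (simp only: H.E.int_pow_add_ext[OF Hp.D Hq.c])
  qed
  finally show ?case .
qed simp

text \<open>Each step contributes the k-th image d^(w k) c of c. Moving d^(w k) to the left past c^k
  multiplies its exponent by \<beta>^k; this is the origin of the sum of i \<beta>^i.\<close>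

lemma \<sigma>b_a: "(\<sigma>b ^^ k) aH = aH \<otimes>\<^bsub>HH\<^esub> (dH [^]\<^bsub>HH\<^esub> (int w * (\<Sum>i<k. int i * \<beta> ^ i)) \<otimes>\<^bsub>HH\<^esub> cH [^]\<^bsub>HH\<^esub> int k)"
proof (induction k)
  case (Suc k)
  let ?s = "int w * (\<Sum>i<k. int i * \<beta> ^ i)"
  have step: "cH [^]\<^bsub>HH\<^esub> int (Suc k) = cH [^]\<^bsub>HH\<^esub> int k \<otimes>\<^bsub>HH\<^esub> cH"
    using H.E.int_pow_mult[OF Hq.c, of "int k" 1] by (simp add: add.commute)
  have "(\<sigma>b ^^ Suc k) aH = (\<sigma>b ^^ k) (\<sigma>b aH)" by (simp only: funpow_Suc_right comp_apply)
  also have "\<dots> = (\<sigma>b ^^ k) aH \<otimes>\<^bsub>HH\<^esub> (\<sigma>b ^^ k) cH"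
    unfolding \<sigma>b(2) by (rule hom_mult[OF hom_funpow[OF \<sigma>b(1)]]) simp_all
  also have "\<dots> = aH \<otimes>\<^bsub>HH\<^esub> (dH [^]\<^bsub>HH\<^esub> ?s \<otimes>\<^bsub>HH\<^esub> (cH [^]\<^bsub>HH\<^esub> int k \<otimes>\<^bsub>HH\<^esub> (dH [^]\<^bsub>HH\<^esub> (int w * int k) \<otimes>\<^bsub>HH\<^esub> cH)))"
    unfolding Suc \<sigma>b_c by (simp add: H.E.m_assoc)
  also have "cH [^]\<^bsub>HH\<^esub> int k \<otimes>\<^bsub>HH\<^esub> (dH [^]\<^bsub>HH\<^esub> (int w * int k) \<otimes>\<^bsub>HH\<^esub> cH)
      = dH [^]\<^bsub>HH\<^esub> (int w * int k * \<beta> ^ k) \<otimes>\<^bsub>HH\<^esub> cH [^]\<^bsub>HH\<^esub> int (Suc k)"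
    unfolding step using H.E.commute_ext[OF Hp.c_pow_D_pow, where w = cH] by simp
  also have "dH [^]\<^bsub>HH\<^esub> ?s \<otimes>\<^bsub>HH\<^esub> (dH [^]\<^bsub>HH\<^esub> (int w * int k * \<beta> ^ k) \<otimes>\<^bsub>HH\<^esub> cH [^]\<^bsub>HH\<^esub> int (Suc k))
      = dH [^]\<^bsub>HH\<^esub> (?s + int w * int k * \<beta> ^ k) \<otimes>\<^bsub>HH\<^esub> cH [^]\<^bsub>HH\<^esub> int (Suc k)"
    by (rule H.E.int_pow_add_ext) simp_all
  also have "?s + int w * int k * \<beta> ^ k = int w * (\<Sum>i<Suc k. int i * \<beta> ^ i)" by (simp add: algebra_simps)
  finally show ?case .
qed simp

text \<open>The p^m-th iterate of \<sigma>b sends a to a1 and c to c1 and fixes d, which is exactly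
  conjugation by d.\<close>

sublocale J: cyclic_extension HH \<sigma>b "p ^ m" dH
proof (unfold_locales)
  show "\<sigma>b \<in> hom HH HH" by (rule \<sigma>b)
  show "1 < p ^ m" by (rule pm_gt_1)
  show "dH \<in> carrier HH" by (rule Hp.D)
  show "\<sigma>b dH = dH" by (rule \<sigma>b)
  fix u assume u: "u \<in> carrier HH"
  let ?F = "\<sigma>b ^^ (p ^ m)"
  have Fh: "?F \<in> hom HH HH" by (rule hom_funpow[OF \<sigma>b(1)])
  interpret F: group_hom HH HH ?F using Fh by unfold_locales
  have Fa: "dH \<otimes>\<^bsub>HH\<^esub> ?F aH = aH \<otimes>\<^bsub>HH\<^esub> dH"
  proof -
    have "dH [^]\<^bsub>HH\<^esub> (int w * (int p ^ m * S)) = Hq.t [^]\<^bsub>HH\<^esub> (int w * S)"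
      using Hp.D_pow_m[of "int w * S"] by (simp add: mult.left_commute)
    moreover have "cH [^]\<^bsub>HH\<^esub> int (p ^ m) = Hq.g" by (simp add: Hq.g_def)
    ultimately have "?F aH = aH \<otimes>\<^bsub>HH\<^esub> (Hq.t [^]\<^bsub>HH\<^esub> (int w * S) \<otimes>\<^bsub>HH\<^esub> Hq.g)"
      unfolding \<sigma>b_a S by (simp only:)
    also have "\<dots> = Hq.a1" using Hq.t_g by (simp add: H.E.m_assoc)
    finally show ?thesis using Hp.aD by simp
  qed
  have Fc: "dH \<otimes>\<^bsub>HH\<^esub> ?F cH = cH \<otimes>\<^bsub>HH\<^esub> dH"
  proof -
    have "?F cH = Hq.c1" unfolding \<sigma>b_c using Hp.D_pow_m[of "int w"] by (simp add: mult.commute)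
    then show ?thesis using Hp.cD by simp
  qed
  obtain k i :: nat and j :: int
    where kij: "u = dH [^]\<^bsub>HH\<^esub> int k \<otimes>\<^bsub>HH\<^esub> (cH [^]\<^bsub>HH\<^esub> int i \<otimes>\<^bsub>HH\<^esub> aH [^]\<^bsub>HH\<^esub> j)"
    using HH_elem[OF u] .
  have 1: "aH [^]\<^bsub>HH\<^esub> j \<otimes>\<^bsub>HH\<^esub> dH = dH \<otimes>\<^bsub>HH\<^esub> ?F (aH [^]\<^bsub>HH\<^esub> j)"
    unfolding F.hom_int_pow[OF Hq.a] by (rule H.E.conj_int_pow[OF Fa[symmetric]]) simp_all
  have 2: "cH [^]\<^bsub>HH\<^esub> int i \<otimes>\<^bsub>HH\<^esub> dH = dH \<otimes>\<^bsub>HH\<^esub> ?F (cH [^]\<^bsub>HH\<^esub> int i)"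
    unfolding F.hom_int_pow[OF Hq.c] by (rule H.E.conj_int_pow[OF Fc[symmetric]]) simp_all
  have 3: "dH [^]\<^bsub>HH\<^esub> int k \<otimes>\<^bsub>HH\<^esub> dH = dH \<otimes>\<^bsub>HH\<^esub> ?F (dH [^]\<^bsub>HH\<^esub> int k)"
    unfolding \<sigma>b_d_pow by (rule Hq.pow_self_commute) simp
  have 4: "(y \<otimes>\<^bsub>HH\<^esub> z) \<otimes>\<^bsub>HH\<^esub> dH = dH \<otimes>\<^bsub>HH\<^esub> ?F (y \<otimes>\<^bsub>HH\<^esub> z)"
    if "y \<otimes>\<^bsub>HH\<^esub> dH = dH \<otimes>\<^bsub>HH\<^esub> ?F y" "z \<otimes>\<^bsub>HH\<^esub> dH = dH \<otimes>\<^bsub>HH\<^esub> ?F z" "y \<in> carrier HH" "z \<in> carrier HH" for y z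
  proof -
    have "(y \<otimes>\<^bsub>HH\<^esub> z) \<otimes>\<^bsub>HH\<^esub> dH = y \<otimes>\<^bsub>HH\<^esub> (z \<otimes>\<^bsub>HH\<^esub> dH)" using that(3,4) by (simp add: H.E.m_assoc)
    also have "\<dots> = (y \<otimes>\<^bsub>HH\<^esub> dH) \<otimes>\<^bsub>HH\<^esub> ?F z" unfolding that(2) using that(3,4) by (simp add: H.E.m_assoc)
    also have "\<dots> = dH \<otimes>\<^bsub>HH\<^esub> ?F (y \<otimes>\<^bsub>HH\<^esub> z)" unfolding that(1) using that(3,4) by (simp add: H.E.m_assoc)
    finally show ?thesis .
  qed
  have "u \<otimes>\<^bsub>HH\<^esub> dH = dH \<otimes>\<^bsub>HH\<^esub> ?F u" unfolding kij by (intro 4 1 2 3) simp_all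
  then show "dH \<otimes>\<^bsub>HH\<^esub> ?F u = u \<otimes>\<^bsub>HH\<^esub> dH" by simp
qed

end

section \<open>Orders and nilpotency class of the model\<close>

fun ucs :: "('a, 'b) monoid_scheme \<Rightarrow> nat \<Rightarrow> 'a set" where
  "ucs G 0 = {\<one>\<^bsub>G\<^esub>}"
| "ucs G (Suc n) = {x \<in> carrier G. \<forall>y \<in> carrier G. x \<otimes>\<^bsub>G\<^esub> y \<otimes>\<^bsub>G\<^esub> inv\<^bsub>G\<^esub> x \<otimes>\<^bsub>G\<^esub> inv\<^bsub>G\<^esub> y \<in> ucs G n}"

context group
begin

text \<open>For normal N the elements commuting with x modulo N form a subgroup, since [x, y z] is
  [x,y] times a conjugate of [x,z]; so a generating set decides.\<close>

lemma commutator_mem_subgroup: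
  assumes N: "N \<lhd> G" and S: "S \<subseteq> carrier G" and x: "x \<in> carrier G" and y: "y \<in> generate G S"
    and c: "\<And>s. s \<in> S \<Longrightarrow> x \<otimes> s \<otimes> inv x \<otimes> inv s \<in> N"
  shows "x \<otimes> y \<otimes> inv x \<otimes> inv y \<in> N"
proof -
  interpret N: normal N G by fact
  have conj: "g \<otimes> n \<otimes> inv g \<in> N" "inv g \<otimes> n \<otimes> g \<in> N" if "n \<in> N" "g \<in> carrier G" for n g
    using that N.inv_op_closed1 N.inv_op_closed2 by auto
  have inv_case: "x \<otimes> inv y \<otimes> inv x \<otimes> inv (inv y) \<in> N"
    if "x \<otimes> y \<otimes> inv x \<otimes> inv y \<in> N" "y \<in> carrier G" for y
  proof -
    have "inv y \<otimes> inv (x \<otimes> y \<otimes> inv x \<otimes> inv y) \<otimes> y \<in> N" using that conj by simp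
    moreover have "inv y \<otimes> inv (x \<otimes> y \<otimes> inv x \<otimes> inv y) \<otimes> y = x \<otimes> inv y \<otimes> inv x \<otimes> inv (inv y)"
      using that x by (simp add: inv_mult_group m_assoc)
    ultimately show ?thesis by simp
  qed
  from y show ?thesis
  proof (induction rule: generate.induct)
    case one show ?case using x by simp
  next
    case (incl h) then show ?case using c by simp
  next
    case (inv h) then show ?case using c S inv_case by blast
  next
    case (eng y z)
    have yz: "y \<in> carrier G" "z \<in> carrier G" using eng generate_in_carrier S by auto
    have "(x \<otimes> y \<otimes> inv x \<otimes> inv y) \<otimes> (y \<otimes> (x \<otimes> z \<otimes> inv x \<otimes> inv z) \<otimes> inv y) \<in> N"
      using eng yz conj by simp
    moreover have "(x \<otimes> y \<otimes> inv x \<otimes> inv y) \<otimes> (y \<otimes> (x \<otimes> z \<otimes> inv x \<otimes> inv z) \<otimes> inv y)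
        = x \<otimes> (y \<otimes> z) \<otimes> inv x \<otimes> inv (y \<otimes> z)"
      using x yz by (simp add: inv_mult_group m_assoc)
    ultimately show ?case by simp
  qed
qed

lemma ucs_normal: "ucs G n \<lhd> G"
proof (induction n)
  case 0
  show ?case by (simp add: normal_inv_iff triv_subgroup)
next
  case (Suc n)
  interpret N: normal "ucs G n" G by (rule Suc)
  have conj: "g \<otimes> k \<otimes> inv g \<in> ucs G n" "inv g \<otimes> k \<otimes> g \<in> ucs G n" if "k \<in> ucs G n" "g \<in> carrier G" for k g
    using that N.inv_op_closed1 N.inv_op_closed2 by auto
  show ?case unfolding normal_inv_iff
  proof (intro conjI ballI)
    show "subgroup (ucs G (Suc n)) G"
    proof
      show "ucs G (Suc n) \<subseteq> carrier G" by auto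
      show "\<one> \<in> ucs G (Suc n)" by simp
      fix x assume x: "x \<in> ucs G (Suc n)"
      then have xc: "x \<in> carrier G" by simp
      show "inv x \<in> ucs G (Suc n)"
      proof (simp add: xc, intro ballI)
        fix y assume y: "y \<in> carrier G"
        have "inv x \<otimes> inv (x \<otimes> y \<otimes> inv x \<otimes> inv y) \<otimes> x \<in> ucs G n" using x y xc conj by simp
        moreover have "inv x \<otimes> inv (x \<otimes> y \<otimes> inv x \<otimes> inv y) \<otimes> x = inv x \<otimes> y \<otimes> x \<otimes> inv y"
          using xc y by (simp add: inv_mult_group m_assoc)
        ultimately show "inv x \<otimes> y \<otimes> x \<otimes> inv y \<in> ucs G n" by simp
      qed
      fix x' assume x': "x' \<in> ucs G (Suc n)"
      then have xc': "x' \<in> carrier G" by simp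
      show "x \<otimes> x' \<in> ucs G (Suc n)"
      proof (simp add: xc xc', intro ballI)
        fix y assume y: "y \<in> carrier G"
        have "(x \<otimes> (x' \<otimes> y \<otimes> inv x' \<otimes> inv y) \<otimes> inv x) \<otimes> (x \<otimes> y \<otimes> inv x \<otimes> inv y) \<in> ucs G n"
          using x x' y xc conj by simp
        moreover have "(x \<otimes> (x' \<otimes> y \<otimes> inv x' \<otimes> inv y) \<otimes> inv x) \<otimes> (x \<otimes> y \<otimes> inv x \<otimes> inv y)
            = x \<otimes> x' \<otimes> y \<otimes> inv (x \<otimes> x') \<otimes> inv y"
          using xc xc' y by (simp add: inv_mult_group m_assoc)
        ultimately show "x \<otimes> x' \<otimes> y \<otimes> inv (x \<otimes> x') \<otimes> inv y \<in> ucs G n" by simp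
      qed
    qed
    fix g x assume g: "g \<in> carrier G" and x: "x \<in> ucs G (Suc n)"
    then have xc: "x \<in> carrier G" by simp
    show "g \<otimes> x \<otimes> inv g \<in> ucs G (Suc n)"
    proof (simp add: xc g, intro ballI)
      fix y assume y: "y \<in> carrier G"
      define y' where "y' = inv g \<otimes> y \<otimes> g"
      have y': "y' \<in> carrier G" using g y by (simp add: y'_def)
      have "g \<otimes> (x \<otimes> y' \<otimes> inv x \<otimes> inv y') \<otimes> inv g \<in> ucs G n" using x y' g conj by simp
      moreover have "g \<otimes> (x \<otimes> y' \<otimes> inv x \<otimes> inv y') \<otimes> inv g
          = g \<otimes> x \<otimes> inv g \<otimes> y \<otimes> inv (g \<otimes> x \<otimes> inv g) \<otimes> inv y"
        using xc g y by (simp add: y'_def inv_mult_group m_assoc)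
      ultimately show "g \<otimes> x \<otimes> inv g \<otimes> y \<otimes> inv (g \<otimes> x \<otimes> inv g) \<otimes> inv y \<in> ucs G n" by simp
    qed
  qed
qed

lemma ucs_subgroup: "subgroup (ucs G n) G"
  using ucs_normal normal_inv_iff by blast

lemma ucs_mono: "ucs G n \<subseteq> ucs G (Suc n)"
proof
  fix x assume x: "x \<in> ucs G n"
  interpret N: normal "ucs G n" G by (rule ucs_normal)
  have xc: "x \<in> carrier G" using x by auto
  show "x \<in> ucs G (Suc n)"
  proof (simp add: xc, intro ballI)
    fix y assume y: "y \<in> carrier G"
    have "x \<otimes> (y \<otimes> inv x \<otimes> inv y) \<in> ucs G n" using x y N.inv_op_closed2 by auto
    then show "x \<otimes> y \<otimes> inv x \<otimes> inv y \<in> ucs G n" using xc y by (simp add: m_assoc)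
  qed
qed

text \<open>Relations in the model have the form x s = s (x z). This z is a conjugate of the
  commutator used in \<open>ucs\<close>, and the terms of the series are normal.\<close>

lemma ucs_SucI:
  assumes gen: "generate G {a, b} = carrier G" and abx: "a \<in> carrier G" "b \<in> carrier G" "x \<in> carrier G"
    and xa: "x \<otimes> a = a \<otimes> (x \<otimes> z)" "z \<in> ucs G n" and xb: "x \<otimes> b = b \<otimes> (x \<otimes> z')" "z' \<in> ucs G n"
  shows "x \<in> ucs G (Suc n)"
proof -
  interpret N: normal "ucs G n" G by (rule ucs_normal)
  have comm: "x \<otimes> s \<otimes> inv x \<otimes> inv s \<in> ucs G n" if "x \<otimes> s = s \<otimes> (x \<otimes> z)" "z \<in> ucs G n" "s \<in> carrier G" for s z
  proof -
    have "(s \<otimes> x) \<otimes> z \<otimes> inv (s \<otimes> x) \<in> ucs G n" using that abx by (intro N.inv_op_closed2) auto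
    moreover have "z \<in> carrier G" using that by auto
    ultimately show ?thesis using that abx by (simp add: inv_mult_group m_assoc)
  qed
  have "x \<otimes> s \<otimes> inv x \<otimes> inv s \<in> ucs G n" if "s \<in> {a, b}" for s
    using that comm[OF xa] comm[OF xb] abx by auto
  then show ?thesis using commutator_mem_subgroup[OF ucs_normal, of "{a, b}" x] abx gen by auto
qed

lemma lcs_subgroup: "subgroup (lcs G n) G"
proof (induction n)
  case 0 show ?case by (simp add: subgroup_self)
next
  case (Suc n)
  have "lcs G n \<subseteq> carrier G" using Suc subgroup.subset by blast
  then show ?case unfolding lcs.simps by (intro generate_is_subgroup) auto
qed

lemma lcs_subset_ucs:
  assumes "ucs G k = carrier G" "n \<le> k" shows "lcs G n \<subseteq> ucs G (k - n)"
  using assms(2)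
proof (induction n)
  case 0 then show ?case using assms by simp
next
  case (Suc n)
  have e: "k - n = Suc (k - Suc n)" using Suc.prems by simp
  have "lcs G n \<subseteq> ucs G (Suc (k - Suc n))" using Suc e by simp
  then show ?case unfolding lcs.simps by (intro generate_subgroup_incl[OF _ ucs_subgroup]) auto
qed

text \<open>The commutators of \<open>lcs\<close> are x y x^(-1) y^(-1); inserting inverses gives
  the convention in which C = [A,B].\<close>

lemma lcs_commutator:
  assumes "x \<in> lcs G n" "y \<in> carrier G" shows "inv x \<otimes> inv y \<otimes> x \<otimes> y \<in> lcs G (Suc n)"
proof -
  interpret L: subgroup "lcs G n" G by (rule lcs_subgroup)
  have "inv x \<otimes> inv y \<otimes> inv (inv x) \<otimes> inv (inv y) \<in> lcs G (Suc n)"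
    unfolding lcs.simps using assms by (intro generate.incl) blast
  then show ?thesis using assms by simp
qed

lemma lcs_one_Suc: "lcs G n = {\<one>} \<Longrightarrow> lcs G (Suc n) = {\<one>}"
proof -
  assume l: "lcs G n = {\<one>}"
  have "{x \<otimes> y \<otimes> inv x \<otimes> inv y | x y. x \<in> lcs G n \<and> y \<in> carrier G} \<subseteq> {\<one>}"
  proof clarify
    fix x y assume "x \<in> lcs G n" and y: "y \<in> carrier G"
    then have "x = \<one>" by (simp only: l singleton_iff)
    then show "x \<otimes> y \<otimes> inv x \<otimes> inv y = \<one>" using y by simp
  qed
  then have "lcs G (Suc n) \<subseteq> {\<one>}"
    unfolding lcs.simps by (intro generate_subgroup_incl triv_subgroup)
  then show ?thesis using subgroup.one_closed[OF lcs_subgroup] by blast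
qed

lemma nil_class_eqI:
  assumes "ucs G (Suc n) = carrier G" "x \<in> lcs G n" "x \<noteq> \<one>"
  shows "nil_class G = Suc n"
  unfolding nil_class_def
proof (rule Least_equality)
  have "lcs G (Suc n) \<subseteq> ucs G (Suc n - Suc n)" using assms(1) by (intro lcs_subset_ucs) simp_all
  then show "lcs G (Suc n) = {\<one>}" using subgroup.one_closed[OF lcs_subgroup] by fastforce
  fix k assume k: "lcs G k = {\<one>}"
  show "Suc n \<le> k"
  proof (rule ccontr)
    assume "\<not> Suc n \<le> k"
    then have "k \<le> n" by simp
    then have "lcs G n = {\<one>}" by (induction rule: dec_induct) (use k lcs_one_Suc in auto)
    then show False using assms by simp
  qed
qed

end

section \<open>The finished model: relations, orders, class\<close>

context model_params
begin

abbreviation "JJ \<equiv> cext HH \<sigma>b (p ^ m) dH"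
definition "aJ = J.emb aH"
definition "cJ = J.emb cH"
definition "dJ = J.emb dH"
definition "bJ = J.s"

lemma Jp_pair: "ac_pair p m l w ex ed \<alpha> \<beta> S v JJ aJ cJ" and Jp_t: "ac_pair.t ex ed v JJ aJ cJ = J.emb Hq.t"
  unfolding aJ_def cJ_def by (rule Hq.hom_pair[OF J.emb_hom J.group_E])+

sublocale Jq: ac_pair p m l w ex ed \<alpha> \<beta> S v JJ aJ cJ by (rule Jp_pair)

lemma J_emb_t_pow: "J.emb (Hq.t [^]\<^bsub>HH\<^esub> (i::int)) = Jq.t [^]\<^bsub>JJ\<^esub> i"
  unfolding Jp_t by (rule J.emb.hom_int_pow) simp

lemma J_emb_g: "J.emb Hq.g = Jq.g"
  unfolding Jq.g_def unfolding Hq.g_def cJ_def by (rule J.emb.hom_int_pow) simp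

sublocale Jp: acd_triple p m l w ex ed \<alpha> \<beta> S v JJ aJ cJ dJ
proof (unfold_locales)
  show "dJ \<in> carrier JJ" by (simp add: dJ_def)
  have "J.emb (aH \<otimes>\<^bsub>HH\<^esub> dH) = J.emb (dH \<otimes>\<^bsub>HH\<^esub> Hq.a1)" by (simp only: Hp.aD)
  then show "aJ \<otimes>\<^bsub>JJ\<^esub> dJ = dJ \<otimes>\<^bsub>JJ\<^esub> Jq.a1"
    by (simp add: J_emb_t_pow J_emb_g aJ_def[symmetric] dJ_def[symmetric] del: pow_nat)
  have "J.emb (cH \<otimes>\<^bsub>HH\<^esub> dH) = J.emb (dH \<otimes>\<^bsub>HH\<^esub> Hq.c1)" by (simp only: Hp.cD)
  then show "cJ \<otimes>\<^bsub>JJ\<^esub> dJ = dJ \<otimes>\<^bsub>JJ\<^esub> Jq.c1"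
    by (simp add: J_emb_t_pow cJ_def[symmetric] dJ_def[symmetric] del: pow_nat)
  have "J.emb (dH [^]\<^bsub>HH\<^esub> (int p ^ m)) = J.emb Hq.t" by (simp only: Hp.D_ord)
  then show "dJ [^]\<^bsub>JJ\<^esub> (int p ^ m) = Jq.t" by (simp only: Jp_t J.emb.hom_int_pow[OF Hp.D] dJ_def)
qed

lemma bJ [simp]: "bJ \<in> carrier JJ" by (simp add: bJ_def)

lemma aJ_bJ: "aJ \<otimes>\<^bsub>JJ\<^esub> bJ = bJ \<otimes>\<^bsub>JJ\<^esub> (aJ \<otimes>\<^bsub>JJ\<^esub> cJ)"
  using J.emb_s[OF Hq.a] by (simp add: aJ_def bJ_def cJ_def \<sigma>b)

lemma cJ_bJ: "cJ \<otimes>\<^bsub>JJ\<^esub> bJ = bJ \<otimes>\<^bsub>JJ\<^esub> Jp.c2"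
proof -
  have "J.emb Hp.c2 = Jp.c2"
    by (simp only: J.emb.hom_mult J.emb.hom_int_pow Hp.D Hq.c H.E.int_pow_closed cJ_def dJ_def)
  then show ?thesis using J.emb_s[OF Hq.c] by (simp add: cJ_def bJ_def \<sigma>b(3))
qed

lemma bJ_pow: "bJ [^]\<^bsub>JJ\<^esub> (int p ^ m * i) = dJ [^]\<^bsub>JJ\<^esub> i"
proof -
  have "bJ [^]\<^bsub>JJ\<^esub> int (p ^ m) = dJ" unfolding int_pow_int bJ_def dJ_def by (rule J.s_pow_n)
  then show ?thesis using J.E.int_pow_pow[OF bJ, of "int (p ^ m)" i] by simp
qed

lemma macd_JJ: "macd JJ aJ bJ cJ \<alpha> \<beta>"
proof (unfold_locales)
  show "aJ \<otimes>\<^bsub>JJ\<^esub> bJ = bJ \<otimes>\<^bsub>JJ\<^esub> aJ \<otimes>\<^bsub>JJ\<^esub> cJ" by (simp add: aJ_bJ J.E.m_assoc)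
  show "aJ \<otimes>\<^bsub>JJ\<^esub> cJ = cJ \<otimes>\<^bsub>JJ\<^esub> aJ [^]\<^bsub>JJ\<^esub> \<alpha>" by (rule Jq.ac)
  have "bJ [^]\<^bsub>JJ\<^esub> \<beta> = bJ \<otimes>\<^bsub>JJ\<^esub> dJ [^]\<^bsub>JJ\<^esub> int w"
    unfolding \<beta> J.E.int_pow_mult[OF bJ] bJ_pow by simp
  then have "cJ \<otimes>\<^bsub>JJ\<^esub> bJ = bJ [^]\<^bsub>JJ\<^esub> \<beta> \<otimes>\<^bsub>JJ\<^esub> cJ" unfolding cJ_bJ by (simp add: J.E.m_assoc)
  then have "inv\<^bsub>JJ\<^esub> cJ \<otimes>\<^bsub>JJ\<^esub> (cJ \<otimes>\<^bsub>JJ\<^esub> bJ) \<otimes>\<^bsub>JJ\<^esub> inv\<^bsub>JJ\<^esub> cJ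
      = inv\<^bsub>JJ\<^esub> cJ \<otimes>\<^bsub>JJ\<^esub> (bJ [^]\<^bsub>JJ\<^esub> \<beta> \<otimes>\<^bsub>JJ\<^esub> cJ) \<otimes>\<^bsub>JJ\<^esub> inv\<^bsub>JJ\<^esub> cJ" by simp
  then show "bJ \<otimes>\<^bsub>JJ\<^esub> inv\<^bsub>JJ\<^esub> cJ = inv\<^bsub>JJ\<^esub> cJ \<otimes>\<^bsub>JJ\<^esub> bJ [^]\<^bsub>JJ\<^esub> \<beta>"
    by (simp add: J.E.m_assoc)
qed simp_all

lemma card_JJ: "card (carrier JJ) = p ^ (5 * m + l)"
proof -
  have "card (carrier JJ) = p ^ m * (p ^ m * (p ^ (2 * m) * p ^ (m + l)))"
  proof -
    have "card {0..<int modulus} = modulus" by simp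
    then show ?thesis unfolding J.card_E H.card_E M.card_E carrier_N0 by (simp only: modulus_def)
  qed
  also have "\<dots> = p ^ (5 * m + l)" unfolding power_add[symmetric] by simp
  finally show ?thesis .
qed

lemma generate_JJ: "generate JJ {aJ, bJ} = carrier JJ"
proof
  show "generate JJ {aJ, bJ} \<subseteq> carrier JJ" by (rule J.E.generate_incl) simp
  have sg: "subgroup (generate JJ {aJ, bJ}) JJ" by (rule J.E.generate_is_subgroup) simp
  interpret K: subgroup "generate JJ {aJ, bJ}" JJ by (rule sg)
  have a: "aJ \<in> generate JJ {aJ, bJ}" and b: "bJ \<in> generate JJ {aJ, bJ}" by (auto intro: generate.incl)
  have "cJ = inv\<^bsub>JJ\<^esub> aJ \<otimes>\<^bsub>JJ\<^esub> (inv\<^bsub>JJ\<^esub> bJ \<otimes>\<^bsub>JJ\<^esub> (aJ \<otimes>\<^bsub>JJ\<^esub> bJ))" by (simp add: aJ_bJ)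
  then have c: "cJ \<in> generate JJ {aJ, bJ}" using a b by (metis K.m_closed K.m_inv_closed)
  have "dJ = bJ [^]\<^bsub>JJ\<^esub> (int p ^ m * 1)" unfolding bJ_pow by simp
  then have d: "dJ \<in> generate JJ {aJ, bJ}" using J.E.subgroup_int_pow_closed[OF sg b] by metis
  show "carrier JJ \<subseteq> generate JJ {aJ, bJ}"
  proof
    fix u assume "u \<in> carrier JJ"
    then obtain n :: nat and x where nx: "x \<in> carrier HH" "u = J.s [^]\<^bsub>JJ\<^esub> n \<otimes>\<^bsub>JJ\<^esub> J.emb x" by (rule J.E_cases)
    obtain k i :: nat and j :: int
      where kij: "x = dH [^]\<^bsub>HH\<^esub> int k \<otimes>\<^bsub>HH\<^esub> (cH [^]\<^bsub>HH\<^esub> int i \<otimes>\<^bsub>HH\<^esub> aH [^]\<^bsub>HH\<^esub> j)"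
      using HH_elem[OF nx(1)] .
    have "J.emb x = dJ [^]\<^bsub>JJ\<^esub> int k \<otimes>\<^bsub>JJ\<^esub> (cJ [^]\<^bsub>JJ\<^esub> int i \<otimes>\<^bsub>JJ\<^esub> aJ [^]\<^bsub>JJ\<^esub> j)"
      unfolding kij aJ_def cJ_def dJ_def
      by (simp only: J.emb.hom_mult J.emb.hom_int_pow Hp.D Hq.a Hq.c H.E.int_pow_closed H.E.m_closed)
    moreover have "J.s [^]\<^bsub>JJ\<^esub> n = bJ [^]\<^bsub>JJ\<^esub> int n" by (simp only: bJ_def int_pow_int)
    ultimately show "u \<in> generate JJ {aJ, bJ}" unfolding nx(2)
      using J.E.subgroup_int_pow_closed[OF sg] a b c d K.m_closed by metis
  qed
qed

lemma emb_pow: "aJ [^]\<^bsub>JJ\<^esub> (i::int) = J.emb (H.emb (aM [^]\<^bsub>MM\<^esub> i))" "cJ [^]\<^bsub>JJ\<^esub> (i::int) = J.emb (H.emb (cM [^]\<^bsub>MM\<^esub> i))"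
  unfolding aJ_def cJ_def aH_def cH_def
  by (simp_all only: J.emb.hom_int_pow H.emb.hom_int_pow H.emb.hom_closed Mp.a Mp.c)

lemma emb_eq_one: "x \<in> carrier MM \<Longrightarrow> J.emb (H.emb x) = \<one>\<^bsub>JJ\<^esub> \<Longrightarrow> x = \<one>\<^bsub>MM\<^esub>"
  by (simp add: J.emb_def H.emb_def J.E_simps H.E_simps)

lemma aJ_pow_one: "aJ [^]\<^bsub>JJ\<^esub> (i::int) = \<one>\<^bsub>JJ\<^esub> \<Longrightarrow> int p ^ (m + l) dvd i"
  using emb_eq_one[of "aM [^]\<^bsub>MM\<^esub> i"] MM_indep[of 0 i] by (simp add: emb_pow)

lemma cJ_pow_one: "cJ [^]\<^bsub>JJ\<^esub> (i::int) = \<one>\<^bsub>JJ\<^esub> \<Longrightarrow> int p ^ (2 * m) dvd i"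
  using emb_eq_one[of "cM [^]\<^bsub>MM\<^esub> i"] MM_indep[of i 0] by (simp add: emb_pow)

lemma v_unit: "\<not> int p dvd v"
proof
  assume "int p dvd v"
  then have "int p dvd int w ^ 2 * (S + 1) * v" by simp
  moreover have "int p dvd int w ^ 2 * (S + 1) * v - 1" using p_dvd_trans[OF _ v, of 1] ml by simp
  ultimately have "int p dvd int w ^ 2 * (S + 1) * v - (int w ^ 2 * (S + 1) * v - 1)" by (rule dvd_diff)
  then show False using p_gt_2 by simp
qed

text \<open>b^(p^(m+l-1)) is t^(p^(l-m-1)), that is, \<tau> to the power v p^(l-m-1). Its a-exponent
  has valuation exactly 2m + (l-m-1) = m+l-1, just short of the order of a; this uses that the
  valuation of ex is exactly 2m and that v is a unit.\<close>

lemma bJ_pow_nontrivial: "bJ [^]\<^bsub>JJ\<^esub> (int p ^ (m + l - 1)) \<noteq> \<one>\<^bsub>JJ\<^esub>"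
proof
  assume b: "bJ [^]\<^bsub>JJ\<^esub> (int p ^ (m + l - 1)) = \<one>\<^bsub>JJ\<^esub>"
  have e: "int p ^ (m + l - 1) = int p ^ m * (int p ^ m * int p ^ (l - m - 1))"
    using ml by (simp add: power_add[symmetric])
  have "Jq.t [^]\<^bsub>JJ\<^esub> (int p ^ (l - m - 1)) = \<one>\<^bsub>JJ\<^esub>" using b unfolding e bJ_pow Jp.D_pow_m .
  then have "Jq.\<tau> [^]\<^bsub>JJ\<^esub> (v * int p ^ (l - m - 1)) = \<one>\<^bsub>JJ\<^esub>" by (simp add: Jq.t_def J.E.int_pow_pow)
  then have "J.emb (H.emb (cM [^]\<^bsub>MM\<^esub> (int ed * (v * int p ^ (l - m - 1))) \<otimes>\<^bsub>MM\<^esub> aM [^]\<^bsub>MM\<^esub> (int ex * (v * int p ^ (l - m - 1))))) = \<one>\<^bsub>JJ\<^esub>"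
    unfolding Jq.\<tau>_pow emb_pow by simp
  then have "cM [^]\<^bsub>MM\<^esub> (int ed * (v * int p ^ (l - m - 1))) \<otimes>\<^bsub>MM\<^esub> aM [^]\<^bsub>MM\<^esub> (int ex * (v * int p ^ (l - m - 1))) = \<one>\<^bsub>MM\<^esub>"
    by (intro emb_eq_one) simp_all
  then have "int p ^ (m + l) dvd int ex * (v * int p ^ (l - m - 1))" using MM_indep by blast
  moreover have "int p ^ (m + l) = int p ^ (2 * m + 1) * int p ^ (l - m - 1)"
    unfolding power_add[symmetric] using ml by simp
  ultimately have "int p ^ (2 * m + 1) * int p ^ (l - m - 1) dvd (int ex * v) * int p ^ (l - m - 1)"
    by (simp add: mult.assoc)
  then have "int p ^ (2 * m + 1) dvd int ex * v" using p_gt_2 by (subst (asm) dvd_mult_cancel_right) simp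
  moreover have "coprime (int p) v" using prime_int_p v_unit by (rule prime_imp_coprime)
  then have "coprime (int p ^ (2 * m + 1)) v" by simp
  ultimately show False using ex(2) by (simp add: coprime_dvd_mult_left_iff)
qed

lemma ord_aJ: "J.E.ord aJ = p ^ (m + l)"
proof (rule dvd_antisym)
  have "aJ [^]\<^bsub>JJ\<^esub> int (p ^ (m + l)) = \<one>\<^bsub>JJ\<^esub>" using Jq.a_ord by simp
  then have "int (J.E.ord aJ) dvd int (p ^ (m + l))" by (simp only: J.E.int_pow_eq_id Jq.a)
  then show "J.E.ord aJ dvd p ^ (m + l)" by (simp only: int_dvd_int_iff)
  have "int p ^ (m + l) dvd int (J.E.ord aJ)" by (rule aJ_pow_one) (simp only: J.E.int_pow_eq_id Jq.a dvd_refl)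
  then show "p ^ (m + l) dvd J.E.ord aJ" by (metis int_dvd_int_iff of_nat_power)
qed

lemma ord_cJ: "J.E.ord cJ = p ^ (2 * m)"
proof (rule dvd_antisym)
  have "cJ [^]\<^bsub>JJ\<^esub> int (p ^ (2 * m)) = \<one>\<^bsub>JJ\<^esub>" using Jq.c_ord by simp
  then have "int (J.E.ord cJ) dvd int (p ^ (2 * m))" by (simp only: J.E.int_pow_eq_id Jq.c)
  then show "J.E.ord cJ dvd p ^ (2 * m)" by (simp only: int_dvd_int_iff)
  have "int p ^ (2 * m) dvd int (J.E.ord cJ)" by (rule cJ_pow_one) (simp only: J.E.int_pow_eq_id Jq.c dvd_refl)
  then show "p ^ (2 * m) dvd J.E.ord cJ" by (metis int_dvd_int_iff of_nat_power)
qed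

lemma ord_bJ: "J.E.ord bJ = p ^ (m + l)"
proof -
  have e: "int p ^ (m + l) = int p ^ m * int p ^ l" by (simp add: power_add)
  have "bJ [^]\<^bsub>JJ\<^esub> (int p ^ (m + l)) = \<one>\<^bsub>JJ\<^esub>" unfolding e bJ_pow by (rule Jp.D_one) simp
  then have "bJ [^]\<^bsub>JJ\<^esub> int (p ^ (m + l)) = \<one>\<^bsub>JJ\<^esub>" by simp
  then have "int (J.E.ord bJ) dvd int (p ^ (m + l))" by (simp only: J.E.int_pow_eq_id bJ)
  then have "J.E.ord bJ dvd p ^ (m + l)" by (simp only: int_dvd_int_iff)
  then obtain k where k: "k \<le> m + l" "J.E.ord bJ = p ^ k" using divides_primepow_nat[OF prime_p] by auto
  have "k = m + l"
  proof (rule ccontr)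
    assume "k \<noteq> m + l"
    then have "k \<le> m + l - 1" using k by simp
    then have "int (J.E.ord bJ) dvd int p ^ (m + l - 1)" unfolding k(2) using p_pow_dvd by simp
    then have "bJ [^]\<^bsub>JJ\<^esub> (int p ^ (m + l - 1)) = \<one>\<^bsub>JJ\<^esub>" by (simp only: J.E.int_pow_eq_id bJ)
    then show False using bJ_pow_nontrivial by simp
  qed
  then show ?thesis using k by simp
qed

lemma bJ_pow_commute: "bJ [^]\<^bsub>JJ\<^esub> (i::int) \<otimes>\<^bsub>JJ\<^esub> bJ = bJ \<otimes>\<^bsub>JJ\<^esub> bJ [^]\<^bsub>JJ\<^esub> i"
  by (rule Jq.pow_self_commute) simp

text \<open>The ladder upwards is: a^(p^(2m)) and t in the centre, then g = c^(p^m), then a^(p^m)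
  and d = b^(p^m), then c, then a and b. At each rung the commutators with the generators a and b
  are products of conjugates of powers of elements of lower rungs.\<close>

lemma ucs_JJ: "ucs JJ 5 = carrier JJ"
proof -
  interpret mJ: macd JJ aJ bJ cJ \<alpha> \<beta> by (rule macd_JJ)
  note SucI = J.E.ucs_SucI[OF generate_JJ Jq.a bJ]
  have sub: "subgroup (ucs JJ n) JJ" for n by (rule J.E.ucs_subgroup)
  have one: "\<one>\<^bsub>JJ\<^esub> \<in> ucs JJ n" for n by (rule subgroup.one_closed[OF sub])
  have pw: "x [^]\<^bsub>JJ\<^esub> (i::int) \<in> ucs JJ n" if "x \<in> ucs JJ n" for x i n
    using J.E.subgroup_int_pow_closed[OF sub that] .
  have mul: "x \<otimes>\<^bsub>JJ\<^esub> y \<in> ucs JJ n" if "x \<in> ucs JJ n" "y \<in> ucs JJ n" for x y n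
    using subgroup.m_closed[OF sub that] .
  have inv: "inv\<^bsub>JJ\<^esub> x \<in> ucs JJ n" if "x \<in> ucs JJ n" for x n
    using subgroup.m_inv_closed[OF sub that] .
  have conj: "inv\<^bsub>JJ\<^esub> y \<otimes>\<^bsub>JJ\<^esub> x \<otimes>\<^bsub>JJ\<^esub> y \<in> ucs JJ n" if "x \<in> ucs JJ n" "y \<in> carrier JJ" for x y n
    using normal.inv_op_closed1[OF J.E.ucs_normal that(2,1)] .
  have mono: "x \<in> ucs JJ (Suc n)" if "x \<in> ucs JJ n" for x n using J.E.ucs_mono that by blast

  let ?P = "int p ^ (2 * m)" let ?Q = "int p ^ m"
  have A1: "aJ [^]\<^bsub>JJ\<^esub> ?P \<in> ucs JJ (Suc 0)"
  proof (rule SucI[where z = "\<one>\<^bsub>JJ\<^esub>" and z' = "\<one>\<^bsub>JJ\<^esub>"])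
    show "aJ [^]\<^bsub>JJ\<^esub> ?P \<otimes>\<^bsub>JJ\<^esub> aJ = aJ \<otimes>\<^bsub>JJ\<^esub> (aJ [^]\<^bsub>JJ\<^esub> ?P \<otimes>\<^bsub>JJ\<^esub> \<one>\<^bsub>JJ\<^esub>)"
      using Jq.pow_self_commute[OF Jq.a] by simp
    let ?n = "p ^ (2 * m)"
    have "(aJ \<otimes>\<^bsub>JJ\<^esub> cJ) [^]\<^bsub>JJ\<^esub> int ?n = aJ [^]\<^bsub>JJ\<^esub> ?P"
    proof -
      have 1: "int p ^ (2 * m + m) dvd geo ?n \<alpha> - int ?n" using geo_cong[OF \<alpha>(2), of "2 * m" ?n] ml by simp
      have 2: "int p ^ (m + 2 * m) dvd (\<alpha> - 1) * int ?n" unfolding power_add using \<alpha>(2) by (intro mult_dvd_mono) simp_all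
      have e: "\<alpha> * geo ?n \<alpha> - ?P = \<alpha> * (geo ?n \<alpha> - int ?n) + (\<alpha> - 1) * int ?n" by (simp add: algebra_simps)
      have 3: "int p ^ (m + l) dvd geo ?n \<alpha> - int ?n" "int p ^ (m + l) dvd (\<alpha> - 1) * int ?n"
        using p_dvd_trans[OF _ 1, of "m + l"] p_dvd_trans[OF _ 2, of "m + l"] ml by auto
      have "int p ^ (m + l) dvd \<alpha> * geo ?n \<alpha> - ?P" unfolding e by (rule dvd_add[OF dvd_mult[OF 3(1)] 3(2)])
      from Jq.a_cong[OF this] have "aJ [^]\<^bsub>JJ\<^esub> (\<alpha> * geo ?n \<alpha>) = aJ [^]\<^bsub>JJ\<^esub> ?P" .
      moreover have "cJ [^]\<^bsub>JJ\<^esub> int ?n = \<one>\<^bsub>JJ\<^esub>" by (rule Jq.c_one) simp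
      ultimately show ?thesis unfolding Jq.ac_pow by simp
    qed
    then show "aJ [^]\<^bsub>JJ\<^esub> ?P \<otimes>\<^bsub>JJ\<^esub> bJ = bJ \<otimes>\<^bsub>JJ\<^esub> (aJ [^]\<^bsub>JJ\<^esub> ?P \<otimes>\<^bsub>JJ\<^esub> \<one>\<^bsub>JJ\<^esub>)"
      using mJ.A_pow_B[of ?P] by simp
  qed (use one in simp_all)
  have a_pow_Z1: "aJ [^]\<^bsub>JJ\<^esub> i \<in> ucs JJ (Suc 0)" if "?P dvd i" for i
  proof -
    obtain r where "i = ?P * r" using \<open>?P dvd i\<close> by (elim dvdE)
    then show ?thesis using pw[OF A1, of r] by (simp only: J.E.int_pow_pow Jq.a)
  qed
  have T: "Jq.t \<in> ucs JJ (Suc 0)"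
  proof (rule SucI[where z = "\<one>\<^bsub>JJ\<^esub>" and z' = "\<one>\<^bsub>JJ\<^esub>"])
    show "Jq.t \<otimes>\<^bsub>JJ\<^esub> aJ = aJ \<otimes>\<^bsub>JJ\<^esub> (Jq.t \<otimes>\<^bsub>JJ\<^esub> \<one>\<^bsub>JJ\<^esub>)" using Jq.t_a[of 1] by simp
    have "Jq.t = bJ [^]\<^bsub>JJ\<^esub> (?Q * (?Q * 1))" unfolding bJ_pow Jp.D_pow_m by simp
    then show "Jq.t \<otimes>\<^bsub>JJ\<^esub> bJ = bJ \<otimes>\<^bsub>JJ\<^esub> (Jq.t \<otimes>\<^bsub>JJ\<^esub> \<one>\<^bsub>JJ\<^esub>)"
      using bJ_pow_commute[of "?Q * (?Q * 1)"] by simp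
  qed (use one in simp_all)
  have Gz: "Jq.g \<in> ucs JJ (Suc (Suc 0))"
  proof (rule SucI[where z = "aJ [^]\<^bsub>JJ\<^esub> (1 - Jq.\<kappa>)" and z' = "Jq.t [^]\<^bsub>JJ\<^esub> int w"])
    have "aJ \<otimes>\<^bsub>JJ\<^esub> (Jq.g \<otimes>\<^bsub>JJ\<^esub> aJ [^]\<^bsub>JJ\<^esub> (1 - Jq.\<kappa>)) = (aJ \<otimes>\<^bsub>JJ\<^esub> Jq.g) \<otimes>\<^bsub>JJ\<^esub> aJ [^]\<^bsub>JJ\<^esub> (1 - Jq.\<kappa>)"
      by (simp add: J.E.m_assoc)
    also have "\<dots> = Jq.g \<otimes>\<^bsub>JJ\<^esub> aJ" unfolding Jq.a_g by (simp add: J.E.m_assoc J.E.int_pow_mult[symmetric])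
    finally show "Jq.g \<otimes>\<^bsub>JJ\<^esub> aJ = aJ \<otimes>\<^bsub>JJ\<^esub> (Jq.g \<otimes>\<^bsub>JJ\<^esub> aJ [^]\<^bsub>JJ\<^esub> (1 - Jq.\<kappa>))" ..
    show "aJ [^]\<^bsub>JJ\<^esub> (1 - Jq.\<kappa>) \<in> ucs JJ (Suc 0)" by (rule a_pow_Z1) (use Jq.\<kappa> dvd_diff_commute in blast)
    have "Jq.g \<otimes>\<^bsub>JJ\<^esub> bJ = bJ \<otimes>\<^bsub>JJ\<^esub> Jp.c2 [^]\<^bsub>JJ\<^esub> ?Q"
      unfolding Jq.g_def by (rule J.E.conj_int_pow[OF cJ_bJ]) simp_all
    then show "Jq.g \<otimes>\<^bsub>JJ\<^esub> bJ = bJ \<otimes>\<^bsub>JJ\<^esub> (Jq.g \<otimes>\<^bsub>JJ\<^esub> Jq.t [^]\<^bsub>JJ\<^esub> int w)"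
      unfolding Jp.c2_pow_m using Jq.t_g by simp
    show "Jq.t [^]\<^bsub>JJ\<^esub> int w \<in> ucs JJ (Suc 0)" by (rule pw[OF T])
  qed simp
  have A3: "aJ [^]\<^bsub>JJ\<^esub> ?Q \<in> ucs JJ (Suc (Suc (Suc 0)))"
  proof -
    let ?A = "aJ [^]\<^bsub>JJ\<^esub> ?Q"
    have 1: "int p ^ (m + m) dvd geo (p ^ m) \<alpha> - int (p ^ m)" using geo_cong[OF \<alpha>(2), of m "p ^ m"] ml by simp
    have 2: "int p ^ (m + m) dvd (\<alpha> - 1) * int (p ^ m)" unfolding power_add using \<alpha>(2) by (intro mult_dvd_mono) simp_all
    have e: "\<alpha> * geo (p ^ m) \<alpha> - ?Q = \<alpha> * (geo (p ^ m) \<alpha> - int (p ^ m)) + (\<alpha> - 1) * int (p ^ m)"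
      by (simp add: algebra_simps)
    have "?P dvd \<alpha> * geo (p ^ m) \<alpha> - ?Q" unfolding e mult_2 by (rule dvd_add[OF dvd_mult[OF 1] 2])
    then have r: "aJ [^]\<^bsub>JJ\<^esub> (\<alpha> * geo (p ^ m) \<alpha> - ?Q) \<in> ucs JJ (Suc 0)" by (rule a_pow_Z1)
    let ?z = "aJ [^]\<^bsub>JJ\<^esub> (\<alpha> * geo (p ^ m) \<alpha> - ?Q)"
    let ?z' = "inv\<^bsub>JJ\<^esub> ?A \<otimes>\<^bsub>JJ\<^esub> Jq.g \<otimes>\<^bsub>JJ\<^esub> ?A \<otimes>\<^bsub>JJ\<^esub> ?z"
    show ?thesis
    proof (rule SucI[where z = "\<one>\<^bsub>JJ\<^esub>" and z' = ?z'])
      show "?A \<otimes>\<^bsub>JJ\<^esub> aJ = aJ \<otimes>\<^bsub>JJ\<^esub> (?A \<otimes>\<^bsub>JJ\<^esub> \<one>\<^bsub>JJ\<^esub>)" using Jq.pow_self_commute[OF Jq.a] by simp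
      show "?z' \<in> ucs JJ (Suc (Suc 0))" by (rule mul[OF conj[OF Gz] mono[OF r]]) simp
      have "(aJ \<otimes>\<^bsub>JJ\<^esub> cJ) [^]\<^bsub>JJ\<^esub> int (p ^ m) = cJ [^]\<^bsub>JJ\<^esub> int (p ^ m) \<otimes>\<^bsub>JJ\<^esub> aJ [^]\<^bsub>JJ\<^esub> (\<alpha> * geo (p ^ m) \<alpha>)"
        by (rule Jq.ac_pow)
      also have "cJ [^]\<^bsub>JJ\<^esub> int (p ^ m) = Jq.g" by (simp add: Jq.g_def)
      also have "aJ [^]\<^bsub>JJ\<^esub> (\<alpha> * geo (p ^ m) \<alpha>) = ?A \<otimes>\<^bsub>JJ\<^esub> ?z" by (simp add: J.E.int_pow_mult[symmetric])
      finally have "(aJ \<otimes>\<^bsub>JJ\<^esub> cJ) [^]\<^bsub>JJ\<^esub> ?Q = ?A \<otimes>\<^bsub>JJ\<^esub> ?z'" by (simp add: J.E.m_assoc)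
      then show "?A \<otimes>\<^bsub>JJ\<^esub> bJ = bJ \<otimes>\<^bsub>JJ\<^esub> (?A \<otimes>\<^bsub>JJ\<^esub> ?z')" using mJ.A_pow_B[of ?Q] by simp
    qed (use one in simp_all)
  qed
  have D3: "dJ \<in> ucs JJ (Suc (Suc (Suc 0)))"
  proof -
    let ?y = "Jq.g \<otimes>\<^bsub>JJ\<^esub> Jq.t [^]\<^bsub>JJ\<^esub> (int w * S)"
    have y: "?y \<in> ucs JJ (Suc (Suc 0))" by (rule mul[OF Gz mono[OF pw[OF T]]])
    show ?thesis
    proof (rule SucI[where z = "inv\<^bsub>JJ\<^esub> ?y" and z' = "\<one>\<^bsub>JJ\<^esub>"])
      have "aJ \<otimes>\<^bsub>JJ\<^esub> (dJ \<otimes>\<^bsub>JJ\<^esub> inv\<^bsub>JJ\<^esub> ?y) = (aJ \<otimes>\<^bsub>JJ\<^esub> dJ) \<otimes>\<^bsub>JJ\<^esub> inv\<^bsub>JJ\<^esub> ?y" by (simp add: J.E.m_assoc)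
      also have "\<dots> = dJ \<otimes>\<^bsub>JJ\<^esub> aJ \<otimes>\<^bsub>JJ\<^esub> (?y \<otimes>\<^bsub>JJ\<^esub> inv\<^bsub>JJ\<^esub> ?y)" unfolding Jp.aD by (simp only: J.E.m_assoc Jq.a Jq.closed Jp.D J.E.int_pow_closed J.E.m_closed J.E.inv_closed)
      also have "\<dots> = dJ \<otimes>\<^bsub>JJ\<^esub> aJ" by simp
      finally show "dJ \<otimes>\<^bsub>JJ\<^esub> aJ = aJ \<otimes>\<^bsub>JJ\<^esub> (dJ \<otimes>\<^bsub>JJ\<^esub> inv\<^bsub>JJ\<^esub> ?y)" ..
      show "inv\<^bsub>JJ\<^esub> ?y \<in> ucs JJ (Suc (Suc 0))" by (rule inv[OF y])
      have "dJ = bJ [^]\<^bsub>JJ\<^esub> (?Q * 1)" unfolding bJ_pow by simp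
      then show "dJ \<otimes>\<^bsub>JJ\<^esub> bJ = bJ \<otimes>\<^bsub>JJ\<^esub> (dJ \<otimes>\<^bsub>JJ\<^esub> \<one>\<^bsub>JJ\<^esub>)" using bJ_pow_commute[of "?Q * 1"] by simp
    qed (use one in simp_all)
  qed
  have C4: "cJ \<in> ucs JJ (Suc (Suc (Suc (Suc 0))))"
  proof (rule SucI[where z = "aJ [^]\<^bsub>JJ\<^esub> (1 - \<alpha>)" and z' = "inv\<^bsub>JJ\<^esub> cJ \<otimes>\<^bsub>JJ\<^esub> dJ [^]\<^bsub>JJ\<^esub> int w \<otimes>\<^bsub>JJ\<^esub> cJ"])
    have "aJ \<otimes>\<^bsub>JJ\<^esub> (cJ \<otimes>\<^bsub>JJ\<^esub> aJ [^]\<^bsub>JJ\<^esub> (1 - \<alpha>)) = (aJ \<otimes>\<^bsub>JJ\<^esub> cJ) \<otimes>\<^bsub>JJ\<^esub> aJ [^]\<^bsub>JJ\<^esub> (1 - \<alpha>)"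
      by (simp add: J.E.m_assoc)
    also have "\<dots> = cJ \<otimes>\<^bsub>JJ\<^esub> aJ" unfolding Jq.ac by (simp add: J.E.m_assoc J.E.int_pow_mult[symmetric])
    finally show "cJ \<otimes>\<^bsub>JJ\<^esub> aJ = aJ \<otimes>\<^bsub>JJ\<^esub> (cJ \<otimes>\<^bsub>JJ\<^esub> aJ [^]\<^bsub>JJ\<^esub> (1 - \<alpha>))" ..
    have "?Q dvd 1 - \<alpha>" using \<alpha>(2) dvd_diff_commute by blast
    then obtain r where "1 - \<alpha> = ?Q * r" by (elim dvdE)
    then show "aJ [^]\<^bsub>JJ\<^esub> (1 - \<alpha>) \<in> ucs JJ (Suc (Suc (Suc 0)))" using pw[OF A3, of r] by (simp only: J.E.int_pow_pow Jq.a)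
    show "cJ \<otimes>\<^bsub>JJ\<^esub> bJ = bJ \<otimes>\<^bsub>JJ\<^esub> (cJ \<otimes>\<^bsub>JJ\<^esub> (inv\<^bsub>JJ\<^esub> cJ \<otimes>\<^bsub>JJ\<^esub> dJ [^]\<^bsub>JJ\<^esub> int w \<otimes>\<^bsub>JJ\<^esub> cJ))"
      unfolding cJ_bJ by (simp add: J.E.m_assoc)
    show "inv\<^bsub>JJ\<^esub> cJ \<otimes>\<^bsub>JJ\<^esub> dJ [^]\<^bsub>JJ\<^esub> int w \<otimes>\<^bsub>JJ\<^esub> cJ \<in> ucs JJ (Suc (Suc (Suc 0)))"
      by (rule conj[OF pw[OF D3]]) simp
  qed simp
  have a5: "aJ \<in> ucs JJ (Suc (Suc (Suc (Suc (Suc 0)))))"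
    by (rule SucI[where z = "\<one>\<^bsub>JJ\<^esub>" and z' = cJ]) (use one C4 aJ_bJ in simp_all)
  have b5: "bJ \<in> ucs JJ (Suc (Suc (Suc (Suc (Suc 0)))))"
  proof (rule SucI[where z = "inv\<^bsub>JJ\<^esub> cJ" and z' = "\<one>\<^bsub>JJ\<^esub>"])
    show "bJ \<otimes>\<^bsub>JJ\<^esub> aJ = aJ \<otimes>\<^bsub>JJ\<^esub> (bJ \<otimes>\<^bsub>JJ\<^esub> inv\<^bsub>JJ\<^esub> cJ)" using mJ.BA by (simp add: J.E.m_assoc)
    show "inv\<^bsub>JJ\<^esub> cJ \<in> ucs JJ (Suc (Suc (Suc (Suc 0))))" by (rule inv[OF C4])
  qed (use one in simp_all)
  have five: "5 = Suc (Suc (Suc (Suc (Suc 0))))" by simp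
  have "carrier JJ \<subseteq> ucs JJ 5" unfolding generate_JJ[symmetric] five
    using a5 b5 by (intro J.E.generate_subgroup_incl sub) simp
  moreover have "ucs JJ 5 \<subseteq> carrier JJ" by (rule subgroup.subset[OF sub])
  ultimately show ?thesis by blast
qed

text \<open>A nontrivial commutator of weight 5 is exhibited: c = [a,b], then a^h with h = \<alpha>
  - 1 from [c,a], then u = [a^h,b], then [u,a] = a^(1-\<alpha>^h). The valuation of \<alpha>^h - 1
  is exactly 2m, which is below m + l.\<close>

lemma nil_class_JJ:
  assumes nd: "\<not> int p ^ (m + 1) dvd \<alpha> - 1"
  shows "nil_class JJ = 5"
proof -
  interpret mJ: macd JJ aJ bJ cJ \<alpha> \<beta> by (rule macd_JJ)
  define h where "h = nat (\<alpha> - 1)"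
  have h: "int h = \<alpha> - 1" using \<alpha>(1) by (simp add: h_def)
  have L0: "x \<in> lcs JJ 0" if "x \<in> carrier JJ" for x using that by simp
  have C1: "cJ \<in> lcs JJ (Suc 0)"
  proof -
    have "inv\<^bsub>JJ\<^esub> aJ \<otimes>\<^bsub>JJ\<^esub> inv\<^bsub>JJ\<^esub> bJ \<otimes>\<^bsub>JJ\<^esub> aJ \<otimes>\<^bsub>JJ\<^esub> bJ = cJ" using aJ_bJ by (simp add: J.E.m_assoc)
    then show ?thesis using J.E.lcs_commutator[OF L0[OF Jq.a] bJ] by simp
  qed
  have A2: "aJ [^]\<^bsub>JJ\<^esub> int h \<in> lcs JJ (Suc (Suc 0))"
  proof -
    have "cJ \<otimes>\<^bsub>JJ\<^esub> aJ = aJ \<otimes>\<^bsub>JJ\<^esub> (cJ \<otimes>\<^bsub>JJ\<^esub> aJ [^]\<^bsub>JJ\<^esub> (1 - \<alpha>))"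
    proof -
      have "aJ \<otimes>\<^bsub>JJ\<^esub> (cJ \<otimes>\<^bsub>JJ\<^esub> aJ [^]\<^bsub>JJ\<^esub> (1 - \<alpha>)) = (aJ \<otimes>\<^bsub>JJ\<^esub> cJ) \<otimes>\<^bsub>JJ\<^esub> aJ [^]\<^bsub>JJ\<^esub> (1 - \<alpha>)"
        by (simp add: J.E.m_assoc)
      also have "\<dots> = cJ \<otimes>\<^bsub>JJ\<^esub> aJ" unfolding Jq.ac by (simp add: J.E.m_assoc J.E.int_pow_mult[symmetric])
      finally show ?thesis ..
    qed
    then have "inv\<^bsub>JJ\<^esub> cJ \<otimes>\<^bsub>JJ\<^esub> inv\<^bsub>JJ\<^esub> aJ \<otimes>\<^bsub>JJ\<^esub> cJ \<otimes>\<^bsub>JJ\<^esub> aJ = aJ [^]\<^bsub>JJ\<^esub> (1 - \<alpha>)" by (simp add: J.E.m_assoc)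
    then have "aJ [^]\<^bsub>JJ\<^esub> (1 - \<alpha>) \<in> lcs JJ (Suc (Suc 0))" using J.E.lcs_commutator[OF C1 Jq.a] by simp
    from subgroup.m_inv_closed[OF J.E.lcs_subgroup this] show ?thesis
      unfolding h J.E.int_pow_neg[OF Jq.a, symmetric] by simp
  qed
  let ?k = "\<alpha> * geo h \<alpha>"
  define u where "u = aJ [^]\<^bsub>JJ\<^esub> (- int h) \<otimes>\<^bsub>JJ\<^esub> (cJ [^]\<^bsub>JJ\<^esub> int h \<otimes>\<^bsub>JJ\<^esub> aJ [^]\<^bsub>JJ\<^esub> ?k)"
  have uc: "u \<in> carrier JJ" by (simp add: u_def)
  have U3: "u \<in> lcs JJ (Suc (Suc (Suc 0)))"
  proof -
    have "inv\<^bsub>JJ\<^esub> (aJ [^]\<^bsub>JJ\<^esub> int h) \<otimes>\<^bsub>JJ\<^esub> inv\<^bsub>JJ\<^esub> bJ \<otimes>\<^bsub>JJ\<^esub> aJ [^]\<^bsub>JJ\<^esub> int h \<otimes>\<^bsub>JJ\<^esub> bJ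
        = aJ [^]\<^bsub>JJ\<^esub> (- int h) \<otimes>\<^bsub>JJ\<^esub> (aJ \<otimes>\<^bsub>JJ\<^esub> cJ) [^]\<^bsub>JJ\<^esub> int h"
      using mJ.A_pow_B[of "int h"] by (simp add: J.E.m_assoc J.E.int_pow_neg del: pow_nat)
    also have "\<dots> = u" unfolding u_def Jq.ac_pow ..
    finally show ?thesis using J.E.lcs_commutator[OF A2 bJ] by (simp only:)
  qed
  have "u \<otimes>\<^bsub>JJ\<^esub> aJ = aJ \<otimes>\<^bsub>JJ\<^esub> (u \<otimes>\<^bsub>JJ\<^esub> aJ [^]\<^bsub>JJ\<^esub> (1 - \<alpha> ^ h))"
  proof -
    have "aJ \<otimes>\<^bsub>JJ\<^esub> (u \<otimes>\<^bsub>JJ\<^esub> aJ [^]\<^bsub>JJ\<^esub> (1 - \<alpha> ^ h))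
        = (aJ \<otimes>\<^bsub>JJ\<^esub> aJ [^]\<^bsub>JJ\<^esub> (- int h)) \<otimes>\<^bsub>JJ\<^esub> (cJ [^]\<^bsub>JJ\<^esub> int h \<otimes>\<^bsub>JJ\<^esub> aJ [^]\<^bsub>JJ\<^esub> (?k + (1 - \<alpha> ^ h)))"
      by (simp add: u_def J.E.m_assoc J.E.int_pow_mult del: pow_nat)
    also have "aJ \<otimes>\<^bsub>JJ\<^esub> aJ [^]\<^bsub>JJ\<^esub> (- int h) = aJ [^]\<^bsub>JJ\<^esub> (- int h) \<otimes>\<^bsub>JJ\<^esub> aJ [^]\<^bsub>JJ\<^esub> (1::int)"
      using Jq.pow_self_commute[OF Jq.a, of "- int h"] by simp
    also have "aJ [^]\<^bsub>JJ\<^esub> (- int h) \<otimes>\<^bsub>JJ\<^esub> aJ [^]\<^bsub>JJ\<^esub> (1::int) \<otimes>\<^bsub>JJ\<^esub> (cJ [^]\<^bsub>JJ\<^esub> int h \<otimes>\<^bsub>JJ\<^esub> aJ [^]\<^bsub>JJ\<^esub> (?k + (1 - \<alpha> ^ h)))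
        = aJ [^]\<^bsub>JJ\<^esub> (- int h) \<otimes>\<^bsub>JJ\<^esub> ((aJ [^]\<^bsub>JJ\<^esub> (1::int) \<otimes>\<^bsub>JJ\<^esub> cJ [^]\<^bsub>JJ\<^esub> int h) \<otimes>\<^bsub>JJ\<^esub> aJ [^]\<^bsub>JJ\<^esub> (?k + (1 - \<alpha> ^ h)))"
      by (simp only: J.E.m_assoc Jq.a Jq.c J.E.int_pow_closed J.E.m_closed)
    also have "\<dots> = aJ [^]\<^bsub>JJ\<^esub> (- int h) \<otimes>\<^bsub>JJ\<^esub> (cJ [^]\<^bsub>JJ\<^esub> int h \<otimes>\<^bsub>JJ\<^esub> (aJ [^]\<^bsub>JJ\<^esub> (1 * \<alpha> ^ h) \<otimes>\<^bsub>JJ\<^esub> aJ [^]\<^bsub>JJ\<^esub> (?k + (1 - \<alpha> ^ h))))"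
      unfolding Jq.a_pow_c_pow by (simp only: J.E.m_assoc Jq.a Jq.c J.E.int_pow_closed J.E.m_closed)
    also have "aJ [^]\<^bsub>JJ\<^esub> (1 * \<alpha> ^ h) \<otimes>\<^bsub>JJ\<^esub> aJ [^]\<^bsub>JJ\<^esub> (?k + (1 - \<alpha> ^ h)) = aJ [^]\<^bsub>JJ\<^esub> ?k \<otimes>\<^bsub>JJ\<^esub> aJ"
      using J.E.int_pow_mult[OF Jq.a, of ?k 1] by (simp add: J.E.int_pow_mult[symmetric])
    finally show ?thesis by (simp add: u_def J.E.m_assoc del: pow_nat)
  qed
  then have "inv\<^bsub>JJ\<^esub> u \<otimes>\<^bsub>JJ\<^esub> inv\<^bsub>JJ\<^esub> aJ \<otimes>\<^bsub>JJ\<^esub> u \<otimes>\<^bsub>JJ\<^esub> aJ = aJ [^]\<^bsub>JJ\<^esub> (1 - \<alpha> ^ h)"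
    using uc by (simp add: J.E.m_assoc)
  then have A4: "aJ [^]\<^bsub>JJ\<^esub> (1 - \<alpha> ^ h) \<in> lcs JJ (Suc (Suc (Suc (Suc 0))))"
    using J.E.lcs_commutator[OF U3 Jq.a] by simp
  moreover have "aJ [^]\<^bsub>JJ\<^esub> (1 - \<alpha> ^ h) \<noteq> \<one>\<^bsub>JJ\<^esub>"
  proof
    assume "aJ [^]\<^bsub>JJ\<^esub> (1 - \<alpha> ^ h) = \<one>\<^bsub>JJ\<^esub>"
    then have "int p ^ (m + l) dvd 1 - \<alpha> ^ h" by (rule aJ_pow_one)
    then have "int p ^ (2 * m + 1) dvd \<alpha> ^ h - 1"
      using p_dvd_trans[of "2 * m + 1" "m + l"] ml dvd_diff_commute by auto
    then have d: "int p ^ (2 * m + 1) dvd int h * geo h \<alpha>" unfolding h geo_times .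
    obtain h1 where h1: "int h = int p ^ m * h1" using \<alpha>(2) h by auto
    have nh1: "\<not> int p dvd h1" using not_dvd_cofactor[OF h1] nd h by simp
    have "int p ^ (m + m) dvd geo h \<alpha> - int h" using geo_cong[OF \<alpha>(2), of m h] ml h1 by simp
    then obtain r where "geo h \<alpha> - int h = int p ^ (m + m) * r" by (elim dvdE)
    then have r: "geo h \<alpha> = int p ^ m * (h1 + int p ^ m * r)" using h1 by (simp add: power_add algebra_simps)
    have "int h * geo h \<alpha> = int p ^ (2 * m) * (h1 * (h1 + int p ^ m * r))"
      unfolding r h1 by (simp add: mult_2 power_add)
    then have "int p ^ (2 * m) * int p dvd int p ^ (2 * m) * (h1 * (h1 + int p ^ m * r))" using d by simp
    then have "int p dvd h1 * (h1 + int p ^ m * r)" using p_gt_2 by simp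
    moreover have "int p dvd int p ^ m * r" using ml by simp
    ultimately show False using nh1 prime_int_p by (simp add: prime_dvd_mult_iff dvd_add_left_iff)
  qed
  moreover have "ucs JJ (Suc (Suc (Suc (Suc (Suc 0))))) = carrier JJ" using ucs_JJ by (simp add: eval_nat_numeral)
  ultimately show ?thesis using J.E.nil_class_eqI by (simp add: eval_nat_numeral)
qed

end

text \<open>The carrier type lists exponents of b, d, c and a. The parameters ex and ed are
  reductions of the exponents of A and C in \<open>key_relation\<close> for k = 1, and v exists
  because w and S + 1 are units modulo p.\<close>

lemma (in odd_prime) macdonald_model:
  fixes \<alpha> \<beta> :: int
  assumes pos: "\<alpha> > 1" "\<beta> > 1" and ml: "0 < m" "m < l" "l < 2 * m" "3 * m < 2 * l"
    and v\<alpha>: "int p ^ m dvd \<alpha> - 1" "\<not> int p ^ (m + 1) dvd \<alpha> - 1"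
    and v\<beta>: "int p ^ m dvd \<beta> - 1" "\<not> int p ^ (m + 1) dvd \<beta> - 1"
    and vl: "int p ^ l dvd \<alpha> - \<beta>"
    and p3: "p > 3 \<or> (p = 3 \<and> \<not> [\<alpha> = 7] (mod 9))"
  obtains J :: "(nat \<times> nat \<times> nat \<times> int) monoid" and a b c where "macd J a b c \<alpha> \<beta>"
    "card (carrier J) = p ^ (5 * m + l)" "generate J {a, b} = carrier J"
    "group.ord J a = p ^ (m + l)" "group.ord J b = p ^ (m + l)" "group.ord J c = p ^ (2 * m)" "nil_class J = 5"
proof -
  obtain w1 where w1: "\<beta> - 1 = int p ^ m * w1" using v\<beta>(1) by (elim dvdE)
  have "w1 > 0"
  proof (rule ccontr)
    assume "\<not> w1 > 0"
    then have "int p ^ m * w1 \<le> 0" by (simp add: mult_nonneg_nonpos)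
    then show False using w1 pos by simp
  qed
  define w where "w = nat w1"
  have w: "\<beta> = 1 + int p ^ m * int w" using w1 \<open>w1 > 0\<close> by (simp add: w_def)
  have nw: "\<not> int p dvd int w" using v\<beta>(2) w by auto
  have m1: "m \<ge> 1" using ml by simp
  note X = relation_exponent_multiplicity[OF pos(1) m1 v\<alpha> p3]
  have "2 * m < m + l" using ml by simp
  then obtain ex x1 where ex: "int ex = int p ^ (2 * m) * x1" "\<not> int p dvd x1"
    "int p ^ (m + l) dvd int ex - (\<alpha> * geo (nat \<alpha>) \<alpha> - \<alpha> * \<alpha> ^ nat \<alpha>)"
    using reduced_exponent[OF X] by blast
  have nex: "\<not> int p ^ (2 * m + 1) dvd int ex" using ex(1,2) p_gt_2 by simp
  define ed where "ed = nat ((\<alpha> - \<beta>) mod int p ^ (2 * m))"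
  have edi: "int ed = (\<alpha> - \<beta>) mod int p ^ (2 * m)" using p_gt_2 by (simp add: ed_def)
  have ed2: "int p ^ (2 * m) dvd int ed - (\<alpha> - \<beta>)" unfolding edi by (metis dvd_diff_commute dvd_minus_mod)
  have "int p ^ l dvd int p ^ (2 * m)" using ml by (intro le_imp_power_dvd) simp
  then have ed1: "int p ^ l dvd int ed" unfolding edi using vl by (simp add: dvd_mod)
  obtain S where S: "(\<Sum>i<p ^ m. int i * \<beta> ^ i) = int p ^ m * S" "\<not> int p dvd S + 1"
    by (rule arithmetic_geometric_sum[of m \<beta>]) (use ml v\<beta> in auto)
  have "\<not> int p dvd int w ^ 2 * (S + 1)"
    using nw S(2) prime_int_p by (simp add: prime_dvd_mult_iff prime_dvd_power_iff)
  then obtain v where v: "int p ^ (m + l) dvd int w ^ 2 * (S + 1) * v - 1" using inverse_mod_power by blast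
  interpret M: model_params p m l w ex ed \<alpha> \<beta> S v
    by unfold_locales (use ml pos(1) v\<alpha>(1) w ex nex ed1 ed2 S(1) v in auto)
  show thesis
    by (rule that[OF M.macd_JJ M.card_JJ M.generate_JJ M.ord_aJ M.ord_bJ M.ord_cJ M.nil_class_JJ[OF v\<alpha>(2)]])
qed

section \<open>The presented group\<close>

lemma peq_append:
  assumes "peq R u v" shows "peq R (x @ u @ y) (x @ v @ y)"
  using assms
proof (induction rule: peq.induct)
  case (peq_refl u) show ?case by (rule peq.peq_refl)
next
  case (peq_sym u v) then show ?case using peq.peq_sym by blast
next
  case (peq_trans u v w) then show ?case using peq.peq_trans by blast
next
  case (peq_cancel u g e v)
  show ?case using peq.peq_cancel[of R "x @ u" g e "v @ y"] by simp
next
  case (peq_rel r u v)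
  then show ?case using peq.peq_rel[of r R "x @ u" "v @ y"] by simp
qed

lemma peq_append2:
  assumes "peq R u u'" "peq R v v'" shows "peq R (u @ v) (u' @ v')"
  using peq_append[OF assms(1), of "[]" v] peq_append[OF assms(2), of u' "[]"] peq_trans by fastforce

lemma wclass_eq_iff: "wclass R u = wclass R v \<longleftrightarrow> peq R u v"
  unfolding wclass_def using peq_refl peq_sym peq_trans by (metis (mono_tags, lifting) Collect_cong mem_Collect_eq)

text \<open>\<open>pmult\<close> multiplies chosen representatives; the chosen one is equivalent to
  any given u, so products do not depend on the choice.\<close>

lemma some_wclass: "peq R u (SOME v. v \<in> wclass R u)"
  using someI[of "\<lambda>v. v \<in> wclass R u" u] by (simp add: wclass_def peq_refl)

lemma pmult_wclass: "pmult R (wclass R u) (wclass R v) = wclass R (u @ v)"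
  unfolding pmult_def wclass_eq_iff
  by (rule peq_sym, rule peq_append2[OF some_wclass some_wclass])

lemma winv_Cons: "winv ((g, e) # u) = winv u @ [(g, \<not> e)]"
  by (simp add: winv_def)

lemma peq_winv: "peq R (winv u @ u) []"
proof (induction u)
  case Nil show ?case by (simp add: winv_def peq_refl)
next
  case (Cons x u)
  obtain g e where x: "x = (g, e)" by force
  have "peq R (winv u @ [(g, \<not> e), (g, \<not> \<not> e)] @ u) (winv u @ u)" by (rule peq_cancel)
  then show ?case using Cons peq_trans by (fastforce simp: x winv_Cons)
qed

lemma presented_group_simps:
  "carrier (presented_group R) = range (wclass R)" "\<one>\<^bsub>presented_group R\<^esub> = wclass R []"
  "wclass R u \<otimes>\<^bsub>presented_group R\<^esub> wclass R v = wclass R (u @ v)"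
  by (simp_all add: presented_group_def pmult_wclass)

lemma group_presented_group: "group (presented_group R)"
proof (rule groupI)
  fix x assume "x \<in> carrier (presented_group R)"
  then obtain u where "x = wclass R u" by (auto simp: presented_group_simps)
  then show "\<exists>y\<in>carrier (presented_group R). y \<otimes>\<^bsub>presented_group R\<^esub> x = \<one>\<^bsub>presented_group R\<^esub>"
    by (intro bexI[of _ "wclass R (winv u)"]) (auto simp: presented_group_simps wclass_eq_iff peq_winv)
qed (auto simp: presented_group_simps)

lemma inv_wclass: "inv\<^bsub>presented_group R\<^esub> (wclass R u) = wclass R (winv u)"
  by (rule group.inv_equality[OF group_presented_group])
    (auto simp: presented_group_simps wclass_eq_iff peq_winv)

lemma wclass_concat_replicate: "wclass R (concat (replicate n u)) = wclass R u [^]\<^bsub>presented_group R\<^esub> n"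
proof (induction n)
  case 0 show ?case by (simp add: presented_group_simps)
next
  case (Suc n)
  interpret P: group "presented_group R" by (rule group_presented_group)
  have "wclass R (concat (replicate (Suc n) u)) = wclass R u \<otimes>\<^bsub>presented_group R\<^esub> wclass R u [^]\<^bsub>presented_group R\<^esub> n"
    by (simp add: presented_group_simps(3)[symmetric] Suc)
  then show ?case by (simp only: P.nat_pow_Suc2[of "wclass R u" n] presented_group_simps rangeI)
qed

lemma wclass_wpow: "wclass R (wpow u k) = wclass R u [^]\<^bsub>presented_group R\<^esub> k"
proof -
  interpret P: group "presented_group R" by (rule group_presented_group)
  have c: "wclass R u \<in> carrier (presented_group R)" by (simp add: presented_group_simps)
  show ?thesis
  proof (cases "0 \<le> k")
    case True
    then show ?thesis unfolding wpow_def using int_pow_int[of "presented_group R" "wclass R u" "nat k"]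
      by (simp add: wclass_concat_replicate)
  next
    case False
    define n where "n = nat (- k)"
    have k: "k = - int n" using False by (simp add: n_def)
    have "wclass R (wpow u k) = inv\<^bsub>presented_group R\<^esub> (wclass R u) [^]\<^bsub>presented_group R\<^esub> n"
      using False by (simp add: wpow_def wclass_concat_replicate inv_wclass n_def)
    also have "\<dots> = wclass R u [^]\<^bsub>presented_group R\<^esub> k"
      unfolding k P.int_pow_neg_int[OF c] by (rule P.nat_pow_inv[OF c])
    finally show ?thesis .
  qed
qed

lemma wclass_relator: "r \<in> R \<Longrightarrow> wclass R r = \<one>\<^bsub>presented_group R\<^esub>"
  using peq_rel[of r R "[]" "[]"] by (simp add: presented_group_simps wclass_eq_iff)

section \<open>Evaluating words, and the universal property\<close>

fun weval :: "('a, 'b) monoid_scheme \<Rightarrow> ('g \<Rightarrow> 'a) \<Rightarrow> 'g word \<Rightarrow> 'a" where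
  "weval H f [] = \<one>\<^bsub>H\<^esub>"
| "weval H f ((g, e) # u) = (if e then inv\<^bsub>H\<^esub> (f g) else f g) \<otimes>\<^bsub>H\<^esub> weval H f u"

context group
begin

context
  fixes f :: "'g \<Rightarrow> 'a"
  assumes f: "\<And>g. f g \<in> carrier G"
begin

lemma weval_closed [simp]: "weval G f u \<in> carrier G"
  by (induction u rule: weval.induct[of _ undefined undefined]) (auto simp: f)

lemma weval_append: "weval G f (u @ v) = weval G f u \<otimes> weval G f v"
proof (induction u)
  case (Cons x u)
  then show ?case by (cases x) (simp add: f m_assoc)
qed simp

lemma weval_winv: "weval G f (winv u) = inv (weval G f u)"
proof (induction u)
  case Nil show ?case by (simp add: winv_def)
next
  case (Cons x u)
  then show ?case by (cases x) (auto simp: winv_Cons weval_append f inv_mult_group)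
qed

lemma weval_wpow: "weval G f (wpow u k) = weval G f u [^] k"
proof -
  have rep: "weval G f (concat (replicate n u)) = weval G f u [^] n" for n u
    by (induction n) (simp_all add: weval_append nat_pow_Suc2 del: nat_pow_Suc Group.nat_pow_Suc)
  show ?thesis
  proof (cases "0 \<le> k")
    case True
    then show ?thesis unfolding wpow_def using int_pow_int[of G "weval G f u" "nat k"] by (simp add: rep)
  next
    case False
    define n where "n = nat (- k)"
    have k: "k = - int n" using False by (simp add: n_def)
    have "weval G f (wpow u k) = inv (weval G f u) [^] n"
      using False by (simp add: wpow_def rep weval_winv n_def)
    also have "\<dots> = weval G f u [^] k" unfolding k int_pow_neg_int[OF weval_closed] by (rule nat_pow_inv) simp
    finally show ?thesis .
  qed
qed

lemma weval_peq:
  assumes R: "\<And>r. r \<in> R \<Longrightarrow> weval G f r = \<one>" and "peq R u v"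
  shows "weval G f u = weval G f v"
  using assms(2)
proof (induction rule: peq.induct)
  case (peq_cancel u g e v)
  then show ?case by (cases e) (simp_all add: weval_append f)
next
  case (peq_rel r u v)
  then show ?case using R by (simp add: weval_append)
qed simp_all

text \<open>Von Dyck's theorem: evaluation is constant on classes once it kills the
  relators.\<close>

lemma presented_group_hom:
  assumes R: "\<And>r. r \<in> R \<Longrightarrow> weval G f r = \<one>"
  shows "\<exists>F\<in>hom (presented_group R) G. \<forall>u. F (wclass R u) = weval G f u"
proof -
  define F where "F = (\<lambda>x. weval G f (SOME u. u \<in> x))"
  have F: "F (wclass R u) = weval G f u" for u
    unfolding F_def using weval_peq[OF R some_wclass[of R u]] by simp
  have "F \<in> hom (presented_group R) G"
    by (rule homI) (auto simp: presented_group_simps F weval_append)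
  then show ?thesis using F by blast
qed

end

end

lemma macd_Gab: "macd (Gab \<alpha> \<beta>) (genA \<alpha> \<beta>) (genB \<alpha> \<beta>) (genC \<alpha> \<beta>) \<alpha> \<beta>"
proof -
  let ?R = "Grels \<alpha> \<beta>"
  let ?P = "presented_group ?R"
  interpret P: group ?P by (rule group_presented_group)
  let ?A = "wclass ?R wA" let ?B = "wclass ?R wB" let ?C = "wclass ?R wC"
  have c: "wclass ?R u \<in> carrier ?P" for u by (simp add: presented_group_simps)
  have C: "?C = inv\<^bsub>?P\<^esub> ?A \<otimes>\<^bsub>?P\<^esub> inv\<^bsub>?P\<^esub> ?B \<otimes>\<^bsub>?P\<^esub> ?A \<otimes>\<^bsub>?P\<^esub> ?B"
    unfolding inv_wclass presented_group_simps(3) by (simp add: wC_def)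
  have "winv wC @ wA @ wC @ wpow wA (- \<alpha>) \<in> ?R" "wC @ wB @ winv wC @ wpow wB (- \<beta>) \<in> ?R"
    by (simp_all add: Grels_def)
  from this[THEN wclass_relator]
  have r1: "inv\<^bsub>?P\<^esub> ?C \<otimes>\<^bsub>?P\<^esub> (?A \<otimes>\<^bsub>?P\<^esub> (?C \<otimes>\<^bsub>?P\<^esub> ?A [^]\<^bsub>?P\<^esub> (- \<alpha>))) = \<one>\<^bsub>?P\<^esub>"
    and r2: "?C \<otimes>\<^bsub>?P\<^esub> (?B \<otimes>\<^bsub>?P\<^esub> (inv\<^bsub>?P\<^esub> ?C \<otimes>\<^bsub>?P\<^esub> ?B [^]\<^bsub>?P\<^esub> (- \<beta>))) = \<one>\<^bsub>?P\<^esub>"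
    unfolding inv_wclass wclass_wpow[symmetric] presented_group_simps(3) by simp_all
  have "?A \<otimes>\<^bsub>?P\<^esub> ?C = ?C \<otimes>\<^bsub>?P\<^esub> ?A [^]\<^bsub>?P\<^esub> \<alpha>"
  proof -
    have "?C \<otimes>\<^bsub>?P\<^esub> (inv\<^bsub>?P\<^esub> ?C \<otimes>\<^bsub>?P\<^esub> (?A \<otimes>\<^bsub>?P\<^esub> (?C \<otimes>\<^bsub>?P\<^esub> ?A [^]\<^bsub>?P\<^esub> (- \<alpha>)))) \<otimes>\<^bsub>?P\<^esub> ?A [^]\<^bsub>?P\<^esub> \<alpha>
        = ?C \<otimes>\<^bsub>?P\<^esub> \<one>\<^bsub>?P\<^esub> \<otimes>\<^bsub>?P\<^esub> ?A [^]\<^bsub>?P\<^esub> \<alpha>" by (simp only: r1)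
    then show ?thesis by (simp add: c P.m_assoc P.int_pow_mult[symmetric])
  qed
  moreover have "?B \<otimes>\<^bsub>?P\<^esub> inv\<^bsub>?P\<^esub> ?C = inv\<^bsub>?P\<^esub> ?C \<otimes>\<^bsub>?P\<^esub> ?B [^]\<^bsub>?P\<^esub> \<beta>"
  proof -
    have "inv\<^bsub>?P\<^esub> ?C \<otimes>\<^bsub>?P\<^esub> (?C \<otimes>\<^bsub>?P\<^esub> (?B \<otimes>\<^bsub>?P\<^esub> (inv\<^bsub>?P\<^esub> ?C \<otimes>\<^bsub>?P\<^esub> ?B [^]\<^bsub>?P\<^esub> (- \<beta>)))) \<otimes>\<^bsub>?P\<^esub> ?B [^]\<^bsub>?P\<^esub> \<beta>
        = inv\<^bsub>?P\<^esub> ?C \<otimes>\<^bsub>?P\<^esub> \<one>\<^bsub>?P\<^esub> \<otimes>\<^bsub>?P\<^esub> ?B [^]\<^bsub>?P\<^esub> \<beta>" by (simp only: r2)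
    then show ?thesis by (simp add: c P.m_assoc P.int_pow_mult[symmetric])
  qed
  moreover have "?A \<otimes>\<^bsub>?P\<^esub> ?B = ?B \<otimes>\<^bsub>?P\<^esub> ?A \<otimes>\<^bsub>?P\<^esub> ?C" unfolding C by (simp add: c P.m_assoc)
  ultimately show ?thesis
    unfolding Gab_def genA_def genB_def genC_def by unfold_locales (use c in simp_all)
qed

lemma generate_Gab: "generate (Gab \<alpha> \<beta>) {genA \<alpha> \<beta>, genB \<alpha> \<beta>} = carrier (Gab \<alpha> \<beta>)"
proof -
  let ?R = "Grels \<alpha> \<beta>"
  let ?P = "presented_group ?R"
  interpret P: group ?P by (rule group_presented_group)
  let ?A = "wclass ?R wA" let ?B = "wclass ?R wB"
  have c: "wclass ?R u \<in> carrier ?P" for u by (simp add: presented_group_simps)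
  interpret K: subgroup "generate ?P {?A, ?B}" ?P by (rule P.generate_is_subgroup) (simp add: c)
  have letter: "wclass ?R [(g, e)] \<in> generate ?P {?A, ?B}" for g e
  proof -
    have AB: "?A \<in> generate ?P {?A, ?B}" "?B \<in> generate ?P {?A, ?B}" by (auto intro: generate.incl)
    have "wclass ?R [(g, False)] = (if g then ?A else ?B)" by (cases g) (simp_all add: wA_def wB_def)
    moreover have "wclass ?R [(g, True)] = inv\<^bsub>?P\<^esub> (wclass ?R [(g, False)])"
      unfolding inv_wclass by (simp add: winv_def)
    ultimately show ?thesis using AB by (cases e) (auto split: if_splits)
  qed
  have "wclass ?R u \<in> generate ?P {?A, ?B}" for u
  proof (induction u)
    case Nil show ?case using K.one_closed by (simp add: presented_group_simps)
  next
    case (Cons x u)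
    obtain g e where x: "x = (g, e)" by force
    have "wclass ?R (x # u) = wclass ?R [(g, e)] \<otimes>\<^bsub>?P\<^esub> wclass ?R u" by (simp add: presented_group_simps x)
    then show ?case using Cons letter by simp
  qed
  then have "carrier ?P \<subseteq> generate ?P {?A, ?B}" by (auto simp: presented_group_simps)
  moreover have "generate ?P {?A, ?B} \<subseteq> carrier ?P" by (rule P.generate_incl) (simp add: c)
  ultimately show ?thesis unfolding Gab_def genA_def genB_def by blast
qed

lemma (in macd) Gab_hom:
  obtains F where "F \<in> hom (Gab \<alpha> \<beta>) G" "F (genA \<alpha> \<beta>) = A" "F (genB \<alpha> \<beta>) = B"
proof -
  define f where "f = (\<lambda>g. if g then A else B)"
  have f: "f g \<in> carrier G" for g by (simp add: f_def)
  have eA: "weval G f wA = A" and eB: "weval G f wB = B" by (simp_all add: wA_def wB_def f_def)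
  have eC: "weval G f wC = C"
    unfolding wC_def by (simp add: weval_append[OF f] weval_winv[OF f] eA eB AB m_assoc)
  have rel: "weval G f r = \<one>" if r: "r \<in> Grels \<alpha> \<beta>" for r
  proof -
    consider "r = winv wC @ wA @ wC @ wpow wA (- \<alpha>)" | "r = wC @ wB @ winv wC @ wpow wB (- \<beta>)"
      using r unfolding Grels_def by blast
    then show ?thesis
    proof cases
      case 1
      have "weval G f r = inv C \<otimes> (A \<otimes> C) \<otimes> A [^] (- \<alpha>)"
        unfolding 1 by (simp add: weval_append[OF f] weval_winv[OF f] weval_wpow[OF f] eA eC m_assoc)
      then show ?thesis unfolding AC by (simp add: m_assoc int_pow_mult[symmetric])
    next
      case 2
      have "weval G f r = C \<otimes> (B \<otimes> inv C) \<otimes> B [^] (- \<beta>)"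
        unfolding 2 by (simp add: weval_append[OF f] weval_winv[OF f] weval_wpow[OF f] eB eC m_assoc)
      then show ?thesis unfolding BC by (simp add: m_assoc int_pow_mult[symmetric])
    qed
  qed
  have "\<exists>F\<in>hom (presented_group (Grels \<alpha> \<beta>)) G. \<forall>u. F (wclass (Grels \<alpha> \<beta>) u) = weval G f u"
    by (rule presented_group_hom[OF f]) (rule rel)
  then obtain F where "F \<in> hom (presented_group (Grels \<alpha> \<beta>)) G" "\<forall>u. F (wclass (Grels \<alpha> \<beta>) u) = weval G f u"
    by (elim bexE)
  then show thesis using that eA eB unfolding Gab_def genA_def genB_def by simp
qed

text \<open>The exponents enter only through A^\<alpha> and B^\<beta>. This lets the final proof
  pass to positive representatives of \<alpha>, \<beta>, and back again in the model.\<close>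

lemma (in macd) cong_exponents:
  assumes "A [^] \<alpha>' = A [^] \<alpha>" "B [^] \<beta>' = B [^] \<beta>" shows "macd G A B C \<alpha>' \<beta>'"
  by unfold_locales (use AB AC BC assms in simp_all)

text \<open>Uniqueness: a candidate y = x^i has order dividing p^E, so y^w = y, while x y^(-1) has
  order dividing s, so its w-th power is 1. Multiplying the two gives x^w = y.\<close>

lemma (in group) ppart_eq:
  assumes p: "Factorial_Ring.prime p" and x: "x \<in> carrier G"
    and xp: "(x [^] w) [^] int (p ^ E) = \<one>" and xs: "(x [^] (1 - w)) [^] int s = \<one>"
    and s: "\<not> p dvd s" and wp: "int p ^ E dvd w - 1" and ws: "int s dvd w"
  shows "ppart G p x = x [^] (w::int)"
  unfolding ppart_def
proof (rule the_equality)
  have copr: "coprime n p" if "n dvd s" for n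
  proof -
    have "\<not> p dvd n" using that s dvd_trans by blast
    then show ?thesis using p prime_imp_coprime coprime_commute by blast
  qed
  have "x \<otimes> inv (x [^] w) = x [^] (1 - w)" using x by (simp add: int_pow_diff)
  moreover have "ord (x [^] (1 - w)) dvd s" using xs x by (simp add: int_pow_eq_id)
  moreover have "(x [^] w) [^] (p ^ E) = \<one>" using xp by (simp only: int_pow_int)
  ultimately show "x [^] w \<in> generate G {x} \<and> (\<exists>k::nat. (x [^] w) [^] (p ^ k) = \<one>) \<and> coprime (ord (x \<otimes> inv (x [^] w))) p"
    using generate_pow[OF x] copr by auto
  have "int (ord x) dvd w * int (p ^ E) * int s" "int (ord x) dvd (1 - w) * int s * int (p ^ E)"
  proof -
    have "x [^] (w * int (p ^ E)) = \<one>" "x [^] ((1 - w) * int s) = \<one>" using xp xs x by (simp_all only: int_pow_pow)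
    then show "int (ord x) dvd w * int (p ^ E) * int s" "int (ord x) dvd (1 - w) * int s * int (p ^ E)"
      using x by (simp_all only: int_pow_eq_id dvd_mult2)
  qed
  then have "int (ord x) dvd w * int (p ^ E) * int s + (1 - w) * int s * int (p ^ E)" by (rule dvd_add)
  then have "int (ord x) dvd int (p ^ E * s)" by (simp add: algebra_simps)
  then have ox: "ord x dvd p ^ E * s" by (simp only: int_dvd_int_iff)
  fix y assume y: "y \<in> generate G {x} \<and> (\<exists>k::nat. y [^] (p ^ k) = \<one>) \<and> coprime (ord (x \<otimes> inv y)) p"
  then obtain i :: int where i: "y = x [^] i" using generate_pow[OF x] by auto
  obtain k :: nat where k: "y [^] (p ^ k) = \<one>" using y by blast
  have yc: "y \<in> carrier G" using i x by simp
  have sub: "ord z dvd p ^ E * s" if "z = x [^] (j::int)" for z j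
  proof -
    have "x [^] int (p ^ E * s) = \<one>" using ox x by (simp only: int_pow_eq_id int_dvd_int_iff)
    then have "z [^] int (p ^ E * s) = \<one>" using x that by (metis int_pow_one int_pow_pow mult.commute)
    then show ?thesis using x that by (simp only: int_pow_eq_id int_dvd_int_iff int_pow_closed)
  qed
  have "ord y dvd p ^ E"
  proof -
    have "ord y dvd p ^ k" using k yc by (simp add: pow_eq_id)
    moreover have "coprime (p ^ k) s" using s p by (simp add: prime_imp_coprime)
    ultimately have "coprime (ord y) s" using coprime_divisors[of "ord y" "p ^ k" s s] by simp
    then show ?thesis using sub[OF i] by (simp add: coprime_dvd_mult_left_iff)
  qed
  then have "int (ord y) dvd w - 1" using wp by (metis dvd_trans int_dvd_int_iff of_nat_power)
  then have yw: "y [^] w = y" using yc int_pow_eq[of y 1 w] by simp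
  have z: "x \<otimes> inv y = x [^] (1 - i)" using x by (simp add: i int_pow_diff)
  have "ord (x [^] (1 - i)) dvd s"
  proof -
    have "coprime (ord (x [^] (1 - i))) (p ^ E)" using y unfolding z by simp
    then show ?thesis using sub[of "x [^] (1 - i)" "1 - i"] by (simp add: coprime_dvd_mult_right_iff)
  qed
  then have "int (ord (x [^] (1 - i))) dvd w" using ws by (metis dvd_trans int_dvd_int_iff)
  then have zw: "(x [^] (1 - i)) [^] w = \<one>" using x by (simp add: int_pow_eq_id)
  have "x [^] w = x [^] ((1 - i) * w + i * w)" by (simp add: algebra_simps)
  also have "\<dots> = (x [^] (1 - i)) [^] w \<otimes> y [^] w" using x i by (simp add: int_pow_mult int_pow_pow)
  finally show "y = x [^] w" using yw zw yc by simp
qed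

section \<open>Invariance of class and orders under isomorphism\<close>

lemma lcs_iso:
  assumes h: "h \<in> iso K J" and K: "group K" and J: "group J"
  shows "h ` lcs K n = lcs J n"
proof -
  interpret K: group K by fact
  interpret J: group J by fact
  interpret h: group_hom K J h using h by unfold_locales (simp add: iso_def)
  have onto: "h ` carrier K = carrier J" using h by (auto simp: iso_def bij_betw_def)
  show ?thesis
  proof (induction n)
    case 0 show ?case using onto by simp
  next
    case (Suc n)
    let ?S = "{x \<otimes>\<^bsub>K\<^esub> y \<otimes>\<^bsub>K\<^esub> inv\<^bsub>K\<^esub> x \<otimes>\<^bsub>K\<^esub> inv\<^bsub>K\<^esub> y | x y. x \<in> lcs K n \<and> y \<in> carrier K}"
    have sub: "lcs K n \<subseteq> carrier K" by (rule subgroup.subset[OF K.lcs_subgroup])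
    have hc: "h (x \<otimes>\<^bsub>K\<^esub> y \<otimes>\<^bsub>K\<^esub> inv\<^bsub>K\<^esub> x \<otimes>\<^bsub>K\<^esub> inv\<^bsub>K\<^esub> y) = h x \<otimes>\<^bsub>J\<^esub> h y \<otimes>\<^bsub>J\<^esub> inv\<^bsub>J\<^esub> (h x) \<otimes>\<^bsub>J\<^esub> inv\<^bsub>J\<^esub> (h y)"
      if "x \<in> lcs K n" "y \<in> carrier K" for x y
      using that sub by (simp add: subset_iff)
    have "h ` ?S = {x \<otimes>\<^bsub>J\<^esub> y \<otimes>\<^bsub>J\<^esub> inv\<^bsub>J\<^esub> x \<otimes>\<^bsub>J\<^esub> inv\<^bsub>J\<^esub> y | x y. x \<in> lcs J n \<and> y \<in> carrier J}" (is "_ = ?T")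
    proof
      show "h ` ?S \<subseteq> ?T" using hc Suc onto by (fastforce simp: image_iff)
      show "?T \<subseteq> h ` ?S"
      proof
        fix z assume "z \<in> ?T"
        then obtain x y where xy: "x \<in> lcs J n" "y \<in> carrier J" "z = x \<otimes>\<^bsub>J\<^esub> y \<otimes>\<^bsub>J\<^esub> inv\<^bsub>J\<^esub> x \<otimes>\<^bsub>J\<^esub> inv\<^bsub>J\<^esub> y" by blast
        obtain x' y' where x'y': "x' \<in> lcs K n" "x = h x'" "y' \<in> carrier K" "y = h y'"
          using xy(1,2) Suc onto by (metis imageE)
        have "z = h (x' \<otimes>\<^bsub>K\<^esub> y' \<otimes>\<^bsub>K\<^esub> inv\<^bsub>K\<^esub> x' \<otimes>\<^bsub>K\<^esub> inv\<^bsub>K\<^esub> y')" using hc[OF x'y'(1,3)] xy(3) x'y' by simp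
        then show "z \<in> h ` ?S" using x'y' by blast
      qed
    qed
    moreover have "?S \<subseteq> carrier K" using sub by auto
    ultimately show ?case unfolding lcs.simps using h.generate_img[of ?S] by simp
  qed
qed

lemma nil_class_iso:
  assumes h: "h \<in> iso K J" and K: "group K" and J: "group J"
  shows "nil_class K = nil_class J"
proof -
  interpret K: group K by fact
  interpret J: group J by fact
  interpret h: group_hom K J h using h by unfold_locales (simp add: iso_def)
  have inj: "inj_on h (carrier K)" using h by (auto simp: iso_def bij_betw_def)
  have "lcs K n = {\<one>\<^bsub>K\<^esub>} \<longleftrightarrow> lcs J n = {\<one>\<^bsub>J\<^esub>}" for n
  proof -
    have "lcs K n \<subseteq> carrier K" by (rule subgroup.subset[OF K.lcs_subgroup])
    then have "h ` lcs K n = h ` {\<one>\<^bsub>K\<^esub>} \<longleftrightarrow> lcs K n = {\<one>\<^bsub>K\<^esub>}"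
      by (intro inj_on_image_eq_iff[OF inj]) auto
    then show ?thesis using lcs_iso[OF h K J, of n] by simp
  qed
  then show ?thesis by (simp add: nil_class_def)
qed

lemma ord_iso:
  assumes h: "h \<in> iso K J" and K: "group K" and J: "group J" and x: "x \<in> carrier K"
  shows "group.ord K x = group.ord J (h x)"
proof -
  interpret K: group K by fact
  interpret J: group J by fact
  interpret h: group_hom K J h using h by unfold_locales (simp add: iso_def)
  have inj: "inj_on h (carrier K)" using h by (auto simp: iso_def bij_betw_def)
  have "x [^]\<^bsub>K\<^esub> n = \<one>\<^bsub>K\<^esub> \<longleftrightarrow> h x [^]\<^bsub>J\<^esub> n = \<one>\<^bsub>J\<^esub>" for n :: nat
  proof -
    have "h (x [^]\<^bsub>K\<^esub> n) = h \<one>\<^bsub>K\<^esub> \<longleftrightarrow> x [^]\<^bsub>K\<^esub> n = \<one>\<^bsub>K\<^esub>" using x by (intro inj_on_eq_iff[OF inj]) auto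
    then show ?thesis using x by (simp add: h.hom_nat_pow)
  qed
  then have "K.ord x dvd n \<longleftrightarrow> J.ord (h x) dvd n" for n using x by (simp add: K.pow_eq_id[symmetric] J.pow_eq_id[symmetric])
  then show ?thesis by (meson dvd_antisym dvd_refl)
qed

section \<open>The Sylow subgroup\<close>

context group
begin

lemma generate_commute_elt:
  assumes T: "T \<subseteq> carrier G" and x: "x \<in> carrier G" and comm: "\<And>t. t \<in> T \<Longrightarrow> x \<otimes> t = t \<otimes> x"
    and z: "z \<in> generate G T"
  shows "x \<otimes> z = z \<otimes> x"
  using z
proof (induction rule: generate.induct)
  case one show ?case using x by simp
next
  case (incl t) then show ?case by (rule comm)
next
  case (inv t)
  then have t: "t \<in> carrier G" using T by blast
  show ?case using commute_pow[OF comm[OF inv, symmetric] t x, of "- 1"] t x by (simp add: int_pow_neg)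
next
  case (eng y z)
  then have "y \<in> carrier G" "z \<in> carrier G" using generate_in_carrier[OF T] by blast+
  then show ?case using commute_mult[OF eng.IH x] by simp
qed

lemma generate_commute:
  assumes S: "S \<subseteq> carrier G" and T: "T \<subseteq> carrier G"
    and comm: "\<And>s t. s \<in> S \<Longrightarrow> t \<in> T \<Longrightarrow> s \<otimes> t = t \<otimes> s"
    and y: "y \<in> generate G S" and z: "z \<in> generate G T"
  shows "y \<otimes> z = z \<otimes> y"
proof -
  have zc: "z \<in> carrier G" using z generate_in_carrier[OF T] by blast
  have "z \<otimes> s = s \<otimes> z" if "s \<in> S" for s
    using generate_commute_elt[OF T _ comm[OF that] z] that S by auto
  then show ?thesis using generate_commute_elt[OF S zc _ y] by simp
qed

lemma subgroup_pow_card: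
  assumes H: "subgroup H G" and x: "x \<in> H"
  shows "x [^] card H = \<one>"
proof -
  interpret K: group "G\<lparr>carrier := H\<rparr>" by (rule subgroup_imp_group[OF H])
  have "x [^]\<^bsub>G\<lparr>carrier := H\<rparr>\<^esub> Coset.order (G\<lparr>carrier := H\<rparr>) = \<one>\<^bsub>G\<lparr>carrier := H\<rparr>\<^esub>"
    by (rule K.pow_order_eq_1) (simp add: x)
  then show ?thesis by (simp add: Coset.order_def nat_pow_consistent[symmetric])
qed

text \<open>For x = y z a large power of p kills y. So if x is a p-element, the order of z is a
  power of p and also divides |Q|, hence is 1.\<close>

lemma sylow_p_eq:
  assumes p: "Factorial_Ring.prime p" and P: "subgroup P G" and Q: "subgroup Q G"
    and comm: "\<And>y z. y \<in> P \<Longrightarrow> z \<in> Q \<Longrightarrow> y \<otimes> z = z \<otimes> y"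
    and prod: "\<And>x. x \<in> carrier G \<Longrightarrow> \<exists>y\<in>P. \<exists>z\<in>Q. x = y \<otimes> z"
    and cP: "card P dvd p ^ n" and cQ: "\<not> p dvd card Q"
  shows "sylow_p G p = P"
proof
  interpret P: subgroup P G by fact
  interpret Q: subgroup Q G by fact
  have P1: "y [^] (p ^ (n + k)) = \<one>" if "y \<in> P" for y k
  proof -
    obtain j where "p ^ n = card P * j" using cP by (elim dvdE)
    then have "p ^ (n + k) = card P * (j * p ^ k)" by (simp add: power_add mult.assoc)
    then have "y [^] (p ^ (n + k)) = (y [^] card P) [^] (j * p ^ k)"
      using that by (simp only: nat_pow_pow P.mem_carrier)
    then show ?thesis by (simp add: subgroup_pow_card[OF P that])
  qed
  show "P \<subseteq> sylow_p G p"
  proof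
    fix y assume "y \<in> P"
    then show "y \<in> sylow_p G p" using P1[of y 0] unfolding sylow_p_def by (auto intro!: exI[of _ n])
  qed
  show "sylow_p G p \<subseteq> P"
  proof
    fix x assume "x \<in> sylow_p G p"
    then obtain k where x: "x \<in> carrier G" and k: "x [^] (p ^ k) = \<one>" unfolding sylow_p_def by blast
    obtain y z where yz: "y \<in> P" "z \<in> Q" "x = y \<otimes> z" using prod[OF x] by blast
    have c: "y \<in> carrier G" "z \<in> carrier G" using yz by auto
    have "\<one> = (x [^] (p ^ k)) [^] (p ^ n)" using k by simp
    also have "\<dots> = x [^] (p ^ (n + k))" using x by (simp add: nat_pow_pow power_add mult.commute)
    also have "\<dots> = y [^] (p ^ (n + k)) \<otimes> z [^] (p ^ (n + k))"
      unfolding yz(3) using comm[OF yz(1,2)] c by (rule pow_mult_distrib)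
    also have "\<dots> = z [^] (p ^ (n + k))" using P1[OF yz(1)] c by simp
    finally have "z [^] (p ^ (n + k)) = \<one>" by simp
    then have "ord z dvd p ^ (n + k)" using c by (simp add: pow_eq_id)
    moreover have "ord z dvd card Q" using subgroup_pow_card[OF Q yz(2)] c by (simp add: pow_eq_id)
    moreover have "coprime (p ^ (n + k)) (card Q)" using cQ p by (simp add: prime_imp_coprime)
    ultimately have "is_unit (ord z)" by (rule coprime_common_divisor[rotated])
    then have "z [^] (1::nat) = \<one>" using c(2) pow_eq_id[of z 1] by simp
    then have "z = \<one>" using c by simp
    then show "x \<in> P" using yz c by simp
  qed
qed

end

text \<open>The p-parts and the complementary parts generate commuting subgroups whose product
  contains A and B. \<open>p_group_bound\<close> makes the order of the first a power of p; the
  factorisation <A><C><B> applied to the second makes its order a divisor of s^3.\<close>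

lemma (in macd) sylow_p_description:
  assumes odd: "odd_prime p" and pos: "\<alpha> > 1" "\<beta> > 1" and oA: "ord A > 0" and oB: "ord B > 0"
    and gen: "generate G {A, B} = carrier G"
    and m: "0 < m" "m < l" "l < 2 * m" "3 * m < 2 * l"
    and v\<alpha>: "int p ^ m dvd \<alpha> - 1" "\<not> int p ^ (m + 1) dvd \<alpha> - 1"
    and v\<beta>: "int p ^ m dvd \<beta> - 1" "\<not> int p ^ (m + 1) dvd \<beta> - 1"
    and vl: "int p ^ l dvd \<alpha> - \<beta>" "\<not> int p ^ (l + 1) dvd \<alpha> - \<beta>"
    and p3: "p > 3 \<or> (p = 3 \<and> \<not> [\<alpha> = 7] (mod 9) \<and> \<not> [\<beta> = 7] (mod 9))"
  obtains w where "int p ^ (m + l) dvd w - 1" "sylow_p G p = generate G {A [^] w, B [^] w}"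
    "finite (sylow_p G p)" "card (sylow_p G p) dvd p ^ (5 * m + l)"
    "ppart G p A = A [^] w" "ppart G p B = B [^] w" "ppart G p C = C [^] w" "C [^] w \<in> sylow_p G p"
proof -
  interpret P: odd_prime p by fact
  have p1: "int p dvd \<alpha> - 1" "int p dvd \<beta> - 1"
    using v\<alpha>(1) v\<beta>(1) m(1) by (metis dvd_power dvd_trans)+
  have pos': "\<alpha> > 0" "\<beta> > 0" using pos by simp_all
  \<comment> \<open>4m + l + 1 serves both uses of E: 3m < E in \<open>p_group_bound\<close>, and m
    + l \<le> E, so that w is 1 modulo p^(m+l).\<close>
  obtain E s w where E: "E \<ge> 4 * m + l + 1" and s: "\<not> p dvd s" and wp: "int p ^ E dvd w - 1" and ws: "int s dvd w"
    and mp: "macd G (A [^] w) (B [^] w) (C [^] w) \<alpha> \<beta>"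
    and op: "(A [^] w) [^] int (p ^ E) = \<one>" "(B [^] w) [^] int (p ^ E) = \<one>" "(C [^] w) [^] int (p ^ E) = \<one>"
    and ms: "macd G (A [^] (1 - w)) (B [^] (1 - w)) (C [^] (1 - w)) \<alpha> \<beta>"
    and os: "(A [^] (1 - w)) [^] int s = \<one>" "(B [^] (1 - w)) [^] int s = \<one>" "(C [^] (1 - w)) [^] int s = \<one>"
    and c1: "A [^] w \<otimes> B [^] (1 - w) = B [^] (1 - w) \<otimes> A [^] w"
    and c2: "B [^] w \<otimes> A [^] (1 - w) = A [^] (1 - w) \<otimes> B [^] w"
    by (rule p_part_decomposition[OF odd pos' oA oB gen p1])
  let ?P = "generate G {A [^] w, B [^] w}" and ?Q = "generate G {A [^] (1 - w), B [^] (1 - w)}"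
  obtain h1 k1 where h1: "\<alpha> - 1 = int p ^ m * h1" and k1: "\<beta> - 1 = int p ^ m * k1"
    using v\<alpha>(1) v\<beta>(1) by (elim dvdE)
  have "int p ^ m * int p dvd int p ^ m * (h1 - k1)"
  proof -
    have "int p ^ (m + 1) dvd int p ^ l" using m by (intro le_imp_power_dvd) simp
    moreover have "\<alpha> - \<beta> = int p ^ m * (h1 - k1)" using h1 k1 by (simp add: right_diff_distrib)
    ultimately show ?thesis using vl(1) dvd_trans[of "int p ^ (m + 1)" "int p ^ l" "\<alpha> - \<beta>"] by (simp add: mult.commute)
  qed
  then have hk: "int p dvd h1 - k1" using P.p_gt_2 by simp
  have h1': "\<not> int p dvd h1" using v\<alpha>(2) unfolding h1 by auto
  have k1': "\<not> int p dvd k1" using v\<beta>(2) unfolding k1 by auto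
  interpret p: macd G "A [^] w" "B [^] w" "C [^] w" \<alpha> \<beta> by (rule mp)
  interpret p: macd_p G "A [^] w" "B [^] w" "C [^] w" \<alpha> \<beta> p E m l h1 k1
    by unfold_locales (use op h1 k1 h1' k1' hk E m odd in simp_all)
  have bigE: "3 * m < E" using E m by simp
  note bound = p.p_group_bound[OF pos bigE vl p3]
  interpret s: macd G "A [^] (1 - w)" "B [^] (1 - w)" "C [^] (1 - w)" \<alpha> \<beta> by (rule ms)
  have s0: "s > 0" using s by (cases s) auto
  have ods: "ord (A [^] (1 - w)) dvd s" "ord (B [^] (1 - w)) dvd s" using os by (simp_all add: int_pow_eq_id)
  then have od0: "ord (A [^] (1 - w)) > 0" "ord (B [^] (1 - w)) > 0" using s0 by (auto intro: Nat.gr0I)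
  have "(C [^] (1 - w)) [^] int s = (A [^] (1 - w)) [^] (0::int)" using os by simp
  moreover have "(B [^] (1 - w)) [^] int s \<in> s.AC_prod"
    unfolding os s.AC_prod_def by (auto intro!: exI[of _ "0::int"])
  ultimately have "card ?Q dvd ord (A [^] (1 - w)) * s * s"
    by (rule s.card_generate_AB(2)[OF od0 s0 _ s0])
  then have "card ?Q dvd s * s * s" using ods(1) by (meson dvd_refl dvd_trans mult_dvd_mono)
  moreover have "\<not> p dvd s * s * s" using s P.prime_p by (simp add: prime_dvd_mult_iff)
  ultimately have nQ: "\<not> p dvd card ?Q" using dvd_trans by blast
  have sP: "subgroup ?P G" and sQ: "subgroup ?Q G" by (simp_all add: generate_is_subgroup)
  interpret SP: subgroup ?P G by fact
  interpret SQ: subgroup ?Q G by fact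
  have selfcomm: "x [^] w \<otimes> x [^] (1 - w) = x [^] (1 - w) \<otimes> x [^] w" if "x \<in> carrier G" for x
    using that by (simp add: int_pow_mult[symmetric])
  have comm: "y \<otimes> z = z \<otimes> y" if "y \<in> ?P" "z \<in> ?Q" for y z
    by (rule generate_commute[OF _ _ _ that]) (use c1 c2 selfcomm[OF A] selfcomm[OF B] in auto)
  let ?K = "{y \<otimes> z | y z. y \<in> ?P \<and> z \<in> ?Q}"
  have sK: "subgroup ?K G"
  proof (rule subgroupI)
    show "?K \<subseteq> carrier G" using SP.mem_carrier SQ.mem_carrier by auto
    show "?K \<noteq> {}" using SP.one_closed SQ.one_closed by blast
  next
    fix x assume "x \<in> ?K"
    then obtain y z where yz: "x = y \<otimes> z" "y \<in> ?P" "z \<in> ?Q" by blast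
    have "inv x = inv z \<otimes> inv y" unfolding yz(1) using yz SP.mem_carrier SQ.mem_carrier by (simp add: inv_mult_group)
    also have "\<dots> = inv y \<otimes> inv z" using comm[of "inv y" "inv z"] yz by simp
    finally show "inv x \<in> ?K" using yz SP.m_inv_closed SQ.m_inv_closed by blast
  next
    fix x x' assume "x \<in> ?K" "x' \<in> ?K"
    then obtain y z y' z' where yz: "x = y \<otimes> z" "y \<in> ?P" "z \<in> ?Q" "x' = y' \<otimes> z'" "y' \<in> ?P" "z' \<in> ?Q" by blast
    have c: "y \<in> carrier G" "z \<in> carrier G" "y' \<in> carrier G" "z' \<in> carrier G"
      using yz SP.mem_carrier SQ.mem_carrier by blast+
    have "x \<otimes> x' = y \<otimes> (z \<otimes> y') \<otimes> z'" using yz(1,4) c by (simp add: m_assoc)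
    also have "\<dots> = y \<otimes> (y' \<otimes> z) \<otimes> z'" using comm[OF yz(5,3)] by simp
    also have "\<dots> = (y \<otimes> y') \<otimes> (z \<otimes> z')" using c by (simp add: m_assoc)
    finally show "x \<otimes> x' \<in> ?K" using yz SP.m_closed SQ.m_closed by blast
  qed
  have "{A, B} \<subseteq> ?K"
  proof -
    have "x = x [^] w \<otimes> x [^] (1 - w)" if "x \<in> carrier G" for x
      using that by (simp add: int_pow_mult[symmetric])
    then have "A = A [^] w \<otimes> A [^] (1 - w)" "B = B [^] w \<otimes> B [^] (1 - w)" by (blast intro: A B)+
    moreover have "A [^] w \<in> ?P" "B [^] w \<in> ?P" "A [^] (1 - w) \<in> ?Q" "B [^] (1 - w) \<in> ?Q"
      by (simp_all add: generate.incl)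
    ultimately show ?thesis by blast
  qed
  then have K: "carrier G \<subseteq> ?K" unfolding gen[symmetric] by (rule generate_subgroup_incl[OF _ sK])
  have prod: "\<exists>y\<in>?P. \<exists>z\<in>?Q. x = y \<otimes> z" if "x \<in> carrier G" for x
    using subsetD[OF K that] by blast
  have syl: "sylow_p G p = ?P" by (rule sylow_p_eq[OF P.prime_p sP sQ comm prod bound(2) nQ])
  have pp: "ppart G p x = x [^] w"
    if "x \<in> carrier G" "(x [^] w) [^] int (p ^ E) = \<one>" "(x [^] (1 - w)) [^] int s = \<one>" for x
    by (rule ppart_eq[OF P.prime_p that s wp ws])
  have "(C [^] w) [^] (p ^ E) = \<one>" using op(3) by (simp only: int_pow_int)
  then have Cs: "C [^] w \<in> sylow_p G p" unfolding sylow_p_def by auto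
  have "int p ^ (m + l) dvd int p ^ E" using E by (intro le_imp_power_dvd) simp
  then have "int p ^ (m + l) dvd w - 1" using wp by (rule dvd_trans)
  then show thesis
    by (rule that) (use Cs syl bound pp[OF A op(1) os(1)] pp[OF B op(2) os(2)] pp[OF C op(3) os(3)] in simp_all)
qed

theorem theorem7p3:
  fixes p :: nat and \<alpha> \<beta> :: int and m l :: nat
  assumes "Factorial_Ring.prime p"
    and "\<alpha> \<noteq> 1" and "\<beta> \<noteq> 1"
    and "p > 3 \<or> (p = 3 \<and> \<not> [\<alpha> = 7] (mod 9) \<and> \<not> [\<beta> = 7] (mod 9))"
    and "multiplicity (int p) (\<alpha> - 1) = m" and "multiplicity (int p) (\<beta> - 1) = m"
    and "m > 0"
    and "multiplicity (int p) (\<alpha> - \<beta>) = l"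
    and "m < l" and "l < 2 * m" and "2 * l > 3 * m"
  shows "card (carrier (sylow_group (Gab \<alpha> \<beta>) p)) = p ^ (5 * m + l)
       \<and> nil_class (sylow_group (Gab \<alpha> \<beta>) p) = 5
       \<and> group.ord (sylow_group (Gab \<alpha> \<beta>) p) (ppart (Gab \<alpha> \<beta>) p (genA \<alpha> \<beta>)) = p ^ (m + l)
       \<and> group.ord (sylow_group (Gab \<alpha> \<beta>) p) (ppart (Gab \<alpha> \<beta>) p (genB \<alpha> \<beta>)) = p ^ (m + l)
       \<and> group.ord (sylow_group (Gab \<alpha> \<beta>) p) (ppart (Gab \<alpha> \<beta>) p (genC \<alpha> \<beta>)) = p ^ (2 * m)"
proof -
  have odd: "odd_prime p"
    using assms(1,4) by unfold_locales (auto simp: prime_odd_nat)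
  interpret P: odd_prime p by (rule odd)
  have m: "0 < m" "m < l" "l < 2 * m" "3 * m < 2 * l" using assms by simp_all
  have "\<alpha> \<noteq> \<beta>" using assms(8) m by auto
  have nu: "\<not> is_unit (int p)" using P.p_gt_2 by simp
  have val: "int p ^ k dvd x \<longleftrightarrow> k \<le> multiplicity (int p) x" if "x \<noteq> 0" for k x
    using that nu by (rule power_dvd_iff_le_multiplicity)
  have v\<alpha>: "int p ^ m dvd \<alpha> - 1" "\<not> int p ^ (m + 1) dvd \<alpha> - 1"
    using val[of "\<alpha> - 1" m] val[of "\<alpha> - 1" "m + 1"] assms(2,5) by simp_all
  have v\<beta>: "int p ^ m dvd \<beta> - 1" "\<not> int p ^ (m + 1) dvd \<beta> - 1"
    using val[of "\<beta> - 1" m] val[of "\<beta> - 1" "m + 1"] assms(3,6) by simp_all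
  have vl: "int p ^ l dvd \<alpha> - \<beta>" "\<not> int p ^ (l + 1) dvd \<alpha> - \<beta>"
    using val[of "\<alpha> - \<beta>" l] val[of "\<alpha> - \<beta>" "l + 1"] \<open>\<alpha> \<noteq> \<beta>\<close> assms(8) by simp_all
  have p1: "int p dvd \<alpha> - 1" "int p dvd \<beta> - 1"
    using v\<alpha>(1) v\<beta>(1) m(1) by (metis dvd_power dvd_trans)+
  have n2: "\<not> int p dvd 2" "\<not> int p dvd 1" using P.p_gt_2 zdvd_imp_le[of "int p" 2] zdvd_imp_le[of "int p" 1] by auto
  have abs2: "\<bar>x\<bar> \<ge> 2" if "int p dvd x - 1" "x \<noteq> 1" for x
  proof (rule ccontr)
    assume "\<not> \<bar>x\<bar> \<ge> 2"
    then have "x = 0 \<or> x = - 1" using that(2) by arith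
    then show False using that(1) n2 by (auto simp: dvd_minus_iff)
  qed
  \<comment> \<open>Both numbers are 1 modulo the odd prime p, so their sum is not 0. Hence
    \<alpha>^2 and \<beta>^2 differ, and \<open>C_pow_in_A\<close> yields a nonzero exponent for k =
    2, an even k being chosen to make both powers nonnegative.\<close>
  have "\<alpha> \<noteq> - \<beta>"
  proof
    assume "\<alpha> = - \<beta>"
    then have "\<alpha> - 1 + (\<beta> - 1) = - 2" by simp
    then show False using dvd_add[OF p1] n2 by simp
  qed
  then have sq: "\<alpha> ^ 2 \<noteq> \<beta> ^ 2" using \<open>\<alpha> \<noteq> \<beta>\<close> by (simp add: power2_eq_iff)
  let ?G = "Gab \<alpha> \<beta>" and ?A = "genA \<alpha> \<beta>" and ?B = "genB \<alpha> \<beta>" and ?C = "genC \<alpha> \<beta>"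
  interpret G: macd ?G ?A ?B ?C \<alpha> \<beta> by (rule macd_Gab)
  interpret S: macd ?G ?B ?A "inv\<^bsub>?G\<^esub> ?C" \<beta> \<alpha> by (rule G.swap)
  have oA: "G.ord ?A > 0"
  proof -
    obtain i where "?C [^]\<^bsub>?G\<^esub> ((\<alpha> ^ 2 - \<beta> ^ 2) * (\<beta> - 1)) = ?A [^]\<^bsub>?G\<^esub> (i::int)"
      using G.C_pow_in_A[of 2] by auto
    then show ?thesis by (rule G.A_finite_order) (use sq assms(3) abs2[OF p1(1) assms(2)] in auto)
  qed
  have oB: "G.ord ?B > 0"
  proof -
    obtain i where "(inv\<^bsub>?G\<^esub> ?C) [^]\<^bsub>?G\<^esub> ((\<beta> ^ 2 - \<alpha> ^ 2) * (\<alpha> - 1)) = ?B [^]\<^bsub>?G\<^esub> (i::int)"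
      using S.C_pow_in_A[of 2] by auto
    then show ?thesis by (rule S.A_finite_order) (use sq assms(2) abs2[OF p1(2) assms(3)] in auto)
  qed
  \<comment> \<open>Exponents matter only modulo the orders, so both may be made positive without changing any valuation.\<close>
  define N where "N = 9 * int p ^ (m + l + 1) * int (G.ord ?A) * int (G.ord ?B) * (\<bar>\<alpha>\<bar> + \<bar>\<beta>\<bar> + 1)"
  define \<alpha>' \<beta>' where "\<alpha>' = \<alpha> + N" and "\<beta>' = \<beta> + N"
  have N: "N \<ge> \<bar>\<alpha>\<bar> + \<bar>\<beta>\<bar> + 2"
  proof -
    have "1 \<le> int p ^ (m + l + 1) * int (G.ord ?A) * int (G.ord ?B)"
      using P.p_gt_2 oA oB by (simp add: int_one_le_iff_zero_less)
    then have "9 * (\<bar>\<alpha>\<bar> + \<bar>\<beta>\<bar> + 1) * 1 \<le> 9 * (\<bar>\<alpha>\<bar> + \<bar>\<beta>\<bar> + 1) * (int p ^ (m + l + 1) * int (G.ord ?A) * int (G.ord ?B))"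
      by (intro mult_left_mono) simp_all
    also have "\<dots> = N" by (simp add: N_def algebra_simps)
    finally show ?thesis by simp
  qed
  have pos: "\<alpha>' > 1" "\<beta>' > 1" using N by (simp_all add: \<alpha>'_def \<beta>'_def)
  have Np: "int p ^ k dvd N" if "k \<le> m + l + 1" for k
  proof -
    have "int p ^ k dvd int p ^ (m + l + 1)" using that by (rule le_imp_power_dvd)
    then show ?thesis unfolding N_def by (simp only: dvd_mult dvd_mult2)
  qed
  have shift: "int p ^ k dvd x + N - 1 \<longleftrightarrow> int p ^ k dvd x - 1" if "k \<le> m + l + 1" for k x
    using dvd_add_left_iff[OF Np[OF that], of "x - 1"] by (simp add: algebra_simps)
  have v\<alpha>': "int p ^ m dvd \<alpha>' - 1" "\<not> int p ^ (m + 1) dvd \<alpha>' - 1"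
    and v\<beta>': "int p ^ m dvd \<beta>' - 1" "\<not> int p ^ (m + 1) dvd \<beta>' - 1"
    unfolding \<alpha>'_def \<beta>'_def using v\<alpha> v\<beta> shift[of m] shift[of "m + 1"] by simp_all
  have "\<alpha>' - \<beta>' = \<alpha> - \<beta>" by (simp add: \<alpha>'_def \<beta>'_def)
  then have vl': "int p ^ l dvd \<alpha>' - \<beta>'" "\<not> int p ^ (l + 1) dvd \<alpha>' - \<beta>'" using vl by simp_all
  have "[x + N = x] (mod 9)" for x by (simp add: N_def cong_iff_dvd_diff)
  then have "[x + N = 7] (mod 9) \<longleftrightarrow> [x = 7] (mod 9)" for x by (meson cong_sym cong_trans)
  then have p3: "p > 3 \<or> (p = 3 \<and> \<not> [\<alpha>' = 7] (mod 9) \<and> \<not> [\<beta>' = 7] (mod 9))"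
    using assms(4) by (simp add: \<alpha>'_def \<beta>'_def)
  have "macd ?G ?A ?B ?C \<alpha>' \<beta>'"
  proof (rule G.cong_exponents)
    show "?A [^]\<^bsub>?G\<^esub> \<alpha>' = ?A [^]\<^bsub>?G\<^esub> \<alpha>"
      by (rule G.int_pow_cong[of _ "int (G.ord ?A)"]) (simp_all add: G.int_pow_eq_id \<alpha>'_def N_def)
    show "?B [^]\<^bsub>?G\<^esub> \<beta>' = ?B [^]\<^bsub>?G\<^esub> \<beta>"
      by (rule G.int_pow_cong[of _ "int (G.ord ?B)"]) (simp_all add: G.int_pow_eq_id \<beta>'_def N_def)
  qed
  then interpret G': macd ?G ?A ?B ?C \<alpha>' \<beta>' .
  obtain w where w: "int p ^ (m + l) dvd w - 1"
    and syl: "sylow_p ?G p = generate ?G {?A [^]\<^bsub>?G\<^esub> w, ?B [^]\<^bsub>?G\<^esub> w}"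
    and fin: "finite (sylow_p ?G p)" and crd: "card (sylow_p ?G p) dvd p ^ (5 * m + l)"
    and pp: "ppart ?G p ?A = ?A [^]\<^bsub>?G\<^esub> w" "ppart ?G p ?B = ?B [^]\<^bsub>?G\<^esub> w" "ppart ?G p ?C = ?C [^]\<^bsub>?G\<^esub> w"
    and Cs: "?C [^]\<^bsub>?G\<^esub> w \<in> sylow_p ?G p"
    by (rule G'.sylow_p_description[OF odd pos oA oB generate_Gab m v\<alpha>' v\<beta>' vl' p3])
  have p3': "p > 3 \<or> (p = 3 \<and> \<not> [\<alpha>' = 7] (mod 9))" using p3 by blast
  obtain J :: "(nat \<times> nat \<times> nat \<times> int) monoid" and a b c where J': "macd J a b c \<alpha>' \<beta>'"
    and cJ: "card (carrier J) = p ^ (5 * m + l)" and gJ: "generate J {a, b} = carrier J"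
    and oJ: "group.ord J a = p ^ (m + l)" "group.ord J b = p ^ (m + l)" "group.ord J c = p ^ (2 * m)"
    and nJ: "nil_class J = 5"
    by (rule P.macdonald_model[OF pos m v\<alpha>' v\<beta>' vl'(1) p3'])
  interpret J': macd J a b c \<alpha>' \<beta>' by (rule J')
  have red: "x [^]\<^bsub>J\<^esub> i = x [^]\<^bsub>J\<^esub> j" if "x \<in> carrier J" "J'.ord x dvd p ^ (m + l)" "int p ^ (m + l) dvd i - j" for x and i j :: int
    by (rule J'.int_pow_cong[of _ "int p ^ (m + l)"])
      (use that in \<open>simp_all only: J'.int_pow_eq_id of_nat_power[symmetric] int_dvd_int_iff\<close>)
  have N': "int p ^ (m + l) dvd \<alpha> - \<alpha>'" "int p ^ (m + l) dvd \<beta> - \<beta>'"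
    using Np[of "m + l"] by (simp_all add: \<alpha>'_def \<beta>'_def)
  \<comment> \<open>The model was built for the shifted exponents. Its a and b have order p^(m+l),
    which divides N, so the original relations hold in it as well.\<close>
  have "macd J a b c \<alpha> \<beta>"
    by (rule J'.cong_exponents) (use red[OF J'.A _ N'(1)] red[OF J'.B _ N'(2)] oJ in simp_all)
  then interpret J: macd J a b c \<alpha> \<beta> .
  obtain F where F: "F \<in> hom ?G J" "F ?A = a" "F ?B = b" by (rule J.Gab_hom)
  interpret F: group_hom ?G J F using F by unfold_locales
  have FC: "F ?C = c"
  proof -
    have "F (?A \<otimes>\<^bsub>?G\<^esub> ?B) = F (?B \<otimes>\<^bsub>?G\<^esub> ?A \<otimes>\<^bsub>?G\<^esub> ?C)" by (simp only: G.AB)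
    then have "a \<otimes>\<^bsub>J\<^esub> b = b \<otimes>\<^bsub>J\<^esub> a \<otimes>\<^bsub>J\<^esub> F ?C" using F by simp
    then have "b \<otimes>\<^bsub>J\<^esub> a \<otimes>\<^bsub>J\<^esub> F ?C = b \<otimes>\<^bsub>J\<^esub> a \<otimes>\<^bsub>J\<^esub> c" by (simp only: J.AB)
    then show ?thesis using J'.l_cancel[of "b \<otimes>\<^bsub>J\<^esub> a" "F ?C" c] by simp
  qed
  \<comment> \<open>w is 1 modulo p^(m+l), a common multiple of the orders of a, b and c, so F sends
    the p-parts to a, b and c themselves.\<close>
  have Fw: "F (?A [^]\<^bsub>?G\<^esub> w) = a" "F (?B [^]\<^bsub>?G\<^esub> w) = b" "F (?C [^]\<^bsub>?G\<^esub> w) = c"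
  proof -
    have d: "p ^ (2 * m) dvd p ^ (m + l)" using m by (intro le_imp_power_dvd) simp
    show "F (?A [^]\<^bsub>?G\<^esub> w) = a" using F.hom_int_pow[of ?A w] red[OF J'.A _ w] oJ by (simp add: F)
    show "F (?B [^]\<^bsub>?G\<^esub> w) = b" using F.hom_int_pow[of ?B w] red[OF J'.B _ w] oJ by (simp add: F)
    show "F (?C [^]\<^bsub>?G\<^esub> w) = c" using F.hom_int_pow[of ?C w] red[OF J'.C _ w] oJ d by (simp add: FC)
  qed
  let ?S = "sylow_group ?G p"
  have cS: "carrier ?S = sylow_p ?G p" by (simp add: sylow_group_def)
  have sub: "subgroup (sylow_p ?G p) ?G" unfolding syl by (rule G.generate_is_subgroup) simp
  have grS: "group ?S" unfolding sylow_group_def by (rule G.subgroup_imp_group[OF sub])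
  have onto: "F ` sylow_p ?G p = carrier J"
  proof -
    have "F ` sylow_p ?G p = generate J (F ` {?A [^]\<^bsub>?G\<^esub> w, ?B [^]\<^bsub>?G\<^esub> w})"
      unfolding syl by (rule F.generate_img[symmetric]) simp
    then show ?thesis using gJ Fw by simp
  qed
  \<comment> \<open>The upper bound meets surjectivity onto a group of exactly that order, so F is
    bijective on the Sylow subgroup and carries order and class over from the model.\<close>
  have "card (sylow_p ?G p) \<le> p ^ (5 * m + l)" using crd P.p_gt_2 by (intro dvd_imp_le) simp_all
  moreover have "card (carrier J) \<le> card (sylow_p ?G p)" using card_image_le[OF fin, of F] onto by simp
  ultimately have card: "card (sylow_p ?G p) = p ^ (5 * m + l)" using cJ by simp
  then have "inj_on F (sylow_p ?G p)" using fin onto cJ by (intro eq_card_imp_inj_on) simp_all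
  then have "bij_betw F (carrier ?S) (carrier J)" using onto by (simp add: bij_betw_def cS)
  moreover have "F \<in> hom ?S J"
    using subgroup.subset[OF sub] by (auto intro!: homI simp: sylow_group_def subset_iff)
  ultimately have iso: "F \<in> iso ?S J" by (simp add: iso_def)
  have in_S: "?A [^]\<^bsub>?G\<^esub> w \<in> carrier ?S" "?B [^]\<^bsub>?G\<^esub> w \<in> carrier ?S" "?C [^]\<^bsub>?G\<^esub> w \<in> carrier ?S"
    using Cs unfolding cS by (simp_all add: syl generate.incl)
  show ?thesis
    using card nil_class_iso[OF iso grS J'.group_axioms] ord_iso[OF iso grS J'.group_axioms in_S(1)]
      ord_iso[OF iso grS J'.group_axioms in_S(2)] ord_iso[OF iso grS J'.group_axioms in_S(3)]
    by (simp add: cS pp Fw oJ nJ)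
qed

end
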